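(* In the setting of the context, let $q=D|u(T_1)|^2$ and $$F=(f(T_2)-\partial_tu(T_2))u(T_1)-(f(T_1)-\partial_tu(T_1))u(T_2),$$ and suppose that $q\in W^{2,2}(\Omega)\cap W^{1,\infty}(\Omega)\cap\mathcal A_q$ and $F\in L^\infty(\Omega)$. Let $\tilde q\in\mathcal A_q$ and $\tilde F\in L^\infty(\Omega)$, and suppose that the $W^{1,2}(\Omega)$-norms of $q$ and $\tilde q$ are bounded by a constant $C$. Let $w$ be the weak solution of $-\nabla\cdot(q\nabla w)=F$ in $\Omega$, $w=0$ on $\partial\Omega$ (so that $w=u(T_2)/u(T_1)-1$), and let $\tilde w$ be the weak solution of $-\nabla\cdot(\tilde q\nabla\tilde w)=\tilde F$ in $\Omega$, $\tilde w=0$ on $\partial\Omega$. Then there is a constant $c>0$, independent of $\tilde q$ and $\tilde F$ (it may depend on $\Omega,\underline c_q,\bar c_q,C,q,F$), such that $$\int_\Omega\frac{(q-\tilde q)^2}{q^2}\left(q|\nabla w|^2+Fw\right)dx\le c\left(\|w-\tilde w\|_{W^{1,2}(\Omega)}+\|F-\tilde F\|_{L^2(\Omega)}\right).$$ Moreover, if there are $\beta\ge0$ and $c_0>0$ such that $q|\nabla w|^2+Fw\ge c_0\,\mathrm{dist}(x,\partial\Omega)^\beta$ for a.e. $x\in\Omega$, then, with a constant $c>0$ that may additionally depend on $\beta$ and $c_0$, $$\|q-\tilde q\|_{L^2(\Omega)}\le c\left(\|w-\tilde w\|_{W^{1,2}(\Omega)}+\|F-\tilde F\|_{L^2(\Om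ega)}\right)^{\frac1{2(1+\beta)}}.$$
   Context: $\Omega\subset\mathbb R^d$ ($d=1,2,3$) is a convex polyhedral domain. For fixed constants $0<\underline c_D\le\bar c_D$, $\bar c_\sigma>0$, $0<\underline c_q\le\bar c_q$: $\mathcal A_D=\{D\in W^{1,2}(\Omega):\underline c_D\le D\le\bar c_D\text{ a.e.}\}$, $\mathcal A_\sigma=\{\sigma\in L^\infty(\Omega):0\le\sigma\le\bar c_\sigma\text{ a.e.}\}$, $\mathcal A_q=\{q\in W^{1,2}(\Omega):\underline c_q\le q\le\bar c_q\text{ a.e.}\}$. $u$ is the solution of the parabolic problem $\partial_tu-\nabla\cdot(D\nabla u)+\sigma u=f$ in $\Omega\times(0,T]$, $u=g$ on $\partial\Omega\times(0,T]$, $u(0)=u_0$ in $\Omega$, where: (i) $u_0\in W^{2,2}(\Omega)\cap W^{1,\infty}(\Omega)$, $u_0\ge c_0'>0$; (ii) $f\in C^k(0,T;L^\infty(\Omega))\cap C^{k+1}(0,T;L^2(\Omega))$ for an integer $k\ge1$, $f\ge0$, and for some $T_0>0$ one has $f(x,t)=f_1(x)$ for $0<t\le T_0$ and $f(x,t)=f_2(x)$ for $t\ge2T_0$; (iii) $g=g(x)\in W^{3/2,2}(\partial\Omega)\cap W^{1,\infty}(\partial\Omega)$, $g\ge c_g>0$; (iv) $D\in\mathcal A_D\cap W^{1,\infty}(\Omega)$, $\sigma\in\mathcal A_\sigma$. Under these assumptions $u\ge\underline c_u$ on $\overline\Omega\times[0,T]$ for some constant $\underline c_u>0$. The times satisfy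 $0<T_1\le T_0$ and $2T_0\le T_2\le T$. *)

theory Defs
  imports "HOL-Analysis.Analysis" "HOL-Probability.Essential_Supremum"
begin

(* Functions on \<Omega> are total functions of which only the values on \<Omega> matter; two functions
   that agree a.e. on \<Omega> represent the same element of the spaces below. *)

definition convex_polyhedral_domain :: "(real^'d) set \<Rightarrow> bool" where
  "convex_polyhedral_domain \<Omega> \<longleftrightarrow> \<Omega> \<noteq> {} \<and> (\<exists>P. polytope P \<and> \<Omega> = interior P)"

definition L2 :: "(real^'d) set \<Rightarrow> (real^'d \<Rightarrow> real) set" where
  "L2 \<Omega> = {f \<in> borel_measurable (lebesgue_on \<Omega>). integrable (lebesgue_on \<Omega>) (\<lambda>x. (f x)\<^sup>2)}"

definition L2_norm :: "(real^'d) set \<Rightarrow> (real^'d \<Rightarrow> real) \<Rightarrow> real" where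
  "L2_norm \<Omega> f = sqrt (LINT x|lebesgue_on \<Omega>. (f x)\<^sup>2)"

definition Linf :: "(real^'d) set \<Rightarrow> (real^'d \<Rightarrow> real) set" where
  "Linf \<Omega> = {f \<in> borel_measurable (lebesgue_on \<Omega>).
                esssup (lebesgue_on \<Omega>) (\<lambda>x. ereal \<bar>f x\<bar>) < \<infinity>}"

definition Linf_norm :: "(real^'d) set \<Rightarrow> (real^'d \<Rightarrow> real) \<Rightarrow> real" where
  "Linf_norm \<Omega> f = real_of_ereal (esssup (lebesgue_on \<Omega>) (\<lambda>x. ereal \<bar>f x\<bar>))"

definition pd :: "'d \<Rightarrow> (real^'d \<Rightarrow> real) \<Rightarrow> real^'d \<Rightarrow> real" where
  "pd i f x = frechet_derivative f (at x) (axis i 1)"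

definition smooth :: "(real^'d \<Rightarrow> real) \<Rightarrow> bool" where
  "smooth f \<longleftrightarrow> (\<forall>is x. foldr pd is f differentiable (at x))"

definition test_functions :: "(real^'d) set \<Rightarrow> (real^'d \<Rightarrow> real) set" where
  "test_functions \<Omega> = {\<phi>. smooth \<phi> \<and> compact (closure {x. \<phi> x \<noteq> 0}) \<and> closure {x. \<phi> x \<noteq> 0} \<subseteq> \<Omega>}"

definition locally_integrable :: "(real^'d) set \<Rightarrow> (real^'d \<Rightarrow> real) \<Rightarrow> bool" where
  "locally_integrable \<Omega> f \<longleftrightarrow> (\<forall>K. compact K \<and> K \<subseteq> \<Omega> \<longrightarrow> integrable (lebesgue_on K) f)"

definition is_weak_pd :: "(real^'d) set \<Rightarrow> 'd \<Rightarrow> (real^'d \<Rightarrow> real) \<Rightarrow> (real^'d \<Rightarrow> real) \<Rightarrow> bool" where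
  "is_weak_pd \<Omega> i f h \<longleftrightarrow> locally_integrable \<Omega> f \<and> locally_integrable \<Omega> h \<and>
     (\<forall>\<phi> \<in> test_functions \<Omega>.
        (LINT x|lebesgue_on \<Omega>. f x * pd i \<phi> x) = - (LINT x|lebesgue_on \<Omega>. h x * \<phi> x))"

(* For open \<Omega> weak derivatives are unique up to null sets, so the choice is immaterial wherever a
   weak derivative exists; on functions without one, weak_pd and weak_grad are meaningless. *)
definition weak_pd :: "(real^'d) set \<Rightarrow> 'd \<Rightarrow> (real^'d \<Rightarrow> real) \<Rightarrow> real^'d \<Rightarrow> real" where
  "weak_pd \<Omega> i f = (SOME h. is_weak_pd \<Omega> i f h)"

definition weak_grad :: "(real^'d) set \<Rightarrow> (real^'d \<Rightarrow> real) \<Rightarrow> real^'d \<Rightarrow> real^'d" where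
  "weak_grad \<Omega> f x = (\<chi> i. weak_pd \<Omega> i f x)"

(* sobolev X \<Omega> k: all weak derivatives of order at most k exist and lie in X. *)
primrec sobolev ::
  "(real^'d \<Rightarrow> real) set \<Rightarrow> (real^'d) set \<Rightarrow> nat \<Rightarrow> (real^'d \<Rightarrow> real) set" where
  "sobolev X \<Omega> 0 = X"
| "sobolev X \<Omega> (Suc k) = {f \<in> X. \<forall>i. \<exists>h \<in> sobolev X \<Omega> k. is_weak_pd \<Omega> i f h}"

abbreviation W12 :: "(real^'d) set \<Rightarrow> (real^'d \<Rightarrow> real) set" where
  "W12 \<Omega> \<equiv> sobolev (L2 \<Omega>) \<Omega> 1"

abbreviation W22 :: "(real^'d) set \<Rightarrow> (real^'d \<Rightarrow> real) set" where
  "W22 \<Omega> \<equiv> sobolev (L2 \<Omega>) \<Omega> 2"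

abbreviation W1inf :: "(real^'d) set \<Rightarrow> (real^'d \<Rightarrow> real) set" where
  "W1inf \<Omega> \<equiv> sobolev (Linf \<Omega>) \<Omega> 1"

definition W12_norm :: "(real^'d) set \<Rightarrow> (real^'d \<Rightarrow> real) \<Rightarrow> real" where
  "W12_norm \<Omega> f = sqrt ((L2_norm \<Omega> f)\<^sup>2 + (\<Sum>i\<in>UNIV. (L2_norm \<Omega> (weak_pd \<Omega> i f))\<^sup>2))"

definition W12_0 :: "(real^'d) set \<Rightarrow> (real^'d \<Rightarrow> real) set" where
  "W12_0 \<Omega> = {f \<in> W12 \<Omega>. \<exists>\<phi>. (\<forall>n::nat. \<phi> n \<in> test_functions \<Omega>) \<and>
                 (\<lambda>n. W12_norm \<Omega> (\<lambda>x. f x - \<phi> n x)) \<longlonglongrightarrow> 0}"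

(* v = g on the boundary in the sense of traces, for continuous boundary data g.  The extension G
   is irrelevant: a W12 function that is continuous on the closure and vanishes on the boundary
   lies in W12_0. *)
definition has_trace :: "(real^'d) set \<Rightarrow> (real^'d \<Rightarrow> real) \<Rightarrow> (real^'d \<Rightarrow> real) \<Rightarrow> bool" where
  "has_trace \<Omega> v g \<longleftrightarrow> v \<in> W12 \<Omega> \<and>
     (\<exists>G \<in> W12 \<Omega>. continuous_on (closure \<Omega>) G \<and> (\<forall>x \<in> frontier \<Omega>. G x = g x) \<and>
        (\<lambda>x. v x - G x) \<in> W12_0 \<Omega>)"

(* Continuous elements of the space of order 3/2 on the boundary, as the trace space of W22.  For
   dimension at most 3 every trace of a W22 function has a continuous representative. *)
definition W32_2_bd :: "(real^'d) set \<Rightarrow> (real^'d \<Rightarrow> real) set" where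
  "W32_2_bd \<Omega> = {g. \<exists>G \<in> W22 \<Omega>. has_trace \<Omega> G g}"

(* On the boundary of a bounded convex domain the space of order 1 and exponent \<infinity> consists of the
   Lipschitz functions. *)
definition W1inf_bd :: "(real^'d) set \<Rightarrow> (real^'d \<Rightarrow> real) set" where
  "W1inf_bd \<Omega> = {g. \<exists>L. L-lipschitz_on (frontier \<Omega>) g}"

definition time_continuous_on ::
  "((real^'d \<Rightarrow> real) \<Rightarrow> real) \<Rightarrow> real set \<Rightarrow> (real \<Rightarrow> real^'d \<Rightarrow> real) \<Rightarrow> bool" where
  "time_continuous_on N I v \<longleftrightarrow>
     (\<forall>t\<in>I. ((\<lambda>s. N (\<lambda>x. v s x - v t x)) \<longlongrightarrow> 0) (at t within I))"

definition has_time_derivative_on ::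
  "((real^'d \<Rightarrow> real) \<Rightarrow> real) \<Rightarrow> real set \<Rightarrow> (real \<Rightarrow> real^'d \<Rightarrow> real) \<Rightarrow>
     (real \<Rightarrow> real^'d \<Rightarrow> real) \<Rightarrow> bool" where
  "has_time_derivative_on N I v v' \<longleftrightarrow>
     (\<forall>t\<in>I. ((\<lambda>s. N (\<lambda>x. (v s x - v t x) / (s - t) - v' t x)) \<longlongrightarrow> 0) (at t within I))"

(* k times continuously differentiable on I with values in X, N being the norm of X. *)
primrec Ck_time ::
  "(real^'d \<Rightarrow> real) set \<Rightarrow> ((real^'d \<Rightarrow> real) \<Rightarrow> real) \<Rightarrow> real set \<Rightarrow> nat \<Rightarrow>
     (real \<Rightarrow> real^'d \<Rightarrow> real) set" where
  "Ck_time X N I 0 = {v. (\<forall>t\<in>I. v t \<in> X) \<and> time_continuous_on N I v}"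
| "Ck_time X N I (Suc k) = {v. (\<forall>t\<in>I. v t \<in> X) \<and> time_continuous_on N I v \<and>
     (\<exists>v' \<in> Ck_time X N I k. has_time_derivative_on N I v v')}"

(* The sets A_D and A_q are instances of adm_W12, the set A_\<sigma> is an instance of adm_Linf. *)
definition adm_W12 :: "(real^'d) set \<Rightarrow> real \<Rightarrow> real \<Rightarrow> (real^'d \<Rightarrow> real) set" where
  "adm_W12 \<Omega> lo hi = {a \<in> W12 \<Omega>. AE x in lebesgue_on \<Omega>. lo \<le> a x \<and> a x \<le> hi}"

definition adm_Linf :: "(real^'d) set \<Rightarrow> real \<Rightarrow> (real^'d \<Rightarrow> real) set" where
  "adm_Linf \<Omega> hi = {a \<in> Linf \<Omega>. AE x in lebesgue_on \<Omega>. 0 \<le> a x \<and> a x \<le> hi}"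

(* u is the solution, with time derivative ut, of
     u_t - div (D grad u) + \<sigma> u = f in \<Omega> x (0,T],  u = g on the boundary,  u(0) = u0,
   as a classical solution of the evolution equation in L2: continuous on [0,T] and continuously
   differentiable on (0,T] (initial and boundary data need not be compatible), the elliptic part
   being taken in the weak sense at each time. *)
definition parabolic_solution ::
  "(real^'d) set \<Rightarrow> real \<Rightarrow> (real^'d \<Rightarrow> real) \<Rightarrow> (real^'d \<Rightarrow> real) \<Rightarrow> (real \<Rightarrow> real^'d \<Rightarrow> real) \<Rightarrow>
     (real^'d \<Rightarrow> real) \<Rightarrow> (real^'d \<Rightarrow> real) \<Rightarrow> (real \<Rightarrow> real^'d \<Rightarrow> real) \<Rightarrow>
     (real \<Rightarrow> real^'d \<Rightarrow> real) \<Rightarrow> bool" where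
  "parabolic_solution \<Omega> T D \<sigma> f g u0 u ut \<longleftrightarrow>
     u \<in> Ck_time (L2 \<Omega>) (L2_norm \<Omega>) {0..T} 0 \<and>
     ut \<in> Ck_time (L2 \<Omega>) (L2_norm \<Omega>) {0<..T} 0 \<and>
     has_time_derivative_on (L2_norm \<Omega>) {0<..T} u ut \<and>
     (AE x in lebesgue_on \<Omega>. u 0 x = u0 x) \<and>
     (\<forall>t\<in>{0<..T}. has_trace \<Omega> (u t) g \<and>
        (\<forall>\<phi> \<in> W12_0 \<Omega>.
           (LINT x|lebesgue_on \<Omega>. ut t x * \<phi> x + D x * (weak_grad \<Omega> (u t) x \<bullet> weak_grad \<Omega> \<phi> x)
                                   + \<sigma> x * u t x * \<phi> x)
           = (LINT x|lebesgue_on \<Omega>. f t x * \<phi> x)))"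

(* w is the weak solution of - div (q grad w) = F in \<Omega>, w = 0 on the boundary. *)
definition elliptic_weak_solution ::
  "(real^'d) set \<Rightarrow> (real^'d \<Rightarrow> real) \<Rightarrow> (real^'d \<Rightarrow> real) \<Rightarrow> (real^'d \<Rightarrow> real) \<Rightarrow> bool" where
  "elliptic_weak_solution \<Omega> q F w \<longleftrightarrow> w \<in> W12_0 \<Omega> \<and>
     (\<forall>\<phi> \<in> W12_0 \<Omega>. (LINT x|lebesgue_on \<Omega>. q x * (weak_grad \<Omega> w x \<bullet> weak_grad \<Omega> \<phi> x))
                     = (LINT x|lebesgue_on \<Omega>. F x * \<phi> x))"

end

theory Submission
  imports Defs
begin

text \<open>
  Write \<open>u\<^sub>1 = u(T\<^sub>1)\<close>, \<open>u\<^sub>2 = u(T\<^sub>2)\<close> and let \<open>q'\<close>, \<open>F'\<close>, \<open>w'\<close> be the second set of data.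

  \<^bold>\<open>The quotient.\<close> Testing the parabolic equation at time \<open>T\<^sub>2\<close> with \<open>u\<^sub>1 \<phi>\<close> and at time \<open>T\<^sub>1\<close> with
  \<open>u\<^sub>2 \<phi>\<close> produces the same reaction term \<open>\<sigma> u\<^sub>1 u\<^sub>2 \<phi>\<close> twice. In the difference it cancels, and the
  fluxes combine to \<open>D (u\<^sub>1 \<nabla>u\<^sub>2 - u\<^sub>2 \<nabla>u\<^sub>1) = q \<nabla>(u\<^sub>2 / u\<^sub>1)\<close>. Hence \<open>u\<^sub>2 / u\<^sub>1 - 1\<close> solves the elliptic
  problem that defines \<open>w\<close>, and uniqueness gives the first claim (\<open>quotient_of_snapshots\<close>). Two points
  need care. The quotient must be differentiable: since \<open>q = D u\<^sub>1\<^sup>2\<close> lies between positive bounds and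
  \<open>q\<close>, \<open>D\<close> have bounded gradients, so have \<open>u\<^sub>1\<close> and \<open>1 / u\<^sub>1\<close> (\<open>reciprocal_snapshot\<close>). It must also
  vanish on the boundary: \<open>u\<^sub>1\<close> and \<open>u\<^sub>2\<close> have the same trace, and a continuous function in \<open>W\<^sup>1\<^sup>,\<^sup>2\<close>
  that vanishes on the boundary is a limit of test functions (\<open>W12_0_continuous_vanishing\<close>).

  \<^bold>\<open>The weighted estimate.\<close> Let \<open>\<psi> = (q - q') / q\<close>. Pointwise
  \<open>2 q \<psi> \<nabla>w \<bullet> \<nabla>(\<psi> w) = q \<nabla>w \<bullet> \<nabla>(\<psi>\<^sup>2 w) + q \<psi>\<^sup>2 \<bar>\<nabla>w\<bar>\<^sup>2\<close>. Integrating and using the equation of \<open>w\<close>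
  with the test function \<open>\<psi>\<^sup>2 w\<close> turns the right-hand side into the weighted integral of the claim. On
  the left, \<open>q \<psi> = q - q'\<close>, and the difference of the two elliptic equations, tested with \<open>\<psi> w\<close>, gives
  \<open>\<integral> (q - q') \<nabla>w \<bullet> \<nabla>(\<psi> w) = \<integral> (F - F') \<psi> w - \<integral> q' \<nabla>(w - w') \<bullet> \<nabla>(\<psi> w)\<close>, to which the Cauchy-Schwarz
  inequality applies (\<open>weighted_stability\<close>). The gradient of \<open>\<psi> w\<close> contains \<open>w \<nabla>\<psi>\<close>, and \<open>\<nabla>\<psi>\<close> is
  controlled in \<open>L\<^sup>2\<close> only. Therefore \<open>w\<close> has to be bounded, which follows by comparison with an
  exponential barrier because \<open>q\<close> has a bounded gradient (\<open>elliptic_bounded\<close>).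

  \<^bold>\<open>The unweighted estimate.\<close> Where the distance to the boundary is at least \<open>\<rho>\<close>, the weight is at least
  \<open>c\<^sub>0 \<rho>\<^sup>\<beta>\<close>, so the integral of \<open>(q - q')\<^sup>2\<close> over this region is of order \<open>\<delta> / \<rho>\<^sup>\<beta>\<close>, where \<open>\<delta>\<close> is the
  error in the data. The remaining boundary layer of the convex domain has measure \<open>O(\<rho>)\<close>
  (\<open>boundary_layer_measure\<close>). The choice \<open>\<rho> = \<delta>\<^bsup>1/(1+\<beta>)\<^esup>\<close> balances both contributions
  (\<open>weighted_to_L2\<close>).

  \<^bold>\<open>Sobolev functions.\<close> The arguments need a calculus for weak derivatives and for the closure \<open>W12_0\<close> of
  the test functions. It rests on mollification: mollifications of \<open>L\<^sup>2\<close> functions are smooth and converge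
  (\<open>mollify_L2\<close>), weak derivatives are unique (\<open>fundamental_lemma\<close>), and identities for weak derivatives
  are inherited from smooth functions by local approximation (\<open>local_smooth_approx\<close>), in particular the
  product and the chain rule. The chain rule supplies truncations. These show that bounded factors
  preserve \<open>W12_0\<close> (\<open>W12_0_mult_bounded\<close>), which makes \<open>\<psi> w\<close> and \<open>\<psi>\<^sup>2 w\<close> admissible test functions.
\<close>


section \<open>Smooth functions and test functions\<close>

lemma pd_eqI:
  fixes f :: "real^'d \<Rightarrow> real"
  assumes "(f has_derivative f') (at x)"
  shows "pd i f x = f' (axis i 1)"
  using frechet_derivative_at[OF assms] by (simp add: pd_def)

lemma has_derivative_frechet:
  fixes f :: "real^'d \<Rightarrow> real"
  assumes "f differentiable (at x)"
  shows "(f has_derivative frechet_derivative f (at x)) (at x)"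
  using assms frechet_derivative_works by blast

lemma frechet_pd_sum:
  fixes f :: "real^'d \<Rightarrow> real"
  assumes "f differentiable (at x)"
  shows "frechet_derivative f (at x) h = (\<Sum>i\<in>UNIV. h $ i * pd i f x)"
proof -
  interpret bounded_linear "frechet_derivative f (at x)"
    using has_derivative_frechet[OF assms] by (rule has_derivative_bounded_linear)
  have "h = (\<Sum>i\<in>UNIV. h $ i *\<^sub>R axis i 1)"
    using basis_expansion[of h] by (simp add: scalar_mult_eq_scaleR)
  then have "frechet_derivative f (at x) h = frechet_derivative f (at x) (\<Sum>i\<in>UNIV. h $ i *\<^sub>R axis i 1)"
    by simp
  then show ?thesis
    by (simp add: sum scaleR pd_def)
qed

lemma has_derivative_pd_sum:
  fixes f :: "real^'d \<Rightarrow> real"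
  assumes "f differentiable (at x)"
  shows "(f has_derivative (\<lambda>h. \<Sum>i\<in>UNIV. h $ i * pd i f x)) (at x)"
  using has_derivative_frechet[OF assms] frechet_pd_sum[OF assms] by (metis (no_types, lifting) ext)

lemma pd_const [simp]: "pd i (\<lambda>x. c) = (\<lambda>x. 0)"
  by (rule ext, rule pd_eqI, rule has_derivative_const)

lemma pd_add:
  assumes "f differentiable (at x)" "g differentiable (at x)"
  shows "pd i (\<lambda>x. f x + g x) x = pd i f x + pd i g x"
  using pd_eqI[OF has_derivative_add[OF assms[THEN has_derivative_frechet]], of i] by (simp add: pd_def)

lemma pd_diff:
  assumes "f differentiable (at x)" "g differentiable (at x)"
  shows "pd i (\<lambda>x. f x - g x) x = pd i f x - pd i g x"
  using pd_eqI[OF has_derivative_diff[OF assms[THEN has_derivative_frechet]], of i] by (simp add: pd_def)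

lemma pd_mult:
  assumes "f differentiable (at x)" "g differentiable (at x)"
  shows "pd i (\<lambda>x. f x * g x) x = f x * pd i g x + g x * pd i f x"
  using pd_eqI[OF has_derivative_mult[OF assms[THEN has_derivative_frechet]], of i] by (simp add: pd_def)

lemma pd_coord:
  "pd i (\<lambda>x::real^'d. x $ j) x = (if i = j then 1 else 0)"
proof -
  have "((\<lambda>x::real^'d. x $ j) has_derivative (\<lambda>h. h $ j)) (at x)"
    by (rule bounded_linear_imp_has_derivative) (rule bounded_linear_vec_nth)
  from pd_eqI[OF this, of i] show ?thesis by (simp add: axis_def)
qed

lemma has_derivative_comp_real:
  fixes f :: "real^'d \<Rightarrow> real"
  assumes "(p has_real_derivative p' (f x)) (at (f x))" "f differentiable (at x)"
  shows "((\<lambda>x. p (f x)) has_derivative (\<lambda>h. p' (f x) * frechet_derivative f (at x) h)) (at x)"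
  using has_derivative_compose[OF has_derivative_frechet[OF assms(2)], of p "\<lambda>h. p' (f x) * h"] assms(1)
  by (simp add: has_field_derivative_def)

lemma pd_comp:
  fixes f :: "real^'d \<Rightarrow> real"
  assumes "(p has_real_derivative p' (f x)) (at (f x))" "f differentiable (at x)"
  shows "pd i (\<lambda>x. p (f x)) x = p' (f x) * pd i f x"
  using pd_eqI[OF has_derivative_comp_real[where p=p and p'=p' and f=f, OF assms], of i] by (simp add: pd_def)

lemma differentiable_comp:
  fixes f :: "real^'d \<Rightarrow> real"
  assumes "(p has_real_derivative p' (f x)) (at (f x))" "f differentiable (at x)"
  shows "(\<lambda>x. p (f x)) differentiable (at x)"
  using has_derivative_comp_real[where p=p and p'=p' and f=f, OF assms] by (rule differentiableI)

lemma smooth_differentiable: "smooth f \<Longrightarrow> f differentiable (at x)"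
  unfolding smooth_def by (metis foldr_Nil id_apply)

lemma smooth_pd: "smooth f \<Longrightarrow> smooth (pd i f)"
  unfolding smooth_def
proof (intro allI)
  fix "is" x assume *: "\<forall>is x. foldr pd is f differentiable (at x)"
  show "foldr pd is (pd i f) differentiable (at x)"
    using *[rule_format, of "is @ [i]" x] by simp
qed

text \<open>Smoothness is the weakest property that implies differentiability and passes to all partial
  derivatives. It therefore suffices to exhibit some family of functions with these two features.\<close>

lemma smooth_coinduct:
  assumes "f \<in> S" "\<And>f x. f \<in> S \<Longrightarrow> f differentiable (at x)" "\<And>f i. f \<in> S \<Longrightarrow> pd i f \<in> S"
  shows "smooth f"
proof -
  have "foldr pd is f \<in> S" for "is"
    by (induction "is") (auto intro: assms)
  then show ?thesis using assms(2) unfolding smooth_def by blast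
qed

lemma smooth_continuous: "smooth f \<Longrightarrow> continuous_on A f"
  by (meson continuous_at_imp_continuous_on differentiable_imp_continuous_within smooth_differentiable)

lemma smooth_const [simp]: "smooth (\<lambda>x. c)"
  by (rule smooth_coinduct[where S="range (\<lambda>c x. c)"]) auto

lemma smooth_add:
  assumes "smooth f" "smooth g" shows "smooth (\<lambda>x. f x + g x)"
proof (rule smooth_coinduct[where S="{\<lambda>x. f x + g x | f g. smooth f \<and> smooth g}"])
  fix h i assume "h \<in> {\<lambda>x. f x + g x | f g. smooth f \<and> smooth g}"
  then obtain f g where h: "h = (\<lambda>x. f x + g x)" "smooth f" "smooth g" by blast
  then have "pd i h = (\<lambda>x. pd i f x + pd i g x)"
    by (auto simp: pd_add smooth_differentiable)
  then show "pd i h \<in> {\<lambda>x. f x + g x | f g. smooth f \<and> smooth g}" using h smooth_pd by blast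
next
  show "(\<lambda>x. f x + g x) \<in> {\<lambda>x. f x + g x | f g. smooth f \<and> smooth g}" using assms by blast
qed (auto intro!: derivative_intros intro: smooth_differentiable)

text \<open>By the product rule, products alone are not closed under differentiation; their finite sums are.\<close>

inductive_set sum_of_products :: "(real^'d \<Rightarrow> real) set" where
  "smooth f \<Longrightarrow> smooth g \<Longrightarrow> (\<lambda>x. f x * g x) \<in> sum_of_products"
| "f \<in> sum_of_products \<Longrightarrow> g \<in> sum_of_products \<Longrightarrow> (\<lambda>x. f x + g x) \<in> sum_of_products"

lemma smooth_mult:
  assumes "smooth f" "smooth g" shows "smooth (\<lambda>x. f x * g x)"
proof (rule smooth_coinduct[where S=sum_of_products])
  show "(\<lambda>x. f x * g x) \<in> sum_of_products" using assms by (rule sum_of_products.intros(1))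
  show diff: "h differentiable (at x)" if "h \<in> sum_of_products" for h :: "real^'d \<Rightarrow> real" and x
    using that by induction (auto intro!: derivative_intros intro: smooth_differentiable)
  show "pd i h \<in> sum_of_products" if "h \<in> sum_of_products" for h :: "real^'d \<Rightarrow> real" and i
    using that
  proof induction
    case (1 f g)
    then have "pd i (\<lambda>x. f x * g x) = (\<lambda>x. f x * pd i g x + g x * pd i f x)"
      by (auto simp: pd_mult smooth_differentiable)
    then show ?case using 1 by (auto intro!: sum_of_products.intros smooth_pd)
  next
    case (2 f g)
    then have "pd i (\<lambda>x. f x + g x) = (\<lambda>x. pd i f x + pd i g x)"
      by (auto simp: pd_add diff)
    then show ?case using 2 by (auto intro!: sum_of_products.intros)
  qed
qed

lemma smooth_cmult: "smooth f \<Longrightarrow> smooth (\<lambda>x. c * f x)"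
  using smooth_mult[of "\<lambda>x. c" f] by simp

lemma smooth_diff: "smooth f \<Longrightarrow> smooth g \<Longrightarrow> smooth (\<lambda>x. f x - g x)"
  using smooth_add[of f "\<lambda>x. (-1) * g x"] smooth_cmult[of g "-1"] by simp

lemma smooth_prod:
  assumes "finite A" "\<And>i. i \<in> A \<Longrightarrow> smooth (f i)" shows "smooth (\<lambda>x. \<Prod>i\<in>A. f i x)"
  using assms by (induction A) (auto intro!: smooth_mult)

lemma pd_reflect:
  fixes f :: "real^'d \<Rightarrow> real"
  assumes "f differentiable (at (a - x))"
  shows "(\<lambda>y. f (a - y)) differentiable (at x)" "pd i (\<lambda>y. f (a - y)) x = - pd i f (a - x)"
proof -
  have "((\<lambda>y. a - y) has_derivative (\<lambda>h. - h)) (at x)"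
    by (auto intro!: derivative_eq_intros)
  from has_derivative_compose[OF this has_derivative_pd_sum[OF assms]]
  have *: "((\<lambda>y. f (a - y)) has_derivative (\<lambda>h. \<Sum>i\<in>UNIV. (- h) $ i * pd i f (a - x))) (at x)" .
  then show "(\<lambda>y. f (a - y)) differentiable (at x)" by (rule differentiableI)
  have "(\<Sum>j\<in>UNIV. (- axis i 1) $ j * pd j f (a - x)) = (\<Sum>j\<in>UNIV. if j = i then - pd j f (a - x) else 0)"
    by (rule sum.cong) (auto simp: axis_def)
  then show "pd i (\<lambda>y. f (a - y)) x = - pd i f (a - x)"
    using pd_eqI[OF *, of i] by simp
qed

lemma smooth_reflect:
  fixes f :: "real^'d \<Rightarrow> real"
  assumes "smooth f" shows "smooth (\<lambda>y. f (a - y))"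
proof (rule smooth_coinduct[where S="{\<lambda>y. f (a - y) | f. smooth f}"])
  fix h i assume "h \<in> {\<lambda>y. f (a - y) | f. smooth f}"
  then obtain f where h: "h = (\<lambda>y. f (a - y))" "smooth f" by blast
  then have "pd i h = (\<lambda>y. (\<lambda>z. (-1) * pd i f z) (a - y))"
    by (auto simp: pd_reflect smooth_differentiable)
  then show "pd i h \<in> {\<lambda>y. f (a - y) | f. smooth f}"
    using smooth_cmult[OF smooth_pd[OF h(2)], of "-1" i] by (intro CollectI exI[of _ "\<lambda>z. (-1) * pd i f z"]) simp
next
  show "(\<lambda>y. f (a - y)) \<in> {\<lambda>y. f (a - y) | f. smooth f}" using assms by blast
qed (auto intro!: pd_reflect intro: smooth_differentiable)

lemma smooth_exp_coord: "smooth (\<lambda>x::real^'d. c * exp (l * x $ i))"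
proof (rule smooth_coinduct[where S="range (\<lambda>c x. c * exp (l * x $ i))"])
  have *: "((\<lambda>x::real^'d. c * exp (l * x $ i)) has_derivative
          (\<lambda>h. (c * l * exp (l * x $ i)) * h $ i)) (at x)" for c and x :: "real^'d"
    by (auto intro!: derivative_eq_intros bounded_linear_imp_has_derivative bounded_linear_vec_nth)
  show "h differentiable at x" if "h \<in> range (\<lambda>c x. c * exp (l * x $ i))" for h and x :: "real^'d"
    using that differentiableI[OF *] by blast
  show "pd j h \<in> range (\<lambda>c x. c * exp (l * x $ i))" if "h \<in> range (\<lambda>c x. c * exp (l * x $ i))"
    for h :: "real^'d \<Rightarrow> real" and j
  proof -
    from that obtain c where h: "h = (\<lambda>x. c * exp (l * x $ i))" by auto
    have "pd j h = (\<lambda>x. (if i = j then c * l else 0) * exp (l * x $ i))"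
      unfolding h using pd_eqI[OF *, of j] by (auto simp: axis_def)
    then show ?thesis by blast
  qed
qed blast

lemma pd_exp_coord: "pd j (\<lambda>x::real^'d. c * exp (l * x $ i)) x = (if j = i then c * l * exp (l * x $ i) else 0)"
proof -
  have *: "((\<lambda>x::real^'d. c * exp (l * x $ i)) has_derivative
          (\<lambda>h. (c * l * exp (l * x $ i)) * h $ i)) (at x)"
    by (auto intro!: derivative_eq_intros bounded_linear_imp_has_derivative bounded_linear_vec_nth)
  then show ?thesis using pd_eqI[OF *, of j] by (auto simp: axis_def)
qed

lemma smooth_coord: "smooth (\<lambda>x::real^'d. x $ i)"
proof (rule smooth_coinduct[where S="insert (\<lambda>x. x $ i) (range (\<lambda>c x. c))"])
  have "pd j (\<lambda>x::real^'d. x $ i) = (\<lambda>x. if j = i then 1 else 0)" for j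
    by (auto simp: pd_coord)
  then show "pd j h \<in> insert (\<lambda>x. x $ i) (range (\<lambda>c x. c))" if "h \<in> insert (\<lambda>x. x $ i) (range (\<lambda>c x. c))"
    for h :: "real^'d \<Rightarrow> real" and j
    using that by auto
qed (auto intro: bounded_linear_imp_differentiable[OF bounded_linear_vec_nth])

subsection \<open>Compactly supported functions\<close>

lemma test_smooth: "\<phi> \<in> test_functions \<Omega> \<Longrightarrow> smooth \<phi>"
  by (simp add: test_functions_def)

lemma test_support:
  assumes "\<phi> \<in> test_functions \<Omega>"
  shows "\<exists>K. compact K \<and> K \<subseteq> \<Omega> \<and> (\<forall>x. x \<notin> K \<longrightarrow> \<phi> x = 0)"
  using assms closure_subset[of "{x. \<phi> x \<noteq> 0}"]
  by (intro exI[of _ "closure {x. \<phi> x \<noteq> 0}"]) (auto simp: test_functions_def)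

lemma test_functionI:
  assumes "smooth \<phi>" "compact K" "K \<subseteq> \<Omega>" "\<And>x. x \<notin> K \<Longrightarrow> \<phi> x = 0"
  shows "\<phi> \<in> test_functions \<Omega>"
proof -
  have "closure {x. \<phi> x \<noteq> 0} \<subseteq> K"
    using assms(2,4) by (intro closure_minimal) (auto intro: compact_imp_closed)
  moreover then have "compact (closure {x. \<phi> x \<noteq> 0})"
    using assms(2) by (meson closed_closure compact_closure bounded_subset compact_imp_bounded closure_subset subset_trans)
  ultimately show ?thesis using assms by (auto simp: test_functions_def)
qed

lemma pd_zero_outside:
  fixes f :: "real^'d \<Rightarrow> real"
  assumes "compact K" "\<And>x. x \<notin> K \<Longrightarrow> f x = 0" "x \<notin> K"
  shows "pd i f x = 0"
proof -
  have "((\<lambda>x. 0) has_derivative (\<lambda>x. 0)) (at x)" by simp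
  then have "(f has_derivative (\<lambda>x. 0)) (at x)"
    by (rule has_derivative_transform_within_open[where s="- K"])
       (use assms in \<open>auto intro: compact_imp_closed\<close>)
  from pd_eqI[OF this] show ?thesis .
qed

lemma test_pd: "\<phi> \<in> test_functions \<Omega> \<Longrightarrow> pd i \<phi> \<in> test_functions \<Omega>"
proof -
  assume \<phi>: "\<phi> \<in> test_functions \<Omega>"
  obtain K where K: "compact K" "K \<subseteq> \<Omega>" "\<forall>x. x \<notin> K \<longrightarrow> \<phi> x = 0"
    using test_support[OF \<phi>] by blast
  show ?thesis
    using smooth_pd[OF test_smooth[OF \<phi>]] K(1,2)
    by (rule test_functionI) (rule pd_zero_outside[OF K(1)], simp_all add: K(3))
qed

lemma test_mult: "smooth f \<Longrightarrow> \<phi> \<in> test_functions \<Omega> \<Longrightarrow> (\<lambda>x. f x * \<phi> x) \<in> test_functions \<Omega>"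
proof -
  assume f: "smooth f" and \<phi>: "\<phi> \<in> test_functions \<Omega>"
  obtain K where K: "compact K" "K \<subseteq> \<Omega>" "\<forall>x. x \<notin> K \<longrightarrow> \<phi> x = 0"
    using test_support[OF \<phi>] by blast
  show ?thesis
    using smooth_mult[OF f test_smooth[OF \<phi>]] K(1,2) by (rule test_functionI) (simp add: K(3))
qed

lemma test_mono: "\<phi> \<in> test_functions \<Omega> \<Longrightarrow> \<Omega> \<subseteq> \<Omega>' \<Longrightarrow> \<phi> \<in> test_functions \<Omega>'"
  by (auto simp: test_functions_def)

lemma compact_support_bounded:
  fixes f :: "real^'d \<Rightarrow> real"
  assumes "continuous_on UNIV f" "compact K" "\<And>x. x \<notin> K \<Longrightarrow> f x = 0"
  shows "\<exists>B>0. \<forall>x. \<bar>f x\<bar> \<le> B"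
proof -
  have "compact (f ` K)"
    using assms by (meson compact_continuous_image continuous_on_subset subset_UNIV)
  then obtain B where B: "B > 0" "\<forall>x\<in>f ` K. norm x \<le> B"
    using bounded_pos compact_imp_bounded by metis
  have "\<bar>f x\<bar> \<le> B" for x
    using B assms(3)[of x] by (cases "x \<in> K") auto
  with B show ?thesis by blast
qed

lemma test_bounded:
  assumes "\<phi> \<in> test_functions \<Omega>"
  shows "\<exists>B>0. \<forall>x. \<bar>\<phi> x\<bar> \<le> B"
proof -
  obtain K where K: "compact K" "\<forall>x. x \<notin> K \<longrightarrow> \<phi> x = 0"
    using test_support[OF assms] by blast
  show ?thesis
    using smooth_continuous[OF test_smooth[OF assms]] K(1)
    by (rule compact_support_bounded) (simp add: K(2))
qed

subsection \<open>Integration by parts without boundary terms\<close>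

lemma integral_lborel_shift:
  fixes f :: "'a::euclidean_space \<Rightarrow> real"
  assumes "f \<in> borel_measurable borel"
  shows "(LINT x|lborel. f (x + c)) = (LINT x|lborel. f x)"
proof -
  have "(LINT x|lborel. f x) = (LINT x|distr lborel borel ((+) c). f x)"
    by (simp add: lborel_distr_plus)
  also have "\<dots> = (LINT x|lborel. f (c + x))"
    using assms by (intro integral_distr) auto
  finally show ?thesis by (simp add: add.commute)
qed

lemma integrable_compact_support:
  fixes f :: "real^'d \<Rightarrow> real"
  assumes "continuous_on UNIV f" "compact K" "\<And>x. x \<notin> K \<Longrightarrow> f x = 0"
  shows "integrable lborel f"
proof -
  have "integrable lborel (\<lambda>x. indicator K x *\<^sub>R f x)"
    using assms by (intro borel_integrable_compact) (auto intro: continuous_on_subset)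
  moreover have "(\<lambda>x. indicator K x *\<^sub>R f x) = f"
    using assms(3) by (auto simp: indicator_def fun_eq_iff)
  ultimately show ?thesis by simp
qed

text \<open>Turns a partial derivative into a derivative in one variable, to which the mean value theorem applies.\<close>

lemma pd_line:
  fixes f :: "real^'d \<Rightarrow> real"
  assumes "\<And>x. f differentiable (at x)"
  shows "((\<lambda>t. f (x + t *\<^sub>R axis i 1)) has_real_derivative pd i f (x + t *\<^sub>R axis i 1)) (at t)"
proof -
  have "((\<lambda>t. x + t *\<^sub>R axis i 1) has_derivative (\<lambda>h. h *\<^sub>R axis i (1::real))) (at t)"
    by (auto intro!: derivative_eq_intros)
  from has_derivative_compose[OF this has_derivative_frechet[OF assms]]
  have D: "((\<lambda>t. f (x + t *\<^sub>R axis i 1)) has_derivative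
     (\<lambda>h. frechet_derivative f (at (x + t *\<^sub>R axis i 1)) (h *\<^sub>R axis i 1))) (at t)" .
  interpret bounded_linear "frechet_derivative f (at (x + t *\<^sub>R axis i 1))"
    using has_derivative_frechet[OF assms] by (rule has_derivative_bounded_linear)
  show ?thesis
    unfolding has_field_derivative_def
    by (rule has_derivative_eq_rhs[OF D]) (auto simp: scaleR pd_def mult.commute)
qed

text \<open>The integral of a difference quotient vanishes by translation invariance, and difference
  quotients converge boundedly to the partial derivative.\<close>

lemma integral_pd_zero:
  fixes f :: "real^'d \<Rightarrow> real"
  assumes diff: "\<And>x. f differentiable (at x)" and cont: "continuous_on UNIV (pd i f)"
    and K: "compact K" "\<And>x. x \<notin> K \<Longrightarrow> f x = 0"
  shows "(LINT x|lborel. pd i f x) = 0"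
proof -
  define e :: "real^'d" where "e = axis i 1"
  define h where "h n = inverse (real (Suc n))" for n
  have h: "h n > 0" "h n \<le> 1" "h \<longlonglongrightarrow> 0" for n
    unfolding h_def using LIMSEQ_inverse_real_of_nat by (auto simp: divide_simps)
  define s where "s n x = (f (x + h n *\<^sub>R e) - f x) / h n" for n x
  have contf: "continuous_on UNIV f"
    using diff by (meson continuous_at_imp_continuous_on differentiable_imp_continuous_within)
  have fint: "integrable lborel f"
    using contf K by (rule integrable_compact_support)
  have fmeas [measurable]: "f \<in> borel_measurable borel"
    using contf by (rule borel_measurable_continuous_onI)
  obtain B where B: "B > 0" "\<forall>x. \<bar>pd i f x\<bar> \<le> B"
    using compact_support_bounded[OF cont K(1)] pd_zero_outside[OF K(1), of f] K(2) by blast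
  define K' where "K' = {x + y | x y. x \<in> K \<and> y \<in> cball 0 (1::real)}"
  have K': "compact K'" unfolding K'_def using K(1) by (intro compact_sums) auto
  have fs: "integrable lborel (\<lambda>x. f (x + c))" for c
  proof -
    have "integrable (distr lborel borel ((+) c)) f" by (simp add: lborel_distr_plus fint)
    then have "integrable lborel (\<lambda>x. f (c + x))" by (subst (asm) integrable_distr_eq) auto
    then show ?thesis by (simp add: add.commute)
  qed
  have s0: "(LINT x|lborel. s n x) = 0" for n
    unfolding s_def using integral_lborel_shift[OF fmeas] fs fint by simp
  have smeas: "s n \<in> borel_measurable lborel" for n
    unfolding s_def by measurable
  have bound: "norm (s n x) \<le> indicator K' x * B" for n x
  proof (cases "x \<in> K'")
    case True
    define g where "g t = f (x + t *\<^sub>R e)" for t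
    have "\<exists>z. 0 < z \<and> z < h n \<and> g (h n) - g 0 = (h n - 0) * pd i f (x + z *\<^sub>R e)"
      using pd_line[OF diff] h unfolding e_def g_def by (intro MVT2) auto
    then obtain z where "g (h n) - g 0 = h n * pd i f (x + z *\<^sub>R e)" by auto
    then have "s n x = pd i f (x + z *\<^sub>R e)"
      using h(1)[of n] by (simp add: s_def g_def)
    then show ?thesis using B(2) True by simp
  next
    case False
    have "x \<notin> K" using False K'_def by force
    have "x + h n *\<^sub>R e \<notin> K"
    proof
      assume "x + h n *\<^sub>R e \<in> K"
      moreover have "- h n *\<^sub>R e \<in> cball 0 1" using h(1,2)[of n] by (simp add: e_def norm_axis_1)
      moreover have "x = (x + h n *\<^sub>R e) + (- h n *\<^sub>R e)" by simp
      ultimately show False using False K'_def by blast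
    qed
    with \<open>x \<notin> K\<close> show ?thesis using K(2) False by (simp add: s_def)
  qed
  have lim: "(\<lambda>n. s n x) \<longlonglongrightarrow> pd i f x" for x
  proof -
    have "((\<lambda>t. (f (x + t *\<^sub>R e) - f x) / t) \<longlongrightarrow> pd i f x) (at 0)"
      using pd_line[OF diff, of x i 0] unfolding e_def by (simp add: has_field_derivative_iff)
    moreover have "filterlim h (at 0) sequentially"
      using h(1,3) by (auto simp: filterlim_at eventually_sequentially dual_order.strict_implies_not_eq)
    ultimately show ?thesis unfolding s_def by (rule filterlim_compose)
  qed
  have Bint: "integrable lborel (\<lambda>x. indicator K' x * B)"
    using K' by (auto intro!: emeasure_compact_finite borel_compact integrable_mult_left)
  have "(\<lambda>n. LINT x|lborel. s n x) \<longlonglongrightarrow> (LINT x|lborel. pd i f x)"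
    using borel_measurable_continuous_onI[OF cont] smeas Bint lim bound
    by (intro integral_dominated_convergence[where w="\<lambda>x. indicator K' x * B"]) auto
  with s0 show ?thesis by (simp add: LIMSEQ_const_iff)
qed

subsection \<open>Mollifiers\<close>

text \<open>The family below is closed under differentiation up to linear combinations, and contains
  the standard smooth function that is positive exactly on the positive half line.\<close>

definition flat :: "nat \<Rightarrow> real \<Rightarrow> real" where
  "flat k t = (if t \<le> 0 then 0 else exp (- inverse t) * inverse t ^ k)"

lemma flat_tendsto_0: "(flat k \<longlongrightarrow> 0) (at 0)"
proof -
  have "((\<lambda>x. x ^ k / exp x) \<longlongrightarrow> (0::real)) at_top" by (rule tendsto_power_div_exp_0)
  from filterlim_compose[OF this filterlim_inverse_at_top_right]
  have "((\<lambda>t. inverse t ^ k / exp (inverse t)) \<longlongrightarrow> (0::real)) (at_right 0)" .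
  then have "(flat k \<longlongrightarrow> 0) (at_right 0)"
    by (rule Lim_transform_eventually)
       (auto simp: flat_def eventually_at_filter exp_minus divide_inverse mult.commute)
  moreover have "(flat k \<longlongrightarrow> 0) (at_left 0)"
    by (rule Lim_transform_eventually[OF tendsto_const]) (auto simp: flat_def eventually_at_filter)
  ultimately show ?thesis by (simp add: filterlim_at_split)
qed

lemma flat_deriv: "(flat k has_real_derivative (flat (k+2) t - k * flat (k+1) t)) (at t)"
proof (cases t "0::real" rule: linorder_cases)
  case less
  have "((\<lambda>t. 0) has_real_derivative 0) (at t)" by simp
  then have "(flat k has_real_derivative 0) (at t)"
    by (rule has_field_derivative_transform_within_open[where S="{..<0}"]) (use less in \<open>auto simp: flat_def\<close>)
  then show ?thesis using less by (simp add: flat_def)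
next
  case equal
  have "((\<lambda>h. (flat k (0 + h) - flat k 0) / h) \<longlongrightarrow> 0) (at 0)"
    using flat_tendsto_0[of "Suc k"]
    by (rule Lim_transform_eventually) (auto simp: flat_def eventually_at_filter field_simps)
  then show ?thesis using equal by (simp add: DERIV_def flat_def)
next
  case greater
  have "((\<lambda>t. inverse t ^ k) has_real_derivative - k * inverse t ^ (k+1)) (at t)"
  proof (induction k)
    case (Suc k)
    show ?case using DERIV_mult[OF DERIV_inverse[of t] Suc] greater
      by (simp add: algebra_simps power2_eq_square)
  qed simp
  moreover have "((\<lambda>t. exp (- inverse t)) has_real_derivative exp (- inverse t) * inverse t ^ 2) (at t)"
    using greater by (auto intro!: derivative_eq_intros simp: power2_eq_square)
  ultimately have "((\<lambda>t. exp (- inverse t) * inverse t ^ k) has_real_derivative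
     (exp (- inverse t) * inverse t ^ (k+2) - k * (exp (- inverse t) * inverse t ^ (k+1)))) (at t)"
    by (intro DERIV_mult'[THEN DERIV_cong]) (auto simp: power2_eq_square algebra_simps)
  then have "(flat k has_real_derivative
     (exp (- inverse t) * inverse t ^ (k+2) - k * (exp (- inverse t) * inverse t ^ (k+1)))) (at t)"
    by (rule has_field_derivative_transform_within_open[where S="{0<..}"]) (use greater in \<open>auto simp: flat_def\<close>)
  then show ?thesis using greater by (simp add: flat_def)
qed

inductive_set flat_sums :: "real \<Rightarrow> real \<Rightarrow> 'd \<Rightarrow> (real^'d \<Rightarrow> real) set" for a b i where
  "(\<lambda>x. c * flat k (a * x $ i + b)) \<in> flat_sums a b i"
| "f \<in> flat_sums a b i \<Longrightarrow> g \<in> flat_sums a b i \<Longrightarrow> (\<lambda>x. f x + g x) \<in> flat_sums a b i"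

lemma smooth_flat: "smooth (\<lambda>x::real^'d. flat 0 (a * x $ i + b))"
proof (rule smooth_coinduct[where S="flat_sums a b i"])
  have *: "((\<lambda>x::real^'d. c * flat k (a * x $ i + b)) has_derivative
        (\<lambda>h. (c * a * (flat (k+2) (a * x $ i + b) - k * flat (k+1) (a * x $ i + b))) * h $ i)) (at x)" for c k and x :: "real^'d"
  proof -
    have 1: "((\<lambda>x::real^'d. a * x $ i + b) has_derivative (\<lambda>h. a * h $ i)) (at x)"
      by (auto intro!: derivative_eq_intros bounded_linear_imp_has_derivative bounded_linear_vec_nth)
    have 2: "(flat k has_derivative (*) (flat (k+2) t - k * flat (k+1) t)) (at t)" for t
      using flat_deriv[of k t] by (simp add: has_field_derivative_def)
    have "((\<lambda>x::real^'d. c * flat k (a * x $ i + b)) has_derivative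
       (\<lambda>h. c * ((flat (k+2) (a * x $ i + b) - k * flat (k+1) (a * x $ i + b)) * (a * h $ i)))) (at x)"
      using has_derivative_compose[OF 1 2] by (rule has_derivative_mult_right)
    then show ?thesis by (simp add: algebra_simps)
  qed
  show "(\<lambda>x. flat 0 (a * x $ i + b)) \<in> flat_sums a b i"
    using flat_sums.intros(1)[of 1 0 a i b] by simp
  show diff: "h differentiable (at x)" if "h \<in> flat_sums a b i" for h and x :: "real^'d"
    using that
  proof induction
    case (1 c k) show ?case using * by (rule differentiableI)
  qed (rule differentiable_add)
  show "pd j h \<in> flat_sums a b i" if "h \<in> flat_sums a b i" for h :: "real^'d \<Rightarrow> real" and j
    using that
  proof induction
    case (1 c k)
    have "pd j (\<lambda>x. c * flat k (a * x $ i + b)) = (\<lambda>x. (if i = j then c * a else 0) * flat (k+2) (a * x $ i + b)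
        + (if i = j then - c * a * k else 0) * flat (k+1) (a * x $ i + b))"
    proof
      fix x :: "real^'d"
      show "pd j (\<lambda>x. c * flat k (a * x $ i + b)) x = (if i = j then c * a else 0) * flat (k+2) (a * x $ i + b)
        + (if i = j then - c * a * k else 0) * flat (k+1) (a * x $ i + b)"
        using pd_eqI[OF *, of j c k x] by (auto simp: axis_def algebra_simps)
    qed
    then show ?case
      by (simp only:) (rule flat_sums.intros(2)[OF flat_sums.intros(1) flat_sums.intros(1)])
  next
    case (2 f g)
    then have "pd j (\<lambda>x. f x + g x) = (\<lambda>x. pd j f x + pd j g x)"
      by (auto simp: pd_add diff)
    then show ?case using 2 by (auto intro!: flat_sums.intros)
  qed
qed

text \<open>The normalized product of one-dimensional bumps in the coordinates.\<close>

lemma mollifier_exists: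
  assumes "\<epsilon> > 0"
  shows "\<exists>\<eta> :: real^'d \<Rightarrow> real. smooth \<eta> \<and> (\<forall>x. 0 \<le> \<eta> x) \<and>
    (\<forall>x. x \<notin> cball 0 \<epsilon> \<longrightarrow> \<eta> x = 0) \<and> (LINT x|lborel. \<eta> x) = 1"
proof -
  \<comment> \<open>the support lies in the cube of half side length \<open>d\<close>, whose points have \<open>l\<^sup>1\<close> norm at most \<open>\<epsilon>\<close>\<close>
  define d where "d = \<epsilon> / CARD('d)"
  have d: "d > 0" using assms by (simp add: d_def)
  define \<eta>0 :: "real^'d \<Rightarrow> real" where
    "\<eta>0 x = (\<Prod>i\<in>UNIV. flat 0 (1 * x $ i + d) * flat 0 ((-1) * x $ i + d))" for x
  have sm: "smooth \<eta>0"
    unfolding \<eta>0_def by (intro smooth_prod smooth_mult smooth_flat) auto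
  have pos: "0 \<le> \<eta>0 x" for x by (simp add: \<eta>0_def prod_nonneg flat_def)
  have supp: "\<eta>0 x = 0" if "x \<notin> cball 0 \<epsilon>" for x
  proof (rule ccontr)
    assume "\<eta>0 x \<noteq> 0"
    then have "\<bar>x $ i\<bar> \<le> d" for i
      unfolding \<eta>0_def flat_def by (auto simp: prod_zero_iff split: if_splits) (smt (verit, best))
    then have "norm x \<le> (\<Sum>i\<in>(UNIV::'d set). d)"
      by (intro order_trans[OF norm_le_l1_cart] sum_mono) auto
    also have "\<dots> = \<epsilon>" by (simp add: d_def)
    finally show False using that by simp
  qed
  define I where "I = (LINT x|lborel. \<eta>0 x)"
  have int: "integrable lborel \<eta>0"
    using smooth_continuous[OF sm] compact_cball supp by (rule integrable_compact_support)
  have "I \<noteq> 0"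
  proof
    assume "I = 0"
    then have "AE x in lborel. \<eta>0 x = 0"
      unfolding I_def using int pos by (subst (asm) integral_nonneg_eq_0_iff_AE) auto
    then have "AE x in lebesgue. x \<in> {x. \<eta>0 x = 0}" by (intro AE_completion) simp
    moreover have "closed {x. \<eta>0 x = 0}"
      using smooth_continuous[OF sm] by (auto intro!: closed_Collect_eq)
    ultimately have "0 \<in> {x. \<eta>0 x = 0}" by (intro mem_closed_if_AE_lebesgue)
    moreover have "\<eta>0 0 > 0" using d by (auto simp: \<eta>0_def flat_def intro!: prod_pos)
    ultimately show False by simp
  qed
  moreover have "I \<ge> 0" unfolding I_def using pos by (intro Bochner_Integration.integral_nonneg) auto
  ultimately have I: "I > 0" by simp
  have "smooth (\<lambda>x. (1 / I) * \<eta>0 x)" using sm by (rule smooth_cmult)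
  moreover have "\<forall>x. 0 \<le> (1 / I) * \<eta>0 x" using I pos by simp
  moreover have "\<forall>x. x \<notin> cball 0 \<epsilon> \<longrightarrow> (1 / I) * \<eta>0 x = 0" using supp by simp
  moreover have "(LINT x|lborel. (1 / I) * \<eta>0 x) = 1" using I int by (simp add: I_def)
  ultimately show ?thesis by blast
qed

section \<open>Square integrable functions\<close>

lemma L2I:
  "f \<in> borel_measurable (lebesgue_on \<Omega>) \<Longrightarrow> integrable (lebesgue_on \<Omega>) (\<lambda>x. (f x)\<^sup>2) \<Longrightarrow> f \<in> L2 \<Omega>"
  by (simp add: L2_def)

lemma L2_meas: "f \<in> L2 \<Omega> \<Longrightarrow> f \<in> borel_measurable (lebesgue_on \<Omega>)"
  by (simp add: L2_def)

lemma L2_sq: "f \<in> L2 \<Omega> \<Longrightarrow> integrable (lebesgue_on \<Omega>) (\<lambda>x. (f x)\<^sup>2)"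
  by (simp add: L2_def)

lemma meas_cong_AE:
  fixes f g :: "real^'d \<Rightarrow> real"
  assumes \<Omega>: "\<Omega> \<in> sets lebesgue" and f: "f \<in> borel_measurable (lebesgue_on \<Omega>)"
    and ae: "AE x in lebesgue_on \<Omega>. f x = g x"
  shows "g \<in> borel_measurable (lebesgue_on \<Omega>)"
proof -
  have "(\<lambda>x. if x \<in> \<Omega> then f x else 0) \<in> borel_measurable lebesgue"
    using f \<Omega> by (rule borel_measurable_if_I)
  moreover have "AE x in lebesgue. (if x \<in> \<Omega> then f x else 0) = (if x \<in> \<Omega> then g x else 0)"
    using ae \<Omega> by (auto simp: AE_restrict_space_iff elim!: eventually_mono)
  ultimately have "(\<lambda>x. if x \<in> \<Omega> then g x else 0) \<in> borel_measurable lebesgue"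
    by (rule borel_measurable_AE)
  then show ?thesis by (rule borel_measurable_if_D)
qed

lemma L2_bounded_by:
  assumes f: "f \<in> L2 \<Omega>" and g: "g \<in> borel_measurable (lebesgue_on \<Omega>)"
    and b: "AE x in lebesgue_on \<Omega>. \<bar>g x\<bar> \<le> B * \<bar>f x\<bar>"
  shows "g \<in> L2 \<Omega>"
proof (rule L2I[OF g])
  show "integrable (lebesgue_on \<Omega>) (\<lambda>x. (g x)\<^sup>2)"
  proof (rule Bochner_Integration.integrable_bound)
    show "integrable (lebesgue_on \<Omega>) (\<lambda>x. B\<^sup>2 * (f x)\<^sup>2)" using L2_sq[OF f] by simp
    show "(\<lambda>x. (g x)\<^sup>2) \<in> borel_measurable (lebesgue_on \<Omega>)" using g by measurable
    show "AE x in lebesgue_on \<Omega>. norm ((g x)\<^sup>2) \<le> norm (B\<^sup>2 * (f x)\<^sup>2)"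
      using b
    proof eventually_elim
      case (elim x)
      then have "\<bar>g x\<bar>\<^sup>2 \<le> (B * \<bar>f x\<bar>)\<^sup>2" by (intro power_mono) auto
      then show ?case by (simp add: power_mult_distrib)
    qed
  qed
qed

lemma L2_cong_AE:
  assumes "\<Omega> \<in> sets lebesgue" "f \<in> L2 \<Omega>" "AE x in lebesgue_on \<Omega>. f x = g x"
  shows "g \<in> L2 \<Omega>"
proof (rule L2_bounded_by[OF assms(2), where B=1])
  show "g \<in> borel_measurable (lebesgue_on \<Omega>)" using assms(1) L2_meas[OF assms(2)] assms(3) by (rule meas_cong_AE)
  show "AE x in lebesgue_on \<Omega>. \<bar>g x\<bar> \<le> 1 * \<bar>f x\<bar>" using assms(3) by eventually_elim simp
qed

lemma L2_mult_integrable: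
  assumes "f \<in> L2 \<Omega>" "g \<in> L2 \<Omega>"
  shows "integrable (lebesgue_on \<Omega>) (\<lambda>x. f x * g x)"
proof (rule Bochner_Integration.integrable_bound)
  show "integrable (lebesgue_on \<Omega>) (\<lambda>x. (f x)\<^sup>2 + (g x)\<^sup>2)" using assms by (auto intro: L2_sq)
  show "(\<lambda>x. f x * g x) \<in> borel_measurable (lebesgue_on \<Omega>)"
    using assms[THEN L2_meas] by measurable
  have "\<bar>a * b\<bar> \<le> \<bar>a\<^sup>2 + b\<^sup>2\<bar>" for a b :: real
  proof -
    have "2 * (\<bar>a\<bar> * \<bar>b\<bar>) \<le> a\<^sup>2 + b\<^sup>2"
      using zero_le_power2[of "\<bar>a\<bar> - \<bar>b\<bar>"] by (simp add: power2_diff)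
    moreover have "0 \<le> \<bar>a\<bar> * \<bar>b\<bar>" by simp
    ultimately show ?thesis unfolding abs_mult by linarith
  qed
  then show "AE x in lebesgue_on \<Omega>. norm (f x * g x) \<le> norm ((f x)\<^sup>2 + (g x)\<^sup>2)" by simp
qed

lemma L2_add:
  assumes "f \<in> L2 \<Omega>" "g \<in> L2 \<Omega>" shows "(\<lambda>x. f x + g x) \<in> L2 \<Omega>"
proof (rule L2I)
  show "(\<lambda>x. f x + g x) \<in> borel_measurable (lebesgue_on \<Omega>)"
    using assms[THEN L2_meas] by measurable
  have eq: "(f x + g x)\<^sup>2 = (f x)\<^sup>2 + (g x)\<^sup>2 + 2 * (f x * g x)" for x
    by (simp add: power2_sum)
  show "integrable (lebesgue_on \<Omega>) (\<lambda>x. (f x + g x)\<^sup>2)"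
    unfolding eq
    by (intro Bochner_Integration.integrable_add integrable_mult_right L2_sq L2_mult_integrable assms)
qed

lemma L2_cmult:
  assumes "f \<in> L2 \<Omega>" shows "(\<lambda>x. c * f x) \<in> L2 \<Omega>"
  using L2_meas[OF assms] by (intro L2_bounded_by[OF assms, where B="\<bar>c\<bar>"]) (auto simp: abs_mult)

lemma L2_uminus: "f \<in> L2 \<Omega> \<Longrightarrow> (\<lambda>x. - f x) \<in> L2 \<Omega>"
  using L2_cmult[of f \<Omega> "-1"] by simp

lemma L2_diff: "f \<in> L2 \<Omega> \<Longrightarrow> g \<in> L2 \<Omega> \<Longrightarrow> (\<lambda>x. f x - g x) \<in> L2 \<Omega>"
  using L2_add[of f \<Omega> "\<lambda>x. - g x"] L2_uminus[of g \<Omega>] by simp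

lemma L2_bdd_mult:
  assumes "b \<in> borel_measurable (lebesgue_on \<Omega>)" "AE x in lebesgue_on \<Omega>. \<bar>b x\<bar> \<le> B" "f \<in> L2 \<Omega>"
  shows "(\<lambda>x. b x * f x) \<in> L2 \<Omega>"
proof (rule L2_bounded_by[OF assms(3), where B=B])
  show "(\<lambda>x. b x * f x) \<in> borel_measurable (lebesgue_on \<Omega>)"
    using assms(1) L2_meas[OF assms(3)] by measurable
  show "AE x in lebesgue_on \<Omega>. \<bar>b x * f x\<bar> \<le> B * \<bar>f x\<bar>"
    using assms(2) by eventually_elim (simp add: abs_mult mult_right_mono)
qed

lemma L2_norm_nonneg: "0 \<le> L2_norm \<Omega> f"
  by (simp add: L2_norm_def)

lemma L2_norm_sq: "(L2_norm \<Omega> f)\<^sup>2 = (LINT x|lebesgue_on \<Omega>. (f x)\<^sup>2)"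
  by (simp add: L2_norm_def)

lemma L2_norm_mono:
  assumes f: "f \<in> L2 \<Omega>" and g: "g \<in> borel_measurable (lebesgue_on \<Omega>)"
    and b: "AE x in lebesgue_on \<Omega>. \<bar>g x\<bar> \<le> B * \<bar>f x\<bar>" and B: "0 \<le> B"
  shows "L2_norm \<Omega> g \<le> B * L2_norm \<Omega> f"
proof -
  have "(LINT x|lebesgue_on \<Omega>. (g x)\<^sup>2) \<le> (LINT x|lebesgue_on \<Omega>. B\<^sup>2 * (f x)\<^sup>2)"
  proof (rule integral_mono_AE)
    show "AE x in lebesgue_on \<Omega>. (g x)\<^sup>2 \<le> B\<^sup>2 * (f x)\<^sup>2"
      using b
    proof eventually_elim
      case (elim x)
      then have "\<bar>g x\<bar>\<^sup>2 \<le> (B * \<bar>f x\<bar>)\<^sup>2" by (intro power_mono) auto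
      then show ?case by (simp add: power_mult_distrib)
    qed
  qed (use L2_sq[OF f] L2_sq[OF L2_bounded_by[OF f g b]] in auto)
  then have "sqrt (LINT x|lebesgue_on \<Omega>. (g x)\<^sup>2) \<le> sqrt (B\<^sup>2 * (LINT x|lebesgue_on \<Omega>. (f x)\<^sup>2))"
    by simp
  then show ?thesis using B by (simp add: L2_norm_def real_sqrt_mult)
qed

lemma L2_norm_cong_AE:
  assumes "\<Omega> \<in> sets lebesgue" "f \<in> L2 \<Omega>" "AE x in lebesgue_on \<Omega>. f x = g x"
  shows "L2_norm \<Omega> g = L2_norm \<Omega> f"
proof -
  have "(LINT x|lebesgue_on \<Omega>. (g x)\<^sup>2) = (LINT x|lebesgue_on \<Omega>. (f x)\<^sup>2)"
  proof (rule integral_cong_AE)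
    show "AE x in lebesgue_on \<Omega>. (g x)\<^sup>2 = (f x)\<^sup>2" using assms(3) by eventually_elim simp
  qed (use L2_sq[OF assms(2)] L2_sq[OF L2_cong_AE[OF assms]] in auto)
  then show ?thesis by (simp add: L2_norm_def)
qed

lemma L2_norm_cmult: "L2_norm \<Omega> (\<lambda>x. c * f x) = \<bar>c\<bar> * L2_norm \<Omega> f"
  by (simp add: L2_norm_def power_mult_distrib real_sqrt_mult)

lemma L2_norm_minus_commute: "L2_norm \<Omega> (\<lambda>x. f x - g x) = L2_norm \<Omega> (\<lambda>x. g x - f x)"
  by (simp add: L2_norm_def power2_commute)

lemma L2_norm_eq_0:
  assumes "f \<in> L2 \<Omega>" "L2_norm \<Omega> f = 0" shows "AE x in lebesgue_on \<Omega>. f x = 0"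
proof -
  have "(LINT x|lebesgue_on \<Omega>. (f x)\<^sup>2) = 0" using assms(2) by (simp add: L2_norm_def)
  then have "AE x in lebesgue_on \<Omega>. (f x)\<^sup>2 = 0"
    using L2_sq[OF assms(1)] by (subst (asm) integral_nonneg_eq_0_iff_AE) auto
  then show ?thesis by eventually_elim simp
qed

text \<open>The quadratic form \<open>\<integral> (s f + t g)\<^sup>2\<close> in \<open>s\<close> and \<open>t\<close> is nonnegative, hence so is its determinant.\<close>

lemma L2_Cauchy_Schwarz:
  assumes f: "f \<in> L2 \<Omega>" and g: "g \<in> L2 \<Omega>"
  shows "\<bar>LINT x|lebesgue_on \<Omega>. f x * g x\<bar> \<le> L2_norm \<Omega> f * L2_norm \<Omega> g"
proof -
  define a b c where "a = (LINT x|lebesgue_on \<Omega>. (f x)\<^sup>2)" and "b = (LINT x|lebesgue_on \<Omega>. f x * g x)"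
    and "c = (LINT x|lebesgue_on \<Omega>. (g x)\<^sup>2)"
  have quad: "0 \<le> s\<^sup>2 * a + 2 * (s * t) * b + t\<^sup>2 * c" for s t
  proof -
    have "0 \<le> (LINT x|lebesgue_on \<Omega>. (s * f x + t * g x)\<^sup>2)"
      by (rule Bochner_Integration.integral_nonneg) simp
    also have "\<dots> = (LINT x|lebesgue_on \<Omega>. s\<^sup>2 * (f x)\<^sup>2 + 2 * (s * t) * (f x * g x) + t\<^sup>2 * (g x)\<^sup>2)"
      by (rule Bochner_Integration.integral_cong) (auto simp: power2_sum power_mult_distrib)
    also have "\<dots> = s\<^sup>2 * a + 2 * (s * t) * b + t\<^sup>2 * c"
      using L2_sq[OF f] L2_sq[OF g] L2_mult_integrable[OF f g]
      by (simp add: a_def b_def c_def Bochner_Integration.integral_add)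
    finally show ?thesis .
  qed
  have "b\<^sup>2 \<le> a * c"
  proof (cases "c = 0")
    case True
    have "b = 0"
    proof (rule ccontr)
      assume "b \<noteq> 0"
      from quad[of 1 "- (a + 1) / (2 * b)"] True \<open>b \<noteq> 0\<close> show False by (simp add: field_simps)
    qed
    then show ?thesis using True by simp
  next
    case False
    have "c \<ge> 0" unfolding c_def by (rule Bochner_Integration.integral_nonneg) simp
    with False have "c > 0" by simp
    from quad[of c "- b"] have "0 \<le> c * (a * c - b\<^sup>2)" by (simp add: power2_eq_square algebra_simps)
    then show ?thesis using \<open>c > 0\<close> by (simp add: zero_le_mult_iff)
  qed
  then have "\<bar>b\<bar> \<le> sqrt (a * c)" by (metis real_sqrt_abs real_sqrt_le_mono)
  then show ?thesis by (simp add: L2_norm_def a_def b_def c_def real_sqrt_mult)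
qed

lemma L2_norm_triangle:
  assumes f: "f \<in> L2 \<Omega>" and g: "g \<in> L2 \<Omega>"
  shows "L2_norm \<Omega> (\<lambda>x. f x + g x) \<le> L2_norm \<Omega> f + L2_norm \<Omega> g"
proof (rule power2_le_imp_le)
  have "(L2_norm \<Omega> (\<lambda>x. f x + g x))\<^sup>2 = (LINT x|lebesgue_on \<Omega>. (f x)\<^sup>2 + 2 * (f x * g x) + (g x)\<^sup>2)"
    unfolding L2_norm_sq by (rule Bochner_Integration.integral_cong) (auto simp: power2_sum)
  also have "\<dots> = (L2_norm \<Omega> f)\<^sup>2 + 2 * (LINT x|lebesgue_on \<Omega>. f x * g x) + (L2_norm \<Omega> g)\<^sup>2"
    using L2_sq[OF f] L2_sq[OF g] L2_mult_integrable[OF f g]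
    by (simp add: L2_norm_sq Bochner_Integration.integral_add)
  also have "\<dots> \<le> (L2_norm \<Omega> f + L2_norm \<Omega> g)\<^sup>2"
    using L2_Cauchy_Schwarz[OF f g] by (simp add: power2_sum)
  finally show "(L2_norm \<Omega> (\<lambda>x. f x + g x))\<^sup>2 \<le> (L2_norm \<Omega> f + L2_norm \<Omega> g)\<^sup>2" .
qed (simp add: L2_norm_nonneg)

lemma L2_norm_triangle_diff:
  assumes "f \<in> L2 \<Omega>" "g \<in> L2 \<Omega>" "h \<in> L2 \<Omega>"
  shows "L2_norm \<Omega> (\<lambda>x. f x - h x) \<le> L2_norm \<Omega> (\<lambda>x. f x - g x) + L2_norm \<Omega> (\<lambda>x. g x - h x)"
  using L2_norm_triangle[OF L2_diff[OF assms(1,2)] L2_diff[OF assms(2,3)]] by simp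

lemma tendsto_0_le:
  fixes f g :: "nat \<Rightarrow> real"
  assumes "g \<longlonglongrightarrow> 0" "\<And>n. 0 \<le> f n" "\<And>n. f n \<le> g n"
  shows "f \<longlonglongrightarrow> 0"
  by (rule tendsto_sandwich[OF _ _ tendsto_const assms(1)]) (simp_all add: assms(2,3))

lemma L2_tendsto_add:
  assumes "\<And>n. f n \<in> L2 \<Omega>" "f' \<in> L2 \<Omega>" "\<And>n. g n \<in> L2 \<Omega>" "g' \<in> L2 \<Omega>"
    "(\<lambda>n. L2_norm \<Omega> (\<lambda>x. f n x - f' x)) \<longlonglongrightarrow> 0" "(\<lambda>n. L2_norm \<Omega> (\<lambda>x. g n x - g' x)) \<longlonglongrightarrow> 0"
  shows "(\<lambda>n. L2_norm \<Omega> (\<lambda>x. (f n x + g n x) - (f' x + g' x))) \<longlonglongrightarrow> 0"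
proof (rule tendsto_0_le)
  show "(\<lambda>n. L2_norm \<Omega> (\<lambda>x. f n x - f' x) + L2_norm \<Omega> (\<lambda>x. g n x - g' x)) \<longlonglongrightarrow> 0"
    using tendsto_add[OF assms(5,6)] by simp
  show "L2_norm \<Omega> (\<lambda>x. (f n x + g n x) - (f' x + g' x))
     \<le> L2_norm \<Omega> (\<lambda>x. f n x - f' x) + L2_norm \<Omega> (\<lambda>x. g n x - g' x)" for n
    using L2_norm_triangle[OF L2_diff[OF assms(1,2)] L2_diff[OF assms(3,4)], of n n]
    by (simp add: algebra_simps)
qed (rule L2_norm_nonneg)

lemma L2_tendsto_inner:
  assumes "\<And>n. f n \<in> L2 \<Omega>" "f' \<in> L2 \<Omega>" "k \<in> L2 \<Omega>"
    "(\<lambda>n. L2_norm \<Omega> (\<lambda>x. f n x - f' x)) \<longlonglongrightarrow> 0"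
  shows "(\<lambda>n. LINT x|lebesgue_on \<Omega>. f n x * k x) \<longlonglongrightarrow> (LINT x|lebesgue_on \<Omega>. f' x * k x)"
proof (rule LIM_zero_cancel, rule tendsto_rabs_zero_cancel, rule tendsto_0_le)
  show "(\<lambda>n. L2_norm \<Omega> (\<lambda>x. f n x - f' x) * L2_norm \<Omega> k) \<longlonglongrightarrow> 0"
    using tendsto_mult_right[OF assms(4), of "L2_norm \<Omega> k"] by simp
  show "\<bar>(LINT x|lebesgue_on \<Omega>. f n x * k x) - (LINT x|lebesgue_on \<Omega>. f' x * k x)\<bar>
     \<le> L2_norm \<Omega> (\<lambda>x. f n x - f' x) * L2_norm \<Omega> k" for n
    using L2_Cauchy_Schwarz[OF L2_diff[OF assms(1,2)] assms(3), of n]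
      L2_mult_integrable[OF assms(1,3), of n] L2_mult_integrable[OF assms(2,3)]
    by (simp add: left_diff_distrib Bochner_Integration.integral_diff)
qed simp

lemma L2_AE_subseq:
  assumes "\<And>n. f n \<in> L2 \<Omega>" "f' \<in> L2 \<Omega>"
    "(\<lambda>n. L2_norm \<Omega> (\<lambda>x. f n x - f' x)) \<longlonglongrightarrow> 0"
  shows "\<exists>r::nat\<Rightarrow>nat. strict_mono r \<and> (AE x in lebesgue_on \<Omega>. (\<lambda>n. f (r n) x) \<longlonglongrightarrow> f' x)"
proof -
  have "(\<lambda>n. LINT x|lebesgue_on \<Omega>. norm ((f n x - f' x)\<^sup>2)) \<longlonglongrightarrow> 0"
    using tendsto_power[OF assms(3), of 2] by (simp add: L2_norm_sq)
  from tendsto_L1_AE_subseq[OF _ this] L2_sq[OF L2_diff[OF assms(1,2)]]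
  obtain r :: "nat \<Rightarrow> nat" where r: "strict_mono r" "AE x in lebesgue_on \<Omega>. (\<lambda>n. (f (r n) x - f' x)\<^sup>2) \<longlonglongrightarrow> 0"
    by blast
  have "AE x in lebesgue_on \<Omega>. (\<lambda>n. f (r n) x) \<longlonglongrightarrow> f' x"
    using r(2)
  proof eventually_elim
    case (elim x)
    from tendsto_real_sqrt[OF this] have "(\<lambda>n. \<bar>f (r n) x - f' x\<bar>) \<longlonglongrightarrow> 0" by simp
    then have "(\<lambda>n. f (r n) x - f' x) \<longlonglongrightarrow> 0" by (rule tendsto_rabs_zero_cancel)
    then show ?case by (rule LIM_zero_cancel)
  qed
  with r(1) show ?thesis by blast
qed

lemma L2_dominated:
  assumes "\<And>n. f n \<in> borel_measurable (lebesgue_on \<Omega>)" "f' \<in> borel_measurable (lebesgue_on \<Omega>)"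
    "AE x in lebesgue_on \<Omega>. (\<lambda>n. f n x) \<longlonglongrightarrow> f' x"
    "g \<in> L2 \<Omega>" "\<And>n. AE x in lebesgue_on \<Omega>. \<bar>f n x - f' x\<bar> \<le> \<bar>g x\<bar>"
  shows "(\<lambda>n. L2_norm \<Omega> (\<lambda>x. f n x - f' x)) \<longlonglongrightarrow> 0"
proof -
  have "(\<lambda>n. LINT x|lebesgue_on \<Omega>. (f n x - f' x)\<^sup>2) \<longlonglongrightarrow> (LINT x|lebesgue_on \<Omega>. 0)"
  proof (rule integral_dominated_convergence[where w="\<lambda>x. (g x)\<^sup>2"])
    show "(\<lambda>x. (f n x - f' x)\<^sup>2) \<in> borel_measurable (lebesgue_on \<Omega>)" for n
      using assms(1)[of n] assms(2) by measurable
    show "integrable (lebesgue_on \<Omega>) (\<lambda>x. (g x)\<^sup>2)" using assms(4) by (rule L2_sq)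
    show "AE x in lebesgue_on \<Omega>. (\<lambda>n. (f n x - f' x)\<^sup>2) \<longlonglongrightarrow> 0"
      using assms(3)
    proof eventually_elim
      case (elim x)
      from tendsto_power[OF LIM_zero[OF this], of 2] show ?case by simp
    qed
    show "AE x in lebesgue_on \<Omega>. norm ((f n x - f' x)\<^sup>2) \<le> (g x)\<^sup>2" for n
      using assms(5)[of n] by eventually_elim (simp add: abs_le_square_iff)
  qed simp
  from tendsto_real_sqrt[OF this] show ?thesis by (simp add: L2_norm_def)
qed

text \<open>In \<open>b\<^sub>n f\<^sub>n - b f = b\<^sub>n (f\<^sub>n - f) + (b\<^sub>n - b) f\<close> the common bound of the \<open>b\<^sub>n\<close> controls the first
  term, and dominated convergence the second. For this reason the \<open>b\<^sub>n\<close> need to converge only almost everywhere.\<close>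

lemma L2_tendsto_bdd_mult:
  assumes "\<And>n. f n \<in> L2 \<Omega>" "f' \<in> L2 \<Omega>"
    "(\<lambda>n. L2_norm \<Omega> (\<lambda>x. f n x - f' x)) \<longlonglongrightarrow> 0"
    "\<And>n. b n \<in> borel_measurable (lebesgue_on \<Omega>)" "b' \<in> borel_measurable (lebesgue_on \<Omega>)"
    "\<And>n. AE x in lebesgue_on \<Omega>. \<bar>b n x\<bar> \<le> B"
    "AE x in lebesgue_on \<Omega>. (\<lambda>n. b n x) \<longlonglongrightarrow> b' x"
  shows "(\<lambda>n. L2_norm \<Omega> (\<lambda>x. b n x * f n x - b' x * f' x)) \<longlonglongrightarrow> 0"
proof (rule tendsto_0_le)
  note [measurable] = assms(4,5) L2_meas[OF assms(1)] L2_meas[OF assms(2)]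
  have b': "AE x in lebesgue_on \<Omega>. \<bar>b' x\<bar> \<le> B"
  proof -
    have "AE x in lebesgue_on \<Omega>. \<forall>n. \<bar>b n x\<bar> \<le> B" using assms(6) by (simp add: AE_all_countable)
    with assms(7) show ?thesis
    proof eventually_elim
      case (elim x)
      then show ?case using tendsto_upperbound[OF tendsto_rabs, of "\<lambda>n. b n x" "b' x" sequentially B] by simp
    qed
  qed
  have lim: "(\<lambda>n. L2_norm \<Omega> (\<lambda>x. b n x * f' x - b' x * f' x)) \<longlonglongrightarrow> 0"
  proof (rule L2_dominated)
    show "AE x in lebesgue_on \<Omega>. (\<lambda>n. b n x * f' x) \<longlonglongrightarrow> b' x * f' x"
      using assms(7) by eventually_elim (rule tendsto_mult_right)
    show "(\<lambda>x. 2 * B * f' x) \<in> L2 \<Omega>" using assms(2) by (rule L2_cmult)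
    show "AE x in lebesgue_on \<Omega>. \<bar>b n x * f' x - b' x * f' x\<bar> \<le> \<bar>2 * B * f' x\<bar>" for n
      using assms(6)[of n] b'
    proof eventually_elim
      case (elim x)
      have "\<bar>b n x * f' x - b' x * f' x\<bar> = \<bar>b n x - b' x\<bar> * \<bar>f' x\<bar>"
        by (simp add: abs_mult[symmetric] algebra_simps)
      also have "\<dots> \<le> (2 * B) * \<bar>f' x\<bar>" using elim by (intro mult_right_mono) auto
      also have "\<dots> = \<bar>2 * B * f' x\<bar>" using elim by (simp add: abs_mult)
      finally show ?case .
    qed
  qed measurable
  show "(\<lambda>n. \<bar>B\<bar> * L2_norm \<Omega> (\<lambda>x. f n x - f' x) + L2_norm \<Omega> (\<lambda>x. b n x * f' x - b' x * f' x)) \<longlonglongrightarrow> 0"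
    using tendsto_add[OF tendsto_mult_left[OF assms(3), of "\<bar>B\<bar>"] lim] by simp
  fix n
  have 1: "(\<lambda>x. b n x * (f n x - f' x)) \<in> L2 \<Omega>"
    using assms(4,6) L2_diff[OF assms(1,2)] by (rule L2_bdd_mult)
  have 2: "(\<lambda>x. b n x * f' x - b' x * f' x) \<in> L2 \<Omega>"
    using L2_bdd_mult[OF assms(4,6,2)] L2_bdd_mult[OF assms(5) b' assms(2)] by (rule L2_diff)
  have "L2_norm \<Omega> (\<lambda>x. b n x * (f n x - f' x)) \<le> \<bar>B\<bar> * L2_norm \<Omega> (\<lambda>x. f n x - f' x)"
  proof (rule L2_norm_mono[OF L2_diff[OF assms(1,2)]])
    show "AE x in lebesgue_on \<Omega>. \<bar>b n x * (f n x - f' x)\<bar> \<le> \<bar>B\<bar> * \<bar>f n x - f' x\<bar>"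
      using assms(6)[of n] by eventually_elim (auto simp: abs_mult intro!: mult_right_mono)
  qed auto
  with L2_norm_triangle[OF 1 2]
  show "L2_norm \<Omega> (\<lambda>x. b n x * f n x - b' x * f' x)
    \<le> \<bar>B\<bar> * L2_norm \<Omega> (\<lambda>x. f n x - f' x) + L2_norm \<Omega> (\<lambda>x. b n x * f' x - b' x * f' x)"
    by (simp add: algebra_simps)
qed (rule L2_norm_nonneg)

lemma lebesgue_on_UNIV [simp]: "lebesgue_on UNIV = (lebesgue :: (real^'d) measure)"
  by (rule lebesgue_on_UNIV_eq)

lemma L2_restrict:
  assumes "f \<in> L2 UNIV" "\<Omega> \<in> sets lebesgue"
  shows "f \<in> L2 \<Omega>" "L2_norm \<Omega> f \<le> L2_norm UNIV f"
proof -
  have m: "f \<in> borel_measurable lebesgue" "integrable lebesgue (\<lambda>x. (f x)\<^sup>2)"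
    using assms(1) by (auto simp: L2_def)
  have "integrable lebesgue (\<lambda>x. indicator \<Omega> x *\<^sub>R (f x)\<^sup>2)"
    using integrable_mult_indicator[OF assms(2) m(2)] .
  then have i: "integrable (lebesgue_on \<Omega>) (\<lambda>x. (f x)\<^sup>2)"
    using assms(2) by (subst integrable_restrict_space) auto
  then show "f \<in> L2 \<Omega>"
    using m(1) by (intro L2I) (auto intro: measurable_restrict_space1)
  have "(LINT x|lebesgue_on \<Omega>. (f x)\<^sup>2) \<le> (LINT x|lebesgue_on UNIV. (f x)\<^sup>2)"
    using m assms(2) by (intro integral_mono_lebesgue_on_AE) auto
  then show "L2_norm \<Omega> f \<le> L2_norm UNIV f" by (simp add: L2_norm_def)
qed

lemma L2_of_bounded:
  assumes "\<Omega> \<in> lmeasurable" "f \<in> borel_measurable (lebesgue_on \<Omega>)" "AE x in lebesgue_on \<Omega>. \<bar>f x\<bar> \<le> B"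
  shows "f \<in> L2 \<Omega>"
proof -
  interpret finite_measure "lebesgue_on \<Omega>" using assms(1) by (rule finite_measure_lebesgue_on)
  have "(\<lambda>x. 1) \<in> L2 \<Omega>" by (rule L2I) auto
  from L2_bdd_mult[OF assms(2,3) this] show ?thesis by simp
qed

lemma L2_extend:
  assumes "\<Omega> \<in> sets lebesgue" "f \<in> L2 \<Omega>"
  shows "(\<lambda>x. if x \<in> \<Omega> then f x else 0) \<in> L2 UNIV"
proof (rule L2I)
  show "(\<lambda>x. if x \<in> \<Omega> then f x else 0) \<in> borel_measurable (lebesgue_on UNIV)"
    using borel_measurable_if_I[OF L2_meas[OF assms(2)] assms(1)] by simp
  have "(\<lambda>x. (if x \<in> \<Omega> then f x else 0)\<^sup>2) = (\<lambda>x. if x \<in> \<Omega> then (f x)\<^sup>2 else 0)" by auto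
  then show "integrable (lebesgue_on UNIV) (\<lambda>x. (if x \<in> \<Omega> then f x else 0)\<^sup>2)"
    using Lebesgue_Measure.integrable_restrict_UNIV[OF assms(1), of "\<lambda>x. (f x)\<^sup>2"] L2_sq[OF assms(2)] by simp
qed

section \<open>Mollification\<close>

definition conv :: "(real^'d \<Rightarrow> real) \<Rightarrow> (real^'d \<Rightarrow> real) \<Rightarrow> real^'d \<Rightarrow> real" where
  "conv f \<eta> x = (LINT y|lebesgue. f y * \<eta> (x - y))"

lemma integrable_mult_bounded_continuous:
  fixes f \<psi> :: "real^'d \<Rightarrow> real"
  assumes f: "integrable M f" and M: "sets borel \<subseteq> sets M" "space M = UNIV"
    and \<psi>: "continuous_on UNIV \<psi>" "\<And>x. \<bar>\<psi> x\<bar> \<le> B"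
  shows "integrable M (\<lambda>x. f x * \<psi> x)"
proof (rule Bochner_Integration.integrable_bound)
  have "\<psi> \<in> borel_measurable borel" using \<psi>(1) by (rule borel_measurable_continuous_onI)
  then have [measurable]: "\<psi> \<in> borel_measurable M"
    using M by (auto simp: measurable_def)
  show "(\<lambda>x. f x * \<psi> x) \<in> borel_measurable M" using f by measurable
  show "integrable M (\<lambda>x. B * f x)" using f by simp
  show "AE x in M. norm (f x * \<psi> x) \<le> norm (B * f x)"
  proof (rule AE_I2)
    fix x
    have "\<bar>f x\<bar> * \<bar>\<psi> x\<bar> \<le> \<bar>f x\<bar> * \<bar>B\<bar>" using \<psi>(2)[of x] by (intro mult_left_mono) auto
    then show "norm (f x * \<psi> x) \<le> norm (B * f x)" by (simp add: abs_mult mult.commute)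
  qed
qed

lemma sets_borel_lebesgue: "sets borel \<subseteq> sets (lebesgue :: (real^'d) measure)"
  by (metis sets_completionI_sets sets_lborel subsetI)

lemma conv_integrable:
  fixes f \<eta> :: "real^'d \<Rightarrow> real"
  assumes f: "integrable lebesgue f" and \<eta>: "\<eta> \<in> test_functions UNIV"
  shows "integrable lebesgue (\<lambda>y. f y * \<eta> (x - y))"
proof -
  obtain B where B: "B > 0" "\<forall>x. \<bar>\<eta> x\<bar> \<le> B" using test_bounded[OF \<eta>] by blast
  show ?thesis
  proof (rule integrable_mult_bounded_continuous[OF f sets_borel_lebesgue])
    show "continuous_on UNIV (\<lambda>y. \<eta> (x - y))"
      by (intro smooth_continuous smooth_reflect test_smooth[OF \<eta>])
    show "\<bar>\<eta> (x - y)\<bar> \<le> B" for y using B by blast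
  qed simp
qed

text \<open>Dominates the difference quotients of the kernel and their limits, respectively.\<close>

lemma test_lipschitz:
  fixes \<eta> :: "real^'d \<Rightarrow> real"
  assumes \<eta>: "\<eta> \<in> test_functions UNIV"
  shows "\<exists>L\<ge>0. (\<forall>x y. \<bar>\<eta> x - \<eta> y\<bar> \<le> L * norm (x - y)) \<and>
      (\<forall>z h. \<bar>\<Sum>i\<in>UNIV. h $ i * pd i \<eta> z\<bar> \<le> L * norm h)"
proof -
  have "\<forall>i. \<exists>B. \<forall>x. \<bar>pd i \<eta> x\<bar> \<le> B" using test_bounded[OF test_pd[OF \<eta>]] by blast
  then obtain B where B: "\<And>i x. \<bar>pd i \<eta> x\<bar> \<le> B i" by metis
  define L where "L = (\<Sum>i\<in>UNIV. B i)"
  have B0: "0 \<le> B i" for i using B[of i 0] by linarith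
  have L: "0 \<le> L" unfolding L_def by (rule sum_nonneg) (rule B0)
  have bd: "\<bar>\<Sum>i\<in>UNIV. h $ i * pd i \<eta> z\<bar> \<le> L * norm h" for h z
  proof -
    have "\<bar>\<Sum>i\<in>UNIV. h $ i * pd i \<eta> z\<bar> \<le> (\<Sum>i\<in>UNIV. \<bar>h $ i * pd i \<eta> z\<bar>)" by (rule sum_abs)
    also have "\<dots> \<le> (\<Sum>i\<in>UNIV. norm h * B i)"
      using B component_le_norm_cart[of h] by (intro sum_mono) (auto simp: abs_mult intro!: mult_mono)
    also have "\<dots> = L * norm h" by (simp add: L_def sum_distrib_left mult.commute)
    finally show ?thesis .
  qed
  have "norm (\<eta> x - \<eta> y) \<le> L * norm (x - y)" for x y
  proof (rule differentiable_bound[where S=UNIV])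
    show "(\<eta> has_derivative (\<lambda>h. \<Sum>i\<in>UNIV. h $ i * pd i \<eta> x)) (at x within UNIV)" for x
      using has_derivative_pd_sum[OF smooth_differentiable[OF test_smooth[OF \<eta>]]] by simp
    show "onorm (\<lambda>h. \<Sum>i\<in>UNIV. h $ i * pd i \<eta> x) \<le> L" for x
      using bd L by (intro onorm_bound) auto
  qed auto
  with L bd show ?thesis by auto
qed

text \<open>Differentiation under the integral sign: the difference quotients of the kernel are bounded
  by its Lipschitz constant, so dominated convergence applies.\<close>

lemma conv_has_derivative:
  fixes f \<eta> :: "real^'d \<Rightarrow> real"
  assumes f: "integrable lebesgue f" and \<eta>: "\<eta> \<in> test_functions UNIV"
  shows "(conv f \<eta> has_derivative (\<lambda>h. \<Sum>i\<in>UNIV. h $ i * conv f (pd i \<eta>) x)) (at x)"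
  unfolding has_derivative_iff_norm tendsto_at_iff_sequentially
proof (intro conjI allI impI)
  show "bounded_linear (\<lambda>h. \<Sum>i\<in>UNIV. h $ i * conv f (pd i \<eta>) x)"
    by (intro bounded_linear_sum bounded_linear_mult_left[THEN bounded_linear_compose] bounded_linear_vec_nth)
  fix X :: "nat \<Rightarrow> real^'d" assume X: "\<forall>i. X i \<in> UNIV - {x}" "X \<longlonglongrightarrow> x"
  obtain L where L: "L \<ge> 0" "\<And>x y. \<bar>\<eta> x - \<eta> y\<bar> \<le> L * norm (x - y)"
    "\<And>z h. \<bar>\<Sum>i\<in>UNIV. h $ i * pd i \<eta> z\<bar> \<le> L * norm h"
    using test_lipschitz[OF \<eta>] by blast
  define R where "R n y = (\<eta> (X n - y) - \<eta> (x - y) - (\<Sum>i\<in>UNIV. (X n - x) $ i * pd i \<eta> (x - y))) / norm (X n - x)" for n y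
  have int: "integrable lebesgue (\<lambda>y. f y * \<theta> (z - y))" if "\<theta> \<in> test_functions UNIV" for \<theta> z
    using conv_integrable[OF f that] .
  have intR: "integrable lebesgue (\<lambda>y. f y * R n y)"
    and eq: "(LINT y|lebesgue. f y * R n y) =
      (conv f \<eta> (X n) - conv f \<eta> x - (\<Sum>i\<in>UNIV. (X n - x) $ i * conv f (pd i \<eta>) x)) / norm (X n - x)" for n
  proof -
    have e: "(\<lambda>y. f y * R n y) = (\<lambda>y. (f y * \<eta> (X n - y) - f y * \<eta> (x - y) -
         (\<Sum>i\<in>UNIV. (X n - x) $ i * (f y * pd i \<eta> (x - y)))) / norm (X n - x))"
      by (auto simp: R_def fun_eq_iff algebra_simps sum_distrib_left)
    have i1: "integrable lebesgue (\<lambda>y. \<Sum>i\<in>UNIV. (X n - x) $ i * (f y * pd i \<eta> (x - y)))"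
      by (intro Bochner_Integration.integrable_sum integrable_mult_right int test_pd \<eta>)
    have i2: "integrable lebesgue (\<lambda>y. f y * \<eta> (X n - y) - f y * \<eta> (x - y))"
      by (intro Bochner_Integration.integrable_diff int \<eta>)
    show "integrable lebesgue (\<lambda>y. f y * R n y)"
      unfolding e by (intro integrable_divide Bochner_Integration.integrable_diff i1 int \<eta>)
    have "(LINT y|lebesgue. (\<Sum>i\<in>UNIV. (X n - x) $ i * (f y * pd i \<eta> (x - y))))
        = (\<Sum>i\<in>UNIV. (X n - x) $ i * conv f (pd i \<eta>) x)"
      unfolding conv_def
      by (subst Bochner_Integration.integral_sum)
         (auto intro!: integrable_mult_right int test_pd \<eta> simp del: vector_minus_component)
    then show "(LINT y|lebesgue. f y * R n y) =
      (conv f \<eta> (X n) - conv f \<eta> x - (\<Sum>i\<in>UNIV. (X n - x) $ i * conv f (pd i \<eta>) x)) / norm (X n - x)"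
      unfolding e integral_divide_zero Bochner_Integration.integral_diff[OF i2 i1]
        Bochner_Integration.integral_diff[OF int[OF \<eta>] int[OF \<eta>]] by (simp add: conv_def)
  qed
  have "(\<lambda>n. LINT y|lebesgue. f y * R n y) \<longlonglongrightarrow> (LINT y|(lebesgue::(real^'d) measure). 0)"
  proof (rule integral_dominated_convergence[where w="\<lambda>y. 2 * L * \<bar>f y\<bar>"])
    show "integrable lebesgue (\<lambda>y. 2 * L * \<bar>f y\<bar>)" using f by simp
    show "(\<lambda>y. f y * R n y) \<in> borel_measurable lebesgue" for n
      using intR[of n] by (rule borel_measurable_integrable)
    show "AE y in lebesgue. (\<lambda>n. f y * R n y) \<longlonglongrightarrow> 0"
    proof (rule AE_I2)
      fix y
      have D: "(\<eta> has_derivative (\<lambda>h. \<Sum>i\<in>UNIV. h $ i * pd i \<eta> (x - y))) (at (x - y))"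
        using has_derivative_pd_sum[OF smooth_differentiable[OF test_smooth[OF \<eta>]]] .
      have X': "(\<lambda>n. X n - y) \<longlonglongrightarrow> x - y" using X(2) by (intro tendsto_intros)
      have X0: "\<forall>n. X n - y \<in> UNIV - {x - y}" using X(1) by auto
      have "(\<lambda>n. norm (R n y)) \<longlonglongrightarrow> 0"
        using D[unfolded has_derivative_iff_norm tendsto_at_iff_sequentially, THEN conjunct2, rule_format, OF X0[rule_format] X']
        by (simp add: comp_def R_def del: vector_minus_component)
      then have "(\<lambda>n. R n y) \<longlonglongrightarrow> 0" by (rule tendsto_norm_zero_cancel)
      from tendsto_mult_left[OF this, of "f y"] show "(\<lambda>n. f y * R n y) \<longlonglongrightarrow> 0" by simp
    qed
    show "AE y in lebesgue. norm (f y * R n y) \<le> 2 * L * \<bar>f y\<bar>" for n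
    proof (rule AE_I2)
      fix y
      have "\<bar>\<eta> (X n - y) - \<eta> (x - y) - (\<Sum>i\<in>UNIV. (X n - x) $ i * pd i \<eta> (x - y))\<bar> \<le> 2 * L * norm (X n - x)"
        using L(2)[of "X n - y" "x - y"] L(3)[of "X n - x" "x - y"] by (simp del: vector_minus_component)
      moreover have "norm (X n - x) > 0" using X(1) by auto
      ultimately have "\<bar>R n y\<bar> \<le> 2 * L" by (simp add: R_def divide_simps del: vector_minus_component)
      then have "\<bar>f y\<bar> * \<bar>R n y\<bar> \<le> \<bar>f y\<bar> * (2 * L)" by (rule mult_left_mono) simp
      then show "norm (f y * R n y) \<le> 2 * L * \<bar>f y\<bar>" by (simp add: abs_mult mult_ac)
    qed
  qed simp
  then have "(\<lambda>n. norm (LINT y|lebesgue. f y * R n y)) \<longlonglongrightarrow> 0" by (intro tendsto_norm_zero) simp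
  then show "((\<lambda>y. norm (conv f \<eta> y - conv f \<eta> x - (\<Sum>i\<in>UNIV. (y - x) $ i * conv f (pd i \<eta>) x)) / norm (y - x)) \<circ> X)
      \<longlonglongrightarrow> 0"
    unfolding eq by (simp add: comp_def del: vector_minus_component)
qed

lemma pd_conv:
  fixes f \<eta> :: "real^'d \<Rightarrow> real"
  assumes f: "integrable lebesgue f" and \<eta>: "\<eta> \<in> test_functions UNIV"
  shows "pd i (conv f \<eta>) = conv f (pd i \<eta>)"
proof
  fix x
  have "(\<Sum>j\<in>UNIV. axis i 1 $ j * conv f (pd j \<eta>) x) = (\<Sum>j\<in>UNIV. if j = i then conv f (pd j \<eta>) x else 0)"
    by (rule sum.cong) (auto simp: axis_def)
  then show "pd i (conv f \<eta>) x = conv f (pd i \<eta>) x"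
    using pd_eqI[OF conv_has_derivative[OF f \<eta>]] by simp
qed

lemma smooth_conv:
  fixes f \<eta> :: "real^'d \<Rightarrow> real"
  assumes f: "integrable lebesgue f" and \<eta>: "\<eta> \<in> test_functions UNIV"
  shows "smooth (conv f \<eta>)"
proof (rule smooth_coinduct[where S="conv f ` test_functions UNIV"])
  show "h differentiable at x" if "h \<in> conv f ` test_functions UNIV" for h x
    using that conv_has_derivative[OF f] by (auto intro: differentiableI)
  show "pd i h \<in> conv f ` test_functions UNIV" if "h \<in> conv f ` test_functions UNIV" for h i
    using that pd_conv[OF f] test_pd by blast
qed (use \<eta> in blast)

lemma conv_zero_outside:
  assumes "\<And>y. y \<notin> K \<Longrightarrow> f y = 0" "\<And>y. y \<notin> cball 0 r \<Longrightarrow> \<eta> y = 0"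
    "x \<notin> (\<Union>y\<in>K. cball y r)"
  shows "conv f \<eta> x = 0"
proof -
  have "f y * \<eta> (x - y) = 0" for y
    using assms(1)[of y] assms(2)[of "x - y"] assms(3) by (cases "y \<in> K") (auto simp: dist_norm norm_minus_commute)
  then show ?thesis unfolding conv_def by (simp only: Bochner_Integration.integral_zero)
qed

lemma integrable_lborel_shift:
  fixes f :: "'a::euclidean_space \<Rightarrow> real"
  assumes "integrable lborel f" shows "integrable lborel (\<lambda>x. f (x + c))"
proof -
  have "integrable (distr lborel borel ((+) c)) f" by (simp add: lborel_distr_plus assms)
  then have "integrable lborel (\<lambda>x. f (c + x))"
    using borel_measurable_integrable[OF assms] by (subst (asm) integrable_distr_eq) auto
  then show ?thesis by (simp add: add.commute)
qed

lemma lborel_reflect: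
  fixes x :: "'a::euclidean_space" and f :: "'a \<Rightarrow> real"
  assumes [measurable]: "f \<in> borel_measurable borel"
  shows "(LINT y|lborel. f (x - y)) = (LINT y|lborel. f y)"
    and "integrable lborel f \<Longrightarrow> integrable lborel (\<lambda>y. f (x - y))"
proof -
  have *: "lborel = distr lborel borel (\<lambda>y. x - y)"
    using lborel_affine[of "-1" x] by (simp add: density_1)
  have "(LINT y|lborel. f y) = (LINT y|distr lborel borel (\<lambda>y. x - y). f y)" using * by simp
  also have "\<dots> = (LINT y|lborel. f (x - y))" by (subst integral_distr) auto
  finally show "(LINT y|lborel. f (x - y)) = (LINT y|lborel. f y)" by simp
  assume "integrable lborel f"
  then have "integrable (distr lborel borel (\<lambda>y. x - y)) f" using * by simp
  then show "integrable lborel (\<lambda>y. f (x - y))" by (subst (asm) integrable_distr_eq) auto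
qed


subsection \<open>Continuity of translations\<close>

text \<open>Lebesgue measure is outer regular for open sets and inner regular for closed sets. Intersecting the
  closed set with a large ball makes it compact and loses little measure, since \<open>A\<close> has finite measure.\<close>

lemma compact_open_sandwich:
  fixes A :: "'a::euclidean_space set"
  assumes A: "A \<in> sets borel" "emeasure lborel A < \<infinity>" and e: "e > 0"
  shows "\<exists>K U. compact K \<and> open U \<and> K \<subseteq> A \<and> A \<subseteq> U \<and> emeasure lborel (U - K) < ennreal e"
proof -
  have AL: "A \<in> sets lebesgue" using A(1) by simp
  obtain U where U: "open U" "A \<subseteq> U" "emeasure lebesgue (U - A) < ennreal (e/2)"
    by (rule sets_lebesgue_outer_open[OF AL half_gt_zero[OF e]])
  obtain T where T: "closed T" "T \<subseteq> A" "emeasure lebesgue (A - T) < ennreal (e/2)"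
    by (rule sets_lebesgue_inner_closed[OF AL half_gt_zero[OF e]])
  have [measurable]: "T \<in> sets borel" "U \<in> sets borel" using T(1) U(1) by auto
  note A(1)[measurable]
  define B where "B n = A - T \<inter> cball 0 (real n)" for n
  have "(\<lambda>n. emeasure lborel (B n)) \<longlonglongrightarrow> emeasure lborel (\<Inter>n. B n)"
  proof (rule Lim_emeasure_decseq)
    show "range B \<subseteq> sets lborel" unfolding B_def by auto
    show "decseq B" unfolding B_def decseq_def by (auto simp: dist_norm)
    show "emeasure lborel (B n) \<noteq> \<infinity>" for n
      using A(2) emeasure_mono[of "B n" A lborel] A(1) by (auto simp: B_def top_unique)
  qed
  moreover have "(\<Inter>n. B n) = A - T"
  proof -
    have "\<exists>n. x \<in> cball 0 (real n)" for x :: 'a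
      using real_arch_simple[of "norm x"] by auto
    then show ?thesis unfolding B_def by blast
  qed
  ultimately have "(\<lambda>n. emeasure lborel (B n)) \<longlonglongrightarrow> emeasure lborel (A - T)" by simp
  moreover have "emeasure lborel (A - T) < ennreal (e/2)" using T(3) by simp
  ultimately have "\<forall>\<^sub>F n in sequentially. emeasure lborel (B n) < ennreal (e/2)"
    by (rule order_tendstoD(2))
  then obtain n where n: "emeasure lborel (B n) < ennreal (e/2)"
    by (auto simp: eventually_sequentially)
  define K where "K = T \<inter> cball 0 (real n)"
  have "U - K \<subseteq> (U - A) \<union> B n" by (auto simp: K_def B_def)
  then have "emeasure lborel (U - K) \<le> emeasure lborel ((U - A) \<union> B n)"
    by (rule emeasure_mono) (auto simp: B_def)
  also have "\<dots> \<le> emeasure lborel (U - A) + emeasure lborel (B n)"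
    by (rule emeasure_subadditive) (auto simp: B_def)
  also have "\<dots> < ennreal (e/2) + ennreal (e/2)"
    using U(3) n by (intro add_strict_mono) auto
  also have "\<dots> = ennreal e" using e by (simp flip: ennreal_plus)
  finally have "emeasure lborel (U - K) < ennreal e" .
  moreover have "compact K" unfolding K_def using T(1) by (simp add: closed_Int_compact)
  moreover have "K \<subseteq> A" using T(2) by (auto simp: K_def)
  ultimately show ?thesis using U(1,2) by blast
qed

text \<open>For the indicator function of \<open>A\<close> with \<open>K \<subseteq> A \<subseteq> U\<close>, a translation by less than the distance of \<open>K\<close> from
  the complement of \<open>U\<close> changes values only on \<open>U - K\<close> and its translate, a set of small measure. Sums and
  dominated limits pass through the triangle inequality.\<close>

lemma L1_translation:
  fixes f :: "'a::euclidean_space \<Rightarrow> real"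
  assumes "integrable lborel f" and "\<epsilon> > 0"
  shows "\<exists>\<delta>>0. \<forall>h. norm h \<le> \<delta> \<longrightarrow> (LINT x|lborel. \<bar>f (x - h) - f x\<bar>) < \<epsilon>"
  using assms
proof (induction arbitrary: \<epsilon> rule: integrable_induct)
  case (base A c)
  define e where "e = \<epsilon> / (4 * (\<bar>c\<bar> + 1))"
  have e: "e > 0" using base by (simp add: e_def)
  obtain K U where KU: "compact K" "open U" "K \<subseteq> A" "A \<subseteq> U" "emeasure lborel (U - K) < ennreal e"
    using compact_open_sandwich[of A e] base e by auto
  define V where "V = U - K"
  have V [measurable]: "V \<in> sets borel" using KU(1,2) by (auto simp: V_def compact_imp_closed)
  have Vf: "emeasure lborel V < \<infinity>" 
    using order.strict_trans[OF KU(5) ennreal_less_top] by (simp add: V_def)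
  have Vm: "measure lborel V < e"
  proof -
    have "emeasure lborel V = ennreal (measure lborel V)"
      using Vf by (intro emeasure_eq_ennreal_measure) auto
    then show ?thesis using KU(5) by (simp add: V_def[symmetric] ennreal_less_iff)
  qed
  obtain \<delta> where \<delta>: "\<delta> > 0" "(\<Union>x\<in>K. cball x \<delta>) \<subseteq> U"
    by (rule compact_subset_open_imp_cball_epsilon_subset[OF KU(1,2) order_trans[OF KU(3,4)]])
  have "(LINT x|lborel. \<bar>indicator A (x - h) *\<^sub>R c - indicator A x *\<^sub>R c\<bar>) < \<epsilon>" if h: "norm h \<le> \<delta>" for h
  proof -
    have iV: "integrable lborel (indicat_real V)" using Vf by simp
    have iV': "integrable lborel (\<lambda>x. indicat_real V (x - h))"
      using integrable_lborel_shift[OF iV, of "- h"] by simp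
    have pt: "\<bar>indicator A (x - h) *\<^sub>R c - indicator A x *\<^sub>R c\<bar> \<le> \<bar>c\<bar> * (indicator V x + indicator V (x - h))" for x
    proof -
      have "x \<in> U" if "x - h \<in> K" using that \<delta>(2) h by (force simp: dist_norm)
      moreover have "x - h \<in> U" if "x \<in> K" using that \<delta>(2) h by (force simp: dist_norm)
      ultimately show ?thesis using KU(3,4) by (auto simp: V_def indicator_def)
    qed
    have "(LINT x|lborel. \<bar>indicator A (x - h) *\<^sub>R c - indicator A x *\<^sub>R c\<bar>)
        \<le> (LINT x|lborel. \<bar>c\<bar> * (indicator V x + indicator V (x - h)))"
      using iV iV' pt by (intro integral_mono_AE') auto
    also have "\<dots> = \<bar>c\<bar> * (measure lborel V + measure lborel V)"
      using iV iV' integral_lborel_shift[of "indicat_real V" "- h"] by simp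
    also have "\<dots> \<le> (\<bar>c\<bar> + 1) * (2 * e)"
      using Vm e by (intro mult_mono) auto
    also have "\<dots> < \<epsilon>" using base(3) by (simp add: e_def field_simps add_pos_nonneg)
    finally show ?thesis .
  qed
  with \<delta>(1) show ?case by blast
next
  case (add f g)
  obtain d1 where d1: "d1 > 0" "\<And>h. norm h \<le> d1 \<Longrightarrow> (LINT x|lborel. \<bar>f (x - h) - f x\<bar>) < \<epsilon>/2"
    using add.IH(1)[of "\<epsilon>/2"] add.prems by auto
  obtain d2 where d2: "d2 > 0" "\<And>h. norm h \<le> d2 \<Longrightarrow> (LINT x|lborel. \<bar>g (x - h) - g x\<bar>) < \<epsilon>/2"
    using add.IH(2)[of "\<epsilon>/2"] add.prems by auto
  have "(LINT x|lborel. \<bar>f (x - h) + g (x - h) - (f x + g x)\<bar>) < \<epsilon>" if "norm h \<le> min d1 d2" for h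
  proof -
    have i: "integrable lborel (\<lambda>x. \<bar>f (x - h) - f x\<bar>)" "integrable lborel (\<lambda>x. \<bar>g (x - h) - g x\<bar>)"
      using integrable_lborel_shift[OF add.hyps(1), of "-h"] integrable_lborel_shift[OF add.hyps(2), of "-h"]
        add.hyps by auto
    have "(LINT x|lborel. \<bar>f (x - h) + g (x - h) - (f x + g x)\<bar>)
        \<le> (LINT x|lborel. \<bar>f (x - h) - f x\<bar> + \<bar>g (x - h) - g x\<bar>)"
      using i by (intro integral_mono_AE') auto
    also have "\<dots> = (LINT x|lborel. \<bar>f (x - h) - f x\<bar>) + (LINT x|lborel. \<bar>g (x - h) - g x\<bar>)"
      using i by simp
    also have "\<dots> < \<epsilon>" using d1(2)[of h] d2(2)[of h] that by simp
    finally show ?thesis .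
  qed
  then show ?case using d1(1) d2(1) by (intro exI[of _ "min d1 d2"]) auto
next
  case (lim f s)
  have "(\<lambda>n. LINT x|lborel. \<bar>s n x - f x\<bar>) \<longlonglongrightarrow> (LINT x|(lborel::'a measure). 0)"
  proof (rule integral_dominated_convergence[where w="\<lambda>x. 3 * \<bar>f x\<bar>"])
    show "AE x in lborel. (\<lambda>n. \<bar>s n x - f x\<bar>) \<longlonglongrightarrow> 0"
    proof (rule AE_I2)
      fix x :: 'a assume "x \<in> space lborel"
      from tendsto_rabs[OF LIM_zero[OF lim.hyps(2)[OF this]]] show "(\<lambda>n. \<bar>s n x - f x\<bar>) \<longlonglongrightarrow> 0" by simp
    qed
    show "AE x in lborel. norm \<bar>s n x - f x\<bar> \<le> 3 * \<bar>f x\<bar>" for n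
    proof (rule AE_I2)
      fix x :: 'a assume "x \<in> space lborel"
      then have "\<bar>s n x\<bar> \<le> 2 * \<bar>f x\<bar>" using lim.hyps(3)[of x n] by simp
      then show "norm \<bar>s n x - f x\<bar> \<le> 3 * \<bar>f x\<bar>" by simp
    qed
    show "(\<lambda>x. \<bar>s n x - f x\<bar>) \<in> borel_measurable lborel" for n
      using lim.hyps(1)[of n] lim.hyps(4) by (intro borel_measurable_abs borel_measurable_diff) auto
  qed (use lim.hyps(4) in auto)
  then have "\<forall>\<^sub>F n in sequentially. (LINT x|lborel. \<bar>s n x - f x\<bar>) < \<epsilon>/3"
    using lim.prems by (intro order_tendstoD(2)) auto
  then obtain n where n: "(LINT x|lborel. \<bar>s n x - f x\<bar>) < \<epsilon>/3"
    by (auto simp: eventually_sequentially)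
  obtain d where d: "d > 0" "\<And>h. norm h \<le> d \<Longrightarrow> (LINT x|lborel. \<bar>s n (x - h) - s n x\<bar>) < \<epsilon>/3"
    using lim.IH[of "\<epsilon>/3" n] lim.prems by auto
  have "(LINT x|lborel. \<bar>f (x - h) - f x\<bar>) < \<epsilon>" if "norm h \<le> d" for h
  proof -
    note sh = integrable_lborel_shift[OF lim.hyps(1)[of n], of "-h"] integrable_lborel_shift[OF lim.hyps(4), of "-h"]
    have i: "integrable lborel (\<lambda>x. \<bar>s n (x - h) - s n x\<bar>)" "integrable lborel (\<lambda>x. \<bar>s n x - f x\<bar>)"
      "integrable lborel (\<lambda>x. \<bar>s n (x - h) - f (x - h)\<bar>)"
      using sh lim.hyps(1)[of n] lim.hyps(4) by auto
    have "(LINT x|lborel. \<bar>f (x - h) - f x\<bar>)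
        \<le> (LINT x|lborel. \<bar>s n (x - h) - s n x\<bar> + \<bar>s n x - f x\<bar> + \<bar>s n (x - h) - f (x - h)\<bar>)"
      using i by (intro integral_mono_AE') auto
    also have "\<dots> = (LINT x|lborel. \<bar>s n (x - h) - s n x\<bar>) + (LINT x|lborel. \<bar>s n x - f x\<bar>)
       + (LINT x|lborel. \<bar>s n (x - h) - f (x - h)\<bar>)"
      using i by simp
    also have "(LINT x|lborel. \<bar>s n (x - h) - f (x - h)\<bar>) = (LINT x|lborel. \<bar>s n x - f x\<bar>)"
      using integral_lborel_shift[OF borel_measurable_integrable[OF i(2), simplified], of "-h"] by simp
    finally show ?thesis using n d(2)[OF that] by simp
  qed
  with d(1) show ?case by (intro exI[of _ d]) simp
qed

text \<open>Square integrable functions are reduced to integrable ones by the signed square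
  \<open>a \<mapsto> a \<bar>a\<bar>\<close>, whose inverse is Hoelder continuous of order one half.\<close>

lemma diff_square_le_signed_square:
  fixes a b :: real
  shows "(a - b)\<^sup>2 \<le> 2 * \<bar>a * \<bar>a\<bar> - b * \<bar>b\<bar>\<bar>"
proof -
  have main: "(a - b)\<^sup>2 \<le> 2 * \<bar>a * \<bar>a\<bar> - b * \<bar>b\<bar>\<bar>" if "b \<le> a" for a b :: real
  proof -
    consider "0 \<le> b" | "a \<le> 0" | "b \<le> 0" "0 \<le> a" using that by linarith
    then show ?thesis
    proof cases
      case 1
      then have "(a - b) * (a - b) \<le> (a - b) * (a + b)" using that by (intro mult_left_mono) auto
      moreover have "0 \<le> (a - b) * (a + b)" using that 1 by simp
      ultimately show ?thesis using that 1 by (simp add: power2_eq_square algebra_simps)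
    next
      case 2
      then have "(a - b) * (a - b) \<le> (a - b) * (- a - b)" using that by (intro mult_left_mono) auto
      moreover have "0 \<le> (a - b) * (- a - b)" using that 2 by simp
      ultimately show ?thesis using that 2 by (simp add: power2_eq_square algebra_simps)
    next
      case 3
      have "0 \<le> (a + b)\<^sup>2" by simp
      moreover have "a * \<bar>a\<bar> - b * \<bar>b\<bar> = a * a + b * b" using 3 by simp
      ultimately show ?thesis by (simp add: power2_eq_square algebra_simps)
    qed
  qed
  show ?thesis
  proof (cases "b \<le> a")
    case False
    then have "(b - a)\<^sup>2 \<le> 2 * \<bar>b * \<bar>b\<bar> - a * \<bar>a\<bar>\<bar>" by (intro main) auto
    then show ?thesis by (simp add: power2_commute abs_minus_commute)
  qed (rule main)
qed

lemma integrable_square_diff: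
  fixes f g :: "'a \<Rightarrow> real"
  assumes [measurable]: "f \<in> borel_measurable M" "g \<in> borel_measurable M"
    and "integrable M (\<lambda>x. (f x)\<^sup>2)" "integrable M (\<lambda>x. (g x)\<^sup>2)"
  shows "integrable M (\<lambda>x. (f x - g x)\<^sup>2)"
proof (rule Bochner_Integration.integrable_bound)
  show "integrable M (\<lambda>x. 2 * (f x)\<^sup>2 + 2 * (g x)\<^sup>2)" using assms by simp
  show "AE x in M. norm ((f x - g x)\<^sup>2) \<le> norm (2 * (f x)\<^sup>2 + 2 * (g x)\<^sup>2)"
  proof (rule AE_I2)
    fix x
    have "0 \<le> (f x + g x)\<^sup>2" by simp
    then have "(f x - g x)\<^sup>2 \<le> 2 * (f x)\<^sup>2 + 2 * (g x)\<^sup>2" by (simp add: power2_sum power2_diff)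
    then show "norm ((f x - g x)\<^sup>2) \<le> norm (2 * (f x)\<^sup>2 + 2 * (g x)\<^sup>2)" by simp
  qed
qed measurable

lemma L2_translation:
  fixes f :: "'a::euclidean_space \<Rightarrow> real"
  assumes f: "f \<in> borel_measurable borel" "integrable lborel (\<lambda>x. (f x)\<^sup>2)" and "\<epsilon> > 0"
  shows "\<exists>\<delta>>0. \<forall>h. norm h \<le> \<delta> \<longrightarrow> (LINT x|lborel. (f (x - h) - f x)\<^sup>2) < \<epsilon>"
proof -
  note [measurable] = f(1)
  define G where "G x = f x * \<bar>f x\<bar>" for x
  have [measurable]: "G \<in> borel_measurable borel" unfolding G_def by measurable
  have G: "integrable lborel G"
    by (rule Bochner_Integration.integrable_bound[OF f(2)]) (auto simp: G_def power2_eq_square abs_mult)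
  obtain d where d: "d > 0" "\<And>h. norm h \<le> d \<Longrightarrow> (LINT x|lborel. \<bar>G (x - h) - G x\<bar>) < \<epsilon>/2"
    using L1_translation[OF G, of "\<epsilon>/2"] assms(3) by auto
  have "(LINT x|lborel. (f (x - h) - f x)\<^sup>2) < \<epsilon>" if "norm h \<le> d" for h
  proof -
    have "integrable lborel (\<lambda>x. 2 * \<bar>G (x - h) - G x\<bar>)"
      using integrable_lborel_shift[OF G, of "-h"] G by auto
    then have "(LINT x|lborel. (f (x - h) - f x)\<^sup>2) \<le> (LINT x|lborel. 2 * \<bar>G (x - h) - G x\<bar>)"
      using diff_square_le_signed_square unfolding G_def by (intro integral_mono_AE') auto
    then show ?thesis using d(2)[OF that] by simp
  qed
  with d(1) show ?thesis by blast
qed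

text \<open>A mollification is a weighted mean of translates. Jensen's inequality for the weight \<open>\<eta>\<close> and an
  interchange of integrals bound its distance from \<open>f\<close> by that of the translates.\<close>

lemma conv_L2_bound:
  fixes f \<eta> :: "real^'d \<Rightarrow> real"
  assumes f: "f \<in> borel_measurable borel" "integrable lborel f" "integrable lborel (\<lambda>x. (f x)\<^sup>2)"
    and \<eta>: "\<eta> \<in> test_functions UNIV" "\<And>x. 0 \<le> \<eta> x" "(LINT x|lborel. \<eta> x) = 1"
    and supp: "\<And>x. x \<notin> cball 0 \<delta> \<Longrightarrow> \<eta> x = 0"
    and \<epsilon>: "0 \<le> \<epsilon>" "\<And>h. norm h \<le> \<delta> \<Longrightarrow> (LINT x|lborel. (f (x - h) - f x)\<^sup>2) \<le> \<epsilon>"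
  shows "integrable lborel (\<lambda>x. (conv f \<eta> x - f x)\<^sup>2)" "(LINT x|lborel. (conv f \<eta> x - f x)\<^sup>2) \<le> \<epsilon>"
proof -
  note [measurable] = f(1)
  have c\<eta>: "continuous_on UNIV \<eta>" by (rule smooth_continuous[OF test_smooth[OF \<eta>(1)]])
  have [measurable]: "\<eta> \<in> borel_measurable borel" using c\<eta> by (rule borel_measurable_continuous_onI)
  obtain B where B: "B > 0" "\<And>x. \<bar>\<eta> x\<bar> \<le> B" using test_bounded[OF \<eta>(1)] by blast
  have i\<eta>: "integrable lborel \<eta>" using c\<eta> compact_cball supp by (rule integrable_compact_support)
  have fL: "integrable lebesgue f" using f(1,2) by (subst integrable_completion) auto
  have [measurable]: "conv f \<eta> \<in> borel_measurable borel"
    using smooth_continuous[OF smooth_conv[OF fL \<eta>(1)]] by (rule borel_measurable_continuous_onI)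
  have im: "integrable lborel (\<lambda>y. g y * \<eta> y)" if "integrable lborel g" for g
    by (rule integrable_mult_bounded_continuous[OF that _ _ c\<eta> B(2)]) auto
  have i1: "integrable lborel (\<lambda>y. (f (x - y) - f x) * \<eta> y)" for x
    using im[OF lborel_reflect(2)[OF f(1,2)], of x] i\<eta> by (simp add: left_diff_distrib)
  have sq: "integrable lborel (\<lambda>y. (f (x - y))\<^sup>2)" for x
    using lborel_reflect(2)[of "\<lambda>y. (f y)\<^sup>2" x] f(3) by simp
  have i2: "integrable lborel (\<lambda>y. (f (x - y) - f x)\<^sup>2 * \<eta> y)" for x
  proof -
    have "(f (x - y) - f x)\<^sup>2 * \<eta> y = (f (x - y))\<^sup>2 * \<eta> y - 2 * f x * (f (x - y) * \<eta> y) + (f x)\<^sup>2 * \<eta> y" for y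
      by (simp add: power2_diff algebra_simps)
    then show ?thesis
      using im[OF sq, of x] im[OF lborel_reflect(2)[OF f(1,2)], of x] i\<eta> by simp
  qed
  have m: "conv f \<eta> x - f x = (LINT y|lborel. (f (x - y) - f x) * \<eta> y)" for x
  proof -
    have "conv f \<eta> x = (LINT y|lborel. f y * \<eta> (x - y))"
      unfolding conv_def by (rule integral_completion) simp
    also have "\<dots> = (LINT y|lborel. f (x - y) * \<eta> y)"
      using lborel_reflect(1)[of "\<lambda>y. f y * \<eta> (x - y)" x] by simp
    finally show ?thesis
      using im[OF lborel_reflect(2)[OF f(1,2)], of x] i\<eta> \<eta>(3) by (simp add: left_diff_distrib)
  qed
  have jensen: "(conv f \<eta> x - f x)\<^sup>2 \<le> (LINT y|lborel. (f (x - y) - f x)\<^sup>2 * \<eta> y)" for x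
  proof -
    define a where "a = conv f \<eta> x - f x"
    have "0 \<le> (LINT y|lborel. (f (x - y) - f x - a)\<^sup>2 * \<eta> y)"
      using \<eta>(2) by (intro Bochner_Integration.integral_nonneg) simp
    also have "\<dots> = (LINT y|lborel. (f (x - y) - f x)\<^sup>2 * \<eta> y - 2 * a * ((f (x - y) - f x) * \<eta> y) + a\<^sup>2 * \<eta> y)"
    proof -
      have "(b - a)\<^sup>2 * e = b\<^sup>2 * e - 2 * a * (b * e) + a\<^sup>2 * e" for b e :: real
        by (simp add: power2_eq_square algebra_simps)
      then show ?thesis by (simp only:)
    qed
    also have "\<dots> = (LINT y|lborel. (f (x - y) - f x)\<^sup>2 * \<eta> y) - 2 * a * a + a\<^sup>2 * 1"
      using i1[of x] i2[of x] i\<eta> m[of x] \<eta>(3) by (simp add: a_def)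
    finally show ?thesis unfolding a_def[symmetric] by (simp add: power2_eq_square)
  qed
  have "(\<integral>\<^sup>+x. ennreal ((conv f \<eta> x - f x)\<^sup>2) \<partial>lborel)
      \<le> (\<integral>\<^sup>+x. (\<integral>\<^sup>+y. ennreal ((f (x - y) - f x)\<^sup>2 * \<eta> y) \<partial>lborel) \<partial>lborel)"
  proof (rule nn_integral_mono)
    fix x
    have "(\<integral>\<^sup>+y. ennreal ((f (x - y) - f x)\<^sup>2 * \<eta> y) \<partial>lborel) = ennreal (LINT y|lborel. (f (x - y) - f x)\<^sup>2 * \<eta> y)"
      using i2 \<eta>(2) by (intro nn_integral_eq_integral) auto
    then show "ennreal ((conv f \<eta> x - f x)\<^sup>2) \<le> (\<integral>\<^sup>+y. ennreal ((f (x - y) - f x)\<^sup>2 * \<eta> y) \<partial>lborel)"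
      using jensen[of x] by (simp add: ennreal_leI)
  qed
  also have "\<dots> = (\<integral>\<^sup>+y. (\<integral>\<^sup>+x. ennreal ((f (x - y) - f x)\<^sup>2 * \<eta> y) \<partial>lborel) \<partial>lborel)"
    by (rule lborel_pair.Fubini'[symmetric]) measurable
  also have "\<dots> \<le> (\<integral>\<^sup>+y. ennreal (\<epsilon> * \<eta> y) \<partial>lborel)"
  proof (rule nn_integral_mono)
    fix y
    show "(\<integral>\<^sup>+x. ennreal ((f (x - y) - f x)\<^sup>2 * \<eta> y) \<partial>lborel) \<le> ennreal (\<epsilon> * \<eta> y)"
    proof (cases "y \<in> cball 0 \<delta>")
      case True
      have "integrable lborel (\<lambda>x. (f (x - y))\<^sup>2)"
        using integrable_lborel_shift[OF f(3), of "-y"] by simp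
      then have "integrable lborel (\<lambda>x. (f (x - y) - f x)\<^sup>2)"
        using f(3) by (intro integrable_square_diff) auto
      then have "(\<integral>\<^sup>+x. ennreal ((f (x - y) - f x)\<^sup>2 * \<eta> y) \<partial>lborel)
          = ennreal (LINT x|lborel. (f (x - y) - f x)\<^sup>2 * \<eta> y)"
        using \<eta>(2) by (intro nn_integral_eq_integral) auto
      also have "\<dots> \<le> ennreal (\<epsilon> * \<eta> y)"
        using \<epsilon>(2)[of y] True \<eta>(2)[of y] by (auto intro!: ennreal_leI mult_right_mono)
      finally show ?thesis .
    qed (simp add: supp)
  qed
  also have "\<dots> = ennreal \<epsilon>"
    using i\<eta> \<eta>(2,3) \<epsilon>(1) by (subst nn_integral_eq_integral) auto
  finally have le: "(\<integral>\<^sup>+x. ennreal ((conv f \<eta> x - f x)\<^sup>2) \<partial>lborel) \<le> ennreal \<epsilon>" .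
  then show "integrable lborel (\<lambda>x. (conv f \<eta> x - f x)\<^sup>2)"
    by (intro integrableI_nonneg) (auto intro: order_le_less_trans)
  show "(LINT x|lborel. (conv f \<eta> x - f x)\<^sup>2) \<le> \<epsilon>"
    using \<epsilon>(1) le by (rule integral_real_bounded)
qed

definition mollifier :: "(nat \<Rightarrow> real^'d \<Rightarrow> real) \<Rightarrow> bool" where
  "mollifier \<eta> \<longleftrightarrow> (\<forall>n. \<eta> n \<in> test_functions UNIV \<and> (\<forall>x. 0 \<le> \<eta> n x) \<and>
     (\<forall>x. x \<notin> cball 0 (inverse (Suc n)) \<longrightarrow> \<eta> n x = 0) \<and> (LINT x|lborel. \<eta> n x) = 1)"

lemma ex_mollifier: "\<exists>\<eta> :: nat \<Rightarrow> real^'d \<Rightarrow> real. mollifier \<eta>"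
proof -
  have "\<exists>\<eta> :: real^'d \<Rightarrow> real. \<eta> \<in> test_functions UNIV \<and> (\<forall>x. 0 \<le> \<eta> x) \<and>
     (\<forall>x. x \<notin> cball 0 (inverse (Suc n)) \<longrightarrow> \<eta> x = 0) \<and> (LINT x|lborel. \<eta> x) = 1" for n
  proof -
    obtain \<eta> :: "real^'d \<Rightarrow> real" where "smooth \<eta>" "\<forall>x. 0 \<le> \<eta> x"
      "\<forall>x. x \<notin> cball 0 (inverse (real (Suc n))) \<longrightarrow> \<eta> x = 0" "(LINT x|lborel. \<eta> x) = 1"
      using mollifier_exists[of "inverse (real (Suc n))"] by auto
    moreover from this have "\<eta> \<in> test_functions UNIV"
      by (intro test_functionI[where K="cball 0 (inverse (real (Suc n)))"]) auto
    ultimately show ?thesis by blast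
  qed
  then show ?thesis unfolding mollifier_def by metis
qed

text \<open>By continuity of translations in \<open>L\<^sup>2\<close>. A Borel measurable representative \<open>g\<close> of \<open>f\<close> is used where
  product measurability matters.\<close>

lemma mollify_L2:
  fixes f :: "real^'d \<Rightarrow> real"
  assumes \<eta>: "mollifier \<eta>" and f: "integrable lebesgue f" "f \<in> L2 UNIV"
  shows "conv f (\<eta> n) \<in> L2 UNIV"
    and "(\<lambda>n. L2_norm UNIV (\<lambda>x. conv f (\<eta> n) x - f x)) \<longlonglongrightarrow> 0"
proof -
  obtain g where g: "g \<in> borel_measurable lborel" "AE x in lborel. f x = g x"
    using completion_ex_borel_measurable_real[OF borel_measurable_integrable[OF f(1)]] by auto
  have gL: "AE x in lebesgue. f x = g x" using g(2) by (rule AE_completion)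
  have [measurable]: "g \<in> borel_measurable borel" "g \<in> borel_measurable lebesgue"
    using g(1) measurable_completion[OF g(1)] by auto
  have fm [measurable]: "f \<in> borel_measurable lebesgue" using f(1) by (rule borel_measurable_integrable)
  have gi: "integrable lborel g"
  proof -
    have "integrable lebesgue g" using f(1) measurable_completion[OF g(1)] gL by (rule integrable_cong_AE_imp)
    then show ?thesis using integrable_completion[OF g(1)] by simp
  qed
  have f2: "integrable lebesgue (\<lambda>x. (f x)\<^sup>2)" using L2_sq[OF f(2)] by simp
  have "integrable lebesgue (\<lambda>x. (g x)\<^sup>2)"
    using gL by (intro integrable_cong_AE_imp[OF f2]) (auto elim!: eventually_mono)
  then have g2: "integrable lborel (\<lambda>x. (g x)\<^sup>2)" by (subst (asm) integrable_completion) auto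
  have t: "\<eta> n \<in> test_functions UNIV" for n using \<eta> by (simp add: mollifier_def)
  have cfg: "conv f (\<eta> n) = conv g (\<eta> n)" for n
  proof
    fix x
    have [measurable]: "\<eta> n \<in> borel_measurable borel"
      by (intro borel_measurable_continuous_onI smooth_continuous test_smooth[OF t])
    have "(\<lambda>y. \<eta> n (x - y)) \<in> borel_measurable lborel" by simp
    then have [measurable]: "(\<lambda>y. \<eta> n (x - y)) \<in> borel_measurable lebesgue" by (rule measurable_completion)
    show "conv f (\<eta> n) x = conv g (\<eta> n) x"
      unfolding conv_def using gL by (intro integral_cong_AE) (auto elim!: eventually_mono)
  qed
  have fL: "integrable lebesgue g" using gi g(1) by (subst integrable_completion) auto
  have cm: "conv f (\<eta> n) \<in> borel_measurable lborel" for n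
    using smooth_continuous[OF smooth_conv[OF f(1) t]] by (simp add: borel_measurable_continuous_onI)
  have cm' [measurable]: "conv f (\<eta> n) \<in> borel_measurable lebesgue" for n
    using cm by (rule measurable_completion)
  have bound: "integrable lborel (\<lambda>x. (conv f (\<eta> n) x - g x)\<^sup>2)" "(LINT x|lborel. (conv f (\<eta> n) x - g x)\<^sup>2) \<le> \<epsilon>"
    if "0 \<le> \<epsilon>" "\<And>h. norm h \<le> inverse (Suc n) \<Longrightarrow> (LINT x|lborel. (g (x - h) - g x)\<^sup>2) \<le> \<epsilon>" for n \<epsilon>
    unfolding cfg using \<eta> that gi g2 t
    by (auto simp: mollifier_def intro!: conv_L2_bound[where \<delta>="inverse (Suc n)" and \<epsilon>=\<epsilon>])
  have I: "integrable lebesgue (\<lambda>x. (conv f (\<eta> n) x - f x)\<^sup>2)"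
    "(LINT x|lebesgue. (conv f (\<eta> n) x - f x)\<^sup>2) = (LINT x|lborel. (conv f (\<eta> n) x - g x)\<^sup>2)"
    if "integrable lborel (\<lambda>x. (conv f (\<eta> n) x - g x)\<^sup>2)" for n
  proof -
    have ae: "AE x in lebesgue. (conv f (\<eta> n) x - g x)\<^sup>2 = (conv f (\<eta> n) x - f x)\<^sup>2"
      using gL by eventually_elim simp
    have m: "(\<lambda>x. (conv f (\<eta> n) x - g x)\<^sup>2) \<in> borel_measurable lborel" using cm[of n] g(1) by simp
    have i: "integrable lebesgue (\<lambda>x. (conv f (\<eta> n) x - g x)\<^sup>2)"
      using that m by (subst integrable_completion) auto
    show "integrable lebesgue (\<lambda>x. (conv f (\<eta> n) x - f x)\<^sup>2)"
      by (rule integrable_cong_AE_imp[OF i _ ae]) measurable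
    have "(LINT x|lebesgue. (conv f (\<eta> n) x - f x)\<^sup>2) = (LINT x|lebesgue. (conv f (\<eta> n) x - g x)\<^sup>2)"
      using ae by (intro integral_cong_AE) (auto elim!: eventually_mono)
    then show "(LINT x|lebesgue. (conv f (\<eta> n) x - f x)\<^sup>2) = (LINT x|lborel. (conv f (\<eta> n) x - g x)\<^sup>2)"
      using integral_completion[OF m] by simp
  qed
  define W where "W h = (LINT x|lborel. (g (x - h) - g x)\<^sup>2)" for h
  have W: "W h \<le> 4 * (LINT x|lborel. (g x)\<^sup>2)" for h
  proof -
    have s: "integrable lborel (\<lambda>x. (g (x - h))\<^sup>2)"
      using integrable_lborel_shift[OF g2, of "-h"] by simp
    have "W h \<le> (LINT x|lborel. 2 * (g (x - h))\<^sup>2 + 2 * (g x)\<^sup>2)"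
      unfolding W_def
    proof (rule integral_mono_AE')
      show "AE x in lborel. (g (x - h) - g x)\<^sup>2 \<le> 2 * (g (x - h))\<^sup>2 + 2 * (g x)\<^sup>2"
      proof (rule AE_I2)
        fix x
        have "0 \<le> (g (x - h) + g x)\<^sup>2" by simp
        then show "(g (x - h) - g x)\<^sup>2 \<le> 2 * (g (x - h))\<^sup>2 + 2 * (g x)\<^sup>2" by (simp add: power2_sum power2_diff)
      qed
    qed (use s g2 in auto)
    also have "\<dots> = 4 * (LINT x|lborel. (g x)\<^sup>2)"
      using s g2 integral_lborel_shift[of "\<lambda>x. (g x)\<^sup>2" "-h"] by simp
    finally show ?thesis .
  qed
  have nn: "0 \<le> (LINT x|lborel. (g x)\<^sup>2)" by (rule Bochner_Integration.integral_nonneg) simp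
  have int: "integrable lborel (\<lambda>x. (conv f (\<eta> n) x - g x)\<^sup>2)" for n
    using W nn unfolding W_def by (intro bound(1)[of "4 * (LINT x|lborel. (g x)\<^sup>2)"]) auto
  have "(\<lambda>x. conv f (\<eta> n) x - f x) \<in> L2 UNIV" for n
    using I(1)[OF int] by (intro L2I) auto
  from L2_add[OF this f(2)] show "conv f (\<eta> n) \<in> L2 UNIV" by simp
  have "(\<lambda>n. LINT x|lborel. (conv f (\<eta> n) x - g x)\<^sup>2) \<longlonglongrightarrow> 0"
  proof (rule LIMSEQ_I)
    fix r :: real assume r: "0 < r"
    obtain d where d: "d > 0" "\<And>h. norm h \<le> d \<Longrightarrow> (LINT x|lborel. (g (x - h) - g x)\<^sup>2) < r/2"
      using L2_translation[of g "r/2"] g2 r by auto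
    obtain N where N: "inverse (real (Suc N)) < d" using reals_Archimedean[OF d(1)] by auto
    have "norm ((LINT x|lborel. (conv f (\<eta> n) x - g x)\<^sup>2) - 0) < r" if "N \<le> n" for n
    proof -
      have "inverse (real (Suc n)) \<le> inverse (real (Suc N))" using that by (simp add: field_simps)
      with N have "inverse (real (Suc n)) \<le> d" by linarith
      then have "(LINT x|lborel. (conv f (\<eta> n) x - g x)\<^sup>2) \<le> r/2"
        using d(2) r by (intro bound(2)) (auto intro!: less_imp_le)
      moreover have "0 \<le> (LINT x|lborel. (conv f (\<eta> n) x - g x)\<^sup>2)"
        by (rule Bochner_Integration.integral_nonneg) simp
      ultimately show ?thesis using r by simp
    qed
    then show "\<exists>no. \<forall>n\<ge>no. norm ((LINT x|lborel. (conv f (\<eta> n) x - g x)\<^sup>2) - 0) < r" by blast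
  qed
  from tendsto_real_sqrt[OF this]
  show "(\<lambda>n. L2_norm UNIV (\<lambda>x. conv f (\<eta> n) x - f x)) \<longlonglongrightarrow> 0"
    by (simp add: L2_norm_def I(2)[OF int])
qed

section \<open>Weak derivatives\<close>

lemma integral_lebesgue_on_supported:
  fixes g :: "real^'d \<Rightarrow> real"
  assumes "\<Omega> \<in> sets lebesgue" "\<And>x. x \<notin> \<Omega> \<Longrightarrow> g x = 0"
  shows "(LINT x|lebesgue_on \<Omega>. g x) = (LINT x|lebesgue. g x)"
proof -
  have "(\<lambda>x. if x \<in> \<Omega> then g x else 0) = g" using assms(2) by auto
  then show ?thesis using Lebesgue_Measure.integral_restrict_UNIV[OF assms(1), of g] by simp
qed

lemma integrable_lebesgue_on_subset:
  fixes g :: "real^'d \<Rightarrow> real"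
  assumes "\<Omega> \<in> sets lebesgue" "K \<in> sets lebesgue" "K \<subseteq> \<Omega>" "integrable (lebesgue_on \<Omega>) g"
  shows "integrable (lebesgue_on K) g"
proof -
  have "integrable lebesgue (\<lambda>x. if x \<in> \<Omega> then g x else 0)"
    using Lebesgue_Measure.integrable_restrict_UNIV[OF assms(1), of g] assms(4) by simp
  from integrable_mult_indicator[OF assms(2) this]
  have "integrable lebesgue (\<lambda>x. indicator K x *\<^sub>R (if x \<in> \<Omega> then g x else 0))" .
  moreover have "(\<lambda>x. indicator K x *\<^sub>R (if x \<in> \<Omega> then g x else 0)) = (\<lambda>x. if x \<in> K then g x else 0)"
    using assms(3) by (auto simp: indicator_def fun_eq_iff)
  ultimately show ?thesis using Lebesgue_Measure.integrable_restrict_UNIV[OF assms(2), of g] by simp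
qed

lemma AE_lebesgue_on_subset:
  assumes "\<Omega> \<in> sets lebesgue" "K \<in> sets lebesgue" "K \<subseteq> \<Omega>" "AE x in lebesgue_on \<Omega>. P x"
  shows "AE x in lebesgue_on K. P x"
  using assms by (auto simp: AE_restrict_space_iff elim!: eventually_mono)

lemma compact_lebesgue: "compact K \<Longrightarrow> K \<in> sets (lebesgue :: (real^'d) measure)"
  by (simp add: borel_compact)

lemma open_lebesgue: "open K \<Longrightarrow> K \<in> sets (lebesgue :: (real^'d) measure)"
  by simp

lemma integrable_locally_integrable:
  assumes "\<Omega> \<in> sets lebesgue" "integrable (lebesgue_on \<Omega>) f"
  shows "locally_integrable \<Omega> f"
  unfolding locally_integrable_def
  using integrable_lebesgue_on_subset[OF assms(1) compact_lebesgue _ assms(2)] by blast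

lemma L2_subset:
  fixes f :: "real^'d \<Rightarrow> real"
  assumes "\<Omega> \<in> sets lebesgue" "K \<in> sets lebesgue" "K \<subseteq> \<Omega>" "f \<in> L2 \<Omega>"
  shows "f \<in> L2 K"
proof -
  have 1: "(\<lambda>x. if x \<in> \<Omega> then f x else 0) \<in> L2 K"
    using L2_restrict(1)[OF L2_extend[OF assms(1,4)] assms(2)] .
  have "AE x in lebesgue_on K. (if x \<in> \<Omega> then f x else 0) = f x"
    using assms(3) by (intro AE_I2) auto
  with assms(2) 1 show ?thesis by (rule L2_cong_AE)
qed

lemma L2_one_compact: "compact K \<Longrightarrow> (\<lambda>x. 1) \<in> L2 (K :: (real^'d) set)"
  by (rule L2_of_bounded[where B=1]) (auto simp: lmeasurable_compact)

lemma L2_locally_integrable: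
  fixes f :: "real^'d \<Rightarrow> real"
  assumes "\<Omega> \<in> sets lebesgue" "f \<in> L2 \<Omega>"
  shows "locally_integrable \<Omega> f"
  unfolding locally_integrable_def
proof (intro allI impI)
  fix K assume K: "compact K \<and> K \<subseteq> \<Omega>"
  then have "f \<in> L2 K" using L2_subset[OF assms(1) compact_lebesgue _ assms(2)] by blast
  from L2_mult_integrable[OF this L2_one_compact] K show "integrable (lebesgue_on K) f" by simp
qed

lemma locally_integrable_mult:
  fixes f :: "real^'d \<Rightarrow> real"
  assumes \<Omega>: "\<Omega> \<in> sets lebesgue" and f: "locally_integrable \<Omega> f" and \<psi>: "continuous_on UNIV \<psi>"
    and K: "compact K" "K \<subseteq> \<Omega>" "\<And>x. x \<notin> K \<Longrightarrow> \<psi> x = 0"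
  shows "integrable (lebesgue_on \<Omega>) (\<lambda>x. f x * \<psi> x)"
proof -
  obtain B where B: "\<And>x. \<bar>\<psi> x\<bar> \<le> B" using compact_support_bounded[OF \<psi> K(1,3)] by blast
  have "integrable (lebesgue_on K) f" using f K by (simp add: locally_integrable_def)
  then have "integrable lebesgue (\<lambda>x. if x \<in> K then f x else 0)"
    using Lebesgue_Measure.integrable_restrict_UNIV[OF compact_lebesgue[OF K(1)], of f] by simp
  then have "integrable lebesgue (\<lambda>x. (if x \<in> K then f x else 0) * \<psi> x)"
    by (rule integrable_mult_bounded_continuous[OF _ sets_borel_lebesgue _ \<psi> B]) simp
  moreover have "(\<lambda>x. (if x \<in> K then f x else 0) * \<psi> x) = (\<lambda>x. if x \<in> \<Omega> then f x * \<psi> x else 0)"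
    using K(2,3) by (auto simp: fun_eq_iff)
  ultimately show ?thesis using Lebesgue_Measure.integrable_restrict_UNIV[OF \<Omega>, of "\<lambda>x. f x * \<psi> x"] by simp
qed

lemma locally_integrable_test:
  fixes f :: "real^'d \<Rightarrow> real"
  assumes "\<Omega> \<in> sets lebesgue" "locally_integrable \<Omega> f" "\<phi> \<in> test_functions \<Omega>"
  shows "integrable (lebesgue_on \<Omega>) (\<lambda>x. f x * \<phi> x)"
proof -
  obtain K where K: "compact K" "K \<subseteq> \<Omega>" "\<forall>x. x \<notin> K \<longrightarrow> \<phi> x = 0"
    using test_support[OF assms(3)] by blast
  show ?thesis
    by (rule locally_integrable_mult[OF assms(1,2) smooth_continuous[OF test_smooth[OF assms(3)]] K(1,2)])
       (simp add: K(3))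
qed

lemma locally_integrable_cong_AE:
  assumes \<Omega>: "\<Omega> \<in> sets lebesgue" and f: "locally_integrable \<Omega> f" and ae: "AE x in lebesgue_on \<Omega>. f x = g x"
  shows "locally_integrable \<Omega> g"
  unfolding locally_integrable_def
proof (intro allI impI)
  fix K assume K: "compact K \<and> K \<subseteq> \<Omega>"
  then have KL: "K \<in> sets lebesgue" by (simp add: compact_lebesgue)
  have i: "integrable (lebesgue_on K) f" using f K by (simp add: locally_integrable_def)
  have ae': "AE x in lebesgue_on K. f x = g x" using AE_lebesgue_on_subset[OF \<Omega> KL _ ae] K by blast
  show "integrable (lebesgue_on K) g"
    by (rule integrable_cong_AE_imp[OF i meas_cong_AE[OF KL borel_measurable_integrable[OF i] ae'] ae'])
qed

lemma locally_integrable_diff: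
  "locally_integrable \<Omega> f \<Longrightarrow> locally_integrable \<Omega> g \<Longrightarrow> locally_integrable \<Omega> (\<lambda>x. f x - g x)"
  by (auto simp: locally_integrable_def)

lemma locally_integrable_add:
  "locally_integrable \<Omega> f \<Longrightarrow> locally_integrable \<Omega> g \<Longrightarrow> locally_integrable \<Omega> (\<lambda>x. f x + g x)"
  by (auto simp: locally_integrable_def)

lemma continuous_locally_integrable:
  fixes f :: "real^'d \<Rightarrow> real"
  assumes "continuous_on UNIV f" shows "locally_integrable \<Omega> f"
  unfolding locally_integrable_def
proof (intro allI impI)
  fix K assume K: "compact K \<and> K \<subseteq> \<Omega>"
  have "continuous_on K f" using assms continuous_on_subset by blast
  then have 1: "integrable lborel (\<lambda>x. indicator K x *\<^sub>R f x)"
    using K by (intro borel_integrable_compact) auto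
  then have "integrable lebesgue (\<lambda>x. indicator K x *\<^sub>R f x)"
    using borel_measurable_integrable[OF 1] by (subst integrable_completion) auto
  moreover have "(\<lambda>x. indicator K x *\<^sub>R f x) = (\<lambda>x. if x \<in> K then f x else 0)" by (auto simp: indicator_def)
  ultimately show "integrable (lebesgue_on K) f"
    using Lebesgue_Measure.integrable_restrict_UNIV[OF compact_lebesgue, of K f] K by simp
qed

lemma test_L2:
  fixes \<phi> :: "real^'d \<Rightarrow> real"
  assumes "\<phi> \<in> test_functions \<Omega>'" "\<Omega> \<in> sets lebesgue"
  shows "\<phi> \<in> L2 \<Omega>"
proof -
  have c: "continuous_on UNIV \<phi>" by (rule smooth_continuous[OF test_smooth[OF assms(1)]])
  have "locally_integrable UNIV \<phi>" using c by (rule continuous_locally_integrable)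
  from locally_integrable_test[OF _ this test_mono[OF assms(1)]]
  have "integrable lebesgue (\<lambda>x. \<phi> x * \<phi> x)" by simp
  moreover have "\<phi> \<in> borel_measurable lborel" using c by (simp add: borel_measurable_continuous_onI)
  then have "\<phi> \<in> borel_measurable lebesgue" by (rule measurable_completion)
  ultimately have "\<phi> \<in> L2 UNIV" by (intro L2I) (auto simp: power2_eq_square)
  then show ?thesis using assms(2) by (rule L2_restrict(1))
qed

lemma L2_mult_test:
  fixes \<phi> :: "real^'d \<Rightarrow> real"
  assumes "f \<in> L2 \<Omega>" "\<phi> \<in> test_functions \<Omega>'"
  shows "(\<lambda>x. f x * \<phi> x) \<in> L2 \<Omega>"
proof -
  obtain B where B: "\<forall>x. \<bar>\<phi> x\<bar> \<le> B" using test_bounded[OF assms(2)] by blast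
  have "\<phi> \<in> borel_measurable lborel"
    using smooth_continuous[OF test_smooth[OF assms(2)]] by (simp add: borel_measurable_continuous_onI)
  then have "\<phi> \<in> borel_measurable (lebesgue_on \<Omega>)"
    by (intro measurable_restrict_space1 measurable_completion)
  from L2_bdd_mult[OF this _ assms(1)] B show ?thesis by (auto simp: mult.commute)
qed

subsection \<open>Uniqueness\<close>

lemma compact_neighbourhood:
  fixes K :: "(real^'d) set"
  assumes "compact K" shows "compact (\<Union>x\<in>K. cball x r)"
proof -
  have eq: "(\<Union>x\<in>K. cball x r) = {x + y | x y. x \<in> K \<and> y \<in> cball 0 r}"
  proof safe
    fix x y :: "real^'d" assume "x \<in> K" "y \<in> cball x r"
    then show "\<exists>x' y'. y = x' + y' \<and> x' \<in> K \<and> y' \<in> cball 0 r"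
      by (intro exI[of _ x] exI[of _ "y - x"]) (auto simp: dist_norm norm_minus_commute)
  next
    fix x y :: "real^'d" assume "x \<in> K" "y \<in> cball 0 r"
    then show "x + y \<in> (\<Union>x\<in>K. cball x r)" by (intro UN_I[of x]) (auto simp: dist_norm)
  qed
  show ?thesis unfolding eq by (rule compact_sums[OF assms compact_cball])
qed

lemma ex_compact_neighbourhood:
  fixes K :: "(real^'d) set"
  assumes "compact K" "open \<Omega>" "K \<subseteq> \<Omega>"
  shows "\<exists>\<delta>>0. (\<Union>x\<in>K. cball x \<delta>) \<subseteq> \<Omega>"
proof -
  obtain \<delta> where "\<delta> > 0" "(\<Union>x\<in>K. cball x \<delta>) \<subseteq> \<Omega>"
    by (rule compact_subset_open_imp_cball_epsilon_subset[OF assms])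
  then show ?thesis by blast
qed

lemma mollifierD:
  assumes "mollifier \<eta>"
  shows "\<eta> n \<in> test_functions UNIV" "0 \<le> \<eta> n x" "x \<notin> cball 0 (inverse (Suc n)) \<Longrightarrow> \<eta> n x = 0"
    "(LINT x|lborel. \<eta> n x) = 1"
  using assms by (auto simp: mollifier_def)

lemma mollifier_integral:
  fixes \<eta> :: "nat \<Rightarrow> real^'d \<Rightarrow> real"
  assumes "mollifier \<eta>"
  shows "(LINT y|lebesgue. \<eta> n (x - y)) = 1" "integrable lebesgue (\<lambda>y. \<eta> n (x - y))"
proof -
  have c: "continuous_on UNIV (\<eta> n)" by (rule smooth_continuous[OF test_smooth[OF mollifierD(1)[OF assms]]])
  then have m: "\<eta> n \<in> borel_measurable borel" by (rule borel_measurable_continuous_onI)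
  have i: "integrable lborel (\<eta> n)"
    using c compact_cball mollifierD(3)[OF assms] by (rule integrable_compact_support)
  have m': "(\<lambda>y. \<eta> n (x - y)) \<in> borel_measurable lborel" using m by simp
  show "(LINT y|lebesgue. \<eta> n (x - y)) = 1"
    using integral_completion[OF m'] lborel_reflect(1)[OF m] mollifierD(4)[OF assms] by simp
  show "integrable lebesgue (\<lambda>y. \<eta> n (x - y))"
    using integrable_completion[OF m'] lborel_reflect(2)[OF m i] by simp
qed

lemma conv_abs_le:
  assumes "mollifier \<eta>" "integrable lebesgue s" "\<And>y. \<bar>s y\<bar> \<le> 1"
  shows "\<bar>conv s (\<eta> n) x\<bar> \<le> 1"
proof -
  have i: "integrable lebesgue (\<lambda>y. s y * \<eta> n (x - y))"
    using assms(2) mollifierD(1)[OF assms(1)] by (rule conv_integrable)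
  have "\<bar>conv s (\<eta> n) x\<bar> \<le> (LINT y|lebesgue. \<eta> n (x - y))"
    unfolding conv_def
  proof (rule Bochner_Integration.integral_abs_bound_integral[OF i mollifier_integral(2)[OF assms(1)]])
    fix y
    have "\<bar>s y\<bar> * \<eta> n (x - y) \<le> 1 * \<eta> n (x - y)"
      using assms(3) mollifierD(2)[OF assms(1)] by (intro mult_right_mono) auto
    then show "\<bar>s y * \<eta> n (x - y)\<bar> \<le> \<eta> n (x - y)"
      using mollifierD(2)[OF assms(1), of n "x - y"] by (simp add: abs_mult)
  qed
  then show ?thesis using mollifier_integral(1)[OF assms(1)] by simp
qed

text \<open>Test functions converging almost everywhere and boundedly to the sign of \<open>h\<close> on a compact
  set show that the integral of \<open>\<bar>h\<bar>\<close> over this set vanishes.\<close>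

lemma fundamental_lemma_compact:
  fixes h :: "real^'d \<Rightarrow> real"
  assumes \<Omega>: "open \<Omega>" and h: "locally_integrable \<Omega> h"
    and z: "\<And>\<phi>. \<phi> \<in> test_functions \<Omega> \<Longrightarrow> (LINT x|lebesgue_on \<Omega>. h x * \<phi> x) = 0"
    and K: "compact K" "K \<subseteq> \<Omega>"
  shows "AE x in lebesgue. x \<in> K \<longrightarrow> h x = 0"
proof -
  obtain \<eta> :: "nat \<Rightarrow> real^'d \<Rightarrow> real" where \<eta>: "mollifier \<eta>" using ex_mollifier by blast
  have KL: "K \<in> sets lebesgue" using K(1) by (rule compact_lebesgue)
  have hK: "integrable (lebesgue_on K) h" using h K by (simp add: locally_integrable_def)
  define s where "s x = (if x \<in> K then sgn (h x) else 0)" for x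
  have sK: "(\<lambda>x. sgn (h x)) \<in> L2 K"
    using K(1) borel_measurable_integrable[OF hK]
    by (intro L2_of_bounded[where B=1]) (auto simp: lmeasurable_compact abs_sgn_eq)
  have s2: "s \<in> L2 UNIV" unfolding s_def by (rule L2_extend[OF KL sK])
  have si: "integrable lebesgue s"
    unfolding s_def using L2_mult_integrable[OF sK L2_one_compact[OF K(1)]]
    by (subst Lebesgue_Measure.integrable_restrict_UNIV[OF KL]) simp
  have s1: "\<bar>s y\<bar> \<le> 1" for y by (simp add: s_def abs_sgn_eq)
  obtain r :: "nat \<Rightarrow> nat" where r: "strict_mono r" "AE x in lebesgue. (\<lambda>n. conv s (\<eta> (r n)) x) \<longlonglongrightarrow> s x"
    using L2_AE_subseq[OF mollify_L2(1)[OF \<eta> si s2] s2 mollify_L2(2)[OF \<eta> si s2], unfolded lebesgue_on_UNIV]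
    by blast
  obtain \<delta> where \<delta>: "\<delta> > 0" "(\<Union>x\<in>K. cball x \<delta>) \<subseteq> \<Omega>"
    using ex_compact_neighbourhood[OF K(1) \<Omega> K(2)] by blast
  define K' where "K' = (\<Union>x\<in>K. cball x \<delta>)"
  have K': "compact K'" "K' \<subseteq> \<Omega>" using compact_neighbourhood[OF K(1)] \<delta>(2) by (auto simp: K'_def)
  have KL': "K' \<in> sets lebesgue" using K'(1) by (rule compact_lebesgue)
  obtain N where N: "inverse (real (Suc N)) < \<delta>" using reals_Archimedean[OF \<delta>(1)] by auto
  define \<phi> where "\<phi> n = conv s (\<eta> (r (n + N)))" for n
  have sm: "smooth (\<phi> n)" for n unfolding \<phi>_def by (rule smooth_conv[OF si mollifierD(1)[OF \<eta>]])
  have supp: "\<phi> n x = 0" if "x \<notin> K'" for n x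
    unfolding \<phi>_def
  proof (rule conv_zero_outside)
    show "s y = 0" if "y \<notin> K" for y using that by (simp add: s_def)
    show "\<eta> (r (n + N)) y = 0" if "y \<notin> cball 0 (inverse (Suc (r (n + N))))" for y
      using that by (rule mollifierD(3)[OF \<eta>])
    have "N \<le> r (n + N)" using strict_mono_imp_increasing[OF r(1), of "n + N"] by simp
    then have "inverse (real (Suc (r (n + N)))) \<le> inverse (real (Suc N))" by (simp add: field_simps)
    with N have "inverse (real (Suc (r (n + N)))) \<le> \<delta>" by linarith
    then have "(\<Union>y\<in>K. cball y (inverse (Suc (r (n + N))))) \<subseteq> K'" unfolding K'_def by (auto intro: order_trans)
    then show "x \<notin> (\<Union>y\<in>K. cball y (inverse (Suc (r (n + N)))))" using that by blast
  qed
  have test: "\<phi> n \<in> test_functions \<Omega>" for n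
    by (rule test_functionI[OF sm K' supp])
  have hi: "integrable (lebesgue_on K') h" using h K' by (simp add: locally_integrable_def)
  have m: "\<phi> n \<in> borel_measurable (lebesgue_on K')" for n
    using borel_measurable_continuous_onI[OF smooth_continuous[OF sm]]
    by (intro measurable_restrict_space1 measurable_completion) simp
  have sm': "s \<in> borel_measurable (lebesgue_on K')" using si by (intro measurable_restrict_space1) auto
  have hm: "h \<in> borel_measurable (lebesgue_on K')" using hi by auto
  have lim: "(\<lambda>n. LINT x|lebesgue_on K'. h x * \<phi> n x) \<longlonglongrightarrow> (LINT x|lebesgue_on K'. h x * s x)"
  proof (rule integral_dominated_convergence[where w="\<lambda>x. \<bar>h x\<bar>"])
    have ae: "AE x in lebesgue. (\<lambda>n. \<phi> n x) \<longlonglongrightarrow> s x"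
      using r(2)
    proof eventually_elim
      case (elim x)
      from LIMSEQ_ignore_initial_segment[OF this, of N] show ?case by (simp add: \<phi>_def)
    qed
    have "AE x in lebesgue_on K'. (\<lambda>n. \<phi> n x) \<longlonglongrightarrow> s x"
      using ae KL' by (auto simp: AE_restrict_space_iff elim!: eventually_mono)
    then show "AE x in lebesgue_on K'. (\<lambda>n. h x * \<phi> n x) \<longlonglongrightarrow> h x * s x"
      by eventually_elim (rule tendsto_mult_left)
    show "AE x in lebesgue_on K'. norm (h x * \<phi> n x) \<le> \<bar>h x\<bar>" for n
    proof (rule AE_I2)
      fix x
      have "\<bar>h x\<bar> * \<bar>\<phi> n x\<bar> \<le> \<bar>h x\<bar> * 1"
        unfolding \<phi>_def using conv_abs_le[OF \<eta> si s1] by (intro mult_left_mono) auto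
      then show "norm (h x * \<phi> n x) \<le> \<bar>h x\<bar>" by (simp add: abs_mult)
    qed
    show "integrable (lebesgue_on K') (\<lambda>x. \<bar>h x\<bar>)" using hi by auto
    show "(\<lambda>x. h x * \<phi> n x) \<in> borel_measurable (lebesgue_on K')" for n using m[of n] hm by measurable
    show "(\<lambda>x. h x * s x) \<in> borel_measurable (lebesgue_on K')" using sm' hm by measurable
  qed
  have "(LINT x|lebesgue_on K'. h x * \<phi> n x) = 0" for n
  proof -
    have "(LINT x|lebesgue_on K'. h x * \<phi> n x) = (LINT x|lebesgue. h x * \<phi> n x)"
      by (rule integral_lebesgue_on_supported[OF KL']) (simp add: supp)
    also have "\<dots> = (LINT x|lebesgue_on \<Omega>. h x * \<phi> n x)"
      by (rule integral_lebesgue_on_supported[OF open_lebesgue[OF \<Omega>], symmetric])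
         (use supp[of _ n] K'(2) in auto)
    also have "\<dots> = 0" by (rule z[OF test])
    finally show ?thesis .
  qed
  with lim have 0: "(LINT x|lebesgue_on K'. h x * s x) = 0" by (simp add: LIMSEQ_const_iff)
  have "(LINT x|lebesgue_on K. \<bar>h x\<bar>) = (LINT x|lebesgue_on K. h x * s x)"
    by (rule Bochner_Integration.integral_cong) (auto simp: s_def abs_sgn)
  also have "\<dots> = (LINT x|lebesgue. h x * s x)"
    by (rule integral_lebesgue_on_supported[OF KL]) (simp add: s_def)
  also have "\<dots> = (LINT x|lebesgue_on K'. h x * s x)"
    by (rule integral_lebesgue_on_supported[OF KL', symmetric])
       (use \<delta>(1) in \<open>force simp: s_def K'_def\<close>)
  finally have "(LINT x|lebesgue_on K. \<bar>h x\<bar>) = 0" using 0 by simp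
  then have "AE x in lebesgue_on K. \<bar>h x\<bar> = 0"
    using hK by (subst (asm) integral_nonneg_eq_0_iff_AE) auto
  then show ?thesis using KL by (auto simp: AE_restrict_space_iff)
qed

lemma fundamental_lemma:
  fixes h :: "real^'d \<Rightarrow> real"
  assumes \<Omega>: "open \<Omega>" and h: "locally_integrable \<Omega> h"
    and z: "\<And>\<phi>. \<phi> \<in> test_functions \<Omega> \<Longrightarrow> (LINT x|lebesgue_on \<Omega>. h x * \<phi> x) = 0"
  shows "AE x in lebesgue_on \<Omega>. h x = 0"
proof -
  have "\<exists>C. (\<forall>n::nat. compact (C n) \<and> C n \<subseteq> \<Omega>) \<and> \<Union>(range C) = \<Omega>"
    by (rule open_Union_compact_subsets[OF \<Omega>]) metis
  then obtain C :: "nat \<Rightarrow> (real^'d) set" where C: "\<forall>n. compact (C n) \<and> C n \<subseteq> \<Omega>" "\<Union>(range C) = \<Omega>"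
    by blast
  have "AE x in lebesgue. \<forall>n. x \<in> C n \<longrightarrow> h x = 0"
    unfolding AE_all_countable using C(1) by (intro allI fundamental_lemma_compact[OF \<Omega> h z]) auto
  then have "AE x in lebesgue. x \<in> \<Omega> \<longrightarrow> h x = 0"
    by eventually_elim (use C(2) in blast)
  then show ?thesis using open_lebesgue[OF \<Omega>] by (auto simp: AE_restrict_space_iff)
qed

lemma weak_pdD:
  assumes "is_weak_pd \<Omega> i f h"
  shows "locally_integrable \<Omega> f" "locally_integrable \<Omega> h"
    "\<And>\<phi>. \<phi> \<in> test_functions \<Omega> \<Longrightarrow>
      (LINT x|lebesgue_on \<Omega>. f x * pd i \<phi> x) = - (LINT x|lebesgue_on \<Omega>. h x * \<phi> x)"
  using assms by (auto simp: is_weak_pd_def)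

lemma weak_pd_unique:
  assumes \<Omega>: "open \<Omega>" and "is_weak_pd \<Omega> i f h" "is_weak_pd \<Omega> i f h'"
  shows "AE x in lebesgue_on \<Omega>. h x = h' x"
proof -
  note L = open_lebesgue[OF \<Omega>]
  have "AE x in lebesgue_on \<Omega>. h x - h' x = 0"
  proof (rule fundamental_lemma[OF \<Omega> locally_integrable_diff[OF weak_pdD(2)[OF assms(2)] weak_pdD(2)[OF assms(3)]]])
    fix \<phi> assume \<phi>: "\<phi> \<in> test_functions \<Omega>"
    have "(LINT x|lebesgue_on \<Omega>. (h x - h' x) * \<phi> x) =
        (LINT x|lebesgue_on \<Omega>. h x * \<phi> x) - (LINT x|lebesgue_on \<Omega>. h' x * \<phi> x)"
      using locally_integrable_test[OF L weak_pdD(2)[OF assms(2)] \<phi>]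
        locally_integrable_test[OF L weak_pdD(2)[OF assms(3)] \<phi>] by (simp add: left_diff_distrib)
    also have "\<dots> = 0" using weak_pdD(3)[OF assms(2) \<phi>] weak_pdD(3)[OF assms(3) \<phi>] by simp
    finally show "(LINT x|lebesgue_on \<Omega>. (h x - h' x) * \<phi> x) = 0" .
  qed
  then show ?thesis by eventually_elim simp
qed

lemma weak_pd_cong_AE:
  assumes \<Omega>: "open \<Omega>" and w: "is_weak_pd \<Omega> i f h"
    and ae: "AE x in lebesgue_on \<Omega>. f x = f' x" "AE x in lebesgue_on \<Omega>. h x = h' x"
  shows "is_weak_pd \<Omega> i f' h'"
proof -
  note L = open_lebesgue[OF \<Omega>]
  have li: "locally_integrable \<Omega> f'" "locally_integrable \<Omega> h'"
    using locally_integrable_cong_AE[OF L weak_pdD(1)[OF w] ae(1)]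
      locally_integrable_cong_AE[OF L weak_pdD(2)[OF w] ae(2)] by auto
  have "(LINT x|lebesgue_on \<Omega>. f' x * pd i \<phi> x) = - (LINT x|lebesgue_on \<Omega>. h' x * \<phi> x)"
    if \<phi>: "\<phi> \<in> test_functions \<Omega>" for \<phi>
  proof -
    have "(LINT x|lebesgue_on \<Omega>. f' x * pd i \<phi> x) = (LINT x|lebesgue_on \<Omega>. f x * pd i \<phi> x)"
    proof (rule integral_cong_AE)
      show "AE x in lebesgue_on \<Omega>. f' x * pd i \<phi> x = f x * pd i \<phi> x" using ae(1) by eventually_elim simp
    qed (use locally_integrable_test[OF L li(1) test_pd[OF \<phi>]]
          locally_integrable_test[OF L weak_pdD(1)[OF w] test_pd[OF \<phi>]] in auto)
    also have "\<dots> = - (LINT x|lebesgue_on \<Omega>. h x * \<phi> x)" by (rule weak_pdD(3)[OF w \<phi>])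
    also have "(LINT x|lebesgue_on \<Omega>. h x * \<phi> x) = (LINT x|lebesgue_on \<Omega>. h' x * \<phi> x)"
    proof (rule integral_cong_AE)
      show "AE x in lebesgue_on \<Omega>. h x * \<phi> x = h' x * \<phi> x" using ae(2) by eventually_elim simp
    qed (use locally_integrable_test[OF L li(2) \<phi>]
          locally_integrable_test[OF L weak_pdD(2)[OF w] \<phi>] in auto)
    finally show ?thesis .
  qed
  with li show ?thesis by (simp add: is_weak_pd_def)
qed

lemma weak_pd_add:
  assumes L: "\<Omega> \<in> sets lebesgue" and w: "is_weak_pd \<Omega> i f h" "is_weak_pd \<Omega> i f' h'"
  shows "is_weak_pd \<Omega> i (\<lambda>x. f x + f' x) (\<lambda>x. h x + h' x)"
  unfolding is_weak_pd_def
proof (intro conjI ballI)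
  show "locally_integrable \<Omega> (\<lambda>x. f x + f' x)" "locally_integrable \<Omega> (\<lambda>x. h x + h' x)"
    using weak_pdD(1,2)[OF w(1)] weak_pdD(1,2)[OF w(2)] by (auto intro: locally_integrable_add)
  fix \<phi> assume \<phi>: "\<phi> \<in> test_functions \<Omega>"
  note i = locally_integrable_test[OF L weak_pdD(1)[OF w(1)] test_pd[OF \<phi>]]
     locally_integrable_test[OF L weak_pdD(1)[OF w(2)] test_pd[OF \<phi>]]
     locally_integrable_test[OF L weak_pdD(2)[OF w(1)] \<phi>]
     locally_integrable_test[OF L weak_pdD(2)[OF w(2)] \<phi>]
  show "(LINT x|lebesgue_on \<Omega>. (f x + f' x) * pd i \<phi> x) = - (LINT x|lebesgue_on \<Omega>. (h x + h' x) * \<phi> x)"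
    using i weak_pdD(3)[OF w(1) \<phi>] weak_pdD(3)[OF w(2) \<phi>] by (simp add: distrib_right)
qed

lemma weak_pd_cmult:
  assumes w: "is_weak_pd \<Omega> i f h"
  shows "is_weak_pd \<Omega> i (\<lambda>x. c * f x) (\<lambda>x. c * h x)"
  using w unfolding is_weak_pd_def locally_integrable_def by (simp add: mult.assoc)

text \<open>By \<open>integral_pd_zero\<close> for \<open>f \<phi>\<close>, whose compact support removes all boundary terms.\<close>

lemma weak_pd_C1:
  fixes f :: "real^'d \<Rightarrow> real"
  assumes L: "\<Omega> \<in> sets lebesgue" and d: "\<And>x. f differentiable (at x)" and c: "continuous_on UNIV (pd i f)"
  shows "is_weak_pd \<Omega> i f (pd i f)"
  unfolding is_weak_pd_def
proof (intro conjI ballI)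
  have cf: "continuous_on UNIV f"
    using d by (meson continuous_at_imp_continuous_on differentiable_imp_continuous_within)
  show li: "locally_integrable \<Omega> f" "locally_integrable \<Omega> (pd i f)"
    using cf c by (auto intro: continuous_locally_integrable)
  fix \<phi> assume \<phi>: "\<phi> \<in> test_functions \<Omega>"
  obtain K where K: "compact K" "K \<subseteq> \<Omega>" "\<forall>x. x \<notin> K \<longrightarrow> \<phi> x = 0" using test_support[OF \<phi>] by blast
  have eq: "pd i (\<lambda>x. f x * \<phi> x) x = f x * pd i \<phi> x + \<phi> x * pd i f x" for x
    using d smooth_differentiable[OF test_smooth[OF \<phi>]] by (rule pd_mult)
  have ceq: "continuous_on UNIV (pd i (\<lambda>x. f x * \<phi> x))"
    unfolding eq[abs_def] by (intro continuous_intros cf c smooth_continuous smooth_pd test_smooth[OF \<phi>])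
  have z: "pd i \<phi> x = 0" if "x \<notin> K" for x
    using K(3) that by (intro pd_zero_outside[OF K(1)]) auto
  have "(LINT x|lborel. pd i (\<lambda>x. f x * \<phi> x) x) = 0"
  proof (rule integral_pd_zero[OF _ ceq K(1)])
    show "(\<lambda>x. f x * \<phi> x) differentiable at x" for x
      using d smooth_differentiable[OF test_smooth[OF \<phi>]] by (intro derivative_intros)
  qed (simp add: K(3))
  moreover have "pd i (\<lambda>x. f x * \<phi> x) \<in> borel_measurable lborel"
    using borel_measurable_continuous_onI[OF ceq] by simp
  ultimately have "integral\<^sup>L lebesgue (pd i (\<lambda>x. f x * \<phi> x)) = 0"
    using integral_completion[of "pd i (\<lambda>x. f x * \<phi> x)" lborel] by simp
  then have "(LINT x|lebesgue. f x * pd i \<phi> x + \<phi> x * pd i f x) = 0" by (simp only: eq[abs_def])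
  then have "(LINT x|lebesgue_on \<Omega>. f x * pd i \<phi> x + pd i f x * \<phi> x) = 0"
  proof (subst integral_lebesgue_on_supported[OF L])
    fix x assume "x \<notin> \<Omega>"
    then have "x \<notin> K" using K(2) by blast
    then show "f x * pd i \<phi> x + pd i f x * \<phi> x = 0" using K(3) z[of x] by simp
  qed (simp add: mult.commute)
  then show "(LINT x|lebesgue_on \<Omega>. f x * pd i \<phi> x) = - (LINT x|lebesgue_on \<Omega>. pd i f x * \<phi> x)"
    using locally_integrable_test[OF L li(1) test_pd[OF \<phi>]] locally_integrable_test[OF L li(2) \<phi>] by simp
qed

text \<open>Both sides of the defining identity are \<open>L\<^sup>2\<close> inner products with a test function, hence continuous.\<close>

lemma weak_pd_closed:
  assumes L: "\<Omega> \<in> sets lebesgue"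
    and "\<And>n. f n \<in> L2 \<Omega>" "f' \<in> L2 \<Omega>" "\<And>n. h n \<in> L2 \<Omega>" "h' \<in> L2 \<Omega>"
    and c: "(\<lambda>n. L2_norm \<Omega> (\<lambda>x. f n x - f' x)) \<longlonglongrightarrow> 0" "(\<lambda>n. L2_norm \<Omega> (\<lambda>x. h n x - h' x)) \<longlonglongrightarrow> 0"
    and w: "\<And>n. is_weak_pd \<Omega> i (f n) (h n)"
  shows "is_weak_pd \<Omega> i f' h'"
  unfolding is_weak_pd_def
proof (intro conjI ballI)
  show "locally_integrable \<Omega> f'" "locally_integrable \<Omega> h'"
    using assms(3,5) L by (auto intro: L2_locally_integrable)
  fix \<phi> assume \<phi>: "\<phi> \<in> test_functions \<Omega>"
  have "(\<lambda>n. LINT x|lebesgue_on \<Omega>. f n x * pd i \<phi> x) \<longlonglongrightarrow> (LINT x|lebesgue_on \<Omega>. f' x * pd i \<phi> x)"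
    using assms(2,3) test_L2[OF test_pd[OF \<phi>] L] c(1) by (rule L2_tendsto_inner)
  moreover have "(\<lambda>n. LINT x|lebesgue_on \<Omega>. h n x * \<phi> x) \<longlonglongrightarrow> (LINT x|lebesgue_on \<Omega>. h' x * \<phi> x)"
    using assms(4,5) test_L2[OF \<phi> L] c(2) by (rule L2_tendsto_inner)
  ultimately show "(LINT x|lebesgue_on \<Omega>. f' x * pd i \<phi> x) = - (LINT x|lebesgue_on \<Omega>. h' x * \<phi> x)"
    using LIMSEQ_unique[OF _ tendsto_minus] by (simp add: weak_pdD(3)[OF w \<phi>])
qed

section \<open>Calculus in \<open>W\<^sup>1\<^sup>,\<^sup>2\<close>\<close>

text \<open>A \<open>W\<^sup>1\<^sup>,\<^sup>2\<close> function together with a representative of its gradient. Passing the gradient explicitly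
  allows rules such as the product rule to be stated as formulas, independently of the representatives
  that \<open>weak_pd\<close> happens to select.\<close>

definition has_wgrad :: "(real^'d) set \<Rightarrow> (real^'d \<Rightarrow> real) \<Rightarrow> ('d \<Rightarrow> real^'d \<Rightarrow> real) \<Rightarrow> bool" where
  "has_wgrad \<Omega> f G \<longleftrightarrow> f \<in> L2 \<Omega> \<and> (\<forall>i. G i \<in> L2 \<Omega> \<and> is_weak_pd \<Omega> i f (G i))"

lemma wgradD:
  assumes "has_wgrad \<Omega> f G"
  shows "f \<in> L2 \<Omega>" "G i \<in> L2 \<Omega>" "is_weak_pd \<Omega> i f (G i)"
  using assms by (auto simp: has_wgrad_def)

lemma W12_iff: "f \<in> W12 \<Omega> \<longleftrightarrow> (\<exists>G. has_wgrad \<Omega> f G)"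
proof -
  have "f \<in> W12 \<Omega> \<longleftrightarrow> f \<in> L2 \<Omega> \<and> (\<forall>i. \<exists>h\<in>L2 \<Omega>. is_weak_pd \<Omega> i f h)"
    by (simp add: One_nat_def)
  then show ?thesis unfolding has_wgrad_def by metis
qed

lemma weak_pd_eq_AE:
  assumes "open \<Omega>" "is_weak_pd \<Omega> i f h"
  shows "AE x in lebesgue_on \<Omega>. weak_pd \<Omega> i f x = h x"
proof -
  have "is_weak_pd \<Omega> i f (weak_pd \<Omega> i f)"
    unfolding weak_pd_def using assms(2) by (rule someI[of "is_weak_pd \<Omega> i f"])
  from weak_pd_unique[OF assms(1) this assms(2)] show ?thesis .
qed

lemma W12_has_wgrad:
  assumes "open \<Omega>" "f \<in> W12 \<Omega>"
  shows "has_wgrad \<Omega> f (\<lambda>i. weak_pd \<Omega> i f)"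
proof -
  obtain G where G: "has_wgrad \<Omega> f G" using assms(2) unfolding W12_iff by blast
  show ?thesis
    unfolding has_wgrad_def
  proof (intro conjI allI)
    show "f \<in> L2 \<Omega>" by (rule wgradD(1)[OF G])
    fix i
    have "AE x in lebesgue_on \<Omega>. G i x = weak_pd \<Omega> i f x"
      using weak_pd_eq_AE[OF assms(1) wgradD(3)[OF G, of i]] by eventually_elim simp
    with open_lebesgue[OF assms(1)] wgradD(2)[OF G] show "weak_pd \<Omega> i f \<in> L2 \<Omega>" by (rule L2_cong_AE)
    show "is_weak_pd \<Omega> i f (weak_pd \<Omega> i f)"
      unfolding weak_pd_def using wgradD(3)[OF G] by (rule someI[of "is_weak_pd \<Omega> i f"])
  qed
qed

lemma wgrad_unique:
  assumes "open \<Omega>" "has_wgrad \<Omega> f G" "has_wgrad \<Omega> f H"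
  shows "AE x in lebesgue_on \<Omega>. G i x = H i x"
  by (rule weak_pd_unique[OF assms(1) wgradD(3)[OF assms(2)] wgradD(3)[OF assms(3)]])

lemma wgrad_cong_AE:
  assumes \<Omega>: "open \<Omega>" and f: "has_wgrad \<Omega> f G" and ae: "AE x in lebesgue_on \<Omega>. f x = f' x"
    "\<And>i. AE x in lebesgue_on \<Omega>. G i x = G' i x"
  shows "has_wgrad \<Omega> f' G'"
  using L2_cong_AE[OF open_lebesgue[OF \<Omega>] wgradD(1)[OF f] ae(1)]
    L2_cong_AE[OF open_lebesgue[OF \<Omega>] wgradD(2)[OF f] ae(2)]
    weak_pd_cong_AE[OF \<Omega> wgradD(3)[OF f] ae(1) ae(2)] by (simp add: has_wgrad_def)

lemma W12_norm_eq:
  assumes \<Omega>: "open \<Omega>" and f: "has_wgrad \<Omega> f G"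
  shows "W12_norm \<Omega> f = sqrt ((L2_norm \<Omega> f)\<^sup>2 + (\<Sum>i\<in>UNIV. (L2_norm \<Omega> (G i))\<^sup>2))"
proof -
  have "L2_norm \<Omega> (weak_pd \<Omega> i f) = L2_norm \<Omega> (G i)" for i
    by (rule L2_norm_cong_AE[OF open_lebesgue[OF \<Omega>] wgradD(2)[OF f]])
       (use weak_pd_eq_AE[OF \<Omega> wgradD(3)[OF f, of i]] in \<open>auto elim!: eventually_mono\<close>)
  then show ?thesis by (simp add: W12_norm_def)
qed

lemma L2_norm_le_W12_norm:
  assumes \<Omega>: "open \<Omega>" and f: "has_wgrad \<Omega> f G"
  shows "L2_norm \<Omega> f \<le> W12_norm \<Omega> f" "L2_norm \<Omega> (G i) \<le> W12_norm \<Omega> f"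
proof -
  have s: "0 \<le> (\<Sum>i\<in>UNIV. (L2_norm \<Omega> (G i))\<^sup>2)" by (rule sum_nonneg) simp
  show "L2_norm \<Omega> f \<le> W12_norm \<Omega> f"
    unfolding W12_norm_eq[OF assms] using s by (intro real_le_rsqrt) simp
  have "(L2_norm \<Omega> (G i))\<^sup>2 \<le> (\<Sum>i\<in>UNIV. (L2_norm \<Omega> (G i))\<^sup>2)"
    by (rule member_le_sum) auto
  then have "(L2_norm \<Omega> (G i))\<^sup>2 \<le> (L2_norm \<Omega> f)\<^sup>2 + (\<Sum>i\<in>UNIV. (L2_norm \<Omega> (G i))\<^sup>2)"
    by (rule order_trans) simp
  then show "L2_norm \<Omega> (G i) \<le> W12_norm \<Omega> f"
    unfolding W12_norm_eq[OF assms] by (rule real_le_rsqrt)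
qed

lemma W12_norm_nonneg: "0 \<le> W12_norm \<Omega> f"
  by (auto simp: W12_norm_def intro!: add_nonneg_nonneg sum_nonneg)

lemma wgrad_add:
  assumes "\<Omega> \<in> sets lebesgue" "has_wgrad \<Omega> f G" "has_wgrad \<Omega> g H"
  shows "has_wgrad \<Omega> (\<lambda>x. f x + g x) (\<lambda>i x. G i x + H i x)"
  using assms by (auto simp: has_wgrad_def intro: L2_add weak_pd_add)

lemma wgrad_cmult:
  assumes "has_wgrad \<Omega> f G"
  shows "has_wgrad \<Omega> (\<lambda>x. c * f x) (\<lambda>i x. c * G i x)"
  using assms by (auto simp: has_wgrad_def intro: L2_cmult weak_pd_cmult)

lemma wgrad_diff:
  assumes "\<Omega> \<in> sets lebesgue" "has_wgrad \<Omega> f G" "has_wgrad \<Omega> g H"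
  shows "has_wgrad \<Omega> (\<lambda>x. f x - g x) (\<lambda>i x. G i x - H i x)"
  using wgrad_add[OF assms(1,2) wgrad_cmult[OF assms(3), of "-1"]] by simp

lemma wgrad_test:
  assumes "\<phi> \<in> test_functions \<Omega>'" "\<Omega> \<in> sets lebesgue"
  shows "has_wgrad \<Omega> \<phi> (\<lambda>i. pd i \<phi>)"
  unfolding has_wgrad_def
  using test_L2[OF assms] test_L2[OF test_pd[OF assms(1)] assms(2)]
  by (auto intro!: weak_pd_C1[OF assms(2)] smooth_differentiable[OF test_smooth[OF assms(1)]]
      smooth_continuous[OF smooth_pd[OF test_smooth[OF assms(1)]]])

subsection \<open>Localization and smooth approximation\<close>

text \<open>The extension by zero of \<open>\<zeta> f\<close> is weakly differentiable on the whole space, because \<open>\<zeta> \<phi>\<close> is a test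
  function on \<open>\<Omega>\<close> whatever the support of \<open>\<phi>\<close>.\<close>

lemma weak_pd_cutoff:
  fixes f :: "real^'d \<Rightarrow> real"
  assumes L: "\<Omega> \<in> sets lebesgue" and w: "is_weak_pd \<Omega> i f h" and \<zeta>: "\<zeta> \<in> test_functions \<Omega>"
    and \<phi>: "smooth \<phi>"
  shows "(LINT x|lebesgue. (\<zeta> x * f x) * pd i \<phi> x) = - (LINT x|lebesgue. (\<zeta> x * h x + f x * pd i \<zeta> x) * \<phi> x)"
proof -
  obtain K where K: "compact K" "K \<subseteq> \<Omega>" "\<forall>x. x \<notin> K \<longrightarrow> \<zeta> x = 0" using test_support[OF \<zeta>] by blast
  have z: "pd i \<zeta> x = 0" if "x \<notin> K" for x
    using K(3) that by (intro pd_zero_outside[OF K(1)]) auto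
  have out: "\<zeta> x = 0" "pd i \<zeta> x = 0" if "x \<notin> \<Omega>" for x using K(2,3) z that by blast+
  have t1: "(\<lambda>x. \<phi> x * \<zeta> x) \<in> test_functions \<Omega>" "(\<lambda>x. \<phi> x * pd i \<zeta> x) \<in> test_functions \<Omega>"
    "(\<lambda>x. pd i \<phi> x * \<zeta> x) \<in> test_functions \<Omega>"
    using \<zeta> \<phi> smooth_pd by (auto intro: test_mult test_pd)
  have pdm: "pd i (\<lambda>x. \<phi> x * \<zeta> x) x = \<phi> x * pd i \<zeta> x + \<zeta> x * pd i \<phi> x" for x
    using smooth_differentiable[OF \<phi>] smooth_differentiable[OF test_smooth[OF \<zeta>]] by (rule pd_mult)
  note lf = weak_pdD(1)[OF w] and lh = weak_pdD(2)[OF w]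
  note i1 = locally_integrable_test[OF L lf t1(3)] and i2 = locally_integrable_test[OF L lf t1(2)]
    and i3 = locally_integrable_test[OF L lh t1(1)]
  have "(LINT x|lebesgue_on \<Omega>. f x * (\<phi> x * pd i \<zeta> x)) + (LINT x|lebesgue_on \<Omega>. f x * (pd i \<phi> x * \<zeta> x))
      = (LINT x|lebesgue_on \<Omega>. f x * pd i (\<lambda>x. \<phi> x * \<zeta> x) x)"
    using i1 i2 by (simp add: pdm distrib_left mult_ac)
  also have "\<dots> = - (LINT x|lebesgue_on \<Omega>. h x * (\<phi> x * \<zeta> x))"
    by (rule weak_pdD(3)[OF w t1(1)])
  finally have e: "(LINT x|lebesgue_on \<Omega>. f x * (pd i \<phi> x * \<zeta> x))
    = - ((LINT x|lebesgue_on \<Omega>. h x * (\<phi> x * \<zeta> x)) + (LINT x|lebesgue_on \<Omega>. f x * (\<phi> x * pd i \<zeta> x)))" by simp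
  have "(LINT x|lebesgue. (\<zeta> x * f x) * pd i \<phi> x) = (LINT x|lebesgue_on \<Omega>. (\<zeta> x * f x) * pd i \<phi> x)"
    by (rule integral_lebesgue_on_supported[OF L, symmetric]) (simp add: out)
  also have "\<dots> = (LINT x|lebesgue_on \<Omega>. f x * (pd i \<phi> x * \<zeta> x))" by (simp add: mult_ac)
  also have "\<dots> = - (LINT x|lebesgue_on \<Omega>. h x * (\<phi> x * \<zeta> x) + f x * (\<phi> x * pd i \<zeta> x))"
    unfolding e using i2 i3 by simp
  also have "(LINT x|lebesgue_on \<Omega>. h x * (\<phi> x * \<zeta> x) + f x * (\<phi> x * pd i \<zeta> x))
     = (LINT x|lebesgue_on \<Omega>. (\<zeta> x * h x + f x * pd i \<zeta> x) * \<phi> x)" by (simp add: algebra_simps)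
  also have "\<dots> = (LINT x|lebesgue. (\<zeta> x * h x + f x * pd i \<zeta> x) * \<phi> x)"
    by (rule integral_lebesgue_on_supported[OF L]) (simp add: out)
  finally show ?thesis .
qed

lemma L2_UNIV_mult_test:
  fixes f :: "real^'d \<Rightarrow> real"
  assumes "\<Omega> \<in> sets lebesgue" "f \<in> L2 \<Omega>" "\<zeta> \<in> test_functions \<Omega>"
  shows "(\<lambda>x. f x * \<zeta> x) \<in> L2 UNIV" "integrable lebesgue (\<lambda>x. f x * \<zeta> x)"
proof -
  obtain K where K: "compact K" "K \<subseteq> \<Omega>" "\<forall>x. x \<notin> K \<longrightarrow> \<zeta> x = 0" using test_support[OF assms(3)] by blast
  have eq: "(\<lambda>x. if x \<in> \<Omega> then f x * \<zeta> x else 0) = (\<lambda>x. f x * \<zeta> x)" using K(2,3) by (auto simp: fun_eq_iff)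
  show "(\<lambda>x. f x * \<zeta> x) \<in> L2 UNIV"
    using L2_extend[OF assms(1) L2_mult_test[OF assms(2,3)]] unfolding eq .
  show "integrable lebesgue (\<lambda>x. f x * \<zeta> x)"
    using Lebesgue_Measure.integrable_restrict_UNIV[OF assms(1), of "\<lambda>x. f x * \<zeta> x"]
      locally_integrable_test[OF assms(1) L2_locally_integrable[OF assms(1,2)] assms(3)] unfolding eq by simp
qed

lemma wgrad_cutoff:
  fixes f :: "real^'d \<Rightarrow> real"
  assumes L: "\<Omega> \<in> sets lebesgue" and f: "has_wgrad \<Omega> f G" and \<zeta>: "\<zeta> \<in> test_functions \<Omega>"
  shows "has_wgrad UNIV (\<lambda>x. \<zeta> x * f x) (\<lambda>i x. \<zeta> x * G i x + f x * pd i \<zeta> x)"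
    and "integrable lebesgue (\<lambda>x. \<zeta> x * f x)"
    and "integrable lebesgue (\<lambda>x. \<zeta> x * G i x + f x * pd i \<zeta> x)"
proof -
  have 1: "(\<lambda>x. \<zeta> x * f x) \<in> L2 UNIV" "integrable lebesgue (\<lambda>x. \<zeta> x * f x)"
    using L2_UNIV_mult_test[OF L wgradD(1)[OF f] \<zeta>] by (simp_all add: mult.commute)
  have 2: "(\<lambda>x. \<zeta> x * G i x) \<in> L2 UNIV" "integrable lebesgue (\<lambda>x. \<zeta> x * G i x)" for i
    using L2_UNIV_mult_test[OF L wgradD(2)[OF f] \<zeta>] by (simp_all add: mult.commute)
  have 3: "(\<lambda>x. f x * pd i \<zeta> x) \<in> L2 UNIV" "integrable lebesgue (\<lambda>x. f x * pd i \<zeta> x)" for i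
    using L2_UNIV_mult_test[OF L wgradD(1)[OF f] test_pd[OF \<zeta>]] by simp_all
  have 4: "(\<lambda>x. \<zeta> x * G i x + f x * pd i \<zeta> x) \<in> L2 UNIV" for i
    using 2(1) 3(1) by (rule L2_add)
  show "integrable lebesgue (\<lambda>x. \<zeta> x * f x)" by (rule 1)
  show "integrable lebesgue (\<lambda>x. \<zeta> x * G i x + f x * pd i \<zeta> x)"
    using 2(2) 3(2) by (rule Bochner_Integration.integrable_add)
  have w: "is_weak_pd UNIV i (\<lambda>x. \<zeta> x * f x) (\<lambda>x. \<zeta> x * G i x + f x * pd i \<zeta> x)" for i
    unfolding is_weak_pd_def
  proof (intro conjI ballI)
    show "locally_integrable UNIV (\<lambda>x. \<zeta> x * f x)" "locally_integrable UNIV (\<lambda>x. \<zeta> x * G i x + f x * pd i \<zeta> x)"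
      using 1(1) 4 by (auto intro: L2_locally_integrable)
    fix \<phi> :: "real^'d \<Rightarrow> real" assume "\<phi> \<in> test_functions UNIV"
    then show "(LINT x|lebesgue_on UNIV. \<zeta> x * f x * pd i \<phi> x)
       = - (LINT x|lebesgue_on UNIV. (\<zeta> x * G i x + f x * pd i \<zeta> x) * \<phi> x)"
      using weak_pd_cutoff[OF L wgradD(3)[OF f] \<zeta> test_smooth] by (simp only: lebesgue_on_UNIV)
  qed
  show "has_wgrad UNIV (\<lambda>x. \<zeta> x * f x) (\<lambda>i x. \<zeta> x * G i x + f x * pd i \<zeta> x)"
    unfolding has_wgrad_def using 1(1) 4 w by blast
qed

lemma wgrad_UNIV_restrict:
  fixes f :: "real^'d \<Rightarrow> real"
  assumes L: "\<Omega> \<in> sets lebesgue" and f: "has_wgrad UNIV f G"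
  shows "has_wgrad \<Omega> f G"
  unfolding has_wgrad_def
proof (intro conjI allI)
  show 1: "f \<in> L2 \<Omega>" and 2: "G i \<in> L2 \<Omega>" for i
    using L2_restrict(1)[OF wgradD(1)[OF f] L] L2_restrict(1)[OF wgradD(2)[OF f] L] by auto
  fix i
  show "is_weak_pd \<Omega> i f (G i)"
    unfolding is_weak_pd_def
  proof (intro conjI ballI)
    show "locally_integrable \<Omega> f" "locally_integrable \<Omega> (G i)" using L 1 2 by (auto intro: L2_locally_integrable)
    fix \<phi> assume \<phi>: "\<phi> \<in> test_functions \<Omega>"
    obtain K where K: "compact K" "K \<subseteq> \<Omega>" "\<forall>x. x \<notin> K \<longrightarrow> \<phi> x = 0" using test_support[OF \<phi>] by blast
    have z: "pd i \<phi> x = 0" if "x \<notin> K" for x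
      using K(3) that by (intro pd_zero_outside[OF K(1)]) auto
    have "(LINT x|lebesgue_on \<Omega>. f x * pd i \<phi> x) = (LINT x|lebesgue. f x * pd i \<phi> x)"
      using K z by (intro integral_lebesgue_on_supported[OF L]) auto
    also have "\<dots> = - (LINT x|lebesgue. G i x * \<phi> x)"
      using weak_pdD(3)[OF wgradD(3)[OF f] test_mono[OF \<phi>], of i] by (simp only: lebesgue_on_UNIV) simp
    also have "(LINT x|lebesgue. G i x * \<phi> x) = (LINT x|lebesgue_on \<Omega>. G i x * \<phi> x)"
      using K by (intro integral_lebesgue_on_supported[OF L, symmetric]) auto
    finally show "(LINT x|lebesgue_on \<Omega>. f x * pd i \<phi> x) = - (LINT x|lebesgue_on \<Omega>. G i x * \<phi> x)" .
  qed
qed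

text \<open>Derivatives falling on the kernel can be moved to \<open>f\<close>, as reflected and translated kernels are test
  functions. Thus mollification commutes with weak differentiation.\<close>

lemma mollify_wgrad:
  fixes f :: "real^'d \<Rightarrow> real"
  assumes \<eta>: "mollifier \<eta>" and f: "has_wgrad UNIV f G" and fi: "integrable lebesgue f" "\<And>i. integrable lebesgue (G i)"
  shows "smooth (conv f (\<eta> n))" "conv f (\<eta> n) \<in> L2 UNIV" "pd i (conv f (\<eta> n)) \<in> L2 UNIV"
    "(\<lambda>n. L2_norm UNIV (\<lambda>x. conv f (\<eta> n) x - f x)) \<longlonglongrightarrow> 0"
    "(\<lambda>n. L2_norm UNIV (\<lambda>x. pd i (conv f (\<eta> n)) x - G i x)) \<longlonglongrightarrow> 0"
proof -
  have eq: "pd i (conv f (\<eta> n)) = conv (G i) (\<eta> n)" for n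
  proof
    fix x
    have t: "(\<lambda>y. \<eta> n (x - y)) \<in> test_functions UNIV"
    proof (rule test_functionI[where K="cball x (inverse (Suc n))"])
      show "smooth (\<lambda>y. \<eta> n (x - y))" by (intro smooth_reflect test_smooth[OF mollifierD(1)[OF \<eta>]])
      show "\<eta> n (x - y) = 0" if "y \<notin> cball x (inverse (Suc n))" for y
        using that by (intro mollifierD(3)[OF \<eta>]) (simp add: dist_norm norm_minus_commute)
    qed auto
    have pdr: "pd i (\<lambda>y. \<eta> n (x - y)) y = - pd i (\<eta> n) (x - y)" for y
      by (rule pd_reflect(2)) (rule smooth_differentiable[OF test_smooth[OF mollifierD(1)[OF \<eta>]]])
    have "pd i (conv f (\<eta> n)) x = (LINT y|lebesgue. f y * pd i (\<eta> n) (x - y))"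
      by (simp add: pd_conv[OF fi(1) mollifierD(1)[OF \<eta>]] conv_def)
    also have "\<dots> = - (LINT y|lebesgue. f y * pd i (\<lambda>y. \<eta> n (x - y)) y)" by (simp add: pdr)
    also have "\<dots> = conv (G i) (\<eta> n) x"
      using weak_pdD(3)[OF wgradD(3)[OF f] t, of i] by (simp only: lebesgue_on_UNIV conv_def)
    finally show "pd i (conv f (\<eta> n)) x = conv (G i) (\<eta> n) x" .
  qed
  show "smooth (conv f (\<eta> n))" by (rule smooth_conv[OF fi(1) mollifierD(1)[OF \<eta>]])
  show "conv f (\<eta> n) \<in> L2 UNIV" "(\<lambda>n. L2_norm UNIV (\<lambda>x. conv f (\<eta> n) x - f x)) \<longlonglongrightarrow> 0"
    using mollify_L2[OF \<eta> fi(1) wgradD(1)[OF f]] by auto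
  show "pd i (conv f (\<eta> n)) \<in> L2 UNIV" "(\<lambda>n. L2_norm UNIV (\<lambda>x. pd i (conv f (\<eta> n)) x - G i x)) \<longlonglongrightarrow> 0"
    unfolding eq using mollify_L2[OF \<eta> fi(2) wgradD(2)[OF f]] by auto
qed

lemma L2_norm_tendsto_restrict:
  fixes f :: "nat \<Rightarrow> real^'d \<Rightarrow> real"
  assumes "(\<lambda>n. L2_norm UNIV (\<lambda>x. f n x - g x)) \<longlonglongrightarrow> 0" "\<And>n. f n \<in> L2 UNIV" "g \<in> L2 UNIV" "\<Omega> \<in> sets lebesgue"
  shows "(\<lambda>n. L2_norm \<Omega> (\<lambda>x. f n x - g x)) \<longlonglongrightarrow> 0"
  using assms(1) L2_norm_nonneg L2_restrict(2)[OF L2_diff[OF assms(2,3)] assms(4)] by (rule tendsto_0_le)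

text \<open>The mollified indicator function of a neighbourhood of \<open>K\<close>. It equals 1 even near \<open>K\<close>, whence its
  derivatives vanish on \<open>K\<close>.\<close>

lemma ex_cutoff:
  fixes K :: "(real^'d) set"
  assumes K: "compact K" "K \<subseteq> \<Omega>" and \<Omega>: "open \<Omega>"
  shows "\<exists>\<zeta>\<in>test_functions \<Omega>. \<forall>x\<in>K. \<zeta> x = 1 \<and> (\<forall>i. pd i \<zeta> x = 0)"
proof -
  obtain \<delta> where \<delta>: "\<delta> > 0" "(\<Union>x\<in>K. cball x \<delta>) \<subseteq> \<Omega>"
    using ex_compact_neighbourhood[OF K(1) \<Omega> K(2)] by blast
  obtain \<eta> :: "nat \<Rightarrow> real^'d \<Rightarrow> real" where \<eta>: "mollifier \<eta>" using ex_mollifier by blast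
  \<comment> \<open>three layers of width \<open>r\<close>: where \<open>\<zeta>\<close> is 1, where the indicator function is 1, and the support\<close>
  obtain n where n: "inverse (real (Suc n)) < \<delta>/3" using reals_Archimedean[of "\<delta>/3"] \<delta>(1) by auto
  define r where "r = inverse (real (Suc n))"
  have r: "0 < r" "3 * r \<le> \<delta>" using n by (auto simp: r_def)
  define K' where "K' = (\<Union>x\<in>K. cball x (2 * r))"
  define K'' where "K'' = (\<Union>x\<in>K'. cball x r)"
  have c: "compact K'" "compact K''" unfolding K'_def K''_def by (intro compact_neighbourhood K(1))+
  have sub: "K'' \<subseteq> \<Omega>"
  proof
    fix z assume "z \<in> K''"
    then obtain x y where "x \<in> K" "dist x y \<le> 2 * r" "dist y z \<le> r" by (auto simp: K''_def K'_def)
    then have "x \<in> K" "dist x z \<le> \<delta>" using dist_triangle[of x z y] r(2) by auto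
    then have "z \<in> (\<Union>x\<in>K. cball x \<delta>)" by (intro UN_I[of x]) auto
    with \<delta>(2) show "z \<in> \<Omega>" by (rule subsetD)
  qed
  have KL: "K' \<in> sets lebesgue" using c(1) by (rule compact_lebesgue)
  have si: "integrable lebesgue (indicat_real K')"
    using lmeasurable_compact[OF c(1)]
    by (auto simp: fmeasurable_def simp del: emeasure_completion intro!: integrable_real_indicator)
  define \<zeta> where "\<zeta> = conv (indicat_real K') (\<eta> n)"
  have sm: "smooth \<zeta>" unfolding \<zeta>_def by (rule smooth_conv[OF si mollifierD(1)[OF \<eta>]])
  have supp: "\<zeta> x = 0" if "x \<notin> K''" for x
    unfolding \<zeta>_def using that
    by (intro conv_zero_outside[where K=K' and r=r]) (auto simp: K''_def r_def intro: mollifierD(3)[OF \<eta>])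
  have one: "\<zeta> x = 1" if x: "x \<in> (\<Union>x\<in>K. ball x r)" for x
  proof -
    have "indicat_real K' y * \<eta> n (x - y) = \<eta> n (x - y)" for y
    proof (cases "y \<in> K'")
      case False
      have "x - y \<notin> cball 0 r"
      proof
        assume "x - y \<in> cball 0 r"
        then have "dist x y \<le> r" by (simp add: dist_norm norm_minus_commute)
        moreover obtain z where "z \<in> K" "dist z x < r" using x by auto
        ultimately have "z \<in> K" "dist z y \<le> 2 * r" using dist_triangle[of z y x] by auto
        then show False using False by (auto simp: K'_def)
      qed
      then show ?thesis using mollifierD(3)[OF \<eta>, of "x - y" n] by (simp add: r_def)
    qed simp
    then show ?thesis unfolding \<zeta>_def conv_def using mollifier_integral(1)[OF \<eta>] by (simp only:)
  qed
  have xin: "x \<in> (\<Union>x\<in>K. ball x r)" if "x \<in> K" for x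
    using that r(1) by (intro UN_I[of x]) auto
  have "pd i \<zeta> x = 0" if x: "x \<in> K" for i x
  proof -
    have "((\<lambda>_. 1) has_derivative (\<lambda>_. 0)) (at x)" by simp
    then have "(\<zeta> has_derivative (\<lambda>_. 0)) (at x)"
    proof (rule has_derivative_transform_within_open)
      show "open (\<Union>x\<in>K. ball x r)" by auto
      show "x \<in> (\<Union>x\<in>K. ball x r)" by (rule xin[OF x])
    qed (rule one[symmetric])
    from pd_eqI[OF this] show ?thesis .
  qed
  moreover have "\<zeta> x = 1" if "x \<in> K" for x by (rule one[OF xin[OF that]])
  moreover have "\<zeta> \<in> test_functions \<Omega>" by (rule test_functionI[OF sm c(2) sub supp])
  ultimately show ?thesis by blast
qed

text \<open>Near the support of a test function, elements of \<open>W\<^sup>1\<^sup>,\<^sup>2\<close> are limits of smooth functions; this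
  reduces identities tested against a test function to the smooth case.\<close>

lemma local_smooth_approx:
  fixes f :: "real^'d \<Rightarrow> real"
  assumes \<Omega>: "open \<Omega>" and f: "has_wgrad \<Omega> f G" and K: "compact K" "K \<subseteq> \<Omega>"
  shows "\<exists>F f' G'. (\<forall>n. smooth (F n)) \<and> (\<forall>n. F n \<in> L2 \<Omega> \<and> (\<forall>i. pd i (F n) \<in> L2 \<Omega>)) \<and> has_wgrad \<Omega> f' G' \<and>
      (\<forall>x\<in>K. f' x = f x \<and> (\<forall>i. G' i x = G i x)) \<and>
      (\<lambda>n. L2_norm \<Omega> (\<lambda>x. F n x - f' x)) \<longlonglongrightarrow> 0 \<and> (\<forall>i. (\<lambda>n. L2_norm \<Omega> (\<lambda>x. pd i (F n) x - G' i x)) \<longlonglongrightarrow> 0)"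
proof -
  note L = open_lebesgue[OF \<Omega>]
  obtain \<zeta> where \<zeta>: "\<zeta> \<in> test_functions \<Omega>" "\<forall>x\<in>K. \<zeta> x = 1 \<and> (\<forall>i. pd i \<zeta> x = 0)"
    using ex_cutoff[OF K \<Omega>] by blast
  obtain \<eta> :: "nat \<Rightarrow> real^'d \<Rightarrow> real" where \<eta>: "mollifier \<eta>" using ex_mollifier by blast
  define f' where "f' x = \<zeta> x * f x" for x
  define G' where "G' i x = \<zeta> x * G i x + f x * pd i \<zeta> x" for i x
  have w: "has_wgrad UNIV f' G'" "integrable lebesgue f'" "\<And>i. integrable lebesgue (G' i)"
    using wgrad_cutoff[OF L f \<zeta>(1)] unfolding f'_def[abs_def] G'_def[abs_def] by auto
  note M = mollify_wgrad[OF \<eta> w]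
  have "\<forall>x\<in>K. f' x = f x \<and> (\<forall>i. G' i x = G i x)" using \<zeta>(2) by (simp add: f'_def G'_def)
  moreover have "has_wgrad \<Omega> f' G'" by (rule wgrad_UNIV_restrict[OF L w(1)])
  moreover have "(\<lambda>n. L2_norm \<Omega> (\<lambda>x. conv f' (\<eta> n) x - f' x)) \<longlonglongrightarrow> 0"
    using M(4,2) wgradD(1)[OF w(1)] L by (rule L2_norm_tendsto_restrict)
  moreover have "(\<lambda>n. L2_norm \<Omega> (\<lambda>x. pd i (conv f' (\<eta> n)) x - G' i x)) \<longlonglongrightarrow> 0" for i
    using M(5,3) wgradD(2)[OF w(1)] L by (rule L2_norm_tendsto_restrict)
  moreover have "conv f' (\<eta> n) \<in> L2 \<Omega>" "pd i (conv f' (\<eta> n)) \<in> L2 \<Omega>" for n i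
    using M(2,3) L by (auto intro: L2_restrict(1))
  ultimately show ?thesis using M(1) by (intro exI[of _ "\<lambda>n. conv f' (\<eta> n)"] exI[of _ f'] exI[of _ G']) auto
qed

subsection \<open>Product and chain rule\<close>

text \<open>If \<open>f\<close> is replaced by smooth approximations \<open>F\<^sub>n\<close>, the product \<open>F\<^sub>n \<phi>\<close> is a test function for \<open>g\<close>. The
  resulting identity involves each of \<open>F\<^sub>n\<close> and \<open>\<nabla>F\<^sub>n\<close> linearly and passes to the limit.\<close>

lemma weak_pd_mult:
  fixes f g :: "real^'d \<Rightarrow> real"
  assumes \<Omega>: "open \<Omega>" and f: "has_wgrad \<Omega> f G" and g: "has_wgrad \<Omega> g H"
  shows "is_weak_pd \<Omega> i (\<lambda>x. f x * g x) (\<lambda>x. f x * H i x + g x * G i x)"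
  unfolding is_weak_pd_def
proof (intro conjI ballI)
  note L = open_lebesgue[OF \<Omega>]
  note fL = wgradD(1)[OF f] and GL = wgradD(2)[OF f] and gL = wgradD(1)[OF g] and HL = wgradD(2)[OF g]
  have i1: "integrable (lebesgue_on \<Omega>) (\<lambda>x. f x * g x)" "integrable (lebesgue_on \<Omega>) (\<lambda>x. f x * H i x + g x * G i x)"
    using fL GL gL HL by (auto intro!: L2_mult_integrable Bochner_Integration.integrable_add)
  show "locally_integrable \<Omega> (\<lambda>x. f x * g x)" "locally_integrable \<Omega> (\<lambda>x. f x * H i x + g x * G i x)"
    using i1 L by (auto intro: integrable_locally_integrable)
  fix \<phi> assume \<phi>: "\<phi> \<in> test_functions \<Omega>"
  obtain K where K: "compact K" "K \<subseteq> \<Omega>" "\<forall>x. x \<notin> K \<longrightarrow> \<phi> x = 0" using test_support[OF \<phi>] by blast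
  have z: "pd i \<phi> x = 0" if "x \<notin> K" for x
    using K(3) that by (intro pd_zero_outside[OF K(1)]) auto
  obtain F f' G' where F: "\<forall>n. smooth (F n)" "\<forall>n. F n \<in> L2 \<Omega> \<and> (\<forall>i. pd i (F n) \<in> L2 \<Omega>)" "has_wgrad \<Omega> f' G'"
      "\<forall>x\<in>K. f' x = f x \<and> (\<forall>i. G' i x = G i x)"
      "(\<lambda>n. L2_norm \<Omega> (\<lambda>x. F n x - f' x)) \<longlonglongrightarrow> 0" "\<forall>i. (\<lambda>n. L2_norm \<Omega> (\<lambda>x. pd i (F n) x - G' i x)) \<longlonglongrightarrow> 0"
    using local_smooth_approx[OF \<Omega> f K(1,2)] by blast
  have k: "(\<lambda>x. g x * pd i \<phi> x) \<in> L2 \<Omega>" "(\<lambda>x. g x * \<phi> x) \<in> L2 \<Omega>" "(\<lambda>x. H i x * \<phi> x) \<in> L2 \<Omega>"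
    using L2_mult_test[OF gL test_pd[OF \<phi>]] L2_mult_test[OF gL \<phi>] L2_mult_test[OF HL \<phi>] by auto
  have FL: "F n \<in> L2 \<Omega>" "pd i (F n) \<in> L2 \<Omega>" for n using F(2) by auto
  note f'L = wgradD(1)[OF F(3)] and G'L = wgradD(2)[OF F(3), of i]
  have id: "(LINT x|lebesgue_on \<Omega>. F n x * (g x * pd i \<phi> x)) =
     - ((LINT x|lebesgue_on \<Omega>. F n x * (H i x * \<phi> x)) + (LINT x|lebesgue_on \<Omega>. pd i (F n) x * (g x * \<phi> x)))" for n
  proof -
    have t: "(\<lambda>x. F n x * \<phi> x) \<in> test_functions \<Omega>" using F(1) \<phi> by (auto intro: test_mult)
    have pdm: "pd i (\<lambda>x. F n x * \<phi> x) x = F n x * pd i \<phi> x + \<phi> x * pd i (F n) x" for x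
      using F(1) smooth_differentiable test_smooth[OF \<phi>] by (intro pd_mult) blast+
    have "(LINT x|lebesgue_on \<Omega>. F n x * (g x * pd i \<phi> x)) + (LINT x|lebesgue_on \<Omega>. pd i (F n) x * (g x * \<phi> x))
       = (LINT x|lebesgue_on \<Omega>. F n x * (g x * pd i \<phi> x) + pd i (F n) x * (g x * \<phi> x))"
      using L2_mult_integrable[OF FL(1) k(1)] L2_mult_integrable[OF FL(2) k(2)] by simp
    also have "\<dots> = (LINT x|lebesgue_on \<Omega>. g x * pd i (\<lambda>x. F n x * \<phi> x) x)"
      unfolding pdm by (rule Bochner_Integration.integral_cong) (auto simp: algebra_simps)
    also have "\<dots> = - (LINT x|lebesgue_on \<Omega>. H i x * (F n x * \<phi> x))"
      by (rule weak_pdD(3)[OF wgradD(3)[OF g] t])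
    also have "(LINT x|lebesgue_on \<Omega>. H i x * (F n x * \<phi> x)) = (LINT x|lebesgue_on \<Omega>. F n x * (H i x * \<phi> x))"
      by (rule Bochner_Integration.integral_cong) (auto simp: algebra_simps)
    finally show ?thesis by linarith
  qed
  have lim1: "(\<lambda>n. LINT x|lebesgue_on \<Omega>. F n x * (g x * pd i \<phi> x)) \<longlonglongrightarrow> (LINT x|lebesgue_on \<Omega>. f' x * (g x * pd i \<phi> x))"
    using FL(1) f'L k(1) F(5) by (rule L2_tendsto_inner)
  have "(\<lambda>n. - ((LINT x|lebesgue_on \<Omega>. F n x * (H i x * \<phi> x)) + (LINT x|lebesgue_on \<Omega>. pd i (F n) x * (g x * \<phi> x))))
    \<longlonglongrightarrow> - ((LINT x|lebesgue_on \<Omega>. f' x * (H i x * \<phi> x)) + (LINT x|lebesgue_on \<Omega>. G' i x * (g x * \<phi> x)))"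
    by (intro tendsto_minus tendsto_add L2_tendsto_inner FL f'L G'L k F(5) F(6)[rule_format])
  from LIMSEQ_unique[OF lim1 this[folded id]]
  have e: "(LINT x|lebesgue_on \<Omega>. f' x * (g x * pd i \<phi> x))
    = - ((LINT x|lebesgue_on \<Omega>. f' x * (H i x * \<phi> x)) + (LINT x|lebesgue_on \<Omega>. G' i x * (g x * \<phi> x)))" .
  have "(LINT x|lebesgue_on \<Omega>. f x * g x * pd i \<phi> x) = (LINT x|lebesgue_on \<Omega>. f' x * (g x * pd i \<phi> x))"
  proof (rule Bochner_Integration.integral_cong)
    fix x show "f x * g x * pd i \<phi> x = f' x * (g x * pd i \<phi> x)" using F(4) z[of x] by (cases "x \<in> K") auto
  qed simp
  also have "\<dots> = - (LINT x|lebesgue_on \<Omega>. f' x * (H i x * \<phi> x) + G' i x * (g x * \<phi> x))"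
    unfolding e using L2_mult_integrable[OF f'L k(3)] L2_mult_integrable[OF G'L k(2)] by simp
  also have "(LINT x|lebesgue_on \<Omega>. f' x * (H i x * \<phi> x) + G' i x * (g x * \<phi> x))
    = (LINT x|lebesgue_on \<Omega>. (f x * H i x + g x * G i x) * \<phi> x)"
  proof (rule Bochner_Integration.integral_cong)
    fix x show "f' x * (H i x * \<phi> x) + G' i x * (g x * \<phi> x) = (f x * H i x + g x * G i x) * \<phi> x"
      using F(4) K(3) by (cases "x \<in> K") (auto simp: algebra_simps)
  qed simp
  finally show "(LINT x|lebesgue_on \<Omega>. f x * g x * pd i \<phi> x)
    = - (LINT x|lebesgue_on \<Omega>. (f x * H i x + g x * G i x) * \<phi> x)" .
qed

lemma wgrad_mult:
  assumes \<Omega>: "open \<Omega>" and f: "has_wgrad \<Omega> f G" and g: "has_wgrad \<Omega> g H"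
    and "(\<lambda>x. f x * g x) \<in> L2 \<Omega>" "\<And>i. (\<lambda>x. f x * H i x + g x * G i x) \<in> L2 \<Omega>"
  shows "has_wgrad \<Omega> (\<lambda>x. f x * g x) (\<lambda>i x. f x * H i x + g x * G i x)"
  unfolding has_wgrad_def using assms(4,5) weak_pd_mult[OF \<Omega> f g] by blast

text \<open>Outer functions in the chain rule. The bounded derivative makes compositions square integrable on sets of
  finite measure; its continuity is what the limit in the chain rule needs.\<close>

definition C1_bdd :: "real \<Rightarrow> (real \<Rightarrow> real) \<Rightarrow> (real \<Rightarrow> real) \<Rightarrow> bool" where
  "C1_bdd B p p' \<longleftrightarrow> (\<forall>s. (p has_real_derivative p' s) (at s)) \<and> continuous_on UNIV p' \<and> (\<forall>s. \<bar>p' s\<bar> \<le> B)"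

lemma C1_bddD:
  assumes "C1_bdd B p p'"
  shows "(p has_real_derivative p' s) (at s)" "continuous_on UNIV p'" "\<bar>p' s\<bar> \<le> B"
    "\<bar>p s - p t\<bar> \<le> B * \<bar>s - t\<bar>" "continuous_on UNIV p" "p \<in> borel_measurable borel" "p' \<in> borel_measurable borel"
proof -
  show 1: "(p has_real_derivative p' s) (at s)" "continuous_on UNIV p'" "\<bar>p' s\<bar> \<le> B" for s
    using assms by (auto simp: C1_bdd_def)
  show "\<bar>p s - p t\<bar> \<le> B * \<bar>s - t\<bar>"
    using field_differentiable_bound[of UNIV p p' B s t] 1 by auto
  show "continuous_on UNIV p"
    using 1(1) by (meson DERIV_isCont continuous_at_imp_continuous_on)
  then show "p \<in> borel_measurable borel" "p' \<in> borel_measurable borel"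
    using 1(2) by (auto intro: borel_measurable_continuous_onI)
qed

lemma L2_C1_bdd:
  assumes \<Omega>: "\<Omega> \<in> lmeasurable" and p: "C1_bdd B p p'" and f: "f \<in> L2 \<Omega>"
  shows "(\<lambda>x. p (f x)) \<in> L2 \<Omega>"
proof -
  have m: "(\<lambda>x. p (f x) - p 0) \<in> borel_measurable (lebesgue_on \<Omega>)"
    using measurable_compose[OF L2_meas[OF f] C1_bddD(6)[OF p]] by measurable
  have "(\<lambda>x. p (f x) - p 0) \<in> L2 \<Omega>"
    by (rule L2_bounded_by[OF f m, where B=B]) (use C1_bddD(4)[OF p, of _ 0] in auto)
  moreover have "(\<lambda>x. p 0) \<in> L2 \<Omega>" by (rule L2_of_bounded[OF \<Omega>, where B="\<bar>p 0\<bar>"]) auto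
  ultimately have "(\<lambda>x. (p (f x) - p 0) + p 0) \<in> L2 \<Omega>" by (rule L2_add)
  then show ?thesis by simp
qed

lemma L2_C1_bdd_deriv:
  assumes p: "C1_bdd B p p'" and f: "f \<in> L2 \<Omega>" and g: "g \<in> L2 \<Omega>"
  shows "(\<lambda>x. p' (f x) * g x) \<in> L2 \<Omega>"
  by (rule L2_bdd_mult[OF measurable_compose[OF L2_meas[OF f] C1_bddD(7)[OF p]] _ g, where B=B])
     (use C1_bddD(3)[OF p] in auto)

lemma L2_tendsto_C1_bdd:
  assumes \<Omega>: "\<Omega> \<in> lmeasurable" and p: "C1_bdd B p p'"
    and f: "\<And>n. f n \<in> L2 \<Omega>" "f' \<in> L2 \<Omega>" and lim: "(\<lambda>n. L2_norm \<Omega> (\<lambda>x. f n x - f' x)) \<longlonglongrightarrow> 0"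
  shows "(\<lambda>n. L2_norm \<Omega> (\<lambda>x. p (f n x) - p (f' x))) \<longlonglongrightarrow> 0"
proof (rule tendsto_0_le[OF _ L2_norm_nonneg])
  show "(\<lambda>n. B * L2_norm \<Omega> (\<lambda>x. f n x - f' x)) \<longlonglongrightarrow> 0"
    using tendsto_mult_left[OF lim, of B] by simp
  have B: "0 \<le> B" using C1_bddD(3)[OF p, of 0] by linarith
  show "L2_norm \<Omega> (\<lambda>x. p (f n x) - p (f' x)) \<le> B * L2_norm \<Omega> (\<lambda>x. f n x - f' x)" for n
    by (rule L2_norm_mono[OF L2_diff[OF f] L2_meas[OF L2_diff[OF L2_C1_bdd[OF \<Omega> p f(1)] L2_C1_bdd[OF \<Omega> p f(2)]]] _ B])
       (use C1_bddD(4)[OF p] in auto)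
qed

lemma L2_tendsto_C1_bdd_deriv:
  assumes p: "C1_bdd B p p'"
    and f: "\<And>n. f n \<in> L2 \<Omega>" "f' \<in> L2 \<Omega>" and ae: "AE x in lebesgue_on \<Omega>. (\<lambda>n. f n x) \<longlonglongrightarrow> f' x"
    and g: "\<And>n. g n \<in> L2 \<Omega>" "g' \<in> L2 \<Omega>" "(\<lambda>n. L2_norm \<Omega> (\<lambda>x. g n x - g' x)) \<longlonglongrightarrow> 0"
  shows "(\<lambda>n. L2_norm \<Omega> (\<lambda>x. p' (f n x) * g n x - p' (f' x) * g' x)) \<longlonglongrightarrow> 0"
proof (rule L2_tendsto_bdd_mult[OF g, where B=B])
  show "(\<lambda>x. p' (f n x)) \<in> borel_measurable (lebesgue_on \<Omega>)" "(\<lambda>x. p' (f' x)) \<in> borel_measurable (lebesgue_on \<Omega>)" for n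
    using measurable_compose[OF L2_meas[OF f(1)] C1_bddD(7)[OF p]] measurable_compose[OF L2_meas[OF f(2)] C1_bddD(7)[OF p]]
    by auto
  show "AE x in lebesgue_on \<Omega>. \<bar>p' (f n x)\<bar> \<le> B" for n using C1_bddD(3)[OF p] by auto
  have "isCont p' s" for s using C1_bddD(2)[OF p] by (simp add: continuous_on_eq_continuous_at)
  then show "AE x in lebesgue_on \<Omega>. (\<lambda>n. p' (f n x)) \<longlonglongrightarrow> p' (f' x)"
    using ae by (auto elim!: eventually_mono intro: isCont_tendsto_compose)
qed

text \<open>Local smooth approximations \<open>F\<^sub>n\<close> converge almost everywhere along a subsequence. Then \<open>p' \<circ> F\<^sub>n\<close>
  converges boundedly almost everywhere while \<open>\<nabla>F\<^sub>n\<close> converges in \<open>L\<^sup>2\<close>, so their products converge in \<open>L\<^sup>2\<close>.\<close>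

lemma wgrad_comp:
  fixes f :: "real^'d \<Rightarrow> real"
  assumes \<Omega>: "open \<Omega>" "\<Omega> \<in> lmeasurable" and f: "has_wgrad \<Omega> f G" and p: "C1_bdd B p p'"
  shows "has_wgrad \<Omega> (\<lambda>x. p (f x)) (\<lambda>i x. p' (f x) * G i x)"
  unfolding has_wgrad_def
proof (intro conjI allI)
  note L = open_lebesgue[OF \<Omega>(1)]
  show pf: "(\<lambda>x. p (f x)) \<in> L2 \<Omega>" by (rule L2_C1_bdd[OF \<Omega>(2) p wgradD(1)[OF f]])
  show pG: "(\<lambda>x. p' (f x) * G i x) \<in> L2 \<Omega>" for i by (rule L2_C1_bdd_deriv[OF p wgradD(1)[OF f] wgradD(2)[OF f]])
  fix i
  show "is_weak_pd \<Omega> i (\<lambda>x. p (f x)) (\<lambda>x. p' (f x) * G i x)"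
    unfolding is_weak_pd_def
  proof (intro conjI ballI)
    show "locally_integrable \<Omega> (\<lambda>x. p (f x))" "locally_integrable \<Omega> (\<lambda>x. p' (f x) * G i x)"
      using pf pG L by (auto intro: L2_locally_integrable)
    fix \<phi> assume \<phi>: "\<phi> \<in> test_functions \<Omega>"
    obtain K where K: "compact K" "K \<subseteq> \<Omega>" "\<forall>x. x \<notin> K \<longrightarrow> \<phi> x = 0" using test_support[OF \<phi>] by blast
    have z: "pd i \<phi> x = 0" if "x \<notin> K" for x
      using K(3) that by (intro pd_zero_outside[OF K(1)]) auto
    obtain F f' G' where F: "\<forall>n. smooth (F n)" "\<forall>n. F n \<in> L2 \<Omega> \<and> (\<forall>i. pd i (F n) \<in> L2 \<Omega>)" "has_wgrad \<Omega> f' G'"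
        "\<forall>x\<in>K. f' x = f x \<and> (\<forall>i. G' i x = G i x)"
        "(\<lambda>n. L2_norm \<Omega> (\<lambda>x. F n x - f' x)) \<longlonglongrightarrow> 0" "\<forall>i. (\<lambda>n. L2_norm \<Omega> (\<lambda>x. pd i (F n) x - G' i x)) \<longlonglongrightarrow> 0"
      using local_smooth_approx[OF \<Omega>(1) f K(1,2)] by blast
    have FL: "F n \<in> L2 \<Omega>" "pd i (F n) \<in> L2 \<Omega>" for n using F(2) by auto
    note f'L = wgradD(1)[OF F(3)] and G'L = wgradD(2)[OF F(3), of i]
    obtain r :: "nat \<Rightarrow> nat" where r: "strict_mono r" "AE x in lebesgue_on \<Omega>. (\<lambda>n. F (r n) x) \<longlonglongrightarrow> f' x"
      using L2_AE_subseq[OF FL(1) f'L F(5)] by blast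
    have w: "is_weak_pd \<Omega> i (\<lambda>x. p (F n x)) (\<lambda>x. p' (F n x) * pd i (F n) x)" for n
    proof -
      have d: "F n differentiable (at x)" for x using F(1) smooth_differentiable by blast
      have e: "pd i (\<lambda>x. p (F n x)) = (\<lambda>x. p' (F n x) * pd i (F n) x)"
        using pd_comp[where p=p and p'=p' and f="F n", OF C1_bddD(1)[OF p] d] by blast
      have "is_weak_pd \<Omega> i (\<lambda>x. p (F n x)) (pd i (\<lambda>x. p (F n x)))"
      proof (rule weak_pd_C1[OF L])
        show "(\<lambda>x. p (F n x)) differentiable (at x)" for x
          by (rule differentiable_comp[where p=p and p'=p' and f="F n", OF C1_bddD(1)[OF p] d])
        show "continuous_on UNIV (pd i (\<lambda>x. p (F n x)))"
          unfolding e using F(1)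
          by (intro continuous_intros continuous_on_compose2[OF C1_bddD(2)[OF p]] smooth_continuous smooth_pd) auto
      qed
      then show ?thesis unfolding e .
    qed
    have lim1: "(\<lambda>n. L2_norm \<Omega> (\<lambda>x. p (F (r n) x) - p (f' x))) \<longlonglongrightarrow> 0"
      using LIMSEQ_subseq_LIMSEQ[OF L2_tendsto_C1_bdd[OF \<Omega>(2) p FL(1) f'L F(5)] r(1)] by (simp add: comp_def)
    have "(\<lambda>n. L2_norm \<Omega> (\<lambda>x. pd i (F (r n)) x - G' i x)) \<longlonglongrightarrow> 0"
      using LIMSEQ_subseq_LIMSEQ[OF F(6)[rule_format] r(1)] by (simp add: comp_def)
    then have lim2: "(\<lambda>n. L2_norm \<Omega> (\<lambda>x. p' (F (r n) x) * pd i (F (r n)) x - p' (f' x) * G' i x)) \<longlonglongrightarrow> 0"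
      by (intro L2_tendsto_C1_bdd_deriv[OF p FL(1) f'L r(2) FL(2) G'L])
    have "is_weak_pd \<Omega> i (\<lambda>x. p (f' x)) (\<lambda>x. p' (f' x) * G' i x)"
      by (rule weak_pd_closed[OF L L2_C1_bdd[OF \<Omega>(2) p FL(1)] L2_C1_bdd[OF \<Omega>(2) p f'L]
            L2_C1_bdd_deriv[OF p FL] L2_C1_bdd_deriv[OF p f'L G'L] lim1 lim2 w])
    from weak_pdD(3)[OF this \<phi>]
    have e: "(LINT x|lebesgue_on \<Omega>. p (f' x) * pd i \<phi> x) = - (LINT x|lebesgue_on \<Omega>. p' (f' x) * G' i x * \<phi> x)" .
    have "(LINT x|lebesgue_on \<Omega>. p (f x) * pd i \<phi> x) = (LINT x|lebesgue_on \<Omega>. p (f' x) * pd i \<phi> x)"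
    proof (rule Bochner_Integration.integral_cong)
      fix x show "p (f x) * pd i \<phi> x = p (f' x) * pd i \<phi> x" using F(4) z[of x] by (cases "x \<in> K") auto
    qed simp
    also have "\<dots> = - (LINT x|lebesgue_on \<Omega>. p' (f x) * G i x * \<phi> x)"
      unfolding e
    proof (rule arg_cong[where f=uminus], rule Bochner_Integration.integral_cong)
      fix x show "p' (f' x) * G' i x * \<phi> x = p' (f x) * G i x * \<phi> x" using F(4) K(3) by (cases "x \<in> K") auto
    qed simp
    finally show "(LINT x|lebesgue_on \<Omega>. p (f x) * pd i \<phi> x) = - (LINT x|lebesgue_on \<Omega>. p' (f x) * G i x * \<phi> x)" .
  qed
qed

section \<open>Functions vanishing on the boundary\<close>

lemma W12_norm_tendsto_iff:
  assumes \<Omega>: "open \<Omega>" and f: "\<And>n. has_wgrad \<Omega> (f n) (G n)"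
  shows "(\<lambda>n. W12_norm \<Omega> (f n)) \<longlonglongrightarrow> 0 \<longleftrightarrow>
    (\<lambda>n. L2_norm \<Omega> (f n)) \<longlonglongrightarrow> 0 \<and> (\<forall>i. (\<lambda>n. L2_norm \<Omega> (G n i)) \<longlonglongrightarrow> 0)"
proof safe
  assume *: "(\<lambda>n. W12_norm \<Omega> (f n)) \<longlonglongrightarrow> 0"
  show "(\<lambda>n. L2_norm \<Omega> (f n)) \<longlonglongrightarrow> 0"
    using * L2_norm_nonneg L2_norm_le_W12_norm(1)[OF \<Omega> f] by (rule tendsto_0_le)
  show "(\<lambda>n. L2_norm \<Omega> (G n i)) \<longlonglongrightarrow> 0" for i
    using * L2_norm_nonneg L2_norm_le_W12_norm(2)[OF \<Omega> f] by (rule tendsto_0_le)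
next
  assume *: "(\<lambda>n. L2_norm \<Omega> (f n)) \<longlonglongrightarrow> 0" "\<forall>i. (\<lambda>n. L2_norm \<Omega> (G n i)) \<longlonglongrightarrow> 0"
  have "(\<lambda>n. sqrt ((L2_norm \<Omega> (f n))\<^sup>2 + (\<Sum>i\<in>UNIV. (L2_norm \<Omega> (G n i))\<^sup>2)))
     \<longlonglongrightarrow> sqrt (0\<^sup>2 + (\<Sum>i\<in>(UNIV::'a set). 0\<^sup>2))"
    by (intro tendsto_real_sqrt tendsto_add tendsto_power tendsto_sum *(1) *(2)[rule_format])
  then show "(\<lambda>n. W12_norm \<Omega> (f n)) \<longlonglongrightarrow> 0" by (simp add: W12_norm_eq[OF \<Omega> f])
qed

text \<open>Convergence in \<open>W\<^sup>1\<^sup>,\<^sup>2\<close> may be checked with any representative of the gradient.\<close>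

lemma W12_0_iff:
  assumes \<Omega>: "open \<Omega>" and f: "has_wgrad \<Omega> f G"
  shows "f \<in> W12_0 \<Omega> \<longleftrightarrow> (\<exists>\<phi>. (\<forall>n::nat. \<phi> n \<in> test_functions \<Omega>) \<and>
      (\<lambda>n. L2_norm \<Omega> (\<lambda>x. f x - \<phi> n x)) \<longlonglongrightarrow> 0 \<and> (\<forall>i. (\<lambda>n. L2_norm \<Omega> (\<lambda>x. G i x - pd i (\<phi> n) x)) \<longlonglongrightarrow> 0))"
proof -
  have "(\<lambda>n. W12_norm \<Omega> (\<lambda>x. f x - \<phi> n x)) \<longlonglongrightarrow> 0 \<longleftrightarrow>
      (\<lambda>n. L2_norm \<Omega> (\<lambda>x. f x - \<phi> n x)) \<longlonglongrightarrow> 0 \<and> (\<forall>i. (\<lambda>n. L2_norm \<Omega> (\<lambda>x. G i x - pd i (\<phi> n) x)) \<longlonglongrightarrow> 0)"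
    if "\<forall>n::nat. \<phi> n \<in> test_functions \<Omega>" for \<phi>
    using that by (intro W12_norm_tendsto_iff[OF \<Omega>] wgrad_diff[OF open_lebesgue[OF \<Omega>] f]
        wgrad_test[OF _ open_lebesgue[OF \<Omega>]]) blast
  moreover have "f \<in> W12 \<Omega>" using f W12_iff by blast
  ultimately show ?thesis unfolding W12_0_def by blast
qed

lemma W12_0_W12: "f \<in> W12_0 \<Omega> \<Longrightarrow> f \<in> W12 \<Omega>"
  by (simp add: W12_0_def)

lemma W12_0_approx:
  assumes "open \<Omega>" "has_wgrad \<Omega> f G" "f \<in> W12_0 \<Omega>"
  shows "\<exists>\<phi>. (\<forall>n::nat. \<phi> n \<in> test_functions \<Omega>) \<and> (\<forall>n. \<phi> n \<in> L2 \<Omega> \<and> (\<forall>i. pd i (\<phi> n) \<in> L2 \<Omega>)) \<and>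
      (\<lambda>n. L2_norm \<Omega> (\<lambda>x. \<phi> n x - f x)) \<longlonglongrightarrow> 0 \<and> (\<forall>i. (\<lambda>n. L2_norm \<Omega> (\<lambda>x. pd i (\<phi> n) x - G i x)) \<longlonglongrightarrow> 0)"
proof -
  obtain \<phi> where \<phi>: "\<forall>n::nat. \<phi> n \<in> test_functions \<Omega>" "(\<lambda>n. L2_norm \<Omega> (\<lambda>x. f x - \<phi> n x)) \<longlonglongrightarrow> 0"
     "\<forall>i. (\<lambda>n. L2_norm \<Omega> (\<lambda>x. G i x - pd i (\<phi> n) x)) \<longlonglongrightarrow> 0"
    using assms(3) unfolding W12_0_iff[OF assms(1,2)] by blast
  have "\<forall>n. \<phi> n \<in> L2 \<Omega> \<and> (\<forall>i. pd i (\<phi> n) \<in> L2 \<Omega>)"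
    using \<phi>(1) test_pd test_L2[OF _ open_lebesgue[OF assms(1)]] by blast
  moreover have "(\<lambda>n. L2_norm \<Omega> (\<lambda>x. \<phi> n x - f x)) \<longlonglongrightarrow> 0"
    using \<phi>(2) by (subst L2_norm_minus_commute)
  moreover have "(\<lambda>n. L2_norm \<Omega> (\<lambda>x. pd i (\<phi> n) x - G i x)) \<longlonglongrightarrow> 0" for i
    using \<phi>(3) by (subst L2_norm_minus_commute) blast
  ultimately show ?thesis using \<phi>(1) by blast
qed

lemma W12_0_cong_AE:
  assumes \<Omega>: "open \<Omega>" and f: "f \<in> W12_0 \<Omega>" and ae: "AE x in lebesgue_on \<Omega>. f x = f' x"
  shows "f' \<in> W12_0 \<Omega>"
proof -
  obtain G where G: "has_wgrad \<Omega> f G" using W12_0_W12[OF f] unfolding W12_iff by blast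
  have G': "has_wgrad \<Omega> f' G" by (rule wgrad_cong_AE[OF \<Omega> G ae]) auto
  obtain \<phi> where \<phi>: "\<forall>n::nat. \<phi> n \<in> test_functions \<Omega>" "(\<lambda>n. L2_norm \<Omega> (\<lambda>x. f x - \<phi> n x)) \<longlonglongrightarrow> 0"
     "\<forall>i. (\<lambda>n. L2_norm \<Omega> (\<lambda>x. G i x - pd i (\<phi> n) x)) \<longlonglongrightarrow> 0"
    using f unfolding W12_0_iff[OF \<Omega> G] by blast
  have "L2_norm \<Omega> (\<lambda>x. f' x - \<phi> n x) = L2_norm \<Omega> (\<lambda>x. f x - \<phi> n x)" for n
    using \<phi>(1) ae by (intro L2_norm_cong_AE[OF open_lebesgue[OF \<Omega>] L2_diff[OF wgradD(1)[OF G] test_L2[OF _ open_lebesgue[OF \<Omega>]]]])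
      (auto elim!: eventually_mono)
  with \<phi> show ?thesis unfolding W12_0_iff[OF \<Omega> G'] by auto
qed

text \<open>Picking for every \<open>h\<^sub>n\<close> a test function at distance less than \<open>1 / (n + 1)\<close> gives a sequence of test
  functions with the same limit.\<close>

lemma W12_0_closed:
  assumes \<Omega>: "open \<Omega>" and f: "has_wgrad \<Omega> f G" and fn: "\<And>n::nat. has_wgrad \<Omega> (h n) (H n)" "\<And>n. h n \<in> W12_0 \<Omega>"
    and lim: "(\<lambda>n. L2_norm \<Omega> (\<lambda>x. h n x - f x)) \<longlonglongrightarrow> 0" "\<And>i. (\<lambda>n. L2_norm \<Omega> (\<lambda>x. H n i x - G i x)) \<longlonglongrightarrow> 0"
  shows "f \<in> W12_0 \<Omega>"
proof -
  note L = open_lebesgue[OF \<Omega>]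
  have "\<exists>\<phi>\<in>test_functions \<Omega>. W12_norm \<Omega> (\<lambda>x. h n x - \<phi> x) < inverse (real (Suc n))" for n
  proof -
    obtain \<phi> where \<phi>: "\<forall>m::nat. \<phi> m \<in> test_functions \<Omega>" "(\<lambda>m. W12_norm \<Omega> (\<lambda>x. h n x - \<phi> m x)) \<longlonglongrightarrow> 0"
      using fn(2)[of n] unfolding W12_0_def by blast
    have "\<forall>\<^sub>F m in sequentially. W12_norm \<Omega> (\<lambda>x. h n x - \<phi> m x) < inverse (real (Suc n))"
      by (rule order_tendstoD(2)[OF \<phi>(2)]) simp
    then obtain m where "W12_norm \<Omega> (\<lambda>x. h n x - \<phi> m x) < inverse (real (Suc n))"
      by (auto simp: eventually_sequentially)
    with \<phi>(1) show ?thesis by blast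
  qed
  then have "\<exists>\<phi>. \<forall>n. \<phi> n \<in> test_functions \<Omega> \<and> W12_norm \<Omega> (\<lambda>x. h n x - \<phi> n x) < inverse (real (Suc n))"
    by (intro choice) blast
  then obtain \<phi> where \<phi>: "\<forall>n. \<phi> n \<in> test_functions \<Omega>"
     "\<forall>n. W12_norm \<Omega> (\<lambda>x. h n x - \<phi> n x) < inverse (real (Suc n))" by blast
  have t: "\<phi> n \<in> L2 \<Omega>" "pd i (\<phi> n) \<in> L2 \<Omega>" for n i
    using \<phi>(1) test_pd test_L2[OF _ L] by blast+
  have d: "has_wgrad \<Omega> (\<lambda>x. h n x - \<phi> n x) (\<lambda>i x. H n i x - pd i (\<phi> n) x)" for n
    using \<phi>(1) by (intro wgrad_diff[OF L fn(1)] wgrad_test[OF _ L]) blast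
  have "(\<lambda>n. W12_norm \<Omega> (\<lambda>x. h n x - \<phi> n x)) \<longlonglongrightarrow> 0"
    by (rule tendsto_0_le[OF LIMSEQ_inverse_real_of_nat W12_norm_nonneg]) (use \<phi>(2) less_imp_le in blast)
  then have 1: "(\<lambda>n. L2_norm \<Omega> (\<lambda>x. h n x - \<phi> n x)) \<longlonglongrightarrow> 0" "(\<lambda>n. L2_norm \<Omega> (\<lambda>x. H n i x - pd i (\<phi> n) x)) \<longlonglongrightarrow> 0" for i
    unfolding W12_norm_tendsto_iff[OF \<Omega> d] by auto
  have "(\<lambda>n. L2_norm \<Omega> (\<lambda>x. f x - \<phi> n x)) \<longlonglongrightarrow> 0"
  proof (rule tendsto_0_le[OF _ L2_norm_nonneg])
    show "(\<lambda>n. L2_norm \<Omega> (\<lambda>x. f x - h n x) + L2_norm \<Omega> (\<lambda>x. h n x - \<phi> n x)) \<longlonglongrightarrow> 0"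
      using tendsto_add[OF lim(1) 1(1)] by (simp add: L2_norm_minus_commute[of \<Omega> f])
    show "L2_norm \<Omega> (\<lambda>x. f x - \<phi> n x) \<le> L2_norm \<Omega> (\<lambda>x. f x - h n x) + L2_norm \<Omega> (\<lambda>x. h n x - \<phi> n x)" for n
      by (rule L2_norm_triangle_diff[OF wgradD(1)[OF f] wgradD(1)[OF fn(1)] t(1)])
  qed
  moreover have "(\<lambda>n. L2_norm \<Omega> (\<lambda>x. G i x - pd i (\<phi> n) x)) \<longlonglongrightarrow> 0" for i
  proof (rule tendsto_0_le[OF _ L2_norm_nonneg])
    show "(\<lambda>n. L2_norm \<Omega> (\<lambda>x. G i x - H n i x) + L2_norm \<Omega> (\<lambda>x. H n i x - pd i (\<phi> n) x)) \<longlonglongrightarrow> 0"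
      using tendsto_add[OF lim(2) 1(2)] by (simp add: L2_norm_minus_commute[of \<Omega> "G i"])
    show "L2_norm \<Omega> (\<lambda>x. G i x - pd i (\<phi> n) x) \<le> L2_norm \<Omega> (\<lambda>x. G i x - H n i x) + L2_norm \<Omega> (\<lambda>x. H n i x - pd i (\<phi> n) x)" for n
      by (rule L2_norm_triangle_diff[OF wgradD(2)[OF f] wgradD(2)[OF fn(1)] t(2)])
  qed
  ultimately show ?thesis unfolding W12_0_iff[OF \<Omega> f] using \<phi>(1) by blast
qed

lemma test_add:
  assumes "\<phi> \<in> test_functions \<Omega>" "\<psi> \<in> test_functions \<Omega>"
  shows "(\<lambda>x. \<phi> x + \<psi> x) \<in> test_functions \<Omega>"
proof -
  obtain K where K: "compact K" "K \<subseteq> \<Omega>" "\<forall>x. x \<notin> K \<longrightarrow> \<phi> x = 0" using test_support[OF assms(1)] by blast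
  obtain K' where K': "compact K'" "K' \<subseteq> \<Omega>" "\<forall>x. x \<notin> K' \<longrightarrow> \<psi> x = 0" using test_support[OF assms(2)] by blast
  show ?thesis
    by (rule test_functionI[OF smooth_add[OF assms[THEN test_smooth]], of "K \<union> K'"]) (use K K' in auto)
qed

lemma W12_0_add:
  assumes \<Omega>: "open \<Omega>" and "f \<in> W12_0 \<Omega>" "g \<in> W12_0 \<Omega>"
  shows "(\<lambda>x. f x + g x) \<in> W12_0 \<Omega>"
proof -
  note L = open_lebesgue[OF \<Omega>]
  note f = W12_has_wgrad[OF \<Omega> W12_0_W12[OF assms(2)]] and g = W12_has_wgrad[OF \<Omega> W12_0_W12[OF assms(3)]]
  obtain \<phi> where \<phi>: "\<forall>n::nat. \<phi> n \<in> test_functions \<Omega>" "\<forall>n. \<phi> n \<in> L2 \<Omega> \<and> (\<forall>i. pd i (\<phi> n) \<in> L2 \<Omega>)"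
     "(\<lambda>n. L2_norm \<Omega> (\<lambda>x. \<phi> n x - f x)) \<longlonglongrightarrow> 0" "\<forall>i. (\<lambda>n. L2_norm \<Omega> (\<lambda>x. pd i (\<phi> n) x - weak_pd \<Omega> i f x)) \<longlonglongrightarrow> 0"
    using W12_0_approx[OF \<Omega> f assms(2)] by blast
  obtain \<psi> where \<psi>: "\<forall>n::nat. \<psi> n \<in> test_functions \<Omega>" "\<forall>n. \<psi> n \<in> L2 \<Omega> \<and> (\<forall>i. pd i (\<psi> n) \<in> L2 \<Omega>)"
     "(\<lambda>n. L2_norm \<Omega> (\<lambda>x. \<psi> n x - g x)) \<longlonglongrightarrow> 0" "\<forall>i. (\<lambda>n. L2_norm \<Omega> (\<lambda>x. pd i (\<psi> n) x - weak_pd \<Omega> i g x)) \<longlonglongrightarrow> 0"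
    using W12_0_approx[OF \<Omega> g assms(3)] by blast
  have pa: "pd i (\<lambda>x. \<phi> n x + \<psi> n x) = (\<lambda>x. pd i (\<phi> n) x + pd i (\<psi> n) x)" for n i
    using \<phi>(1) \<psi>(1) test_smooth smooth_differentiable by (intro ext pd_add) blast+
  have 1: "(\<lambda>n. L2_norm \<Omega> (\<lambda>x. (\<phi> n x + \<psi> n x) - (f x + g x))) \<longlonglongrightarrow> 0"
    using \<phi> \<psi> wgradD(1)[OF f] wgradD(1)[OF g] by (intro L2_tendsto_add) auto
  have 2: "(\<lambda>n. L2_norm \<Omega> (\<lambda>x. (pd i (\<phi> n) x + pd i (\<psi> n) x) - (weak_pd \<Omega> i f x + weak_pd \<Omega> i g x))) \<longlonglongrightarrow> 0" for i
    using \<phi> \<psi> wgradD(2)[OF f] wgradD(2)[OF g] by (intro L2_tendsto_add) auto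
  have "\<forall>n. (\<lambda>x. \<phi> n x + \<psi> n x) \<in> test_functions \<Omega>" using \<phi>(1) \<psi>(1) by (auto intro: test_add)
  then show ?thesis
    unfolding W12_0_iff[OF \<Omega> wgrad_add[OF L f g]]
    using 1 2 by (intro exI[of _ "\<lambda>n x. \<phi> n x + \<psi> n x"])
      (simp add: pa L2_norm_minus_commute[of \<Omega> "\<lambda>x. f x + g x"] L2_norm_minus_commute[of \<Omega> "\<lambda>x. weak_pd \<Omega> _ f x + weak_pd \<Omega> _ g x"])
qed

text \<open>The mollifications vanish outside a slightly larger compact set, hence are test functions on \<open>\<Omega>\<close> as
  soon as the radius of the mollifier is small.\<close>

lemma W12_0_compact_support:
  fixes f :: "real^'d \<Rightarrow> real"
  assumes \<Omega>: "open \<Omega>" and f: "has_wgrad \<Omega> f G" and K: "compact K" "K \<subseteq> \<Omega>"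
    and z: "\<And>x. x \<in> \<Omega> \<Longrightarrow> x \<notin> K \<Longrightarrow> f x = 0"
  shows "f \<in> W12_0 \<Omega>"
proof -
  note L = open_lebesgue[OF \<Omega>]
  obtain \<zeta> where \<zeta>: "\<zeta> \<in> test_functions \<Omega>" "\<forall>x\<in>K. \<zeta> x = 1 \<and> (\<forall>i. pd i \<zeta> x = 0)"
    using ex_cutoff[OF K \<Omega>] by blast
  have \<zeta>0: "\<zeta> x = 0" if "x \<notin> \<Omega>" for x using test_support[OF \<zeta>(1)] that by blast
  obtain \<eta> :: "nat \<Rightarrow> real^'d \<Rightarrow> real" where \<eta>: "mollifier \<eta>" using ex_mollifier by blast
  define f' where "f' x = \<zeta> x * f x" for x
  define G' where "G' i x = \<zeta> x * G i x + f x * pd i \<zeta> x" for i x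
  have w: "has_wgrad UNIV f' G'" "integrable lebesgue f'" "\<And>i. integrable lebesgue (G' i)"
    using wgrad_cutoff[OF L f \<zeta>(1)] unfolding f'_def[abs_def] G'_def[abs_def] by auto
  note M = mollify_wgrad[OF \<eta> w]
  have f'0: "f' y = 0" if "y \<notin> K" for y using z \<zeta>0 that by (cases "y \<in> \<Omega>") (auto simp: f'_def)
  have f'f: "f' x = f x" if "x \<in> \<Omega>" for x using z[OF that] \<zeta>(2) by (cases "x \<in> K") (auto simp: f'_def)
  obtain \<delta> where \<delta>: "\<delta> > 0" "(\<Union>x\<in>K. cball x \<delta>) \<subseteq> \<Omega>"
    using ex_compact_neighbourhood[OF K(1) \<Omega> K(2)] by blast
  define K' where "K' = (\<Union>x\<in>K. cball x \<delta>)"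
  have K': "compact K'" "K' \<subseteq> \<Omega>" using compact_neighbourhood[OF K(1)] \<delta>(2) by (auto simp: K'_def)
  obtain N where N: "inverse (real (Suc N)) < \<delta>" using reals_Archimedean[OF \<delta>(1)] by auto
  define \<phi> where "\<phi> n = conv f' (\<eta> (n + N))" for n
  have supp: "\<phi> n x = 0" if "x \<notin> K'" for n x
    unfolding \<phi>_def
  proof (rule conv_zero_outside[OF f'0 mollifierD(3)[OF \<eta>]])
    have "inverse (real (Suc (n + N))) \<le> inverse (real (Suc N))" by (simp add: field_simps)
    with N have "inverse (real (Suc (n + N))) \<le> \<delta>" by linarith
    then have "(\<Union>y\<in>K. cball y (inverse (Suc (n + N)))) \<subseteq> K'" unfolding K'_def by (auto intro: order_trans)
    then show "x \<notin> (\<Union>y\<in>K. cball y (inverse (Suc (n + N))))" using that by blast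
  qed
  have test: "\<phi> n \<in> test_functions \<Omega>" for n
    unfolding \<phi>_def by (rule test_functionI[OF M(1) K' supp[unfolded \<phi>_def]])
  have l1: "(\<lambda>n. L2_norm \<Omega> (\<lambda>x. \<phi> n x - f' x)) \<longlonglongrightarrow> 0"
    using LIMSEQ_ignore_initial_segment[OF L2_norm_tendsto_restrict[OF M(4,2) wgradD(1)[OF w(1)] L], of N]
    unfolding \<phi>_def .
  have l2: "(\<lambda>n. L2_norm \<Omega> (\<lambda>x. pd i (\<phi> n) x - G' i x)) \<longlonglongrightarrow> 0" for i
    using LIMSEQ_ignore_initial_segment[OF L2_norm_tendsto_restrict[OF M(5,3) wgradD(2)[OF w(1)] L], of i N]
    unfolding \<phi>_def .
  have "f' \<in> W12_0 \<Omega>"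
    unfolding W12_0_iff[OF \<Omega> wgrad_UNIV_restrict[OF L w(1)]]
    using test l1 l2 by (intro exI[of _ \<phi>]) (simp add: L2_norm_minus_commute[of \<Omega> f'] L2_norm_minus_commute[of \<Omega> "G' _"])
  then show ?thesis by (rule W12_0_cong_AE[OF \<Omega>]) (auto intro!: AE_I2 f'f)
qed

lemma test_W12_0: "open \<Omega> \<Longrightarrow> \<phi> \<in> test_functions \<Omega> \<Longrightarrow> \<phi> \<in> W12_0 \<Omega>"
  using test_support[of \<phi> \<Omega>] W12_0_compact_support[OF _ wgrad_test[OF _ open_lebesgue]] by metis

lemma L2_tendsto_const_mult:
  assumes "\<And>n. f n \<in> L2 \<Omega>" "f' \<in> L2 \<Omega>" "(\<lambda>n. L2_norm \<Omega> (\<lambda>x. f n x - f' x)) \<longlonglongrightarrow> 0"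
    "b \<in> borel_measurable (lebesgue_on \<Omega>)" "AE x in lebesgue_on \<Omega>. \<bar>b x\<bar> \<le> B"
  shows "(\<lambda>n. L2_norm \<Omega> (\<lambda>x. b x * f n x - b x * f' x)) \<longlonglongrightarrow> 0"
  using assms by (intro L2_tendsto_bdd_mult[where B=B]) auto

lemma wgrad_mult_bounded:
  assumes \<Omega>: "open \<Omega>" and f: "has_wgrad \<Omega> f G" and g: "has_wgrad \<Omega> g H"
    and "AE x in lebesgue_on \<Omega>. \<bar>f x\<bar> \<le> B" "AE x in lebesgue_on \<Omega>. \<bar>g x\<bar> \<le> B'"
  shows "has_wgrad \<Omega> (\<lambda>x. f x * g x) (\<lambda>i x. f x * H i x + g x * G i x)"
  by (rule wgrad_mult[OF \<Omega> f g])
     (intro L2_add L2_bdd_mult[OF L2_meas[OF wgradD(1)[OF f]] assms(4)] L2_bdd_mult[OF L2_meas[OF wgradD(1)[OF g]] assms(5)]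
       wgradD(1)[OF f] wgradD(2)[OF f] wgradD(1)[OF g] wgradD(2)[OF g])+

lemma wgrad_mult_W1inf:
  assumes \<Omega>: "open \<Omega>" and f: "has_wgrad \<Omega> f G" and r: "has_wgrad \<Omega> r R"
    and b: "AE x in lebesgue_on \<Omega>. \<bar>r x\<bar> \<le> B" "\<And>i. AE x in lebesgue_on \<Omega>. \<bar>R i x\<bar> \<le> B'"
  shows "has_wgrad \<Omega> (\<lambda>x. r x * f x) (\<lambda>i x. r x * G i x + f x * R i x)"
proof (rule wgrad_mult[OF \<Omega> r f])
  show "(\<lambda>x. r x * f x) \<in> L2 \<Omega>" by (rule L2_bdd_mult[OF L2_meas[OF wgradD(1)[OF r]] b(1) wgradD(1)[OF f]])
  have 1: "(\<lambda>x. r x * G i x) \<in> L2 \<Omega>" for i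
    by (rule L2_bdd_mult[OF L2_meas[OF wgradD(1)[OF r]] b(1) wgradD(2)[OF f]])
  have 2: "(\<lambda>x. R i x * f x) \<in> L2 \<Omega>" for i
    by (rule L2_bdd_mult[OF L2_meas[OF wgradD(2)[OF r]] b(2) wgradD(1)[OF f]])
  show "(\<lambda>x. r x * G i x + f x * R i x) \<in> L2 \<Omega>" for i
    using L2_add[OF 1[of i] 2[of i]] by (simp add: mult.commute)
qed

lemma wgrad_mult_test:
  assumes \<Omega>: "open \<Omega>" and f: "has_wgrad \<Omega> f G" and \<phi>: "\<phi> \<in> test_functions \<Omega>"
  shows "has_wgrad \<Omega> (\<lambda>x. f x * \<phi> x) (\<lambda>i x. f x * pd i \<phi> x + \<phi> x * G i x)" "(\<lambda>x. f x * \<phi> x) \<in> W12_0 \<Omega>"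
proof -
  show *: "has_wgrad \<Omega> (\<lambda>x. f x * \<phi> x) (\<lambda>i x. f x * pd i \<phi> x + \<phi> x * G i x)"
  proof (rule wgrad_mult[OF \<Omega> f wgrad_test[OF \<phi> open_lebesgue[OF \<Omega>]]])
    show "(\<lambda>x. f x * \<phi> x) \<in> L2 \<Omega>" by (rule L2_mult_test[OF wgradD(1)[OF f] \<phi>])
    show "(\<lambda>x. f x * pd i \<phi> x + \<phi> x * G i x) \<in> L2 \<Omega>" for i
      using L2_add[OF L2_mult_test[OF wgradD(1)[OF f] test_pd[OF \<phi>], of i] L2_mult_test[OF wgradD(2)[OF f] \<phi>, of i]]
      by (simp add: mult.commute)
  qed
  obtain K where K: "compact K" "K \<subseteq> \<Omega>" "\<forall>x. x \<notin> K \<longrightarrow> \<phi> x = 0" using test_support[OF \<phi>] by blast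
  show "(\<lambda>x. f x * \<phi> x) \<in> W12_0 \<Omega>"
    by (rule W12_0_compact_support[OF \<Omega> * K(1,2)]) (simp add: K(3))
qed

text \<open>Multiplication by \<open>r\<close> is continuous on \<open>W\<^sup>1\<^sup>,\<^sup>2\<close> and maps test functions to functions with compact support.\<close>

lemma W12_0_mult_W1inf:
  assumes \<Omega>: "open \<Omega>" and v: "has_wgrad \<Omega> v V" "v \<in> W12_0 \<Omega>" and r: "has_wgrad \<Omega> r R"
    and b: "AE x in lebesgue_on \<Omega>. \<bar>r x\<bar> \<le> B" "\<And>i. AE x in lebesgue_on \<Omega>. \<bar>R i x\<bar> \<le> B'"
  shows "(\<lambda>x. r x * v x) \<in> W12_0 \<Omega>"
proof -
  note L = open_lebesgue[OF \<Omega>]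
  obtain \<phi> where \<phi>: "\<forall>n::nat. \<phi> n \<in> test_functions \<Omega>" "\<forall>n. \<phi> n \<in> L2 \<Omega> \<and> (\<forall>i. pd i (\<phi> n) \<in> L2 \<Omega>)"
     "(\<lambda>n. L2_norm \<Omega> (\<lambda>x. \<phi> n x - v x)) \<longlonglongrightarrow> 0" "\<forall>i. (\<lambda>n. L2_norm \<Omega> (\<lambda>x. pd i (\<phi> n) x - V i x)) \<longlonglongrightarrow> 0"
    using W12_0_approx[OF \<Omega> v] by blast
  have t: "\<phi> n \<in> test_functions \<Omega>" "\<phi> n \<in> L2 \<Omega>" "pd i (\<phi> n) \<in> L2 \<Omega>" for n i using \<phi>(1,2) by auto
  note rm = L2_meas[OF wgradD(1)[OF r]] and Rm = L2_meas[OF wgradD(2)[OF r]]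
  have l1: "(\<lambda>n. L2_norm \<Omega> (\<lambda>x. r x * \<phi> n x - r x * v x)) \<longlonglongrightarrow> 0"
    by (rule L2_tendsto_const_mult[OF t(2) wgradD(1)[OF v(1)] \<phi>(3) rm b(1)])
  have l2: "(\<lambda>n. L2_norm \<Omega> (\<lambda>x. (r x * pd i (\<phi> n) x + R i x * \<phi> n x) - (r x * V i x + R i x * v x))) \<longlonglongrightarrow> 0" for i
    by (intro L2_tendsto_add L2_bdd_mult[OF rm b(1)] L2_bdd_mult[OF Rm b(2)] t wgradD(1)[OF v(1)] wgradD(2)[OF v(1)]
         L2_tendsto_const_mult[OF t(3) wgradD(2)[OF v(1)] \<phi>(4)[rule_format] rm b(1)]
         L2_tendsto_const_mult[OF t(2) wgradD(1)[OF v(1)] \<phi>(3) Rm b(2)])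
  show ?thesis
  proof (rule W12_0_closed[OF \<Omega> wgrad_mult_W1inf[OF \<Omega> v(1) r b] wgrad_mult_test(1)[OF \<Omega> r t(1)] wgrad_mult_test(2)[OF \<Omega> r t(1)] l1])
    show "(\<lambda>n. L2_norm \<Omega> (\<lambda>x. (r x * pd i (\<phi> n) x + \<phi> n x * R i x) - (r x * V i x + v x * R i x))) \<longlonglongrightarrow> 0" for i
      using l2[of i] by (simp add: mult.commute)
  qed
qed

text \<open>Although the gradient of \<open>\<psi>\<close> is merely square integrable, multiplication by \<open>\<psi>\<close> is continuous along
  uniformly bounded sequences: the products \<open>h\<^sub>n \<nabla>\<psi>\<close> converge by dominated convergence.\<close>

lemma W12_0_mult_limit:
  assumes \<Omega>: "open \<Omega>" and \<psi>: "has_wgrad \<Omega> \<psi> \<Psi>" "AE x in lebesgue_on \<Omega>. \<bar>\<psi> x\<bar> \<le> P"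
    and v: "has_wgrad \<Omega> v V" and vn: "\<And>n::nat. has_wgrad \<Omega> (h n) (H n)"
    and b: "\<And>n. AE x in lebesgue_on \<Omega>. \<bar>h n x\<bar> \<le> M"
    and lim: "(\<lambda>n. L2_norm \<Omega> (\<lambda>x. h n x - v x)) \<longlonglongrightarrow> 0" "\<And>i. (\<lambda>n. L2_norm \<Omega> (\<lambda>x. H n i x - V i x)) \<longlonglongrightarrow> 0"
       "AE x in lebesgue_on \<Omega>. (\<lambda>n. h n x) \<longlonglongrightarrow> v x"
    and W: "\<And>n. (\<lambda>x. \<psi> x * h n x) \<in> W12_0 \<Omega>"
  shows "(\<lambda>x. \<psi> x * v x) \<in> W12_0 \<Omega>"
proof -
  have bv: "AE x in lebesgue_on \<Omega>. \<bar>v x\<bar> \<le> M"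
  proof -
    have "AE x in lebesgue_on \<Omega>. \<forall>n. \<bar>h n x\<bar> \<le> M" using b by (simp add: AE_all_countable)
    with lim(3) show ?thesis
    proof eventually_elim
      case (elim x)
      then show ?case using tendsto_upperbound[OF tendsto_rabs, of "\<lambda>n. h n x" "v x" sequentially M] by simp
    qed
  qed
  note \<psi>m = L2_meas[OF wgradD(1)[OF \<psi>(1)]] and vm = L2_meas[OF wgradD(1)[OF v]] and hm = L2_meas[OF wgradD(1)[OF vn]]
  have l1: "(\<lambda>n. L2_norm \<Omega> (\<lambda>x. \<psi> x * h n x - \<psi> x * v x)) \<longlonglongrightarrow> 0"
    by (rule L2_tendsto_const_mult[OF wgradD(1)[OF vn] wgradD(1)[OF v] lim(1) \<psi>m \<psi>(2)])
  have l3: "(\<lambda>n. L2_norm \<Omega> (\<lambda>x. h n x * \<Psi> i x - v x * \<Psi> i x)) \<longlonglongrightarrow> 0" for i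
    by (rule L2_tendsto_bdd_mult[OF wgradD(2)[OF \<psi>(1)] wgradD(2)[OF \<psi>(1)] _ hm vm b lim(3)]) (simp add: L2_norm_def)
  have l2: "(\<lambda>n. L2_norm \<Omega> (\<lambda>x. (\<psi> x * H n i x + h n x * \<Psi> i x) - (\<psi> x * V i x + v x * \<Psi> i x))) \<longlonglongrightarrow> 0" for i
    by (intro L2_tendsto_add l3 L2_bdd_mult[OF \<psi>m \<psi>(2)] L2_bdd_mult[OF hm b] L2_bdd_mult[OF vm bv]
         wgradD(2)[OF \<psi>(1)] wgradD(2)[OF v] wgradD(2)[OF vn]
         L2_tendsto_const_mult[OF wgradD(2)[OF vn] wgradD(2)[OF v] lim(2) \<psi>m \<psi>(2)])
  show ?thesis
    by (rule W12_0_closed[OF \<Omega> wgrad_mult_bounded[OF \<Omega> \<psi>(1) v \<psi>(2) bv] wgrad_mult_bounded[OF \<Omega> \<psi>(1) vn \<psi>(2) b] W l1 l2])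
qed

lemma C1_bdd_arctan:
  assumes "k > 0"
  shows "C1_bdd 1 (\<lambda>s. k * arctan (s / k)) (\<lambda>s. 1 / (1 + (s / k)\<^sup>2))"
  unfolding C1_bdd_def
proof (intro conjI allI)
  have pos: "0 < 1 + (s / k)\<^sup>2" for s by (simp add: add_pos_nonneg)
  then have nz: "1 + (s / k)\<^sup>2 \<noteq> 0" for s by (metis less_irrefl)
  show "((\<lambda>s. k * arctan (s / k)) has_real_derivative 1 / (1 + (s / k)\<^sup>2)) (at s)" for s
    using assms nz by (auto intro!: derivative_eq_intros simp: divide_simps)
  show "continuous_on UNIV (\<lambda>s. 1 / (1 + (s / k)\<^sup>2))"
    using assms nz by (intro continuous_intros) auto
  show "\<bar>1 / (1 + (s / k)\<^sup>2)\<bar> \<le> 1" for s using pos[of s] by (simp add: abs_if)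
qed

text \<open>Test functions that approximate the bounded function \<open>w\<close> in \<open>W\<^sup>1\<^sup>,\<^sup>2\<close> need not be bounded uniformly.
  Composition with \<open>s \<mapsto> k arctan (s / k)\<close> makes them so and yields the claim for the truncation of \<open>w\<close>. As
  \<open>k\<close> tends to infinity, the truncations converge to \<open>w\<close> and are dominated by its bound.\<close>

lemma W12_0_mult_bounded:
  assumes \<Omega>: "open \<Omega>" "\<Omega> \<in> lmeasurable"
    and \<psi>: "has_wgrad \<Omega> \<psi> \<Psi>" "AE x in lebesgue_on \<Omega>. \<bar>\<psi> x\<bar> \<le> P"
    and w: "has_wgrad \<Omega> w W" "w \<in> W12_0 \<Omega>" "AE x in lebesgue_on \<Omega>. \<bar>w x\<bar> \<le> M"
  shows "(\<lambda>x. \<psi> x * w x) \<in> W12_0 \<Omega>"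
proof -
  note L = open_lebesgue[OF \<Omega>(1)]
  define T where "T k s = k * arctan (s / k)" for k s :: real
  define T' where "T' k s = 1 / (1 + (s / k)\<^sup>2)" for k s :: real
  have T: "C1_bdd 1 (T k) (T' k)" if "k > 0" for k
    unfolding T_def[abs_def] T'_def[abs_def] using that by (rule C1_bdd_arctan)
  have Tle: "\<bar>T k s\<bar> \<le> \<bar>s\<bar>" if "k > 0" for k s
    using C1_bddD(4)[OF T[OF that], of s 0] by (simp add: T_def)
  obtain \<phi> where \<phi>: "\<forall>n::nat. \<phi> n \<in> test_functions \<Omega>" "\<forall>n. \<phi> n \<in> L2 \<Omega> \<and> (\<forall>i. pd i (\<phi> n) \<in> L2 \<Omega>)"
     "(\<lambda>n. L2_norm \<Omega> (\<lambda>x. \<phi> n x - w x)) \<longlonglongrightarrow> 0" "\<forall>i. (\<lambda>n. L2_norm \<Omega> (\<lambda>x. pd i (\<phi> n) x - W i x)) \<longlonglongrightarrow> 0"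
    using W12_0_approx[OF \<Omega>(1) w(1,2)] by blast
  have t: "\<phi> n \<in> test_functions \<Omega>" "\<phi> n \<in> L2 \<Omega>" "pd i (\<phi> n) \<in> L2 \<Omega>" for n i using \<phi>(1,2) by auto
  note wL = wgradD(1)[OF w(1)] and WL = wgradD(2)[OF w(1)]
  obtain r :: "nat \<Rightarrow> nat" where r: "strict_mono r" "AE x in lebesgue_on \<Omega>. (\<lambda>n. \<phi> (r n) x) \<longlonglongrightarrow> w x"
    using L2_AE_subseq[OF t(2) wL \<phi>(3)] by blast
  have step1: "(\<lambda>x. \<psi> x * T k (w x)) \<in> W12_0 \<Omega>" if k: "k > 0" for k
  proof (rule W12_0_mult_limit[OF \<Omega>(1) \<psi> wgrad_comp[OF \<Omega> w(1) T[OF k]], where h="\<lambda>n x. T k (\<phi> (r n) x)" and M="k * (pi / 2)"])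
    show 1: "has_wgrad \<Omega> (\<lambda>x. T k (\<phi> (r n) x)) (\<lambda>i x. T' k (\<phi> (r n) x) * pd i (\<phi> (r n)) x)" for n
      by (rule wgrad_comp[OF \<Omega> wgrad_test[OF t(1) L] T[OF k]])
    have bd: "\<bar>T k s\<bar> \<le> k * (pi / 2)" for s
    proof -
      have "\<bar>arctan (s / k)\<bar> \<le> pi / 2" using arctan_bounded[of "s / k"] by linarith
      then show ?thesis unfolding T_def using k by (simp add: abs_mult)
    qed
    show 2: "AE x in lebesgue_on \<Omega>. \<bar>T k (\<phi> (r n) x)\<bar> \<le> k * (pi / 2)" for n using bd by auto
    show "(\<lambda>n. L2_norm \<Omega> (\<lambda>x. T k (\<phi> (r n) x) - T k (w x))) \<longlonglongrightarrow> 0"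
      using LIMSEQ_subseq_LIMSEQ[OF L2_tendsto_C1_bdd[OF \<Omega>(2) T[OF k] t(2) wL \<phi>(3)] r(1)] by (simp add: comp_def)
    have "(\<lambda>n. L2_norm \<Omega> (\<lambda>x. pd i (\<phi> (r n)) x - W i x)) \<longlonglongrightarrow> 0" for i
      using LIMSEQ_subseq_LIMSEQ[OF \<phi>(4)[rule_format] r(1)] by (simp add: comp_def)
    then show "(\<lambda>n. L2_norm \<Omega> (\<lambda>x. T' k (\<phi> (r n) x) * pd i (\<phi> (r n)) x - T' k (w x) * W i x)) \<longlonglongrightarrow> 0" for i
      by (intro L2_tendsto_C1_bdd_deriv[OF T[OF k] t(2) wL r(2) t(3) WL])
    have "isCont (T k) s" for s using C1_bddD(5)[OF T[OF k]] by (simp add: continuous_on_eq_continuous_at)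
    then show "AE x in lebesgue_on \<Omega>. (\<lambda>n. T k (\<phi> (r n) x)) \<longlonglongrightarrow> T k (w x)"
      using r(2) by (auto elim!: eventually_mono intro: isCont_tendsto_compose)
    show "(\<lambda>x. \<psi> x * T k (\<phi> (r n) x)) \<in> W12_0 \<Omega>" for n
    proof -
      obtain K where K: "compact K" "K \<subseteq> \<Omega>" "\<forall>x. x \<notin> K \<longrightarrow> \<phi> (r n) x = 0" using test_support[OF t(1)] by blast
      show ?thesis
        by (rule W12_0_compact_support[OF \<Omega>(1) wgrad_mult_bounded[OF \<Omega>(1) \<psi>(1) 1 \<psi>(2) 2] K(1,2)])
           (simp add: K(3) T_def)
    qed
  qed
  show ?thesis
  proof (rule W12_0_mult_limit[OF \<Omega>(1) \<psi> w(1), where h="\<lambda>n x. T (real (Suc n)) (w x)" and M=M])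
    show "has_wgrad \<Omega> (\<lambda>x. T (real (Suc n)) (w x)) (\<lambda>i x. T' (real (Suc n)) (w x) * W i x)" for n
      by (rule wgrad_comp[OF \<Omega> w(1) T]) simp
    show "AE x in lebesgue_on \<Omega>. \<bar>T (real (Suc n)) (w x)\<bar> \<le> M" for n
      using w(3)
    proof eventually_elim
      case (elim x)
      then show ?case using Tle[of "real (Suc n)" "w x"] by simp
    qed
    have Tm: "(\<lambda>x. T (real (Suc n)) (w x)) \<in> borel_measurable (lebesgue_on \<Omega>)"
      "(\<lambda>x. T' (real (Suc n)) (w x)) \<in> borel_measurable (lebesgue_on \<Omega>)" for n
      by (rule measurable_compose[OF L2_meas[OF wL] C1_bddD(6)[OF T]], simp)
         (rule measurable_compose[OF L2_meas[OF wL] C1_bddD(7)[OF T]], simp)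
    have inv: "(\<lambda>n. s / real (Suc n)) \<longlonglongrightarrow> 0" for s
      using tendsto_mult_left[OF LIMSEQ_inverse_real_of_nat, of s] by (simp add: divide_inverse)
    have T'lim: "(\<lambda>n. T' (real (Suc n)) s) \<longlonglongrightarrow> 1" for s
    proof -
      have "(\<lambda>n. 1 / (1 + (s / real (Suc n))\<^sup>2)) \<longlonglongrightarrow> 1 / (1 + 0\<^sup>2)"
        by (intro tendsto_intros inv) simp
      then show ?thesis by (simp add: T'_def)
    qed
    have Tlim: "(\<lambda>n. T (real (Suc n)) s) \<longlonglongrightarrow> s" for s
    proof (cases "s = 0")
      case False
      have D: "(arctan has_real_derivative 1) (at 0)"
        using DERIV_arctan[of 0] by simp
      have "((\<lambda>h. arctan h / h) \<longlongrightarrow> 1) (at 0)" using D by (simp add: has_field_derivative_iff)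
      moreover have "filterlim (\<lambda>n. s / real (Suc n)) (at 0) sequentially"
        using inv[of s] False by (auto simp: filterlim_at)
      ultimately have "(\<lambda>n. arctan (s / real (Suc n)) / (s / real (Suc n))) \<longlonglongrightarrow> 1" by (rule filterlim_compose)
      from tendsto_mult_left[OF this, of s]
      have "(\<lambda>n. s * (arctan (s / real (Suc n)) / (s / real (Suc n)))) \<longlonglongrightarrow> s" by simp
      moreover have "s * (arctan (s / real (Suc n)) / (s / real (Suc n))) = T (real (Suc n)) s" for n
        using False by (simp add: T_def)
      ultimately show ?thesis by simp
    qed (simp add: T_def)
    show "(\<lambda>n. L2_norm \<Omega> (\<lambda>x. T (real (Suc n)) (w x) - w x)) \<longlonglongrightarrow> 0"
    proof (rule L2_dominated[OF Tm(1) L2_meas[OF wL] _ L2_cmult[OF wL, of 2]])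
      show "AE x in lebesgue_on \<Omega>. \<bar>T (real (Suc n)) (w x) - w x\<bar> \<le> \<bar>2 * w x\<bar>" for n
      proof (rule AE_I2)
        fix x show "\<bar>T (real (Suc n)) (w x) - w x\<bar> \<le> \<bar>2 * w x\<bar>" using Tle[of "real (Suc n)" "w x"] by simp
      qed
    qed (use Tlim in auto)
    have "(\<lambda>n. L2_norm \<Omega> (\<lambda>x. T' (real (Suc n)) (w x) * W i x - 1 * W i x)) \<longlonglongrightarrow> 0" for i
      by (rule L2_tendsto_bdd_mult[OF WL WL _ Tm(2), where B=1])
         (use T'lim C1_bddD(3)[OF T] in \<open>auto simp: L2_norm_def\<close>)
    then show "(\<lambda>n. L2_norm \<Omega> (\<lambda>x. T' (real (Suc n)) (w x) * W i x - W i x)) \<longlonglongrightarrow> 0" for i by simp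
    show "AE x in lebesgue_on \<Omega>. (\<lambda>n. T (real (Suc n)) (w x)) \<longlonglongrightarrow> w x" using Tlim by auto
    show "(\<lambda>x. \<psi> x * T (real (Suc n)) (w x)) \<in> W12_0 \<Omega>" for n by (rule step1) simp
  qed
qed

subsection \<open>Positive parts\<close>

text \<open>A continuously differentiable substitute for the positive part, to which it tends as \<open>e\<close> tends to 0.\<close>

definition pos_sq :: "real \<Rightarrow> real \<Rightarrow> real" where
  "pos_sq e s = (max s 0)\<^sup>2 / (max s 0 + e)"

definition pos_sq' :: "real \<Rightarrow> real \<Rightarrow> real" where
  "pos_sq' e s = 1 - (e / (max s 0 + e))\<^sup>2"

lemma pos_sq_simps:
  assumes "e > 0"
  shows "s \<le> 0 \<Longrightarrow> pos_sq e s = 0" "s \<le> 0 \<Longrightarrow> pos_sq' e s = 0" "0 \<le> pos_sq e s" "0 \<le> pos_sq' e s" "pos_sq' e s \<le> 1"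
    "pos_sq e s = 0 \<longleftrightarrow> s \<le> 0"
proof -
  have m: "0 \<le> max s 0" by simp
  then have "0 \<le> e / (max s 0 + e)" "e / (max s 0 + e) \<le> 1" using assms by (auto simp: divide_simps)
  then show "0 \<le> pos_sq' e s" "pos_sq' e s \<le> 1" by (auto simp: pos_sq'_def power_le_one)
  show "0 \<le> pos_sq e s" using m assms by (auto simp: pos_sq_def)
  show "pos_sq e s = 0 \<longleftrightarrow> s \<le> 0" using m assms by (auto simp: pos_sq_def max_def)
qed (use assms in \<open>auto simp: pos_sq_def pos_sq'_def max_def\<close>)

lemma C1_bdd_pos_sq:
  assumes e: "e > 0"
  shows "C1_bdd 1 (pos_sq e) (pos_sq' e)"
  unfolding C1_bdd_def
proof (intro conjI allI)
  fix s :: real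
  consider "s < 0" | "s = 0" | "s > 0" by linarith
  then show "(pos_sq e has_real_derivative pos_sq' e s) (at s)"
  proof cases
    case 1
    have "((\<lambda>s. 0) has_real_derivative 0) (at s)" by simp
    then have "(pos_sq e has_real_derivative 0) (at s)"
      by (rule has_field_derivative_transform_within_open[where S="{..<0}"])
         (use 1 e in \<open>auto simp: pos_sq_simps\<close>)
    then show ?thesis using 1 e by (simp add: pos_sq_simps)
  next
    case 2
    have "((\<lambda>h. (pos_sq e (0 + h) - pos_sq e 0) / h) \<longlongrightarrow> 0) (at 0)"
    proof (rule Lim_null_comparison)
      have "norm ((pos_sq e (0 + h) - pos_sq e 0) / h) \<le> \<bar>h\<bar> / e" for h
      proof (cases "h \<le> 0")
        case True
        then show ?thesis using e by (simp add: pos_sq_simps divide_nonpos_pos)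
      next
        case False
        then have "pos_sq e h / h = h / (h + e)" using e by (simp add: pos_sq_def power2_eq_square max_def)
        also have "\<dots> \<le> h / e" using False e by (intro divide_left_mono) auto
        finally show ?thesis using False e by (simp add: pos_sq_simps)
      qed
      then show "\<forall>\<^sub>F h in at 0. norm ((pos_sq e (0 + h) - pos_sq e 0) / h) \<le> \<bar>h\<bar> / e" by simp
      have "((\<lambda>h. \<bar>h\<bar> / e) \<longlongrightarrow> \<bar>0\<bar> / e) (at 0)" using e by (intro tendsto_intros) auto
      then show "((\<lambda>h. \<bar>h\<bar> / e) \<longlongrightarrow> 0) (at 0)" by simp
    qed
    then show ?thesis using 2 e by (simp add: DERIV_def pos_sq_simps)
  next
    case 3
    have nz: "s + e \<noteq> 0" using 3 e by simp
    have "((\<lambda>s. s\<^sup>2 / (s + e)) has_real_derivative (2 * s * (s + e) - s\<^sup>2) / (s + e)\<^sup>2) (at s)"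
      using nz by (auto intro!: derivative_eq_intros simp: power2_eq_square)
    moreover have "(2 * s * (s + e) - s\<^sup>2) / (s + e)\<^sup>2 = 1 - (e / (s + e))\<^sup>2"
    proof -
      have "2 * s * (s + e) - s\<^sup>2 = (s + e)\<^sup>2 - e\<^sup>2" by (simp add: power2_eq_square algebra_simps)
      then show ?thesis using nz by (simp add: diff_divide_distrib power_divide)
    qed
    ultimately have "((\<lambda>s. s\<^sup>2 / (s + e)) has_real_derivative 1 - (e / (s + e))\<^sup>2) (at s)" by simp
    then have "(pos_sq e has_real_derivative 1 - (e / (s + e))\<^sup>2) (at s)"
      by (rule has_field_derivative_transform_within_open[where S="{0<..}"]) (use 3 in \<open>auto simp: pos_sq_def max_def\<close>)
    then show ?thesis using 3 by (simp add: pos_sq'_def max_def)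
  qed
  show "\<bar>pos_sq' e s\<bar> \<le> 1" using pos_sq_simps[OF e, of s] by simp
next
  have "max s 0 + e \<noteq> 0" for s using e by (simp add: max_def)
  then show "continuous_on UNIV (pos_sq' e)"
    unfolding pos_sq'_def by (intro continuous_intros) auto
qed

text \<open>A continuously differentiable approximation of the identity that vanishes on \<open>[-e, e]\<close>.\<close>

definition trunc :: "real \<Rightarrow> real \<Rightarrow> real" where
  "trunc e s = pos_sq e (s - e) - pos_sq e (- s - e)"

definition trunc' :: "real \<Rightarrow> real \<Rightarrow> real" where
  "trunc' e s = pos_sq' e (s - e) + pos_sq' e (- s - e)"

lemma C1_bdd_trunc:
  assumes e: "e > 0"
  shows "C1_bdd 2 (trunc e) (trunc' e)"
  unfolding C1_bdd_def
proof (intro conjI allI)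
  note P = C1_bdd_pos_sq[OF e]
  fix s :: real
  have 1: "((\<lambda>s. pos_sq e (s - e)) has_real_derivative pos_sq' e (s - e) * 1) (at s)"
    by (rule DERIV_chain2[OF C1_bddD(1)[OF P]]) (auto intro!: derivative_eq_intros)
  have 2: "((\<lambda>s. pos_sq e (- s - e)) has_real_derivative pos_sq' e (- s - e) * (-1)) (at s)"
    by (rule DERIV_chain2[OF C1_bddD(1)[OF P]]) (auto intro!: derivative_eq_intros)
  show "(trunc e has_real_derivative trunc' e s) (at s)"
    using DERIV_diff[OF 1 2] by (simp add: trunc_def[abs_def] trunc'_def)
  show "\<bar>trunc' e s\<bar> \<le> 2"
    using pos_sq_simps(4,5)[OF e, of "s - e"] pos_sq_simps(4,5)[OF e, of "- s - e"] by (simp add: trunc'_def)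
next
  note C = C1_bddD(2)[OF C1_bdd_pos_sq[OF e]]
  show "continuous_on UNIV (trunc' e)"
    unfolding trunc'_def[abs_def] by (intro continuous_intros continuous_on_compose2[OF C]) auto
qed

lemma trunc_zero: "e > 0 \<Longrightarrow> \<bar>s\<bar> \<le> e \<Longrightarrow> trunc e s = 0"
  using pos_sq_simps(1)[of e "s - e"] pos_sq_simps(1)[of e "- s - e"] by (simp add: trunc_def)

lemma pos_sq_tendsto:
  assumes "e \<longlonglongrightarrow> 0" "\<And>n. e n > 0" "s > 0"
  shows "(\<lambda>n. pos_sq (e n) (s - e n)) \<longlonglongrightarrow> s" "(\<lambda>n. pos_sq' (e n) (s - e n)) \<longlonglongrightarrow> 1"
proof -
  have m: "(\<lambda>n. max (s - e n) 0) \<longlonglongrightarrow> max (s - 0) 0" by (intro tendsto_intros assms(1))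
  have "(\<lambda>n. (max (s - e n) 0)\<^sup>2 / (max (s - e n) 0 + e n)) \<longlonglongrightarrow> (max (s - 0) 0)\<^sup>2 / (max (s - 0) 0 + 0)"
    using assms(3) by (intro tendsto_divide tendsto_power tendsto_add m assms(1)) auto
  then show "(\<lambda>n. pos_sq (e n) (s - e n)) \<longlonglongrightarrow> s"
    using assms(3) by (simp add: pos_sq_def power2_eq_square max_def)
  have "(\<lambda>n. 1 - (e n / (max (s - e n) 0 + e n))\<^sup>2) \<longlonglongrightarrow> 1 - (0 / (max (s - 0) 0 + 0))\<^sup>2"
    using assms(3) by (intro tendsto_diff tendsto_const tendsto_divide tendsto_power tendsto_add m assms(1)) auto
  then show "(\<lambda>n. pos_sq' (e n) (s - e n)) \<longlonglongrightarrow> 1" by (simp add: pos_sq'_def)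
qed

lemma trunc_tendsto:
  assumes e: "e \<longlonglongrightarrow> 0" "\<And>n. e n > 0"
  shows "(\<lambda>n. trunc (e n) s) \<longlonglongrightarrow> s" "(\<lambda>n. trunc' (e n) s) \<longlonglongrightarrow> (if s = 0 then 0 else 1)"
proof -
  have z: "pos_sq (e n) (- t - e n) = 0" "pos_sq' (e n) (- t - e n) = 0" if "t \<ge> 0" for t n
    using pos_sq_simps(1,2)[OF e(2)[of n], of "- t - e n"] that e(2)[of n] by simp_all
  consider "s > 0" | "s = 0" | "s < 0" by linarith
  then have "(\<lambda>n. trunc (e n) s) \<longlonglongrightarrow> s \<and> (\<lambda>n. trunc' (e n) s) \<longlonglongrightarrow> (if s = 0 then 0 else 1)"
  proof cases
    case 1
    then show ?thesis using pos_sq_tendsto[OF e 1] z[of s] by (simp add: trunc_def trunc'_def)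
  next
    case 2
    then show ?thesis using z[of 0] by (simp add: trunc_def trunc'_def)
  next
    case 3
    then show ?thesis
      using pos_sq_tendsto[OF e, of "- s"] z[of "- s"] tendsto_minus[OF pos_sq_tendsto(1)[OF e, of "- s"]]
      by (simp add: trunc_def trunc'_def)
  qed
  then show "(\<lambda>n. trunc (e n) s) \<longlonglongrightarrow> s" "(\<lambda>n. trunc' (e n) s) \<longlonglongrightarrow> (if s = 0 then 0 else 1)" by auto
qed

text \<open>The truncations of \<open>g\<close> have compact support in \<open>\<Omega>\<close>. Their gradients converge to the gradient
  of \<open>g\<close> cut off on the zero set, which is therefore also a weak gradient of \<open>g\<close>.\<close>

lemma W12_0_continuous_vanishing:
  fixes g :: "real^'d \<Rightarrow> real"
  assumes \<Omega>: "open \<Omega>" "bounded \<Omega>" "\<Omega> \<in> lmeasurable" and g: "has_wgrad \<Omega> g H"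
    and c: "continuous_on (closure \<Omega>) g" and z: "\<And>x. x \<in> frontier \<Omega> \<Longrightarrow> g x = 0"
  shows "g \<in> W12_0 \<Omega>"
proof -
  note L = open_lebesgue[OF \<Omega>(1)] and gL = wgradD(1)[OF g] and HL = wgradD(2)[OF g]
  define e where "e n = inverse (real (Suc n))" for n
  have e: "e \<longlonglongrightarrow> 0" "\<And>n. e n > 0" unfolding e_def using LIMSEQ_inverse_real_of_nat by auto
  note T = C1_bdd_trunc[OF e(2)]
  have w: "has_wgrad \<Omega> (\<lambda>x. trunc (e n) (g x)) (\<lambda>i x. trunc' (e n) (g x) * H i x)" for n
    by (rule wgrad_comp[OF \<Omega>(1,3) g T])
  have W: "(\<lambda>x. trunc (e n) (g x)) \<in> W12_0 \<Omega>" for n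
  proof (rule W12_0_compact_support[OF \<Omega>(1) w])
    define K where "K = closure \<Omega> \<inter> g -` {y. e n \<le> \<bar>y\<bar>}"
    have "closed {y::real. e n \<le> \<bar>y\<bar>}" by (intro closed_Collect_le continuous_intros)
    then have "closed K" unfolding K_def using c by (intro continuous_closed_preimage) auto
    then show "compact K"
      using \<Omega>(2) by (auto simp: K_def compact_eq_bounded_closed intro: bounded_subset[OF bounded_closure])
    show "K \<subseteq> \<Omega>"
    proof
      fix x assume x: "x \<in> K"
      show "x \<in> \<Omega>"
      proof (rule ccontr)
        assume "x \<notin> \<Omega>"
        then have "x \<in> frontier \<Omega>" using x \<Omega>(1) by (simp add: K_def frontier_def interior_open)
        then show False using z x e(2)[of n] by (simp add: K_def)
      qed
    qed
    show "trunc (e n) (g x) = 0" if "x \<in> \<Omega>" "x \<notin> K" for x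
      using that closure_subset[of \<Omega>] by (intro trunc_zero e(2)) (auto simp: K_def)
  qed
  define H' where "H' i x = (if g x = 0 then 0 else 1) * H i x" for i x
  have gm: "g \<in> borel_measurable (lebesgue_on \<Omega>)" by (rule L2_meas[OF gL])
  have bm: "(\<lambda>x. if g x = 0 then 0 else 1 :: real) \<in> borel_measurable (lebesgue_on \<Omega>)" using gm by measurable
  have H'L: "H' i \<in> L2 \<Omega>" for i
    unfolding H'_def[abs_def] by (rule L2_bdd_mult[OF bm _ HL, where B=1]) auto
  have l1: "(\<lambda>n. L2_norm \<Omega> (\<lambda>x. trunc (e n) (g x) - g x)) \<longlonglongrightarrow> 0"
  proof (rule L2_dominated[OF L2_meas[OF wgradD(1)[OF w]] gm _ L2_cmult[OF gL, of 3]])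
    show "AE x in lebesgue_on \<Omega>. \<bar>trunc (e n) (g x) - g x\<bar> \<le> \<bar>3 * g x\<bar>" for n
    proof (rule AE_I2)
      fix x
      have "\<bar>trunc (e n) (g x)\<bar> \<le> 2 * \<bar>g x\<bar>"
        using C1_bddD(4)[OF T[of n], of "g x" 0] trunc_zero[OF e(2)[of n], of 0] e(2)[of n] by simp
      then show "\<bar>trunc (e n) (g x) - g x\<bar> \<le> \<bar>3 * g x\<bar>" by simp
    qed
  qed (use trunc_tendsto(1)[OF e] in auto)
  have l2: "(\<lambda>n. L2_norm \<Omega> (\<lambda>x. trunc' (e n) (g x) * H i x - H' i x)) \<longlonglongrightarrow> 0" for i
    unfolding H'_def
    by (rule L2_tendsto_bdd_mult[OF HL HL _ measurable_compose[OF gm C1_bddD(7)[OF T]] bm, where B=2])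
       (use C1_bddD(3)[OF T] trunc_tendsto(2)[OF e] in \<open>auto simp: L2_norm_def\<close>)
  have "is_weak_pd \<Omega> i g (H' i)" for i
    by (rule weak_pd_closed[OF L wgradD(1)[OF w] gL wgradD(2)[OF w] H'L l1 l2 wgradD(3)[OF w]])
  then have g': "has_wgrad \<Omega> g H'" unfolding has_wgrad_def using gL H'L by blast
  show ?thesis by (rule W12_0_closed[OF \<Omega>(1) g' w W l1 l2])
qed

subsection \<open>Integration by parts and Poincare's inequality\<close>

lemma weak_pd_integral_by_parts:
  assumes \<Omega>: "open \<Omega>" and g: "g \<in> L2 \<Omega>" "h \<in> L2 \<Omega>" "is_weak_pd \<Omega> i g h"
    and \<phi>: "has_wgrad \<Omega> \<phi> \<Phi>" "\<phi> \<in> W12_0 \<Omega>"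
  shows "(LINT x|lebesgue_on \<Omega>. g x * \<Phi> i x) = - (LINT x|lebesgue_on \<Omega>. h x * \<phi> x)"
proof -
  obtain \<psi> where \<psi>: "\<forall>n::nat. \<psi> n \<in> test_functions \<Omega>" "\<forall>n. \<psi> n \<in> L2 \<Omega> \<and> (\<forall>i. pd i (\<psi> n) \<in> L2 \<Omega>)"
     "(\<lambda>n. L2_norm \<Omega> (\<lambda>x. \<psi> n x - \<phi> x)) \<longlonglongrightarrow> 0" "\<forall>i. (\<lambda>n. L2_norm \<Omega> (\<lambda>x. pd i (\<psi> n) x - \<Phi> i x)) \<longlonglongrightarrow> 0"
    using W12_0_approx[OF \<Omega> \<phi>] by blast
  have t: "\<psi> n \<in> test_functions \<Omega>" "\<psi> n \<in> L2 \<Omega>" "pd i (\<psi> n) \<in> L2 \<Omega>" for n i using \<psi>(1,2) by auto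
  have 1: "(\<lambda>n. LINT x|lebesgue_on \<Omega>. pd i (\<psi> n) x * g x) \<longlonglongrightarrow> (LINT x|lebesgue_on \<Omega>. \<Phi> i x * g x)"
    by (rule L2_tendsto_inner[OF t(3) wgradD(2)[OF \<phi>(1)] g(1) \<psi>(4)[rule_format]])
  have 2: "(\<lambda>n. LINT x|lebesgue_on \<Omega>. \<psi> n x * h x) \<longlonglongrightarrow> (LINT x|lebesgue_on \<Omega>. \<phi> x * h x)"
    by (rule L2_tendsto_inner[OF t(2) wgradD(1)[OF \<phi>(1)] g(2) \<psi>(3)])
  have "(LINT x|lebesgue_on \<Omega>. pd i (\<psi> n) x * g x) = - (LINT x|lebesgue_on \<Omega>. \<psi> n x * h x)" for n
    using weak_pdD(3)[OF g(3) t(1)] by (simp add: mult.commute)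
  with 1 have "(\<lambda>n. - (LINT x|lebesgue_on \<Omega>. \<psi> n x * h x)) \<longlonglongrightarrow> (LINT x|lebesgue_on \<Omega>. \<Phi> i x * g x)" by simp
  from LIMSEQ_unique[OF this tendsto_minus[OF 2]] show ?thesis by (simp add: mult.commute)
qed

lemma bounded_coord:
  assumes "bounded (\<Omega> :: (real^'d) set)"
  shows "\<exists>R>0. \<forall>x\<in>\<Omega>. \<forall>i. \<bar>x $ i\<bar> \<le> R"
proof -
  obtain R where "R > 0" "\<forall>x\<in>\<Omega>. norm x \<le> R" using assms bounded_pos by blast
  then show ?thesis using component_le_norm_cart order_trans by blast
qed

text \<open>Write \<open>\<phi>\<^sup>2 = \<phi>\<^sup>2 \<partial>\<^sub>i x\<^sub>i\<close> and integrate by parts.\<close>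

lemma Poincare_test:
  fixes \<Omega> :: "(real^'d) set"
  assumes \<Omega>: "open \<Omega>" and R: "R > 0" "\<And>x. x \<in> \<Omega> \<Longrightarrow> \<bar>x $ i\<bar> \<le> R" and \<phi>: "\<phi> \<in> test_functions \<Omega>"
  shows "L2_norm \<Omega> \<phi> \<le> 2 * R * L2_norm \<Omega> (pd i \<phi>)"
proof -
  note L = open_lebesgue[OF \<Omega>]
  note t = test_L2[OF \<phi> L] test_L2[OF test_pd[OF \<phi>] L, of i]
  have t2: "(\<lambda>x. \<phi> x * \<phi> x) \<in> test_functions \<Omega>" by (rule test_mult[OF test_smooth[OF \<phi>] \<phi>])
  have p2: "pd i (\<lambda>x. \<phi> x * \<phi> x) x = \<phi> x * pd i \<phi> x + \<phi> x * pd i \<phi> x" for x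
    using smooth_differentiable[OF test_smooth[OF \<phi>]] by (intro pd_mult)
  have c: "is_weak_pd \<Omega> i (\<lambda>x. x $ i) (pd i (\<lambda>x. x $ i))"
    by (rule weak_pd_C1[OF L smooth_differentiable[OF smooth_coord] smooth_continuous[OF smooth_pd[OF smooth_coord]]])
  have xm: "(\<lambda>x. x $ i) \<in> borel_measurable (lebesgue_on \<Omega>)"
    using borel_measurable_continuous_onI[OF smooth_continuous[OF smooth_coord, of UNIV i]]
    by (intro measurable_restrict_space1 measurable_completion) simp
  have b: "AE x in lebesgue_on \<Omega>. \<bar>x $ i\<bar> \<le> R" using R(2) by (intro AE_I2) simp
  have x\<phi>: "(\<lambda>x. x $ i * \<phi> x) \<in> L2 \<Omega>" by (rule L2_bdd_mult[OF xm b t(1)])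
  have n: "L2_norm \<Omega> (\<lambda>x. x $ i * \<phi> x) \<le> R * L2_norm \<Omega> \<phi>"
    by (rule L2_norm_mono[OF t(1) L2_meas[OF x\<phi>]])
       (use R in \<open>auto simp: abs_mult intro!: AE_I2 mult_right_mono\<close>)
  have "(L2_norm \<Omega> \<phi>)\<^sup>2 = (LINT x|lebesgue_on \<Omega>. pd i (\<lambda>x. x $ i) x * (\<phi> x * \<phi> x))"
    unfolding L2_norm_sq by (simp add: pd_coord power2_eq_square)
  also have "\<dots> = - (LINT x|lebesgue_on \<Omega>. x $ i * pd i (\<lambda>x. \<phi> x * \<phi> x) x)"
    using weak_pdD(3)[OF c t2] by simp
  also have "(LINT x|lebesgue_on \<Omega>. x $ i * pd i (\<lambda>x. \<phi> x * \<phi> x) x) = (LINT x|lebesgue_on \<Omega>. 2 * ((x $ i * \<phi> x) * pd i \<phi> x))"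
    by (rule Bochner_Integration.integral_cong) (auto simp: p2 algebra_simps)
  also have "- \<dots> \<le> 2 * \<bar>LINT x|lebesgue_on \<Omega>. (x $ i * \<phi> x) * pd i \<phi> x\<bar>" by simp
  also have "\<dots> \<le> 2 * (L2_norm \<Omega> (\<lambda>x. x $ i * \<phi> x) * L2_norm \<Omega> (pd i \<phi>))"
    using L2_Cauchy_Schwarz[OF x\<phi> t(2)] by simp
  also have "\<dots> \<le> 2 * ((R * L2_norm \<Omega> \<phi>) * L2_norm \<Omega> (pd i \<phi>))"
    using mult_right_mono[OF n L2_norm_nonneg[of \<Omega> "pd i \<phi>"]] by simp
  finally have *: "L2_norm \<Omega> \<phi> * L2_norm \<Omega> \<phi> \<le> L2_norm \<Omega> \<phi> * (2 * R * L2_norm \<Omega> (pd i \<phi>))"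
    by (simp add: power2_eq_square algebra_simps)
  show ?thesis
  proof (cases "L2_norm \<Omega> \<phi> = 0")
    case True
    then show ?thesis using R(1) L2_norm_nonneg[of \<Omega> "pd i \<phi>"] by simp
  next
    case False
    then have "L2_norm \<Omega> \<phi> > 0" using L2_norm_nonneg[of \<Omega> \<phi>] by linarith
    then show ?thesis using * mult_le_cancel_left_pos by blast
  qed
qed

text \<open>By Poincare's inequality in the single direction \<open>i\<close>, applied to approximating test functions.\<close>

lemma W12_0_zero_derivative:
  fixes \<Omega> :: "(real^'d) set"
  assumes \<Omega>: "open \<Omega>" "bounded \<Omega>" and f: "has_wgrad \<Omega> f G" "f \<in> W12_0 \<Omega>"
    and z: "AE x in lebesgue_on \<Omega>. G i x = 0"
  shows "AE x in lebesgue_on \<Omega>. f x = 0"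
proof -
  note L = open_lebesgue[OF \<Omega>(1)]
  obtain R where R: "R > 0" "\<forall>x\<in>\<Omega>. \<forall>i. \<bar>x $ i\<bar> \<le> R" using bounded_coord[OF \<Omega>(2)] by blast
  obtain \<psi> where \<psi>: "\<forall>n::nat. \<psi> n \<in> test_functions \<Omega>" "\<forall>n. \<psi> n \<in> L2 \<Omega> \<and> (\<forall>i. pd i (\<psi> n) \<in> L2 \<Omega>)"
     "(\<lambda>n. L2_norm \<Omega> (\<lambda>x. \<psi> n x - f x)) \<longlonglongrightarrow> 0" "\<forall>i. (\<lambda>n. L2_norm \<Omega> (\<lambda>x. pd i (\<psi> n) x - G i x)) \<longlonglongrightarrow> 0"
    using W12_0_approx[OF \<Omega>(1) f] by blast
  have t: "\<psi> n \<in> test_functions \<Omega>" "\<psi> n \<in> L2 \<Omega>" "pd i (\<psi> n) \<in> L2 \<Omega>" for n i using \<psi>(1,2) by auto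
  have eq: "L2_norm \<Omega> (\<lambda>x. pd i (\<psi> n) x - G i x) = L2_norm \<Omega> (pd i (\<psi> n))" for n
    using z by (intro L2_norm_cong_AE[OF L t(3)]) (auto elim!: eventually_mono)
  have "L2_norm \<Omega> f \<le> L2_norm \<Omega> (\<lambda>x. \<psi> n x - f x) + 2 * R * L2_norm \<Omega> (\<lambda>x. pd i (\<psi> n) x - G i x)" for n
  proof -
    have "L2_norm \<Omega> (\<lambda>x. (f x - \<psi> n x) + \<psi> n x) \<le> L2_norm \<Omega> (\<lambda>x. f x - \<psi> n x) + L2_norm \<Omega> (\<psi> n)"
      by (rule L2_norm_triangle[OF L2_diff[OF wgradD(1)[OF f(1)] t(2)] t(2)])
    moreover have "L2_norm \<Omega> (\<psi> n) \<le> 2 * R * L2_norm \<Omega> (pd i (\<psi> n))"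
      using R by (intro Poincare_test[OF \<Omega>(1) _ _ t(1)]) auto
    ultimately show ?thesis unfolding eq by (simp add: L2_norm_minus_commute[of \<Omega> f])
  qed
  moreover have "(\<lambda>n. L2_norm \<Omega> (\<lambda>x. \<psi> n x - f x) + 2 * R * L2_norm \<Omega> (\<lambda>x. pd i (\<psi> n) x - G i x)) \<longlonglongrightarrow> 0 + 2 * R * 0"
    by (intro tendsto_add tendsto_mult_left \<psi>(3) \<psi>(4)[rule_format])
  ultimately have "L2_norm \<Omega> f \<le> 0 + 2 * R * 0" by (intro LIMSEQ_le_const) auto
  then have "L2_norm \<Omega> f = 0" using L2_norm_nonneg[of \<Omega> f] by simp
  then show ?thesis by (rule L2_norm_eq_0[OF wgradD(1)[OF f(1)]])
qed

lemma wgrad_smooth: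
  fixes f :: "real^'d \<Rightarrow> real"
  assumes \<Omega>: "open \<Omega>" "bounded \<Omega>" "\<Omega> \<in> lmeasurable" and f: "smooth f"
  shows "has_wgrad \<Omega> f (\<lambda>i. pd i f)"
proof -
  have s: "h \<in> L2 \<Omega>" if "smooth h" for h :: "real^'d \<Rightarrow> real"
  proof -
    have "compact (h ` closure \<Omega>)"
      using smooth_continuous[OF that] \<Omega>(2) by (intro compact_continuous_image) auto
    then obtain B where B: "\<forall>y\<in>h ` closure \<Omega>. norm y \<le> B" using bounded_iff compact_imp_bounded by metis
    have m: "h \<in> borel_measurable (lebesgue_on \<Omega>)"
      using borel_measurable_continuous_onI[OF smooth_continuous[OF that, of UNIV]]
      by (intro measurable_restrict_space1 measurable_completion) simp
    show ?thesis
      by (rule L2_of_bounded[OF \<Omega>(3) m, where B=B]) (use B closure_subset[of \<Omega>] in \<open>auto intro!: AE_I2\<close>)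
  qed
  show ?thesis
    unfolding has_wgrad_def using s[OF f] s[OF smooth_pd[OF f]]
    by (auto intro!: weak_pd_C1[OF open_lebesgue[OF \<Omega>(1)]] smooth_differentiable[OF f] smooth_continuous[OF smooth_pd[OF f]])
qed

text \<open>The approximations \<open>h'\<^sub>n\<close> need not vanish on the boundary, only their compositions with \<open>p\<close>. An example
  are positive parts of \<open>\<phi> - v\<close> for test functions \<open>\<phi>\<close> and a fixed \<open>v \<ge> 0\<close>.\<close>

lemma W12_0_comp_limit:
  assumes \<Omega>: "open \<Omega>" "\<Omega> \<in> lmeasurable" and p: "C1_bdd B p p'" and h: "has_wgrad \<Omega> h H"
    and hn: "\<And>n::nat. has_wgrad \<Omega> (h' n) (H' n)" "\<And>n. (\<lambda>x. p (h' n x)) \<in> W12_0 \<Omega>"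
    and lim: "(\<lambda>n. L2_norm \<Omega> (\<lambda>x. h' n x - h x)) \<longlonglongrightarrow> 0" "\<And>i. (\<lambda>n. L2_norm \<Omega> (\<lambda>x. H' n i x - H i x)) \<longlonglongrightarrow> 0"
  shows "(\<lambda>x. p (h x)) \<in> W12_0 \<Omega>"
proof -
  obtain r :: "nat \<Rightarrow> nat" where r: "strict_mono r" "AE x in lebesgue_on \<Omega>. (\<lambda>n. h' (r n) x) \<longlonglongrightarrow> h x"
    using L2_AE_subseq[OF wgradD(1)[OF hn(1)] wgradD(1)[OF h] lim(1)] by blast
  have l1: "(\<lambda>n. L2_norm \<Omega> (\<lambda>x. p (h' (r n) x) - p (h x))) \<longlonglongrightarrow> 0"
    using LIMSEQ_subseq_LIMSEQ[OF L2_tendsto_C1_bdd[OF \<Omega>(2) p wgradD(1)[OF hn(1)] wgradD(1)[OF h] lim(1)] r(1)]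
    by (simp add: comp_def)
  have "(\<lambda>n. L2_norm \<Omega> (\<lambda>x. H' (r n) i x - H i x)) \<longlonglongrightarrow> 0" for i
    using LIMSEQ_subseq_LIMSEQ[OF lim(2) r(1)] by (simp add: comp_def)
  then have l2: "(\<lambda>n. L2_norm \<Omega> (\<lambda>x. p' (h' (r n) x) * H' (r n) i x - p' (h x) * H i x)) \<longlonglongrightarrow> 0" for i
    by (intro L2_tendsto_C1_bdd_deriv[OF p wgradD(1)[OF hn(1)] wgradD(1)[OF h] r(2) wgradD(2)[OF hn(1)] wgradD(2)[OF h]])
  show ?thesis
    by (rule W12_0_closed[OF \<Omega>(1) wgrad_comp[OF \<Omega> h p] wgrad_comp[OF \<Omega> hn(1) p] hn(2) l1 l2])
qed

section \<open>Elliptic problems\<close>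

lemma Linf_bound:
  assumes "F \<in> Linf \<Omega>"
  shows "F \<in> borel_measurable (lebesgue_on \<Omega>)" "\<exists>N\<ge>0. AE x in lebesgue_on \<Omega>. \<bar>F x\<bar> \<le> N"
proof -
  show "F \<in> borel_measurable (lebesgue_on \<Omega>)" using assms by (simp add: Linf_def)
  define E where "E = esssup (lebesgue_on \<Omega>) (\<lambda>x. ereal \<bar>F x\<bar>)"
  have "E < \<infinity>" using assms by (simp add: Linf_def E_def)
  then obtain N where "E \<le> ereal N" by (cases E) auto
  then have N: "E \<le> ereal (max N 0)" by (rule order_trans) simp
  have "AE x in lebesgue_on \<Omega>. ereal \<bar>F x\<bar> \<le> E" unfolding E_def by (rule esssup_AE)
  then have "AE x in lebesgue_on \<Omega>. \<bar>F x\<bar> \<le> max N 0"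
    by eventually_elim (use N order_trans ereal_less_eq(3) in blast)
  then show "\<exists>N\<ge>0. AE x in lebesgue_on \<Omega>. \<bar>F x\<bar> \<le> N" by (intro exI[of _ "max N 0"]) simp
qed

lemma Linf_L2:
  assumes "F \<in> Linf \<Omega>" "\<Omega> \<in> lmeasurable"
  shows "F \<in> L2 \<Omega>"
  using Linf_bound[OF assms(1)] L2_of_bounded[OF assms(2)] by blast

text \<open>The fields \<open>W\<close> and \<open>\<Phi>\<close> are arguments of their own, so that fields such as \<open>\<psi> \<nabla>w\<close>, which are not
  gradients, are covered.\<close>

definition dirichlet :: "(real^'d) set \<Rightarrow> (real^'d \<Rightarrow> real) \<Rightarrow> ('d \<Rightarrow> real^'d \<Rightarrow> real) \<Rightarrow> ('d \<Rightarrow> real^'d \<Rightarrow> real) \<Rightarrow> real" where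
  "dirichlet \<Omega> q W \<Phi> = (LINT x|lebesgue_on \<Omega>. (\<Sum>i\<in>UNIV. (q x * W i x) * \<Phi> i x))"

lemma weak_grad_inner:
  "weak_grad \<Omega> w x \<bullet> weak_grad \<Omega> \<phi> x = (\<Sum>i\<in>UNIV. weak_pd \<Omega> i w x * weak_pd \<Omega> i \<phi> x)"
  by (simp add: weak_grad_def inner_vec_def)

lemma weak_grad_AE:
  assumes \<Omega>: "open \<Omega>" and w: "has_wgrad \<Omega> w W"
  shows "AE x in lebesgue_on \<Omega>. \<forall>i. weak_pd \<Omega> i w x = W i x"
proof -
  have "AE x in lebesgue_on \<Omega>. \<forall>i\<in>UNIV. weak_pd \<Omega> i w x = W i x"
    using weak_pd_eq_AE[OF \<Omega> wgradD(3)[OF w]] by (subst AE_finite_all) auto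
  then show ?thesis by simp
qed

lemma L2_coeff_mult:
  assumes "q \<in> borel_measurable (lebesgue_on \<Omega>)" "AE x in lebesgue_on \<Omega>. lo \<le> q x \<and> q x \<le> hi" "f \<in> L2 \<Omega>"
  shows "(\<lambda>x. q x * f x) \<in> L2 \<Omega>"
proof (rule L2_bdd_mult[OF assms(1) _ assms(3), where B="max \<bar>lo\<bar> \<bar>hi\<bar>"])
  show "AE x in lebesgue_on \<Omega>. \<bar>q x\<bar> \<le> max \<bar>lo\<bar> \<bar>hi\<bar>" using assms(2) by eventually_elim linarith
qed

lemma dirichlet_sum:
  assumes "\<And>i. (\<lambda>x. q x * W i x) \<in> L2 \<Omega>" "\<And>i. \<Phi> i \<in> L2 \<Omega>"
  shows "integrable (lebesgue_on \<Omega>) (\<lambda>x. \<Sum>i\<in>UNIV. (q x * W i x) * \<Phi> i x)"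
    "dirichlet \<Omega> q W \<Phi> = (\<Sum>i\<in>UNIV. LINT x|lebesgue_on \<Omega>. (q x * W i x) * \<Phi> i x)"
proof -
  note i = L2_mult_integrable[OF assms]
  show "integrable (lebesgue_on \<Omega>) (\<lambda>x. \<Sum>i\<in>UNIV. (q x * W i x) * \<Phi> i x)"
    using i by (rule Bochner_Integration.integrable_sum)
  show "dirichlet \<Omega> q W \<Phi> = (\<Sum>i\<in>UNIV. LINT x|lebesgue_on \<Omega>. (q x * W i x) * \<Phi> i x)"
    unfolding dirichlet_def using i by (rule Bochner_Integration.integral_sum)
qed

lemma dirichlet_weak_grad:
  fixes w \<phi> :: "real^'d \<Rightarrow> real"
  assumes \<Omega>: "open \<Omega>" and qm: "q \<in> borel_measurable (lebesgue_on \<Omega>)"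
    and w: "has_wgrad \<Omega> w W" and \<phi>: "has_wgrad \<Omega> \<phi> \<Phi>"
  shows "(LINT x|lebesgue_on \<Omega>. q x * (weak_grad \<Omega> w x \<bullet> weak_grad \<Omega> \<phi> x)) = dirichlet \<Omega> q W \<Phi>"
  unfolding dirichlet_def weak_grad_inner
proof (rule integral_cong_AE)
  have "f \<in> W12 \<Omega>" if "has_wgrad \<Omega> f G" for f G using that W12_iff by blast
  then have [measurable]: "weak_pd \<Omega> i w \<in> borel_measurable (lebesgue_on \<Omega>)" "weak_pd \<Omega> i \<phi> \<in> borel_measurable (lebesgue_on \<Omega>)" for i
    using L2_meas[OF wgradD(2)[OF W12_has_wgrad[OF \<Omega>]]] w \<phi> by blast+
  have [measurable]: "W i \<in> borel_measurable (lebesgue_on \<Omega>)" "\<Phi> i \<in> borel_measurable (lebesgue_on \<Omega>)" for i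
    using L2_meas[OF wgradD(2)[OF w]] L2_meas[OF wgradD(2)[OF \<phi>]] by auto
  note [measurable] = qm
  show "(\<lambda>x. q x * (\<Sum>i\<in>UNIV. weak_pd \<Omega> i w x * weak_pd \<Omega> i \<phi> x)) \<in> borel_measurable (lebesgue_on \<Omega>)"
    "(\<lambda>x. \<Sum>i\<in>UNIV. q x * W i x * \<Phi> i x) \<in> borel_measurable (lebesgue_on \<Omega>)" by measurable
  show "AE x in lebesgue_on \<Omega>. q x * (\<Sum>i\<in>UNIV. weak_pd \<Omega> i w x * weak_pd \<Omega> i \<phi> x) = (\<Sum>i\<in>UNIV. q x * W i x * \<Phi> i x)"
    using weak_grad_AE[OF \<Omega> w] weak_grad_AE[OF \<Omega> \<phi>]
    by eventually_elim (simp add: sum_distrib_left mult.assoc)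
qed

lemma elliptic_weakD:
  fixes w \<phi> :: "real^'d \<Rightarrow> real"
  assumes \<Omega>: "open \<Omega>" and qm: "q \<in> borel_measurable (lebesgue_on \<Omega>)"
    and e: "elliptic_weak_solution \<Omega> q F w" and w: "has_wgrad \<Omega> w W"
    and \<phi>: "has_wgrad \<Omega> \<phi> \<Phi>" "\<phi> \<in> W12_0 \<Omega>"
  shows "dirichlet \<Omega> q W \<Phi> = (LINT x|lebesgue_on \<Omega>. F x * \<phi> x)"
  using e \<phi>(2) dirichlet_weak_grad[OF \<Omega> qm w \<phi>(1)] unfolding elliptic_weak_solution_def by simp

subsection \<open>Uniqueness\<close>

text \<open>Approximating \<open>z\<close> by test functions shows that its own energy \<open>\<integral> q \<bar>\<nabla>z\<bar>\<^sup>2\<close> vanishes.\<close>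

lemma dirichlet_zero:
  fixes \<Omega> :: "(real^'d) set"
  assumes \<Omega>: "open \<Omega>" "bounded \<Omega>" and qm: "q \<in> borel_measurable (lebesgue_on \<Omega>)"
    and q: "0 < lo" "AE x in lebesgue_on \<Omega>. lo \<le> q x \<and> q x \<le> hi"
    and z: "has_wgrad \<Omega> z Z" "z \<in> W12_0 \<Omega>"
    and eq: "\<And>\<phi>. \<phi> \<in> test_functions \<Omega> \<Longrightarrow> dirichlet \<Omega> q Z (\<lambda>i. pd i \<phi>) = 0"
  shows "AE x in lebesgue_on \<Omega>. z x = 0"
proof -
  obtain \<psi> where \<psi>: "\<forall>n::nat. \<psi> n \<in> test_functions \<Omega>" "\<forall>n. \<psi> n \<in> L2 \<Omega> \<and> (\<forall>i. pd i (\<psi> n) \<in> L2 \<Omega>)"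
     "(\<lambda>n. L2_norm \<Omega> (\<lambda>x. \<psi> n x - z x)) \<longlonglongrightarrow> 0" "\<forall>i. (\<lambda>n. L2_norm \<Omega> (\<lambda>x. pd i (\<psi> n) x - Z i x)) \<longlonglongrightarrow> 0"
    using W12_0_approx[OF \<Omega>(1) z] by blast
  have t: "\<psi> n \<in> test_functions \<Omega>" "\<psi> n \<in> L2 \<Omega>" "pd i (\<psi> n) \<in> L2 \<Omega>" for n i using \<psi>(1,2) by auto
  have qZ: "(\<lambda>x. q x * Z i x) \<in> L2 \<Omega>" for i by (rule L2_coeff_mult[OF qm q(2) wgradD(2)[OF z(1)]])
  have "(\<lambda>n. LINT x|lebesgue_on \<Omega>. (q x * Z i x) * pd i (\<psi> n) x) \<longlonglongrightarrow> (LINT x|lebesgue_on \<Omega>. (q x * Z i x) * Z i x)" for i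
    using L2_tendsto_inner[OF t(3) wgradD(2)[OF z(1)] qZ \<psi>(4)[rule_format]] by (simp add: mult.commute)
  then have "(\<lambda>n. \<Sum>i\<in>UNIV. LINT x|lebesgue_on \<Omega>. (q x * Z i x) * pd i (\<psi> n) x)
      \<longlonglongrightarrow> (\<Sum>i\<in>UNIV. LINT x|lebesgue_on \<Omega>. (q x * Z i x) * Z i x)" by (intro tendsto_sum)
  then have "(\<lambda>n. dirichlet \<Omega> q Z (\<lambda>i. pd i (\<psi> n))) \<longlonglongrightarrow> dirichlet \<Omega> q Z Z"
    by (simp add: dirichlet_sum(2)[OF qZ t(3)] dirichlet_sum(2)[OF qZ wgradD(2)[OF z(1)]])
  then have 0: "dirichlet \<Omega> q Z Z = 0" by (simp add: eq[OF t(1)] LIMSEQ_const_iff)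
  have nn: "AE x in lebesgue_on \<Omega>. 0 \<le> (\<Sum>i\<in>UNIV. q x * Z i x * Z i x)"
    using q(2)
  proof eventually_elim
    case (elim x)
    then show ?case using q(1) by (intro sum_nonneg) (auto simp: mult.assoc)
  qed
  have "AE x in lebesgue_on \<Omega>. (\<Sum>i\<in>UNIV. q x * Z i x * Z i x) = 0"
    using 0 integral_nonneg_eq_0_iff_AE[OF dirichlet_sum(1)[OF qZ wgradD(2)[OF z(1)]] nn] by (simp add: dirichlet_def)
  then have "AE x in lebesgue_on \<Omega>. \<forall>i. Z i x = 0"
    using q(2)
  proof eventually_elim
    case (elim x)
    have "0 \<le> q x * Z i x * Z i x" for i using elim(2) q(1) by (simp add: mult.assoc)
    then have "\<forall>i\<in>UNIV. q x * Z i x * Z i x = 0" using elim(1) by (subst (asm) sum_nonneg_eq_0_iff) auto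
    then show ?case using elim(2) q(1) by auto
  qed
  then have "AE x in lebesgue_on \<Omega>. Z i x = 0" for i by eventually_elim simp
  then show ?thesis by (rule W12_0_zero_derivative[OF \<Omega> z])
qed

subsection \<open>Boundedness\<close>

text \<open>The barrier \<open>v\<close> is a multiple of \<open>exp (l R) - exp (l x\<^sub>j)\<close>, where \<open>R\<close> bounds the coordinates in \<open>\<Omega>\<close>.
  For large \<open>l\<close> the second derivative dominates the term containing the gradient of \<open>q\<close>, and \<open>v\<close> becomes a
  nonnegative supersolution: \<open>- \<nabla> \<bullet> (q \<nabla>v) \<ge> N \<ge> F\<close>. Testing with a smoothed positive part of \<open>w - v\<close>
  shows that \<open>w \<le> v\<close>.\<close>

lemma elliptic_upper_bound:
  fixes \<Omega> :: "(real^'d) set"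
  assumes \<Omega>: "open \<Omega>" "bounded \<Omega>" "\<Omega> \<in> lmeasurable"
    and Q: "has_wgrad \<Omega> q Q" and q: "0 < lo" "AE x in lebesgue_on \<Omega>. lo \<le> q x \<and> q x \<le> hi"
    and Qb: "\<And>i. AE x in lebesgue_on \<Omega>. \<bar>Q i x\<bar> \<le> M"
    and F: "F \<in> L2 \<Omega>" "AE x in lebesgue_on \<Omega>. \<bar>F x\<bar> \<le> N" "0 \<le> N"
    and w: "has_wgrad \<Omega> w W" "w \<in> W12_0 \<Omega>"
    and eq: "\<And>\<phi> \<Phi>. has_wgrad \<Omega> \<phi> \<Phi> \<Longrightarrow> \<phi> \<in> W12_0 \<Omega> \<Longrightarrow> dirichlet \<Omega> q W \<Phi> = (LINT x|lebesgue_on \<Omega>. F x * \<phi> x)"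
  shows "\<exists>B. AE x in lebesgue_on \<Omega>. w x \<le> B"
proof -
  note L = open_lebesgue[OF \<Omega>(1)]
  obtain j :: 'd where True by blast
  obtain R where R: "R > 0" "\<forall>x\<in>\<Omega>. \<forall>i. \<bar>x $ i\<bar> \<le> R" using bounded_coord[OF \<Omega>(2)] by blast
  \<comment> \<open>ensures \<open>l q + \<partial>\<^sub>j q \<ge> 1\<close>; the factor \<open>b\<close> then scales the supersolution inequality up to \<open>N\<close>\<close>
  define l where "l = (\<bar>M\<bar> + 1) / lo"
  have l: "l > 0" "l * lo = \<bar>M\<bar> + 1" using q(1) by (auto simp: l_def add_nonneg_pos)
  define b where "b = N * exp (l * R) / l"
  have b: "b \<ge> 0" using F(3) l by (simp add: b_def)
  define v where "v x = b * exp (l * R) - b * exp (l * x $ j)" for x :: "real^'d"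
  have smv: "smooth v" unfolding v_def[abs_def] by (intro smooth_diff smooth_const smooth_exp_coord)
  have pdv: "pd i v x = (if i = j then - (b * l) * exp (l * x $ j) else 0)" for i x
    unfolding v_def[abs_def]
    by (simp add: pd_diff[OF smooth_differentiable[OF smooth_const] smooth_differentiable[OF smooth_exp_coord]] pd_exp_coord)
  have v0: "0 \<le> v x" "v x \<le> b * exp (l * R)" if "x \<in> \<Omega>" for x
  proof -
    have "x $ j \<le> R" using R(2) that abs_le_D1 by blast
    then have "exp (l * x $ j) \<le> exp (l * R)" using l by simp
    then have "b * exp (l * x $ j) \<le> b * exp (l * R)" using b by (rule mult_left_mono)
    then show "0 \<le> v x" by (simp add: v_def)
    show "v x \<le> b * exp (l * R)" using b by (simp add: v_def)
  qed
  note V = wgrad_smooth[OF \<Omega> smv]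
  define h where "h x = w x - v x" for x
  define H where "H i x = W i x - pd i v x" for i x
  have hH: "has_wgrad \<Omega> h H" unfolding h_def[abs_def] H_def[abs_def] by (rule wgrad_diff[OF L w(1) V])
  have P: "C1_bdd 1 (pos_sq 1) (pos_sq' 1)" by (rule C1_bdd_pos_sq) simp
  define \<phi> where "\<phi> x = pos_sq 1 (h x)" for x
  define \<Phi> where "\<Phi> i x = pos_sq' 1 (h x) * H i x" for i x
  have ph: "has_wgrad \<Omega> \<phi> \<Phi>" unfolding \<phi>_def[abs_def] \<Phi>_def[abs_def] by (rule wgrad_comp[OF \<Omega>(1,3) hH P])
  obtain \<psi> where \<psi>: "\<forall>n::nat. \<psi> n \<in> test_functions \<Omega>" "\<forall>n. \<psi> n \<in> L2 \<Omega> \<and> (\<forall>i. pd i (\<psi> n) \<in> L2 \<Omega>)"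
     "(\<lambda>n. L2_norm \<Omega> (\<lambda>x. \<psi> n x - w x)) \<longlonglongrightarrow> 0" "\<forall>i. (\<lambda>n. L2_norm \<Omega> (\<lambda>x. pd i (\<psi> n) x - W i x)) \<longlonglongrightarrow> 0"
    using W12_0_approx[OF \<Omega>(1) w] by blast
  have t: "\<psi> n \<in> test_functions \<Omega>" for n using \<psi>(1) by blast
  \<comment> \<open>the functions \<open>\<psi> n - v\<close> are nonpositive off the support of \<open>\<psi> n\<close>, since \<open>v \<ge> 0\<close>\<close>
  have p0: "\<phi> \<in> W12_0 \<Omega>"
    unfolding \<phi>_def
  proof (rule W12_0_comp_limit[OF \<Omega>(1,3) P hH, where h'="\<lambda>n x. \<psi> n x - v x"])
    show g: "has_wgrad \<Omega> (\<lambda>x. \<psi> n x - v x) (\<lambda>i x. pd i (\<psi> n) x - pd i v x)" for n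
      by (rule wgrad_diff[OF L wgrad_test[OF t L] V])
    show "(\<lambda>x. pos_sq 1 (\<psi> n x - v x)) \<in> W12_0 \<Omega>" for n
    proof -
      obtain K where K: "compact K" "K \<subseteq> \<Omega>" "\<forall>x. x \<notin> K \<longrightarrow> \<psi> n x = 0" using test_support[OF t] by blast
      show ?thesis
        by (rule W12_0_compact_support[OF \<Omega>(1) wgrad_comp[OF \<Omega>(1,3) g P] K(1,2)])
           (use K(3) v0 in \<open>auto intro!: pos_sq_simps(1)\<close>)
    qed
    show "(\<lambda>n. L2_norm \<Omega> (\<lambda>x. \<psi> n x - v x - h x)) \<longlonglongrightarrow> 0"
      using \<psi>(3) by (simp add: h_def algebra_simps)
    show "(\<lambda>n. L2_norm \<Omega> (\<lambda>x. pd i (\<psi> n) x - pd i v x - H i x)) \<longlonglongrightarrow> 0" for i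
      using \<psi>(4) by (simp add: H_def algebra_simps)
  qed
  have \<phi>0: "0 \<le> \<phi> x" for x unfolding \<phi>_def by (rule pos_sq_simps(3)) simp
  note qm = L2_meas[OF wgradD(1)[OF Q]]
  note qL = L2_coeff_mult[OF qm q(2)]
  have qW: "(\<lambda>x. q x * W i x) \<in> L2 \<Omega>" for i by (rule qL[OF wgradD(2)[OF w(1)]])
  have qV: "(\<lambda>x. q x * pd i v x) \<in> L2 \<Omega>" for i by (rule qL[OF wgradD(2)[OF V]])
  have \<Phi>L: "\<Phi> i \<in> L2 \<Omega>" for i by (rule wgradD(2)[OF ph])
  have 1: "dirichlet \<Omega> q W \<Phi> = (LINT x|lebesgue_on \<Omega>. F x * \<phi> x)" by (rule eq[OF ph p0])
  \<comment> \<open>\<open>E\<close> is the only nonzero partial derivative of \<open>v\<close>\<close>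
  define E where "E x = - (b * l) * exp (l * x $ j)" for x :: "real^'d"
  have smE: "smooth E" unfolding E_def[abs_def] by (rule smooth_exp_coord)
  have pdE: "pd j E x = - (b * l * l) * exp (l * x $ j)" for x
    unfolding E_def[abs_def] pd_exp_coord by simp
  note EG = wgrad_smooth[OF \<Omega> smE]
  have expb: "exp (l * x $ j) \<le> exp (l * R)" "exp (- (l * R)) \<le> exp (l * x $ j)" if "x \<in> \<Omega>" for x
  proof -
    have "x $ j \<le> R" "- R \<le> x $ j" using R(2) that abs_le_iff minus_le_iff by metis+
    then have "l * x $ j \<le> l * R" "l * (- R) \<le> l * x $ j"
      using l(1) by (simp_all only: mult_le_cancel_left_pos)
    then show "exp (l * x $ j) \<le> exp (l * R)" "exp (- (l * R)) \<le> exp (l * x $ j)" by auto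
  qed
  have Ebd: "AE x in lebesgue_on \<Omega>. \<bar>E x\<bar> \<le> b * l * exp (l * R)"
    using b l(1) expb(1) by (intro AE_I2) (auto simp: E_def abs_mult intro!: mult_left_mono)
  have Em: "E \<in> borel_measurable (lebesgue_on \<Omega>)" by (rule L2_meas[OF wgradD(1)[OF EG]])
  have QE: "(\<lambda>x. E x * Q j x) \<in> L2 \<Omega>" by (rule L2_bdd_mult[OF Em Ebd wgradD(2)[OF Q]])
  have qE: "(\<lambda>x. q x * pd j E x) \<in> L2 \<Omega>" by (rule qL[OF wgradD(2)[OF EG]])
  have wj: "is_weak_pd \<Omega> j (\<lambda>x. q x * E x) (\<lambda>x. q x * pd j E x + E x * Q j x)"
    by (rule weak_pd_mult[OF \<Omega>(1) Q EG])
  have 2: "dirichlet \<Omega> q (\<lambda>i. pd i v) \<Phi> = (LINT x|lebesgue_on \<Omega>. (q x * E x) * \<Phi> j x)"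
  proof -
    have "(\<Sum>i\<in>UNIV. (q x * pd i v x) * \<Phi> i x) = (\<Sum>i\<in>UNIV. if i = j then (q x * E x) * \<Phi> j x else 0)" for x
      by (rule sum.cong) (auto simp: pdv E_def)
    then show ?thesis unfolding dirichlet_def by simp
  qed
  have 3: "(LINT x|lebesgue_on \<Omega>. (q x * E x) * \<Phi> j x) = - (LINT x|lebesgue_on \<Omega>. (q x * pd j E x + E x * Q j x) * \<phi> x)"
    by (rule weak_pd_integral_by_parts[OF \<Omega>(1) qL[OF wgradD(1)[OF EG]] L2_add[OF qE QE] wj ph p0])
  have super: "AE x in lebesgue_on \<Omega>. q x * pd j E x + E x * Q j x \<le> - N"
    using q(2) Qb[of j] AE_space
  proof eventually_elim
    case (elim x)
    then have x: "x \<in> \<Omega>" by simp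
    have "l * lo \<le> l * q x" using elim(1) l(1) by simp
    moreover have "- \<bar>M\<bar> \<le> Q j x" using elim(2) by linarith
    ultimately have "1 \<le> l * q x + Q j x" using l(2) by linarith
    then have "exp (- (l * R)) * 1 \<le> exp (l * x $ j) * (l * q x + Q j x)"
      using expb(2)[OF x] by (intro mult_mono) auto
    then have "(b * l) * exp (- (l * R)) \<le> (b * l) * (exp (l * x $ j) * (l * q x + Q j x))"
      using b l(1) by (intro mult_left_mono) auto
    moreover have "(b * l) * exp (- (l * R)) = N" using l(1) by (simp add: b_def exp_minus)
    ultimately show ?case by (simp add: pdE E_def algebra_simps)
  qed
  have NL: "(\<lambda>x. N) \<in> L2 \<Omega>" using F(3) by (intro L2_of_bounded[OF \<Omega>(3), where B=N]) auto
  have "dirichlet \<Omega> q (\<lambda>i. pd i v) \<Phi> \<ge> (LINT x|lebesgue_on \<Omega>. N * \<phi> x)"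
  proof -
    have "(LINT x|lebesgue_on \<Omega>. (q x * pd j E x + E x * Q j x) * \<phi> x) \<le> (LINT x|lebesgue_on \<Omega>. - (N * \<phi> x))"
    proof (rule integral_mono_AE)
      show "integrable (lebesgue_on \<Omega>) (\<lambda>x. (q x * pd j E x + E x * Q j x) * \<phi> x)"
        by (rule L2_mult_integrable[OF L2_add[OF qE QE] wgradD(1)[OF ph]])
      show "integrable (lebesgue_on \<Omega>) (\<lambda>x. - (N * \<phi> x))"
        using L2_mult_integrable[OF NL wgradD(1)[OF ph]] by simp
      show "AE x in lebesgue_on \<Omega>. (q x * pd j E x + E x * Q j x) * \<phi> x \<le> - (N * \<phi> x)"
        using super by eventually_elim (use mult_right_mono[OF _ \<phi>0] in fastforce)
    qed
    then show ?thesis unfolding 2 3 by simp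
  qed
  moreover have "(LINT x|lebesgue_on \<Omega>. F x * \<phi> x) \<le> (LINT x|lebesgue_on \<Omega>. N * \<phi> x)"
  proof (rule integral_mono_AE[OF L2_mult_integrable[OF F(1) wgradD(1)[OF ph]] L2_mult_integrable[OF NL wgradD(1)[OF ph]]])
    show "AE x in lebesgue_on \<Omega>. F x * \<phi> x \<le> N * \<phi> x"
      using F(2) by eventually_elim (intro mult_right_mono \<phi>0, linarith)
  qed
  ultimately have le: "dirichlet \<Omega> q W \<Phi> \<le> dirichlet \<Omega> q (\<lambda>i. pd i v) \<Phi>" unfolding 1 by linarith
  have qH: "(\<lambda>x. q x * H i x) \<in> L2 \<Omega>" for i by (rule qL[OF wgradD(2)[OF hH]])
  have "dirichlet \<Omega> q H \<Phi> = dirichlet \<Omega> q W \<Phi> - dirichlet \<Omega> q (\<lambda>i. pd i v) \<Phi>"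
    unfolding dirichlet_def Bochner_Integration.integral_diff[OF dirichlet_sum(1)[OF qW \<Phi>L] dirichlet_sum(1)[OF qV \<Phi>L], symmetric]
    by (simp add: H_def sum_subtractf[symmetric] algebra_simps)
  with le have d0: "dirichlet \<Omega> q H \<Phi> \<le> 0" by simp
  have pt: "0 \<le> q x * H i x * \<Phi> i x" if "lo \<le> q x" for i x
  proof -
    have "q x * H i x * \<Phi> i x = (q x * pos_sq' 1 (h x)) * (H i x)\<^sup>2" by (simp add: \<Phi>_def power2_eq_square)
    moreover have "0 \<le> q x * pos_sq' 1 (h x)" using that q(1) pos_sq_simps(4)[of 1] by (intro mult_nonneg_nonneg) auto
    then have "0 \<le> (q x * pos_sq' 1 (h x)) * (H i x)\<^sup>2" by simp
    ultimately show ?thesis by (simp only:)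
  qed
  have nn: "AE x in lebesgue_on \<Omega>. 0 \<le> (\<Sum>i\<in>UNIV. q x * H i x * \<Phi> i x)"
    using q(2) by eventually_elim (intro sum_nonneg, use pt in blast)
  have "0 \<le> dirichlet \<Omega> q H \<Phi>" unfolding dirichlet_def using nn by (rule integral_nonneg_AE)
  with d0 have "dirichlet \<Omega> q H \<Phi> = 0" by simp
  then have "AE x in lebesgue_on \<Omega>. (\<Sum>i\<in>UNIV. q x * H i x * \<Phi> i x) = 0"
    using integral_nonneg_eq_0_iff_AE[OF dirichlet_sum(1)[OF qH \<Phi>L] nn] by (simp add: dirichlet_def)
  then have "AE x in lebesgue_on \<Omega>. \<Phi> j x = 0"
    using q(2)
  proof eventually_elim
    case (elim x)
    have "\<forall>i\<in>UNIV. q x * H i x * \<Phi> i x = 0" using elim pt by (subst (asm) sum_nonneg_eq_0_iff) auto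
    then have "q x * H j x * \<Phi> j x = 0" by blast
    then have "H j x = 0 \<or> \<Phi> j x = 0" using elim(2) q(1) by auto
    then show ?case by (auto simp: \<Phi>_def)
  qed
  then have "AE x in lebesgue_on \<Omega>. \<phi> x = 0" by (rule W12_0_zero_derivative[OF \<Omega>(1,2) ph p0])
  then have "AE x in lebesgue_on \<Omega>. w x \<le> b * exp (l * R)"
    using AE_space
  proof eventually_elim
    case (elim x)
    then have "h x \<le> 0" using pos_sq_simps(6)[of 1 "h x"] by (simp add: \<phi>_def)
    then show ?case using v0(2)[of x] elim(2) by (simp add: h_def)
  qed
  then show ?thesis by blast
qed

lemma dirichlet_uminus: "dirichlet \<Omega> q (\<lambda>i x. - W i x) \<Phi> = - dirichlet \<Omega> q W \<Phi>"
  by (simp add: dirichlet_def sum_negf)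

lemma elliptic_bounded:
  fixes \<Omega> :: "(real^'d) set"
  assumes \<Omega>: "open \<Omega>" "bounded \<Omega>" "\<Omega> \<in> lmeasurable"
    and Q: "has_wgrad \<Omega> q Q" and q: "0 < lo" "AE x in lebesgue_on \<Omega>. lo \<le> q x \<and> q x \<le> hi"
    and Qb: "\<And>i. AE x in lebesgue_on \<Omega>. \<bar>Q i x\<bar> \<le> M"
    and F: "F \<in> Linf \<Omega>" and e: "elliptic_weak_solution \<Omega> q F w"
  shows "\<exists>B\<ge>0. AE x in lebesgue_on \<Omega>. \<bar>w x\<bar> \<le> B"
proof -
  obtain N where N: "0 \<le> N" "AE x in lebesgue_on \<Omega>. \<bar>F x\<bar> \<le> N" using Linf_bound(2)[OF F] by blast
  note FL = Linf_L2[OF F \<Omega>(3)]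
  note qm = L2_meas[OF wgradD(1)[OF Q]]
  have w0: "w \<in> W12_0 \<Omega>" using e by (simp add: elliptic_weak_solution_def)
  note W = W12_has_wgrad[OF \<Omega>(1) W12_0_W12[OF w0]]
  obtain B1 where B1: "AE x in lebesgue_on \<Omega>. w x \<le> B1"
    using elliptic_upper_bound[OF \<Omega> Q q Qb FL N(2,1) W w0 elliptic_weakD[OF \<Omega>(1) qm e W]] by blast
  have W': "has_wgrad \<Omega> (\<lambda>x. - w x) (\<lambda>i x. - weak_pd \<Omega> i w x)" using wgrad_cmult[OF W, of "-1"] by simp
  have w0': "(\<lambda>x. - w x) \<in> W12_0 \<Omega>"
    using W12_0_mult_W1inf[OF \<Omega>(1) W w0 wgrad_smooth[OF \<Omega> smooth_const[of "-1"]], of 1 0] by simp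
  have F': "(\<lambda>x. - F x) \<in> L2 \<Omega>" "AE x in lebesgue_on \<Omega>. \<bar>- F x\<bar> \<le> N" using L2_uminus[OF FL] N(2) by auto
  have "dirichlet \<Omega> q (\<lambda>i x. - weak_pd \<Omega> i w x) \<Phi> = (LINT x|lebesgue_on \<Omega>. - F x * \<phi> x)"
    if "has_wgrad \<Omega> \<phi> \<Phi>" "\<phi> \<in> W12_0 \<Omega>" for \<phi> \<Phi>
    using elliptic_weakD[OF \<Omega>(1) qm e W that] by (simp add: dirichlet_uminus)
  from elliptic_upper_bound[OF \<Omega> Q q Qb F' N(1) W' w0' this]
  obtain B2 where B2: "AE x in lebesgue_on \<Omega>. - w x \<le> B2" by blast
  have "AE x in lebesgue_on \<Omega>. \<bar>w x\<bar> \<le> max 0 (max B1 B2)"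
    using B1 B2 by eventually_elim linarith
  then show ?thesis by (intro exI[of _ "max 0 (max B1 B2)"]) simp
qed

subsection \<open>Reciprocals\<close>

text \<open>The reciprocal on \<open>[c, \<infinity>)\<close>, continued by its tangent at \<open>c\<close> to a function on the whole line with bounded
  continuous derivative.\<close>

definition recip :: "real \<Rightarrow> real \<Rightarrow> real" where
  "recip c s = (if s < c then 2 / c - s / c\<^sup>2 else 1 / s)"

definition recip' :: "real \<Rightarrow> real \<Rightarrow> real" where
  "recip' c s = - 1 / (max s c)\<^sup>2"

lemma recip_eq: "c \<le> s \<Longrightarrow> recip c s = 1 / s" "c \<le> s \<Longrightarrow> recip' c s = - 1 / s\<^sup>2"
  by (auto simp: recip_def recip'_def max_def)

lemma C1_bdd_recip:
  assumes c: "c > 0"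
  shows "C1_bdd (1 / c\<^sup>2) (recip c) (recip' c)"
  unfolding C1_bdd_def
proof (intro conjI allI)
  fix s :: real
  consider "s < c" | "s = c" | "s > c" by linarith
  then show "(recip c has_real_derivative recip' c s) (at s)"
  proof cases
    case 1
    have "((\<lambda>s. 2 / c - s / c\<^sup>2) has_real_derivative - 1 / c\<^sup>2) (at s)"
      using DERIV_diff[OF DERIV_const DERIV_cdivide[OF DERIV_ident]] by (rule DERIV_cong) simp
    then have "(recip c has_real_derivative - 1 / c\<^sup>2) (at s)"
      by (rule has_field_derivative_transform_within_open[where S="{..<c}"]) (use 1 in \<open>auto simp: recip_def\<close>)
    then show ?thesis using 1 by (simp add: recip'_def max_def)
  next
    case 2
    have q: "(recip c (c + h) - recip c c) / h = - 1 / (c * (c + max h 0))" if "h \<noteq> 0" for h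
    proof (cases "h < 0")
      case True
      then have "recip c (c + h) - recip c c = - h / c\<^sup>2"
        using c by (simp add: recip_def field_simps power2_eq_square)
      then show ?thesis using True by (simp add: power2_eq_square max_def)
    next
      case False
      then have h: "h > 0" using that by simp
      then have "recip c (c + h) - recip c c = - h / (c * (c + h))"
        using c by (simp add: recip_def field_simps)
      then show ?thesis using h by (simp add: max_def)
    qed
    have "((\<lambda>h. - 1 / (c * (c + max h 0))) \<longlongrightarrow> - 1 / (c * (c + max 0 0))) (at 0)"
      using c by (intro tendsto_intros) auto
    then have "((\<lambda>h. (recip c (c + h) - recip c c) / h) \<longlongrightarrow> - 1 / (c * (c + max 0 0))) (at 0)"
      by (rule Lim_transform_eventually) (auto simp: eventually_at_filter q)
    then show ?thesis using 2 by (simp add: DERIV_def recip'_def power2_eq_square)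
  next
    case 3
    have "((\<lambda>s. 1 / s) has_real_derivative - 1 / s\<^sup>2) (at s)"
      using 3 c by (auto intro!: derivative_eq_intros simp: power2_eq_square)
    then have "(recip c has_real_derivative - 1 / s\<^sup>2) (at s)"
      by (rule has_field_derivative_transform_within_open[where S="{c<..}"]) (use 3 in \<open>auto simp: recip_def\<close>)
    then show ?thesis using 3 by (simp add: recip'_def max_def)
  qed
  have "c\<^sup>2 \<le> (max s c)\<^sup>2" using c by (intro power_mono) auto
  then have "1 / (max s c)\<^sup>2 \<le> 1 / c\<^sup>2" using c by (intro divide_left_mono) (auto simp: max_def)
  then show "\<bar>recip' c s\<bar> \<le> 1 / c\<^sup>2" by (simp add: recip'_def)
next
  have "(max s c)\<^sup>2 \<noteq> 0" for s using c by (simp add: max_def)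
  then show "continuous_on UNIV (recip' c)" unfolding recip'_def by (intro continuous_intros) auto
qed

section \<open>Weighted stability\<close>

lemma adm_W12D:
  assumes "open \<Omega>" "a \<in> adm_W12 \<Omega> lo hi"
  shows "has_wgrad \<Omega> a (\<lambda>i. weak_pd \<Omega> i a)" "AE x in lebesgue_on \<Omega>. lo \<le> a x \<and> a x \<le> hi"
    "a \<in> borel_measurable (lebesgue_on \<Omega>)"
proof -
  show 1: "has_wgrad \<Omega> a (\<lambda>i. weak_pd \<Omega> i a)" and "AE x in lebesgue_on \<Omega>. lo \<le> a x \<and> a x \<le> hi"
    using assms W12_has_wgrad[OF assms(1)] by (auto simp: adm_W12_def)
  show "a \<in> borel_measurable (lebesgue_on \<Omega>)" by (rule L2_meas[OF wgradD(1)[OF 1]])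
qed

lemma norm_weak_grad_sq:
  "(norm (weak_grad \<Omega> w x))\<^sup>2 = (\<Sum>i\<in>UNIV. (weak_pd \<Omega> i w x)\<^sup>2)"
  unfolding power2_norm_eq_inner weak_grad_inner by (simp add: power2_eq_square)

text \<open>With \<open>\<psi> = (q - q') / q\<close>, testing the equation of \<open>w\<close> by \<open>\<psi> w\<close> and \<open>\<psi>\<^sup>2 w\<close> shows that the weighted
  integral is twice the integral of \<open>(q - q') \<nabla>w \<bullet> \<nabla>(\<psi> w)\<close>. The latter is controlled by the
  difference of the two equations, and \<open>\<psi> w\<close> is bounded in \<open>W\<^sup>1\<^sup>,\<^sup>2\<close> because \<open>w\<close> is bounded.\<close>

lemma weighted_stability:
  fixes \<Omega> :: "(real^'d) set" and lo hi C M A :: real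
  assumes \<Omega>: "open \<Omega>" "bounded \<Omega>" "\<Omega> \<in> lmeasurable" and lo: "0 < lo"
    and q: "q \<in> adm_W12 \<Omega> lo hi" "W12_norm \<Omega> q \<le> C" and q': "q' \<in> adm_W12 \<Omega> lo hi" "W12_norm \<Omega> q' \<le> C"
    and F: "F \<in> L2 \<Omega>" "F' \<in> L2 \<Omega>"
    and w: "elliptic_weak_solution \<Omega> q F w" "AE x in lebesgue_on \<Omega>. \<bar>w x\<bar> \<le> M"
    and w': "elliptic_weak_solution \<Omega> q' F' w'"
    and A: "A = (1 + hi / lo) * W12_norm \<Omega> w + M * (hi / lo\<^sup>2 * C + C / lo)"
  shows "integrable (lebesgue_on \<Omega>) (\<lambda>x. (q x - q' x)\<^sup>2 / (q x)\<^sup>2 * (q x * (norm (weak_grad \<Omega> w x))\<^sup>2 + F x * w x))"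
    "(LINT x|lebesgue_on \<Omega>. (q x - q' x)\<^sup>2 / (q x)\<^sup>2 * (q x * (norm (weak_grad \<Omega> w x))\<^sup>2 + F x * w x))
      \<le> 2 * A * (1 + CARD('d) * hi) * (W12_norm \<Omega> (\<lambda>x. w x - w' x) + L2_norm \<Omega> (\<lambda>x. F x - F' x))"
proof -
  note L = open_lebesgue[OF \<Omega>(1)]
  note Q = adm_W12D[OF \<Omega>(1) q(1)] and Q' = adm_W12D[OF \<Omega>(1) q'(1)]
  have C0: "0 \<le> C" using W12_norm_nonneg q(2) by (rule order_trans)
  have w0: "w \<in> W12_0 \<Omega>" and w0': "w' \<in> W12_0 \<Omega>" using w(1) w' by (auto simp: elliptic_weak_solution_def)
  define W where "W i = weak_pd \<Omega> i w" for i
  define W' where "W' i = weak_pd \<Omega> i w'" for i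
  have W: "has_wgrad \<Omega> w W" and W': "has_wgrad \<Omega> w' W'"
    unfolding W_def[abs_def] W'_def[abs_def] using W12_has_wgrad[OF \<Omega>(1) W12_0_W12] w0 w0' by auto
  \<comment> \<open>a version of \<open>1 / q\<close> to which the chain rule applies\<close>
  define \<kappa> where "\<kappa> x = recip lo (q x)" for x
  define K where "K i x = recip' lo (q x) * weak_pd \<Omega> i q x" for i x
  have \<kappa>: "has_wgrad \<Omega> \<kappa> K"
    unfolding \<kappa>_def[abs_def] K_def[abs_def] by (rule wgrad_comp[OF \<Omega>(1,3) Q(1) C1_bdd_recip[OF lo]])
  have \<kappa>b: "AE x in lebesgue_on \<Omega>. \<bar>\<kappa> x\<bar> \<le> 1 / lo"
    using Q(2) by eventually_elim (use lo in \<open>auto simp: \<kappa>_def recip_eq divide_simps\<close>)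
  have q'b: "AE x in lebesgue_on \<Omega>. \<bar>q' x\<bar> \<le> hi" using Q'(2) by eventually_elim (use lo in linarith)
  define \<psi> where "\<psi> x = 1 - q' x * \<kappa> x" for x
  define \<Psi> where "\<Psi> i x = - (q' x * K i x + \<kappa> x * weak_pd \<Omega> i q' x)" for i x
  have \<psi>: "has_wgrad \<Omega> \<psi> \<Psi>"
    using wgrad_diff[OF L wgrad_smooth[OF \<Omega> smooth_const[of 1]] wgrad_mult_bounded[OF \<Omega>(1) Q'(1) \<kappa> q'b \<kappa>b]]
    unfolding \<psi>_def[abs_def] \<Psi>_def[abs_def] by simp
  have \<psi>q: "AE x in lebesgue_on \<Omega>. lo \<le> q x \<and> q x \<le> hi \<and> \<psi> x = (q x - q' x) / q x"
    using Q(2) by eventually_elim (use lo in \<open>auto simp: \<psi>_def \<kappa>_def recip_eq diff_divide_distrib\<close>)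
  define P where "P = 1 + hi / lo"
  have \<psi>b: "AE x in lebesgue_on \<Omega>. \<bar>\<psi> x\<bar> \<le> P"
    using \<kappa>b q'b
  proof eventually_elim
    case (elim x)
    then have "\<bar>q' x\<bar> * \<bar>\<kappa> x\<bar> \<le> hi * (1 / lo)" by (intro mult_mono) auto
    then have "\<bar>q' x * \<kappa> x\<bar> \<le> hi / lo" by (simp add: abs_mult)
    then show ?case unfolding \<psi>_def P_def by linarith
  qed
  \<comment> \<open>\<open>hi\<close> is allowed to be negative, in which case the constraint on \<open>q\<close> makes \<open>\<Omega>\<close> a null set\<close>
  have hi_nonneg_or_null: "hi / lo \<ge> 0 \<or> (AE x in lebesgue_on \<Omega>. False)"
  proof (cases "hi \<ge> 0")
    case False
    have "AE x in lebesgue_on \<Omega>. False" using Q(2) by eventually_elim (use False lo in linarith)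
    then show ?thesis by blast
  qed (use lo in simp)
  define \<phi> where "\<phi> x = \<psi> x * w x" for x
  define \<Phi> where "\<Phi> i x = \<psi> x * W i x + w x * \<Psi> i x" for i x
  have \<phi>: "has_wgrad \<Omega> \<phi> \<Phi>"
    unfolding \<phi>_def[abs_def] \<Phi>_def[abs_def] by (rule wgrad_mult_bounded[OF \<Omega>(1) \<psi> W \<psi>b w(2)])
  have \<phi>0: "\<phi> \<in> W12_0 \<Omega>"
    unfolding \<phi>_def[abs_def] by (rule W12_0_mult_bounded[OF \<Omega>(1,3) \<psi> \<psi>b W w0 w(2)])
  have \<phi>b: "AE x in lebesgue_on \<Omega>. \<bar>\<phi> x\<bar> \<le> P * M"
    using \<psi>b w(2)
  proof eventually_elim
    case (elim x)
    then show ?case unfolding \<phi>_def abs_mult by (intro mult_mono) auto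
  qed
  define \<phi>2 where "\<phi>2 x = \<psi> x * \<phi> x" for x
  define \<Phi>2 where "\<Phi>2 i x = \<psi> x * \<Phi> i x + \<phi> x * \<Psi> i x" for i x
  have \<phi>2: "has_wgrad \<Omega> \<phi>2 \<Phi>2"
    unfolding \<phi>2_def[abs_def] \<Phi>2_def[abs_def] by (rule wgrad_mult_bounded[OF \<Omega>(1) \<psi> \<phi> \<psi>b \<phi>b])
  have \<phi>20: "\<phi>2 \<in> W12_0 \<Omega>"
    unfolding \<phi>2_def[abs_def] by (rule W12_0_mult_bounded[OF \<Omega>(1,3) \<psi> \<psi>b \<phi> \<phi>0 \<phi>b])
  note \<psi>m = L2_meas[OF wgradD(1)[OF \<psi>]]
  have \<psi>W: "(\<lambda>x. \<psi> x * W i x) \<in> L2 \<Omega>" for i by (rule L2_bdd_mult[OF \<psi>m \<psi>b wgradD(2)[OF W]])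
  have q\<psi>W: "(\<lambda>x. q x * (\<psi> x * W i x)) \<in> L2 \<Omega>" for i by (rule L2_coeff_mult[OF Q(3,2) \<psi>W])
  have qW: "(\<lambda>x. q x * W i x) \<in> L2 \<Omega>" for i by (rule L2_coeff_mult[OF Q(3,2) wgradD(2)[OF W]])
  have q'W: "(\<lambda>x. q' x * W i x) \<in> L2 \<Omega>" for i by (rule L2_coeff_mult[OF Q'(3,2) wgradD(2)[OF W]])
  have q'W': "(\<lambda>x. q' x * W' i x) \<in> L2 \<Omega>" for i by (rule L2_coeff_mult[OF Q'(3,2) wgradD(2)[OF W']])
  \<comment> \<open>the weighted integrand, and a representative of it whose integrability is that of \<open>L\<^sup>2\<close> products\<close>
  define J where "J x = (q x - q' x)\<^sup>2 / (q x)\<^sup>2 * (q x * (norm (weak_grad \<Omega> w x))\<^sup>2 + F x * w x)" for x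
  define J' where "J' x = (\<Sum>i\<in>UNIV. (q x * (\<psi> x * W i x)) * (\<psi> x * W i x)) + F x * \<phi>2 x" for x
  have J'i: "integrable (lebesgue_on \<Omega>) J'"
    unfolding J'_def[abs_def]
    by (intro Bochner_Integration.integrable_add Bochner_Integration.integrable_sum L2_mult_integrable q\<psi>W \<psi>W F(1) wgradD(1)[OF \<phi>2])
  have JJ': "AE x in lebesgue_on \<Omega>. J' x = J x"
    using \<psi>q
  proof eventually_elim
    case (elim x)
    have "J x = (\<psi> x)\<^sup>2 * (q x * (\<Sum>i\<in>UNIV. (W i x)\<^sup>2) + F x * w x)"
      using elim unfolding J_def norm_weak_grad_sq W_def by (simp add: power_divide)
    then show ?case
      by (simp add: J'_def \<phi>2_def \<phi>_def distrib_left sum_distrib_left power2_eq_square mult_ac)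
  qed
  have Jm: "J \<in> borel_measurable (lebesgue_on \<Omega>)" by (rule meas_cong_AE[OF L borel_measurable_integrable[OF J'i] JJ'])
  have Ji: "integrable (lebesgue_on \<Omega>) J" by (rule integrable_cong_AE_imp[OF J'i Jm JJ'])
  then show "integrable (lebesgue_on \<Omega>) (\<lambda>x. (q x - q' x)\<^sup>2 / (q x)\<^sup>2 * (q x * (norm (weak_grad \<Omega> w x))\<^sup>2 + F x * w x))"
    by (simp add: J_def[abs_def])
  have I1: "dirichlet \<Omega> q W \<Phi>2 = (LINT x|lebesgue_on \<Omega>. F x * \<phi>2 x)" by (rule elliptic_weakD[OF \<Omega>(1) Q(3) w(1) W \<phi>2 \<phi>20])
  have I2: "dirichlet \<Omega> q W \<Phi> = (LINT x|lebesgue_on \<Omega>. F x * \<phi> x)" by (rule elliptic_weakD[OF \<Omega>(1) Q(3) w(1) W \<phi> \<phi>0])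
  have I3: "dirichlet \<Omega> q' W' \<Phi> = (LINT x|lebesgue_on \<Omega>. F' x * \<phi> x)" by (rule elliptic_weakD[OF \<Omega>(1) Q'(3) w' W' \<phi> \<phi>0])
  \<comment> \<open>\<open>2 \<psi> \<nabla>w \<bullet> \<nabla>(\<psi> w) = \<nabla>w \<bullet> \<nabla>(\<psi>\<^sup>2 w) + \<psi>\<^sup>2 \<bar>\<nabla>w\<bar>\<^sup>2\<close> is the reason for the choice of test functions\<close>
  define D where "D = (\<lambda>i x. \<psi> x * W i x)"
  have qD: "(\<lambda>x. q x * D i x) \<in> L2 \<Omega>" and DL: "D i \<in> L2 \<Omega>" for i using q\<psi>W \<psi>W by (simp_all add: D_def)
  have "2 * dirichlet \<Omega> q D \<Phi> = dirichlet \<Omega> q W \<Phi>2 + dirichlet \<Omega> q D D"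
  proof -
    have "2 * dirichlet \<Omega> q D \<Phi> = (LINT x|lebesgue_on \<Omega>. 2 * (\<Sum>i\<in>UNIV. (q x * D i x) * \<Phi> i x))"
      by (simp add: dirichlet_def)
    also have "\<dots> = (LINT x|lebesgue_on \<Omega>. (\<Sum>i\<in>UNIV. (q x * W i x) * \<Phi>2 i x) + (\<Sum>i\<in>UNIV. (q x * D i x) * D i x))"
      by (rule Bochner_Integration.integral_cong)
         (auto simp: D_def \<Phi>_def \<Phi>2_def \<phi>_def sum.distrib[symmetric] sum_distrib_left algebra_simps intro!: sum.cong)
    also have "\<dots> = dirichlet \<Omega> q W \<Phi>2 + dirichlet \<Omega> q D D"
      unfolding dirichlet_def
      by (rule Bochner_Integration.integral_add[OF dirichlet_sum(1)[OF qW wgradD(2)[OF \<phi>2]] dirichlet_sum(1)[OF qD DL]])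
    finally show ?thesis .
  qed
  also have "\<dots> = (LINT x|lebesgue_on \<Omega>. J' x)"
    unfolding I1 unfolding J'_def dirichlet_def D_def
    by (subst Bochner_Integration.integral_add)
       (auto intro!: Bochner_Integration.integrable_sum L2_mult_integrable q\<psi>W \<psi>W F(1) wgradD(1)[OF \<phi>2])
  also have "\<dots> = (LINT x|lebesgue_on \<Omega>. J x)"
    by (rule integral_cong_AE[OF borel_measurable_integrable[OF J'i] Jm JJ'])
  finally have J2: "(LINT x|lebesgue_on \<Omega>. J x) = 2 * dirichlet \<Omega> q D \<Phi>" by simp
  \<comment> \<open>\<open>q \<psi> = q - q'\<close> splits the form into one for each coefficient, to which the two equations apply\<close>
  have "dirichlet \<Omega> q D \<Phi> = (LINT x|lebesgue_on \<Omega>. (\<Sum>i\<in>UNIV. (q x * W i x) * \<Phi> i x) - (\<Sum>i\<in>UNIV. (q' x * W i x) * \<Phi> i x))"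
    unfolding dirichlet_def
  proof (rule integral_cong_AE)
    note [measurable] = L2_meas[OF qD] L2_meas[OF qW] L2_meas[OF q'W] L2_meas[OF wgradD(2)[OF \<phi>]]
    show "(\<lambda>x. \<Sum>i\<in>UNIV. q x * D i x * \<Phi> i x) \<in> borel_measurable (lebesgue_on \<Omega>)"
      "(\<lambda>x. (\<Sum>i\<in>UNIV. q x * W i x * \<Phi> i x) - (\<Sum>i\<in>UNIV. q' x * W i x * \<Phi> i x)) \<in> borel_measurable (lebesgue_on \<Omega>)"
      by measurable
    show "AE x in lebesgue_on \<Omega>. (\<Sum>i\<in>UNIV. q x * D i x * \<Phi> i x)
       = (\<Sum>i\<in>UNIV. q x * W i x * \<Phi> i x) - (\<Sum>i\<in>UNIV. q' x * W i x * \<Phi> i x)"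
      using \<psi>q
    proof eventually_elim
      case (elim x)
      then have "q x * \<psi> x = q x - q' x" using lo by simp
      then have "q x * D i x = q x * W i x - q' x * W i x" for i
        unfolding D_def by (metis left_diff_distrib mult.assoc)
      then show ?case by (simp add: left_diff_distrib sum_subtractf)
    qed
  qed
  also have "\<dots> = dirichlet \<Omega> q W \<Phi> - dirichlet \<Omega> q' W \<Phi>"
    unfolding dirichlet_def
    by (rule Bochner_Integration.integral_diff[OF dirichlet_sum(1)[OF qW wgradD(2)[OF \<phi>]] dirichlet_sum(1)[OF q'W wgradD(2)[OF \<phi>]]])
  also have "\<dots> = (LINT x|lebesgue_on \<Omega>. (F x - F' x) * \<phi> x) - (dirichlet \<Omega> q' W \<Phi> - dirichlet \<Omega> q' W' \<Phi>)"
    using L2_mult_integrable[OF F(1) wgradD(1)[OF \<phi>]] L2_mult_integrable[OF F(2) wgradD(1)[OF \<phi>]]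
    by (simp add: I2 I3 left_diff_distrib)
  also have "dirichlet \<Omega> q' W \<Phi> - dirichlet \<Omega> q' W' \<Phi> = (\<Sum>i\<in>UNIV. LINT x|lebesgue_on \<Omega>. (q' x * (W i x - W' i x)) * \<Phi> i x)"
    unfolding dirichlet_sum(2)[OF q'W wgradD(2)[OF \<phi>]] dirichlet_sum(2)[OF q'W' wgradD(2)[OF \<phi>]] sum_subtractf[symmetric]
  proof (rule sum.cong)
    fix i
    show "(LINT x|lebesgue_on \<Omega>. q' x * W i x * \<Phi> i x) - (LINT x|lebesgue_on \<Omega>. q' x * W' i x * \<Phi> i x)
        = (LINT x|lebesgue_on \<Omega>. q' x * (W i x - W' i x) * \<Phi> i x)"
      using L2_mult_integrable[OF q'W wgradD(2)[OF \<phi>], of i i] L2_mult_integrable[OF q'W' wgradD(2)[OF \<phi>], of i i]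
      by (simp add: right_diff_distrib left_diff_distrib)
  qed simp
  finally have key: "dirichlet \<Omega> q D \<Phi> = (LINT x|lebesgue_on \<Omega>. (F x - F' x) * \<phi> x)
     - (\<Sum>i\<in>UNIV. LINT x|lebesgue_on \<Omega>. (q' x * (W i x - W' i x)) * \<Phi> i x)" .
  \<comment> \<open>it remains to estimate both terms by the Cauchy-Schwarz inequality, \<open>A\<close> being a bound for \<open>\<psi> w\<close> and its derivatives in \<open>L\<^sup>2\<close>\<close>
  define E where "E = W12_norm \<Omega> (\<lambda>x. w x - w' x)"
  define G where "G = L2_norm \<Omega> (\<lambda>x. F x - F' x)"
  have dW: "has_wgrad \<Omega> (\<lambda>x. w x - w' x) (\<lambda>i x. W i x - W' i x)" by (rule wgrad_diff[OF L W W'])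
  have E: "L2_norm \<Omega> (\<lambda>x. W i x - W' i x) \<le> E" "0 \<le> E" for i
    unfolding E_def using L2_norm_le_W12_norm(2)[OF \<Omega>(1) dW] W12_norm_nonneg by auto
  have G0: "0 \<le> G" unfolding G_def by (rule L2_norm_nonneg)
  show "(LINT x|lebesgue_on \<Omega>. (q x - q' x)\<^sup>2 / (q x)\<^sup>2 * (q x * (norm (weak_grad \<Omega> w x))\<^sup>2 + F x * w x))
      \<le> 2 * A * (1 + CARD('d) * hi) * (W12_norm \<Omega> (\<lambda>x. w x - w' x) + L2_norm \<Omega> (\<lambda>x. F x - F' x))"
  proof (cases "AE x in lebesgue_on \<Omega>. False")
    case True
    \<comment> \<open>on a null set \<open>hi\<close> and \<open>M\<close> may be negative, but both sides of the inequality are 0\<close>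
    have z: "(LINT x|lebesgue_on \<Omega>. f x) = 0" for f :: "real^'d \<Rightarrow> real"
      by (rule integral_eq_zero_AE) (use True in \<open>auto elim: eventually_mono\<close>)
    have "G = 0" unfolding G_def L2_norm_def z by simp
    moreover have "E = 0" unfolding E_def W12_norm_eq[OF \<Omega>(1) dW] L2_norm_def z by simp
    ultimately show ?thesis unfolding z by (simp add: E_def G_def)
  next
    case False
    have hi: "0 \<le> hi" and M: "0 \<le> M"
    proof -
      show "0 \<le> hi" using False hi_nonneg_or_null lo by (simp add: zero_le_divide_iff)
      show "0 \<le> M"
      proof (rule ccontr)
        assume "\<not> 0 \<le> M"
        have "AE x in lebesgue_on \<Omega>. False" using w(2) by eventually_elim (use \<open>\<not> 0 \<le> M\<close> in linarith)
        with False show False by blast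
      qed
    qed
    have P0: "0 \<le> P" using hi lo by (simp add: P_def)
    have \<phi>n: "L2_norm \<Omega> \<phi> \<le> P * W12_norm \<Omega> w"
    proof -
      have "L2_norm \<Omega> \<phi> \<le> P * L2_norm \<Omega> w"
        by (rule L2_norm_mono[OF wgradD(1)[OF W] L2_meas[OF wgradD(1)[OF \<phi>]] _ P0])
           (use \<psi>b in \<open>auto simp: \<phi>_def abs_mult elim!: eventually_mono intro: mult_right_mono\<close>)
      also have "\<dots> \<le> P * W12_norm \<Omega> w" using P0 L2_norm_le_W12_norm(1)[OF \<Omega>(1) W] by (rule mult_left_mono[rotated])
      finally show ?thesis .
    qed
    have wm: "w \<in> borel_measurable (lebesgue_on \<Omega>)" by (rule L2_meas[OF wgradD(1)[OF W]])
    have \<kappa>m: "\<kappa> \<in> borel_measurable (lebesgue_on \<Omega>)" by (rule L2_meas[OF wgradD(1)[OF \<kappa>]])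
    have \<Psi>n: "L2_norm \<Omega> (\<Psi> i) \<le> hi / lo\<^sup>2 * C + C / lo" for i
    proof -
      have KL: "K i \<in> L2 \<Omega>" by (rule wgradD(2)[OF \<kappa>])
      have a: "(\<lambda>x. q' x * K i x) \<in> L2 \<Omega>" by (rule L2_bdd_mult[OF Q'(3) q'b KL])
      have b: "(\<lambda>x. \<kappa> x * weak_pd \<Omega> i q' x) \<in> L2 \<Omega>" by (rule L2_bdd_mult[OF \<kappa>m \<kappa>b wgradD(2)[OF Q'(1)]])
      have "L2_norm \<Omega> (\<lambda>x. q' x * K i x) \<le> (hi / lo\<^sup>2) * L2_norm \<Omega> (weak_pd \<Omega> i q)"
      proof (rule L2_norm_mono[OF wgradD(2)[OF Q(1)] L2_meas[OF a]])
        show "AE x in lebesgue_on \<Omega>. \<bar>q' x * K i x\<bar> \<le> (hi / lo\<^sup>2) * \<bar>weak_pd \<Omega> i q x\<bar>"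
          using q'b
        proof eventually_elim
          case (elim x)
          have "\<bar>q' x\<bar> * \<bar>recip' lo (q x)\<bar> \<le> hi * (1 / lo\<^sup>2)"
            using elim C1_bddD(3)[OF C1_bdd_recip[OF lo]] by (intro mult_mono) auto
          then have "\<bar>q' x\<bar> * \<bar>recip' lo (q x)\<bar> * \<bar>weak_pd \<Omega> i q x\<bar> \<le> hi * (1 / lo\<^sup>2) * \<bar>weak_pd \<Omega> i q x\<bar>"
            by (rule mult_right_mono) simp
          then show ?case by (simp add: K_def abs_mult)
        qed
        show "0 \<le> hi / lo\<^sup>2" using hi by simp
      qed
      also have "\<dots> \<le> (hi / lo\<^sup>2) * C"
        using hi L2_norm_le_W12_norm(2)[OF \<Omega>(1) Q(1), of i] q(2) by (intro mult_left_mono) auto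
      finally have 1: "L2_norm \<Omega> (\<lambda>x. q' x * K i x) \<le> (hi / lo\<^sup>2) * C" .
      have "L2_norm \<Omega> (\<lambda>x. \<kappa> x * weak_pd \<Omega> i q' x) \<le> (1 / lo) * L2_norm \<Omega> (weak_pd \<Omega> i q')"
        by (rule L2_norm_mono[OF wgradD(2)[OF Q'(1)] L2_meas[OF b]])
           (use \<kappa>b lo in \<open>auto simp: abs_mult elim!: eventually_mono dest: mult_right_mono[of _ _ "\<bar>weak_pd \<Omega> i q' _\<bar>"]\<close>)
      also have "\<dots> \<le> (1 / lo) * C"
        using lo L2_norm_le_W12_norm(2)[OF \<Omega>(1) Q'(1), of i] q'(2) by (intro mult_left_mono) auto
      finally have 2: "L2_norm \<Omega> (\<lambda>x. \<kappa> x * weak_pd \<Omega> i q' x) \<le> C / lo" by simp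
      have "L2_norm \<Omega> (\<Psi> i) = L2_norm \<Omega> (\<lambda>x. (-1) * (q' x * K i x + \<kappa> x * weak_pd \<Omega> i q' x))"
        by (simp add: \<Psi>_def[abs_def])
      also have "\<dots> = L2_norm \<Omega> (\<lambda>x. q' x * K i x + \<kappa> x * weak_pd \<Omega> i q' x)"
        unfolding L2_norm_cmult by simp
      also have "\<dots> \<le> hi / lo\<^sup>2 * C + C / lo" using L2_norm_triangle[OF a b] 1 2 by linarith
      finally show ?thesis .
    qed
    have \<Phi>n: "L2_norm \<Omega> (\<Phi> i) \<le> A" for i
    proof -
      have w\<Psi>: "(\<lambda>x. w x * \<Psi> i x) \<in> L2 \<Omega>" by (rule L2_bdd_mult[OF wm w(2) wgradD(2)[OF \<psi>]])
      have "L2_norm \<Omega> (\<lambda>x. \<psi> x * W i x) \<le> P * L2_norm \<Omega> (W i)"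
        by (rule L2_norm_mono[OF wgradD(2)[OF W] L2_meas[OF \<psi>W] _ P0])
           (use \<psi>b in \<open>auto simp: abs_mult elim!: eventually_mono intro: mult_right_mono\<close>)
      also have "\<dots> \<le> P * W12_norm \<Omega> w" using P0 L2_norm_le_W12_norm(2)[OF \<Omega>(1) W] by (rule mult_left_mono[rotated])
      finally have 1: "L2_norm \<Omega> (\<lambda>x. \<psi> x * W i x) \<le> P * W12_norm \<Omega> w" .
      have "L2_norm \<Omega> (\<lambda>x. w x * \<Psi> i x) \<le> M * L2_norm \<Omega> (\<Psi> i)"
        by (rule L2_norm_mono[OF wgradD(2)[OF \<psi>] L2_meas[OF w\<Psi>] _ M])
           (use w(2) in \<open>auto simp: abs_mult elim!: eventually_mono intro: mult_right_mono\<close>)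
      also have "\<dots> \<le> M * (hi / lo\<^sup>2 * C + C / lo)" using M \<Psi>n by (rule mult_left_mono[rotated])
      finally have 2: "L2_norm \<Omega> (\<lambda>x. w x * \<Psi> i x) \<le> M * (hi / lo\<^sup>2 * C + C / lo)" .
      show ?thesis
        using L2_norm_triangle[OF \<psi>W w\<Psi>, of i] 1 2 unfolding A \<Phi>_def[abs_def] P_def by linarith
    qed
    have A0: "0 \<le> A" using \<Phi>n L2_norm_nonneg order_trans by blast
    have \<phi>A: "L2_norm \<Omega> \<phi> \<le> A"
    proof -
      have "0 \<le> M * (hi / lo\<^sup>2 * C + C / lo)" using M hi C0 lo by simp
      then show ?thesis using \<phi>n unfolding A P_def by linarith
    qed
    have t1: "\<bar>LINT x|lebesgue_on \<Omega>. (F x - F' x) * \<phi> x\<bar> \<le> G * A"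
      unfolding G_def using L2_Cauchy_Schwarz[OF L2_diff[OF F] wgradD(1)[OF \<phi>]] mult_left_mono[OF \<phi>A L2_norm_nonneg]
      by (rule order_trans)
    have t2: "\<bar>LINT x|lebesgue_on \<Omega>. (q' x * (W i x - W' i x)) * \<Phi> i x\<bar> \<le> (hi * E) * A" for i
    proof -
      have a: "(\<lambda>x. q' x * (W i x - W' i x)) \<in> L2 \<Omega>" by (rule L2_bdd_mult[OF Q'(3) q'b wgradD(2)[OF dW]])
      have "L2_norm \<Omega> (\<lambda>x. q' x * (W i x - W' i x)) \<le> hi * L2_norm \<Omega> (\<lambda>x. W i x - W' i x)"
        by (rule L2_norm_mono[where B=hi, OF wgradD(2)[OF dW] L2_meas[OF a]])
           (use q'b hi in \<open>auto simp: abs_mult elim!: eventually_mono intro: mult_right_mono\<close>)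
      also have "\<dots> \<le> hi * E" using hi E(1) by (intro mult_left_mono)
      finally have b: "L2_norm \<Omega> (\<lambda>x. q' x * (W i x - W' i x)) \<le> hi * E" .
      have "\<bar>LINT x|lebesgue_on \<Omega>. (q' x * (W i x - W' i x)) * \<Phi> i x\<bar>
          \<le> L2_norm \<Omega> (\<lambda>x. q' x * (W i x - W' i x)) * L2_norm \<Omega> (\<Phi> i)"
        by (rule L2_Cauchy_Schwarz[OF a wgradD(2)[OF \<phi>]])
      also have "\<dots> \<le> (hi * E) * A" using b \<Phi>n hi E(2) by (intro mult_mono) (auto simp: L2_norm_nonneg)
      finally show ?thesis .
    qed
    have "\<bar>\<Sum>i\<in>UNIV. LINT x|lebesgue_on \<Omega>. (q' x * (W i x - W' i x)) * \<Phi> i x\<bar> \<le> (\<Sum>i\<in>(UNIV::'d set). (hi * E) * A)"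
      by (rule order_trans[OF sum_abs sum_mono[OF t2]])
    also have "\<dots> = CARD('d) * hi * E * A" by simp
    finally have t3: "\<bar>\<Sum>i\<in>UNIV. LINT x|lebesgue_on \<Omega>. (q' x * (W i x - W' i x)) * \<Phi> i x\<bar> \<le> CARD('d) * hi * E * A" .
    have "(LINT x|lebesgue_on \<Omega>. J x) \<le> 2 * (G * A + CARD('d) * hi * E * A)"
    proof -
      have "2 * (a - b) \<le> 2 * (x + y)" if "\<bar>a\<bar> \<le> x" "\<bar>b\<bar> \<le> y" for a b x y :: real
        using abs_le_D1[OF that(1)] abs_le_D2[OF that(2)] by simp
      from this[OF t1 t3] show ?thesis unfolding J2 key .
    qed
    also have "\<dots> \<le> 2 * A * (1 + CARD('d) * hi) * (E + G)"
    proof -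
      have "0 \<le> 2 * A * (E + CARD('d) * hi * G)" using A0 E(2) hi G0 by simp
      then show ?thesis by (simp add: algebra_simps)
    qed
    finally show ?thesis by (simp add: J_def E_def G_def)
  qed
qed

section \<open>The quotient of two snapshots\<close>

lemma W1inf_has_wgrad:
  fixes f :: "real^'d \<Rightarrow> real"
  assumes \<Omega>: "\<Omega> \<in> lmeasurable" and f: "f \<in> W1inf \<Omega>"
  shows "\<exists>G B. has_wgrad \<Omega> f G \<and> 0 \<le> B \<and> (\<forall>i. AE x in lebesgue_on \<Omega>. \<bar>G i x\<bar> \<le> B)"
proof -
  have f': "f \<in> Linf \<Omega>" "\<forall>i. \<exists>h\<in>Linf \<Omega>. is_weak_pd \<Omega> i f h" using f by (auto simp: One_nat_def)
  then obtain G where G: "\<And>i. G i \<in> Linf \<Omega>" "\<And>i. is_weak_pd \<Omega> i f (G i)" by metis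
  obtain B where B: "\<And>i. 0 \<le> B i" "\<And>i. AE x in lebesgue_on \<Omega>. \<bar>G i x\<bar> \<le> B i"
    using Linf_bound(2)[OF G(1)] by metis
  have le: "B i \<le> (\<Sum>i\<in>UNIV. B i)" for i using B(1) by (intro member_le_sum) auto
  have "AE x in lebesgue_on \<Omega>. \<bar>G i x\<bar> \<le> (\<Sum>i\<in>UNIV. B i)" for i
    using B(2)[of i] by eventually_elim (rule order_trans[OF _ le])
  moreover have "has_wgrad \<Omega> f G"
    unfolding has_wgrad_def using Linf_L2[OF f'(1) \<Omega>] Linf_L2[OF G(1) \<Omega>] G(2) by blast
  moreover have "0 \<le> (\<Sum>i\<in>UNIV. B i)" using B(1) by (rule sum_nonneg)
  ultimately show ?thesis by blast
qed

lemma wgrad_const: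
  assumes "open \<Omega>" "bounded \<Omega>" "\<Omega> \<in> lmeasurable"
  shows "has_wgrad \<Omega> (\<lambda>x. c) (\<lambda>i x. 0)"
  using wgrad_smooth[OF assms smooth_const[of c]] by simp

lemma W12_0_cmult:
  fixes f :: "real^'d \<Rightarrow> real"
  assumes \<Omega>: "open \<Omega>" "bounded \<Omega>" "\<Omega> \<in> lmeasurable" and f: "f \<in> W12_0 \<Omega>"
  shows "(\<lambda>x. c * f x) \<in> W12_0 \<Omega>"
  by (rule W12_0_mult_W1inf[OF \<Omega>(1) W12_has_wgrad[OF \<Omega>(1) W12_0_W12[OF f]] f wgrad_const[OF \<Omega>], of c "\<bar>c\<bar>" 0]) auto

lemma W12_0_diff:
  fixes f g :: "real^'d \<Rightarrow> real"
  assumes \<Omega>: "open \<Omega>" "bounded \<Omega>" "\<Omega> \<in> lmeasurable" and f: "f \<in> W12_0 \<Omega>" and g: "g \<in> W12_0 \<Omega>"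
  shows "(\<lambda>x. f x - g x) \<in> W12_0 \<Omega>"
  using W12_0_add[OF \<Omega>(1) f W12_0_cmult[OF \<Omega> g, of "-1"]] by simp

text \<open>The two functions may use different extensions of the boundary values; these differ by a continuous
  function that vanishes on the boundary.\<close>

lemma same_trace_diff:
  fixes u v :: "real^'d \<Rightarrow> real"
  assumes \<Omega>: "open \<Omega>" "bounded \<Omega>" "\<Omega> \<in> lmeasurable" and u: "has_trace \<Omega> u g" and v: "has_trace \<Omega> v g"
  shows "(\<lambda>x. v x - u x) \<in> W12_0 \<Omega>"
proof -
  obtain G where G: "G \<in> W12 \<Omega>" "continuous_on (closure \<Omega>) G" "\<forall>x\<in>frontier \<Omega>. G x = g x" "(\<lambda>x. u x - G x) \<in> W12_0 \<Omega>"
    using u by (auto simp: has_trace_def)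
  obtain H where H: "H \<in> W12 \<Omega>" "continuous_on (closure \<Omega>) H" "\<forall>x\<in>frontier \<Omega>. H x = g x" "(\<lambda>x. v x - H x) \<in> W12_0 \<Omega>"
    using v by (auto simp: has_trace_def)
  have HG: "(\<lambda>x. H x - G x) \<in> W12_0 \<Omega>"
    by (rule W12_0_continuous_vanishing[OF \<Omega> wgrad_diff[OF open_lebesgue[OF \<Omega>(1)] W12_has_wgrad[OF \<Omega>(1) H(1)] W12_has_wgrad[OF \<Omega>(1) G(1)]]])
       (use G(2,3) H(2,3) in \<open>auto intro: continuous_on_diff\<close>)
  have "(\<lambda>x. (v x - H x) - (u x - G x) + (H x - G x)) \<in> W12_0 \<Omega>"
    by (rule W12_0_add[OF \<Omega>(1) W12_0_diff[OF \<Omega> H(4) G(4)] HG])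
  then show ?thesis by (simp add: algebra_simps)
qed

text \<open>The equation at a fixed time with the time derivative moved to the right. The factor \<open>v\<close> of the test
  function will be the solution at the other time.\<close>

lemma slice_tested:
  fixes u v :: "real^'d \<Rightarrow> real"
  assumes \<Omega>: "open \<Omega>" and D: "D \<in> borel_measurable (lebesgue_on \<Omega>)" "AE x in lebesgue_on \<Omega>. lo \<le> D x \<and> D x \<le> hi"
    and s: "s \<in> borel_measurable (lebesgue_on \<Omega>)" "AE x in lebesgue_on \<Omega>. \<bar>s x\<bar> \<le> S"
    and L: "ut \<in> L2 \<Omega>" "f \<in> L2 \<Omega>" and u: "has_wgrad \<Omega> u U" and v: "has_wgrad \<Omega> v V" and \<phi>: "\<phi> \<in> test_functions \<Omega>"
    and eq: "\<And>\<phi>. \<phi> \<in> W12_0 \<Omega> \<Longrightarrow>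
           (LINT x|lebesgue_on \<Omega>. ut x * \<phi> x + D x * (weak_grad \<Omega> u x \<bullet> weak_grad \<Omega> \<phi> x) + s x * u x * \<phi> x)
           = (LINT x|lebesgue_on \<Omega>. f x * \<phi> x)"
  shows "dirichlet \<Omega> D U (\<lambda>i x. v x * pd i \<phi> x + \<phi> x * V i x) + (LINT x|lebesgue_on \<Omega>. s x * u x * (v x * \<phi> x))
    = (LINT x|lebesgue_on \<Omega>. (f x - ut x) * (v x * \<phi> x))"
    and "integrable (lebesgue_on \<Omega>) (\<lambda>x. s x * u x * (v x * \<phi> x))"
proof -
  define \<Phi> where "\<Phi> = (\<lambda>i x. v x * pd i \<phi> x + \<phi> x * V i x)"
  have \<Phi>: "has_wgrad \<Omega> (\<lambda>x. v x * \<phi> x) \<Phi>" and W: "(\<lambda>x. v x * \<phi> x) \<in> W12_0 \<Omega>"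
    unfolding \<Phi>_def by (rule wgrad_mult_test[OF \<Omega> v \<phi>])+
  have DU: "(\<lambda>x. D x * U i x) \<in> L2 \<Omega>" for i by (rule L2_coeff_mult[OF D wgradD(2)[OF u]])
  have su: "(\<lambda>x. s x * u x) \<in> L2 \<Omega>" by (rule L2_bdd_mult[OF s wgradD(1)[OF u]])
  note vL = wgradD(1)[OF \<Phi>]
  note i1 = L2_mult_integrable[OF L(1) vL] and i2 = dirichlet_sum(1)[OF DU wgradD(2)[OF \<Phi>]]
    and i3 = L2_mult_integrable[OF su vL] and i4 = L2_mult_integrable[OF L(2) vL]
  show "integrable (lebesgue_on \<Omega>) (\<lambda>x. s x * u x * (v x * \<phi> x))" by (rule i3)
  have i12: "integrable (lebesgue_on \<Omega>) (\<lambda>x. ut x * (v x * \<phi> x) + (\<Sum>i\<in>UNIV. D x * U i x * \<Phi> i x))"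
    using i1 i2 by (rule Bochner_Integration.integrable_add)
  have "(LINT x|lebesgue_on \<Omega>. f x * (v x * \<phi> x)) =
     (LINT x|lebesgue_on \<Omega>. ut x * (v x * \<phi> x) + D x * (weak_grad \<Omega> u x \<bullet> weak_grad \<Omega> (\<lambda>x. v x * \<phi> x) x) + s x * u x * (v x * \<phi> x))"
    by (rule eq[OF W, symmetric])
  also have "\<dots> = (LINT x|lebesgue_on \<Omega>. ut x * (v x * \<phi> x) + (\<Sum>i\<in>UNIV. D x * U i x * \<Phi> i x) + s x * u x * (v x * \<phi> x))"
  proof -
    have ae: "AE x in lebesgue_on \<Omega>. ut x * (v x * \<phi> x) + (\<Sum>i\<in>UNIV. D x * U i x * \<Phi> i x) + s x * u x * (v x * \<phi> x)
       = ut x * (v x * \<phi> x) + D x * (weak_grad \<Omega> u x \<bullet> weak_grad \<Omega> (\<lambda>x. v x * \<phi> x) x) + s x * u x * (v x * \<phi> x)"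
      using weak_grad_AE[OF \<Omega> u] weak_grad_AE[OF \<Omega> \<Phi>]
      by eventually_elim (simp add: weak_grad_inner sum_distrib_left mult.assoc)
    have i: "integrable (lebesgue_on \<Omega>) (\<lambda>x. ut x * (v x * \<phi> x) + (\<Sum>i\<in>UNIV. D x * U i x * \<Phi> i x) + s x * u x * (v x * \<phi> x))"
      using i12 i3 by (rule Bochner_Integration.integrable_add)
    from integral_cong_AE[OF borel_measurable_integrable[OF i] meas_cong_AE[OF open_lebesgue[OF \<Omega>] borel_measurable_integrable[OF i] ae] ae]
    show ?thesis by (rule sym)
  qed
  also have "\<dots> = (LINT x|lebesgue_on \<Omega>. ut x * (v x * \<phi> x)) + dirichlet \<Omega> D U \<Phi> + (LINT x|lebesgue_on \<Omega>. s x * u x * (v x * \<phi> x))"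
    unfolding Bochner_Integration.integral_add[OF i12 i3] Bochner_Integration.integral_add[OF i1 i2] dirichlet_def ..
  finally have "dirichlet \<Omega> D U \<Phi> + (LINT x|lebesgue_on \<Omega>. s x * u x * (v x * \<phi> x))
     = (LINT x|lebesgue_on \<Omega>. f x * (v x * \<phi> x)) - (LINT x|lebesgue_on \<Omega>. ut x * (v x * \<phi> x))" by linarith
  also have "\<dots> = (LINT x|lebesgue_on \<Omega>. (f x - ut x) * (v x * \<phi> x))"
    using i1 i4 by (simp add: left_diff_distrib)
  finally show "dirichlet \<Omega> D U (\<lambda>i x. v x * pd i \<phi> x + \<phi> x * V i x) + (LINT x|lebesgue_on \<Omega>. s x * u x * (v x * \<phi> x))
    = (LINT x|lebesgue_on \<Omega>. (f x - ut x) * (v x * \<phi> x))" by (simp add: \<Phi>_def)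
qed

text \<open>Differentiating \<open>D u\<^sub>1\<^sup>2 = q\<close> bounds the gradient of \<open>u\<^sub>1\<close>, because \<open>\<bar>u\<^sub>1\<bar>\<close> is bounded away from zero. The
  sign of \<open>u\<^sub>1\<close> is not known, therefore the reciprocal is written as \<open>u\<^sub>1 D / q\<close> with a positive denominator.\<close>

lemma reciprocal_snapshot:
  fixes u1 :: "real^'d \<Rightarrow> real" and Dlo Dhi qlo qhi :: real
  assumes \<Omega>: "open \<Omega>" "bounded \<Omega>" "\<Omega> \<in> lmeasurable"
    and u1: "has_wgrad \<Omega> u1 U1"
    and D: "has_wgrad \<Omega> D dD" "AE x in lebesgue_on \<Omega>. Dlo \<le> D x \<and> D x \<le> Dhi" "0 < Dlo"
      "\<And>i. AE x in lebesgue_on \<Omega>. \<bar>dD i x\<bar> \<le> BD"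
    and q: "has_wgrad \<Omega> q Q" "AE x in lebesgue_on \<Omega>. qlo \<le> q x \<and> q x \<le> qhi" "0 < qlo"
      "\<And>i. AE x in lebesgue_on \<Omega>. \<bar>Q i x\<bar> \<le> BQ"
    and pos: "0 < Dhi" "0 \<le> qhi" "0 \<le> BD" "0 \<le> BQ"
    and qD: "AE x in lebesgue_on \<Omega>. q x = D x * (u1 x)\<^sup>2"
  shows "\<exists>r R B B'. has_wgrad \<Omega> r R \<and> (AE x in lebesgue_on \<Omega>. u1 x \<noteq> 0 \<and> r x = 1 / u1 x) \<and>
     (\<forall>i. AE x in lebesgue_on \<Omega>. R i x = - U1 i x / (u1 x)\<^sup>2) \<and>
     (AE x in lebesgue_on \<Omega>. \<bar>r x\<bar> \<le> B) \<and> (\<forall>i. AE x in lebesgue_on \<Omega>. \<bar>R i x\<bar> \<le> B')"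
proof -
  note L = open_lebesgue[OF \<Omega>(1)]
  define M where "M = sqrt (qhi / Dlo)"
  define d where "d = sqrt (qlo / Dhi)"
  have d: "0 < d" using q(3) pos(1) by (simp add: d_def)
  have ub: "AE x in lebesgue_on \<Omega>. d \<le> \<bar>u1 x\<bar> \<and> \<bar>u1 x\<bar> \<le> M"
    using qD D(2) q(2)
  proof eventually_elim
    case (elim x)
    have "Dlo * (u1 x)\<^sup>2 \<le> D x * (u1 x)\<^sup>2" using elim by (intro mult_right_mono) auto
    then have "(u1 x)\<^sup>2 \<le> qhi / Dlo" using elim D(3) by (simp add: field_simps)
    then have "sqrt ((u1 x)\<^sup>2) \<le> M" unfolding M_def by (rule real_sqrt_le_mono)
    moreover have "D x * (u1 x)\<^sup>2 \<le> Dhi * (u1 x)\<^sup>2" using elim by (intro mult_right_mono) auto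
    then have "qlo / Dhi \<le> (u1 x)\<^sup>2" using elim pos(1) by (simp add: field_simps)
    then have "d \<le> sqrt ((u1 x)\<^sup>2)" unfolding d_def by (rule real_sqrt_le_mono)
    ultimately show ?case by simp
  qed
  have ub': "AE x in lebesgue_on \<Omega>. \<bar>u1 x\<bar> \<le> M" using ub by eventually_elim simp
  have Db: "AE x in lebesgue_on \<Omega>. \<bar>D x\<bar> \<le> Dhi" using D(2) by eventually_elim (use D(3) in simp)
  have uu: "has_wgrad \<Omega> (\<lambda>x. u1 x * u1 x) (\<lambda>i x. u1 x * U1 i x + u1 x * U1 i x)"
    by (rule wgrad_mult_bounded[OF \<Omega>(1) u1 u1 ub' ub'])
  have uub: "AE x in lebesgue_on \<Omega>. \<bar>u1 x * u1 x\<bar> \<le> M * M"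
    using ub' by eventually_elim (simp only: abs_mult, intro mult_mono', auto)
  note Duu = wgrad_mult_bounded[OF \<Omega>(1) D(1) uu Db uub]
  have qae: "AE x in lebesgue_on \<Omega>. D x * (u1 x * u1 x) = q x" using qD by eventually_elim (simp add: power2_eq_square)
  have Qeq: "AE x in lebesgue_on \<Omega>. D x * (u1 x * U1 i x + u1 x * U1 i x) + u1 x * u1 x * dD i x = Q i x" for i
    by (rule wgrad_unique[OF \<Omega>(1) wgrad_cong_AE[OF \<Omega>(1) Duu qae] q(1)]) auto
  define BU where "BU = (BQ + M * M * BD) / (2 * Dlo * d)"
  have U1b: "AE x in lebesgue_on \<Omega>. \<bar>U1 i x\<bar> \<le> BU" for i
    using Qeq[of i] ub D(2) D(4)[of i] q(4)[of i] uub
  proof eventually_elim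
    case (elim x)
    have "2 * D x * u1 x * U1 i x = Q i x - u1 x * u1 x * dD i x" using elim(1) by (simp add: algebra_simps)
    from arg_cong[OF this, of abs] have "2 * \<bar>D x\<bar> * \<bar>u1 x\<bar> * \<bar>U1 i x\<bar> = \<bar>Q i x - u1 x * u1 x * dD i x\<bar>"
      by (simp add: abs_mult)
    also have "\<dots> \<le> \<bar>Q i x\<bar> + \<bar>u1 x * u1 x\<bar> * \<bar>dD i x\<bar>"
      using abs_triangle_ineq4[of "Q i x" "u1 x * u1 x * dD i x"] by (simp add: abs_mult)
    also have "\<dots> \<le> BQ + M * M * BD" using elim by (intro add_mono mult_mono) auto
    finally have 1: "2 * \<bar>D x\<bar> * \<bar>u1 x\<bar> * \<bar>U1 i x\<bar> \<le> BQ + M * M * BD" .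
    have "Dlo * d \<le> \<bar>D x\<bar> * \<bar>u1 x\<bar>" using elim D(3) d by (intro mult_mono) auto
    then have "(Dlo * d) * \<bar>U1 i x\<bar> \<le> (\<bar>D x\<bar> * \<bar>u1 x\<bar>) * \<bar>U1 i x\<bar>" by (rule mult_right_mono) simp
    with 1 have "(2 * Dlo * d) * \<bar>U1 i x\<bar> \<le> BQ + M * M * BD" by (simp add: algebra_simps)
    then show ?case unfolding BU_def using D(3) d by (simp add: field_simps)
  qed
  define \<kappa> where "\<kappa> x = recip qlo (q x)" for x
  have \<kappa>: "has_wgrad \<Omega> \<kappa> (\<lambda>i x. recip' qlo (q x) * Q i x)"
    unfolding \<kappa>_def[abs_def] by (rule wgrad_comp[OF \<Omega>(1,3) q(1) C1_bdd_recip[OF q(3)]])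
  have \<kappa>b: "AE x in lebesgue_on \<Omega>. \<bar>\<kappa> x\<bar> \<le> 1 / qlo"
    using q(2) by eventually_elim (use q(3) in \<open>auto simp: \<kappa>_def recip_eq divide_simps\<close>)
  note D\<kappa> = wgrad_mult_bounded[OF \<Omega>(1) D(1) \<kappa> Db \<kappa>b]
  have D\<kappa>b: "AE x in lebesgue_on \<Omega>. \<bar>D x * \<kappa> x\<bar> \<le> Dhi * (1 / qlo)"
    using Db \<kappa>b by eventually_elim (simp only: abs_mult, intro mult_mono', auto)
  note r = wgrad_mult_bounded[OF \<Omega>(1) u1 D\<kappa> ub' D\<kappa>b]
  define r where "r x = u1 x * (D x * \<kappa> x)" for x
  define R where "R i x = u1 x * (D x * (recip' qlo (q x) * Q i x) + \<kappa> x * dD i x) + D x * \<kappa> x * U1 i x" for i x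
  have rR: "has_wgrad \<Omega> r R" using r unfolding r_def[abs_def] R_def[abs_def] .
  have req: "AE x in lebesgue_on \<Omega>. u1 x \<noteq> 0 \<and> r x = 1 / u1 x"
    using qD D(2) q(2) ub
  proof eventually_elim
    case (elim x)
    then have "u1 x \<noteq> 0" "D x \<noteq> 0" using d D(3) by auto
    moreover have "\<kappa> x = 1 / (D x * (u1 x)\<^sup>2)" using elim by (simp add: \<kappa>_def recip_eq)
    ultimately show ?case by (simp add: r_def power2_eq_square)
  qed
  have rb: "AE x in lebesgue_on \<Omega>. \<bar>r x\<bar> \<le> 1 / d"
    using req ub by eventually_elim (use d in \<open>simp add: abs_divide divide_left_mono\<close>)
  have "has_wgrad \<Omega> (\<lambda>x. u1 x * r x) (\<lambda>i x. u1 x * R i x + r x * U1 i x)"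
    by (rule wgrad_mult_bounded[OF \<Omega>(1) u1 rR ub' rb])
  moreover have "AE x in lebesgue_on \<Omega>. u1 x * r x = 1" using req by eventually_elim simp
  ultimately have one: "has_wgrad \<Omega> (\<lambda>x. 1) (\<lambda>i x. u1 x * R i x + r x * U1 i x)"
    by (rule wgrad_cong_AE[OF \<Omega>(1)]) simp
  have Req: "AE x in lebesgue_on \<Omega>. R i x = - U1 i x / (u1 x)\<^sup>2" for i
    using wgrad_unique[OF \<Omega>(1) one wgrad_const[OF \<Omega>], of i] req
  proof eventually_elim
    case (elim x)
    then have "u1 x * R i x = - (U1 i x / u1 x)" by simp
    then have "u1 x * R i x / u1 x = - (U1 i x / u1 x) / u1 x" by simp
    then show ?case using elim(2) by (simp add: power2_eq_square)
  qed
  have Rb: "AE x in lebesgue_on \<Omega>. \<bar>R i x\<bar> \<le> BU / d\<^sup>2" for i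
    using Req[of i] U1b[of i] ub
  proof eventually_elim
    case (elim x)
    have "d\<^sup>2 \<le> \<bar>u1 x\<bar>\<^sup>2" using elim d by (intro power_mono) auto
    then have "\<bar>U1 i x\<bar> / (u1 x)\<^sup>2 \<le> BU / d\<^sup>2" using elim d by (intro frac_le) auto
    then show ?case using elim by (simp add: abs_divide)
  qed
  show ?thesis using rR req Req rb Rb by blast
qed

text \<open>Subtracting the equations at the two times, tested crosswise with \<open>u\<^sub>1 \<phi>\<close> and \<open>u\<^sub>2 \<phi>\<close>, eliminates
  the reaction term and leaves for \<open>p = (u\<^sub>2 - u\<^sub>1) / u\<^sub>1\<close> the equation of \<open>w\<close>. Both functions vanish on the
  boundary, so they agree by uniqueness.\<close>

lemma quotient_of_snapshots:
  fixes u1 u2 :: "real^'d \<Rightarrow> real" and Dlo Dhi qlo qhi :: real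
  assumes \<Omega>: "open \<Omega>" "bounded \<Omega>" "\<Omega> \<in> lmeasurable"
    and tr: "has_trace \<Omega> u1 g" "has_trace \<Omega> u2 g"
    and L: "ut1 \<in> L2 \<Omega>" "f1 \<in> L2 \<Omega>" "ut2 \<in> L2 \<Omega>" "f2 \<in> L2 \<Omega>"
    and D: "D \<in> adm_W12 \<Omega> Dlo Dhi" "D \<in> W1inf \<Omega>" "0 < Dlo" "0 < Dhi"
    and q: "q \<in> adm_W12 \<Omega> qlo qhi" "q \<in> W1inf \<Omega>" "0 < qlo" "0 \<le> qhi"
    and s: "s \<in> borel_measurable (lebesgue_on \<Omega>)" "AE x in lebesgue_on \<Omega>. \<bar>s x\<bar> \<le> S"
    and qD: "AE x in lebesgue_on \<Omega>. q x = D x * (u1 x)\<^sup>2"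
    and F: "F \<in> L2 \<Omega>" "AE x in lebesgue_on \<Omega>. F x = (f2 x - ut2 x) * u1 x - (f1 x - ut1 x) * u2 x"
    and eq1: "\<And>\<phi>. \<phi> \<in> W12_0 \<Omega> \<Longrightarrow>
           (LINT x|lebesgue_on \<Omega>. ut1 x * \<phi> x + D x * (weak_grad \<Omega> u1 x \<bullet> weak_grad \<Omega> \<phi> x) + s x * u1 x * \<phi> x)
           = (LINT x|lebesgue_on \<Omega>. f1 x * \<phi> x)"
    and eq2: "\<And>\<phi>. \<phi> \<in> W12_0 \<Omega> \<Longrightarrow>
           (LINT x|lebesgue_on \<Omega>. ut2 x * \<phi> x + D x * (weak_grad \<Omega> u2 x \<bullet> weak_grad \<Omega> \<phi> x) + s x * u2 x * \<phi> x)
           = (LINT x|lebesgue_on \<Omega>. f2 x * \<phi> x)"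
    and w: "elliptic_weak_solution \<Omega> q F w"
  shows "AE x in lebesgue_on \<Omega>. w x = u2 x / u1 x - 1"
proof -
  note LL = open_lebesgue[OF \<Omega>(1)]
  have W12: "u1 \<in> W12 \<Omega>" "u2 \<in> W12 \<Omega>" using tr by (auto simp: has_trace_def)
  define U1 where "U1 = (\<lambda>i. weak_pd \<Omega> i u1)"
  define U2 where "U2 = (\<lambda>i. weak_pd \<Omega> i u2)"
  have U1: "has_wgrad \<Omega> u1 U1" and U2: "has_wgrad \<Omega> u2 U2"
    unfolding U1_def U2_def using W12_has_wgrad[OF \<Omega>(1)] W12 by auto
  obtain dD BD where dD: "has_wgrad \<Omega> D dD" "0 \<le> BD" "\<forall>i. AE x in lebesgue_on \<Omega>. \<bar>dD i x\<bar> \<le> BD"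
    using W1inf_has_wgrad[OF \<Omega>(3) D(2)] by blast
  obtain Q BQ where Q: "has_wgrad \<Omega> q Q" "0 \<le> BQ" "\<forall>i. AE x in lebesgue_on \<Omega>. \<bar>Q i x\<bar> \<le> BQ"
    using W1inf_has_wgrad[OF \<Omega>(3) q(2)] by blast
  note aD = adm_W12D[OF \<Omega>(1) D(1)] and aq = adm_W12D[OF \<Omega>(1) q(1)]
  obtain r R B B' where r: "has_wgrad \<Omega> r R" "AE x in lebesgue_on \<Omega>. u1 x \<noteq> 0 \<and> r x = 1 / u1 x"
     "\<forall>i. AE x in lebesgue_on \<Omega>. R i x = - U1 i x / (u1 x)\<^sup>2"
     "AE x in lebesgue_on \<Omega>. \<bar>r x\<bar> \<le> B" "\<forall>i. AE x in lebesgue_on \<Omega>. \<bar>R i x\<bar> \<le> B'"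
    using reciprocal_snapshot[OF \<Omega> U1 dD(1) aD(2) D(3) dD(3)[rule_format] Q(1) aq(2) q(3) Q(3)[rule_format] D(4) q(4) dD(2) Q(2) qD]
    by blast
  define v where "v x = u2 x - u1 x" for x
  define V where "V i x = U2 i x - U1 i x" for i x
  have V: "has_wgrad \<Omega> v V" unfolding v_def[abs_def] V_def[abs_def] by (rule wgrad_diff[OF LL U2 U1])
  have v0: "v \<in> W12_0 \<Omega>" unfolding v_def[abs_def] by (rule same_trace_diff[OF \<Omega> tr])
  define p where "p x = r x * v x" for x
  define P where "P i x = r x * V i x + v x * R i x" for i x
  have P: "has_wgrad \<Omega> p P" unfolding p_def[abs_def] P_def[abs_def]
    by (rule wgrad_mult_W1inf[OF \<Omega>(1) V r(1,4) r(5)[rule_format]])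
  have p0: "p \<in> W12_0 \<Omega>" unfolding p_def[abs_def]
    by (rule W12_0_mult_W1inf[OF \<Omega>(1) V v0 r(1,4) r(5)[rule_format]])
  have qP: "(\<lambda>x. q x * P i x) \<in> L2 \<Omega>" for i by (rule L2_coeff_mult[OF aq(3,2) wgradD(2)[OF P]])
  have DU1: "(\<lambda>x. D x * U1 i x) \<in> L2 \<Omega>" for i by (rule L2_coeff_mult[OF aD(3,2) wgradD(2)[OF U1]])
  have DU2: "(\<lambda>x. D x * U2 i x) \<in> L2 \<Omega>" for i by (rule L2_coeff_mult[OF aD(3,2) wgradD(2)[OF U2]])
  have flux: "AE x in lebesgue_on \<Omega>. \<forall>i\<in>UNIV. q x * P i x = D x * (u1 x * U2 i x - u2 x * U1 i x)"
  proof (subst AE_finite_all)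
    show "\<forall>i\<in>UNIV. AE x in lebesgue_on \<Omega>. q x * P i x = D x * (u1 x * U2 i x - u2 x * U1 i x)"
    proof
      fix i
      show "AE x in lebesgue_on \<Omega>. q x * P i x = D x * (u1 x * U2 i x - u2 x * U1 i x)"
        using qD r(2) r(3)[rule_format, of i]
      proof eventually_elim
        case (elim x)
        have "q x * P i x = D x * (u1 x)\<^sup>2 * (1 / u1 x * (U2 i x - U1 i x) + (u2 x - u1 x) * (- U1 i x / (u1 x)\<^sup>2))"
          using elim by (simp add: P_def V_def v_def)
        also have "\<dots> = D x * (u1 x * U2 i x - u2 x * U1 i x)"
          using conjunct1[OF elim(2)] by (simp add: field_simps power2_eq_square)
        finally show ?case .
      qed
    qed
  qed simp
  have weak: "dirichlet \<Omega> q P (\<lambda>i. pd i \<phi>) = (LINT x|lebesgue_on \<Omega>. F x * \<phi> x)" if \<phi>: "\<phi> \<in> test_functions \<Omega>" for \<phi>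
  proof -
    note t1 = slice_tested[OF \<Omega>(1) aD(3,2) s L(1,2) U1 U2 \<phi> eq1]
    note t2 = slice_tested[OF \<Omega>(1) aD(3,2) s L(3,4) U2 U1 \<phi> eq2]
    define \<Phi>1 where "\<Phi>1 = (\<lambda>i x. u1 x * pd i \<phi> x + \<phi> x * U1 i x)"
    define \<Phi>2 where "\<Phi>2 = (\<lambda>i x. u2 x * pd i \<phi> x + \<phi> x * U2 i x)"
    have \<Phi>L: "\<Phi>1 i \<in> L2 \<Omega>" "\<Phi>2 i \<in> L2 \<Omega>" for i
      unfolding \<Phi>1_def \<Phi>2_def using wgradD(2)[OF wgrad_mult_test(1)[OF \<Omega>(1) U1 \<phi>]] wgradD(2)[OF wgrad_mult_test(1)[OF \<Omega>(1) U2 \<phi>]] by auto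
    have pL: "pd i \<phi> \<in> L2 \<Omega>" for i by (rule test_L2[OF test_pd[OF \<phi>] LL])
    note m = borel_measurable_integrable[OF dirichlet_sum(1)[OF qP pL]]
    note i1 = dirichlet_sum(1)[OF DU2 \<Phi>L(1)] and i2 = dirichlet_sum(1)[OF DU1 \<Phi>L(2)]
    have "dirichlet \<Omega> q P (\<lambda>i. pd i \<phi>) = (LINT x|lebesgue_on \<Omega>. (\<Sum>i\<in>UNIV. D x * U2 i x * \<Phi>1 i x) - (\<Sum>i\<in>UNIV. D x * U1 i x * \<Phi>2 i x))"
      unfolding dirichlet_def
    proof (rule integral_cong_AE[OF m])
      show "(\<lambda>x. (\<Sum>i\<in>UNIV. D x * U2 i x * \<Phi>1 i x) - (\<Sum>i\<in>UNIV. D x * U1 i x * \<Phi>2 i x)) \<in> borel_measurable (lebesgue_on \<Omega>)"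
        using i1 i2 by auto
      show "AE x in lebesgue_on \<Omega>. (\<Sum>i\<in>UNIV. q x * P i x * pd i \<phi> x)
          = (\<Sum>i\<in>UNIV. D x * U2 i x * \<Phi>1 i x) - (\<Sum>i\<in>UNIV. D x * U1 i x * \<Phi>2 i x)"
        using flux
      proof eventually_elim
        case (elim x)
        have "(\<Sum>i\<in>UNIV. q x * P i x * pd i \<phi> x) = (\<Sum>i\<in>UNIV. D x * U2 i x * \<Phi>1 i x - D x * U1 i x * \<Phi>2 i x)"
        proof (rule sum.cong)
          fix i :: 'd
          have "q x * P i x = D x * (u1 x * U2 i x - u2 x * U1 i x)" using elim by blast
          then show "q x * P i x * pd i \<phi> x = D x * U2 i x * \<Phi>1 i x - D x * U1 i x * \<Phi>2 i x"
            by (simp only:) (simp add: \<Phi>1_def \<Phi>2_def algebra_simps)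
        qed simp
        then show ?case by (simp add: sum_subtractf)
      qed
    qed
    also have "\<dots> = dirichlet \<Omega> D U2 \<Phi>1 - dirichlet \<Omega> D U1 \<Phi>2"
      unfolding dirichlet_def by (rule Bochner_Integration.integral_diff[OF i1 i2])
    also have "\<dots> = (LINT x|lebesgue_on \<Omega>. (f2 x - ut2 x) * (u1 x * \<phi> x)) - (LINT x|lebesgue_on \<Omega>. (f1 x - ut1 x) * (u2 x * \<phi> x))"
    proof -
      have "(LINT x|lebesgue_on \<Omega>. s x * u2 x * (u1 x * \<phi> x)) = (LINT x|lebesgue_on \<Omega>. s x * u1 x * (u2 x * \<phi> x))"
        by (simp add: mult_ac)
      then show ?thesis using t1(1) t2(1) unfolding \<Phi>1_def \<Phi>2_def by linarith
    qed
    also have "\<dots> = (LINT x|lebesgue_on \<Omega>. (f2 x - ut2 x) * (u1 x * \<phi> x) - (f1 x - ut1 x) * (u2 x * \<phi> x))"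
      by (rule Bochner_Integration.integral_diff[symmetric];
          intro L2_mult_integrable L2_diff L L2_mult_test[OF wgradD(1)[OF U1] \<phi>] L2_mult_test[OF wgradD(1)[OF U2] \<phi>])
    also have "\<dots> = (LINT x|lebesgue_on \<Omega>. F x * \<phi> x)"
    proof (rule integral_cong_AE)
      have "integrable (lebesgue_on \<Omega>) (\<lambda>x. (f2 x - ut2 x) * (u1 x * \<phi> x) - (f1 x - ut1 x) * (u2 x * \<phi> x))"
        by (intro Bochner_Integration.integrable_diff L2_mult_integrable L2_diff L
            L2_mult_test[OF wgradD(1)[OF U1] \<phi>] L2_mult_test[OF wgradD(1)[OF U2] \<phi>])
      then show "(\<lambda>x. (f2 x - ut2 x) * (u1 x * \<phi> x) - (f1 x - ut1 x) * (u2 x * \<phi> x)) \<in> borel_measurable (lebesgue_on \<Omega>)" by auto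
      show "(\<lambda>x. F x * \<phi> x) \<in> borel_measurable (lebesgue_on \<Omega>)" by (rule L2_meas[OF L2_mult_test[OF F(1) \<phi>]])
      show "AE x in lebesgue_on \<Omega>. (f2 x - ut2 x) * (u1 x * \<phi> x) - (f1 x - ut1 x) * (u2 x * \<phi> x) = F x * \<phi> x"
        using F(2)
      proof eventually_elim
        case (elim x)
        show ?case unfolding elim by (simp add: algebra_simps)
      qed
    qed
    finally show ?thesis .
  qed
  have w0: "w \<in> W12_0 \<Omega>" using w by (simp add: elliptic_weak_solution_def)
  define W where "W = (\<lambda>i. weak_pd \<Omega> i w)"
  have W: "has_wgrad \<Omega> w W" unfolding W_def by (rule W12_has_wgrad[OF \<Omega>(1) W12_0_W12[OF w0]])
  have qW: "(\<lambda>x. q x * W i x) \<in> L2 \<Omega>" for i by (rule L2_coeff_mult[OF aq(3,2) wgradD(2)[OF W]])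
  have "AE x in lebesgue_on \<Omega>. w x - p x = 0"
  proof (rule dirichlet_zero[OF \<Omega>(1,2) aq(3) q(3) aq(2) wgrad_diff[OF LL W P] W12_0_diff[OF \<Omega> w0 p0]])
    fix \<phi> assume \<phi>: "\<phi> \<in> test_functions \<Omega>"
    have pL: "pd i \<phi> \<in> L2 \<Omega>" for i by (rule test_L2[OF test_pd[OF \<phi>] LL])
    have "dirichlet \<Omega> q (\<lambda>i x. W i x - P i x) (\<lambda>i. pd i \<phi>) = dirichlet \<Omega> q W (\<lambda>i. pd i \<phi>) - dirichlet \<Omega> q P (\<lambda>i. pd i \<phi>)"
      unfolding dirichlet_def Bochner_Integration.integral_diff[OF dirichlet_sum(1)[OF qW pL] dirichlet_sum(1)[OF qP pL], symmetric]
      by (simp add: sum_subtractf[symmetric] algebra_simps)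
    then show "dirichlet \<Omega> q (\<lambda>i x. W i x - P i x) (\<lambda>i. pd i \<phi>) = 0"
      using weak[OF \<phi>] elliptic_weakD[OF \<Omega>(1) aq(3) w W wgrad_test[OF \<phi> LL] test_W12_0[OF \<Omega>(1) \<phi>]] by simp
  qed
  then show ?thesis
    using r(2)
  proof eventually_elim
    case (elim x)
    then show ?case by (simp add: p_def v_def field_simps)
  qed
qed

section \<open>Boundary layers of convex domains\<close>

text \<open>Let \<open>y\<close> be closer than \<open>t r\<close> to the image of \<open>z\<close> under the contraction with centre \<open>a\<close>. Then \<open>y\<close> is the image
  of \<open>z\<close> under a contraction whose centre is still in the ball \<open>ball a r\<close>, so it lies in the convex set \<open>\<Omega>\<close>.\<close>

lemma contraction_infdist:
  fixes \<Omega> :: "(real^'d) set"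
  assumes \<Omega>: "open \<Omega>" "convex \<Omega>" "bounded \<Omega>" and r: "ball a r \<subseteq> \<Omega>" "0 < r" and t: "0 < t" "t < 1"
    and z: "z \<in> \<Omega>"
  shows "t * r \<le> infdist ((1 - t) *\<^sub>R z + t *\<^sub>R a) (frontier \<Omega>)"
proof -
  define x where "x = (1 - t) *\<^sub>R z + t *\<^sub>R a"
  have "frontier \<Omega> \<noteq> {}"
    using \<Omega>(3) z not_bounded_UNIV by (auto simp: frontier_eq_empty)
  moreover have "t * r \<le> dist x y" if y: "y \<in> frontier \<Omega>" for y
  proof (rule ccontr)
    assume "\<not> t * r \<le> dist x y"
    then have n: "norm (y - x) < t * r" by (simp add: dist_norm norm_minus_commute)
    define b where "b = a + (1 / t) *\<^sub>R (y - x)"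
    have "norm ((1 / t) *\<^sub>R (y - x)) = norm (y - x) / t" using t(1) unfolding norm_scaleR by simp
    also have "\<dots> < r" using n t(1) by (simp add: field_simps)
    finally have "norm ((1 / t) *\<^sub>R (y - x)) < r" .
    then have "b \<in> ball a r" by (simp add: b_def dist_norm)
    then have "(1 - t) *\<^sub>R z + t *\<^sub>R b \<in> \<Omega>"
      using \<Omega>(2) z r(1) t by (intro convexD) auto
    moreover have "(1 - t) *\<^sub>R z + t *\<^sub>R b = y"
      using t(1) by (simp add: b_def x_def scaleR_add_right scaleR_diff_right)
    ultimately show False using y \<Omega>(1) by (auto simp: frontier_def interior_open)
  qed
  ultimately show ?thesis unfolding x_def[symmetric] infdist_notempty[OF \<open>frontier \<Omega> \<noteq> {}\<close>] by (intro cINF_greatest)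
qed

text \<open>By \<open>contraction_infdist\<close>, the layer of width \<open>t r\<close> misses the contraction of \<open>\<Omega>\<close> by the factor \<open>1 - t\<close>. What
  the contraction leaves of \<open>\<Omega>\<close> has measure at most \<open>n t\<close> times that of \<open>\<Omega>\<close>, by Bernoulli's inequality.\<close>

lemma boundary_layer_measure:
  fixes \<Omega> :: "(real^'d) set"
  assumes \<Omega>: "open \<Omega>" "convex \<Omega>" "bounded \<Omega>" "\<Omega> \<noteq> {}"
  shows "\<exists>C\<ge>0. \<forall>\<rho>>0. measure lebesgue {x\<in>\<Omega>. infdist x (frontier \<Omega>) < \<rho>} \<le> C * \<rho>"
proof -
  have LM: "\<Omega> \<in> lmeasurable" using \<Omega>(1,3) by (simp add: lmeasurable_open)
  obtain a where a: "a \<in> \<Omega>" using \<Omega>(4) by blast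
  obtain r where r: "r > 0" "ball a r \<subseteq> \<Omega>" using \<Omega>(1) a by (rule openE)
  define m where "m = measure lebesgue \<Omega>"
  define n where "n = CARD('d)"
  have n: "1 \<le> real n" unfolding n_def using zero_less_card_finite[where 'a='d] by linarith
  have m0: "0 \<le> m" by (simp add: m_def)
  define N where "N \<rho> = {x\<in>\<Omega>. infdist x (frontier \<Omega>) < \<rho>}" for \<rho>
  have Nsub: "N \<rho> \<subseteq> \<Omega>" for \<rho> by (auto simp: N_def)
  have NM: "N \<rho> \<in> lmeasurable" for \<rho>
  proof -
    have "open {x. infdist x (frontier \<Omega>) < \<rho>}" by (intro open_Collect_less continuous_intros)
    then have "open (N \<rho>)" using \<Omega>(1) unfolding N_def by (simp add: Collect_conj_eq open_Int)
    then show ?thesis using bounded_subset[OF \<Omega>(3) Nsub] by (simp add: lmeasurable_open)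
  qed
  have "measure lebesgue (N \<rho>) \<le> (real n * m / r) * \<rho>" if \<rho>: "\<rho> > 0" for \<rho>
  proof (cases "\<rho> < r")
    case False
    have "measure lebesgue (N \<rho>) \<le> m"
      unfolding m_def using Nsub NM LM by (intro measure_mono_fmeasurable) (auto simp: fmeasurable_def)
    also have "m \<le> real n * m * (\<rho> / r)"
    proof -
      have "1 * m * 1 \<le> real n * m * (\<rho> / r)" using False r(1) n m0 by (intro mult_mono) auto
      then show ?thesis by simp
    qed
    finally show ?thesis by simp
  next
    case True
    define t where "t = \<rho> / r"
    have t: "0 < t" "t < 1" "t * r = \<rho>" using \<rho> True r(1) by (auto simp: t_def)
    define S where "S = (\<lambda>x. (1 - t) *\<^sub>R x + t *\<^sub>R a) ` \<Omega>"
    have mS: "measure lebesgue S = (1 - t) ^ n * m"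
      unfolding S_def m_def n_def using measure_lebesgue_affine[of "1 - t" "t *\<^sub>R a" \<Omega>] t by simp
    have Ssub: "S \<subseteq> \<Omega>"
      unfolding S_def using convexD[OF \<Omega>(2) _ a, of _ "1 - t" t] t by auto
    have "open S"
    proof -
      have "S = (\<lambda>x. t *\<^sub>R a + x) ` ((\<lambda>x. (1 - t) *\<^sub>R x) ` \<Omega>)" by (auto simp: S_def image_image add.commute)
      then show ?thesis using \<Omega>(1) t by (auto intro!: open_translation open_scaling)
    qed
    then have SM: "S \<in> lmeasurable" using bounded_subset[OF \<Omega>(3) Ssub] by (simp add: lmeasurable_open)
    have "N \<rho> \<subseteq> \<Omega> - S"
      using contraction_infdist[OF \<Omega>(1-3) r(2,1) t(1,2)] unfolding N_def S_def t(3) by force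
    then have "measure lebesgue (N \<rho>) \<le> measure lebesgue (\<Omega> - S)"
      by (rule measure_mono_fmeasurable[OF _ fmeasurableD[OF NM] fmeasurable.Diff[OF LM SM]])
    also have "\<dots> = m - (1 - t) ^ n * m"
      using measurable_measure_Diff[OF LM _ Ssub] SM by (simp add: mS m_def fmeasurable_def)
    also have "\<dots> \<le> real n * t * m"
    proof -
      have "1 + real n * (- t) \<le> (1 + (- t)) ^ n" using t by (intro Bernoulli_inequality) auto
      then have "(1 - real n * t) * m \<le> (1 - t) ^ n * m" using m0 by (intro mult_right_mono) auto
      then show ?thesis by (simp add: algebra_simps)
    qed
    also have "\<dots> = (real n * m / r) * \<rho>" by (simp add: t_def)
    finally show ?thesis .
  qed
  moreover have "0 \<le> real n * m / r" using n m0 r(1) by simp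
  ultimately show ?thesis unfolding N_def by blast
qed

text \<open>For \<open>\<rho> = \<delta>\<^bsup>1/(1+\<beta>)\<^esup>\<close> both terms are multiples of \<open>\<rho>\<close>. If \<open>\<delta> = 0\<close>, let \<open>\<rho>\<close> tend to 0.\<close>

lemma balance_boundary_layer:
  fixes \<beta> a b \<delta> s :: real
  assumes "0 \<le> \<beta>" "0 \<le> a" "0 \<le> b" "0 \<le> \<delta>" "0 \<le> s"
    and le: "\<And>\<rho>. \<rho> > 0 \<Longrightarrow> s\<^sup>2 \<le> a * \<rho> + b * \<delta> / \<rho> powr \<beta>"
  shows "s \<le> sqrt (a + b) * \<delta> powr (1 / (2 * (1 + \<beta>)))"
proof (cases "\<delta> = 0")
  case True
  have "s\<^sup>2 \<le> 0"
  proof (rule field_le_epsilon)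
    fix e :: real assume "e > 0"
    then have "s\<^sup>2 \<le> a * (e / (a + 1))" using le[of "e / (a + 1)"] assms(2) True by simp
    also have "\<dots> \<le> e" using assms(2) \<open>e > 0\<close> by (simp add: field_simps)
    finally show "s\<^sup>2 \<le> 0 + e" by simp
  qed
  then show ?thesis using True by simp
next
  case False
  then have \<delta>: "\<delta> > 0" using assms(4) by simp
  define \<rho> where "\<rho> = \<delta> powr (1 / (1 + \<beta>))"
  have \<rho>: "\<rho> > 0" using \<delta> by (simp add: \<rho>_def)
  have e: "1 - \<beta> / (1 + \<beta>) = 1 / (1 + \<beta>)" using assms(1) by (simp add: field_simps)
  have "\<rho> powr \<beta> = \<delta> powr (\<beta> / (1 + \<beta>))" by (simp add: \<rho>_def powr_powr)
  then have "\<delta> / \<rho> powr \<beta> = \<delta> powr (1 - \<beta> / (1 + \<beta>))" using \<delta> by (simp add: powr_diff)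
  then have d: "\<delta> / \<rho> powr \<beta> = \<rho>" unfolding e \<rho>_def .
  have "s\<^sup>2 \<le> a * \<rho> + b * (\<delta> / \<rho> powr \<beta>)" using le[OF \<rho>] by simp
  then have "s\<^sup>2 \<le> (a + b) * \<rho>" unfolding d by (simp add: distrib_right)
  then have "sqrt (s\<^sup>2) \<le> sqrt ((a + b) * \<rho>)" by (rule real_sqrt_le_mono)
  moreover have "sqrt \<rho> = \<delta> powr (1 / (2 * (1 + \<beta>)))"
    using \<delta> by (simp add: \<rho>_def powr_half_sqrt[symmetric] powr_powr mult.commute)
  ultimately show ?thesis using assms(5) by (simp add: real_sqrt_mult)
qed

text \<open>Outside the boundary layer of width \<open>\<rho>\<close> the weight is at least \<open>c\<^sub>0 \<rho>\<^sup>\<beta>\<close>, which bounds \<open>(q - q')\<^sup>2\<close> by a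
  multiple of the weighted integrand. In the layer, \<open>\<bar>q - q'\<bar> \<le> hi\<close>, and its measure is at most \<open>K \<rho>\<close>.\<close>

lemma weighted_to_L2:
  fixes \<Omega> :: "(real^'d) set" and lo hi c0 \<beta> K :: real
  assumes \<Omega>: "open \<Omega>" "\<Omega> \<in> lmeasurable" and lo: "0 < lo" "lo \<le> hi" and c0: "0 < c0" and \<beta>: "0 \<le> \<beta>"
    and q: "q \<in> adm_W12 \<Omega> lo hi" "q' \<in> adm_W12 \<Omega> lo hi"
    and layer: "0 \<le> K" "\<And>\<rho>. \<rho> > 0 \<Longrightarrow> measure lebesgue {x\<in>\<Omega>. infdist x (frontier \<Omega>) < \<rho>} \<le> K * \<rho>"
    and m: "AE x in lebesgue_on \<Omega>. c0 * infdist x (frontier \<Omega>) powr \<beta> \<le> m x"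
    and int: "integrable (lebesgue_on \<Omega>) (\<lambda>x. (q x - q' x)\<^sup>2 / (q x)\<^sup>2 * m x)"
    and le: "(LINT x|lebesgue_on \<Omega>. (q x - q' x)\<^sup>2 / (q x)\<^sup>2 * m x) \<le> c * \<delta>"
    and c: "0 \<le> c" "0 \<le> \<delta>"
  shows "L2_norm \<Omega> (\<lambda>x. q x - q' x) \<le> sqrt (hi\<^sup>2 * K + hi\<^sup>2 * c / c0) * \<delta> powr (1 / (2 * (1 + \<beta>)))"
proof (rule balance_boundary_layer[OF \<beta> _ _ c(2) L2_norm_nonneg])
  show "0 \<le> hi\<^sup>2 * K" "0 \<le> hi\<^sup>2 * c / c0" using layer(1) c(1) c0 by auto
  fix \<rho> :: real assume \<rho>: "\<rho> > 0"
  note L = open_lebesgue[OF \<Omega>(1)]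
  note a = adm_W12D[OF \<Omega>(1) q(1)] and a' = adm_W12D[OF \<Omega>(1) q(2)]
  define N where "N = {x\<in>\<Omega>. infdist x (frontier \<Omega>) < \<rho>}"
  have "open {x. infdist x (frontier \<Omega>) < \<rho>}" by (intro open_Collect_less continuous_intros)
  then have oN: "open N" using \<Omega>(1) unfolding N_def by (simp add: Collect_conj_eq open_Int)
  have Nsub: "N \<subseteq> \<Omega>" by (auto simp: N_def)
  interpret finite_measure "lebesgue_on \<Omega>" using \<Omega>(2) by (rule finite_measure_lebesgue_on)
  have Nm: "N \<in> sets (lebesgue_on \<Omega>)" using oN Nsub L by (subst sets_restrict_space_iff) auto
  have iN: "integrable (lebesgue_on \<Omega>) (indicat_real N)"
    using Nm by (intro integrable_real_indicator) (auto simp: less_top[symmetric])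
  have mN: "(LINT x|lebesgue_on \<Omega>. indicat_real N x) = measure lebesgue N"
    using L Nsub Nm by (simp add: measure_restrict_space Int_absorb2)
  define k where "k = hi\<^sup>2 / (c0 * \<rho> powr \<beta>)"
  have k: "0 \<le> k" using c0 by (simp add: k_def)
  define J where "J x = (q x - q' x)\<^sup>2 / (q x)\<^sup>2 * m x" for x
  have iJ: "integrable (lebesgue_on \<Omega>) J" unfolding J_def[abs_def] by (rule int)
  have "(L2_norm \<Omega> (\<lambda>x. q x - q' x))\<^sup>2 = (LINT x|lebesgue_on \<Omega>. (q x - q' x)\<^sup>2)" by (rule L2_norm_sq)
  also have "\<dots> \<le> (LINT x|lebesgue_on \<Omega>. hi\<^sup>2 * indicat_real N x + k * J x)"
  proof (rule integral_mono_AE)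
    show "integrable (lebesgue_on \<Omega>) (\<lambda>x. (q x - q' x)\<^sup>2)"
      by (rule L2_sq[OF L2_diff[OF wgradD(1)[OF a(1)] wgradD(1)[OF a'(1)]]])
    show "integrable (lebesgue_on \<Omega>) (\<lambda>x. hi\<^sup>2 * indicat_real N x + k * J x)"
      by (intro Bochner_Integration.integrable_add integrable_mult_right iN iJ)
    show "AE x in lebesgue_on \<Omega>. (q x - q' x)\<^sup>2 \<le> hi\<^sup>2 * indicat_real N x + k * J x"
      using a(2) a'(2) m AE_space
    proof eventually_elim
      case (elim x)
      have x: "x \<in> \<Omega>" using elim(4) by simp
      have "0 \<le> c0 * infdist x (frontier \<Omega>) powr \<beta>" using c0 by simp
      then have mx: "0 \<le> m x" using elim(3) by (rule order_trans)
      then have Jx: "0 \<le> J x" by (simp add: J_def)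
      have qp: "q x > 0" using elim(1) lo by linarith
      show ?case
      proof (cases "x \<in> N")
        case True
        have "\<bar>q x - q' x\<bar> \<le> hi" using elim(1,2) lo by linarith
        then have "(q x - q' x)\<^sup>2 \<le> hi\<^sup>2" using abs_le_square_iff[of "q x - q' x" hi] lo by simp
        moreover have "0 \<le> k * J x" using k Jx by simp
        ultimately show ?thesis using True by simp
      next
        case False
        then have "\<rho> \<le> infdist x (frontier \<Omega>)" using x by (simp add: N_def)
        then have "\<rho> powr \<beta> \<le> infdist x (frontier \<Omega>) powr \<beta>" using \<rho> \<beta> by (intro powr_mono2) auto
        then have "c0 * \<rho> powr \<beta> \<le> m x" using elim(3) c0 by (meson mult_left_mono less_imp_le order_trans)
        then have "(q x - q' x)\<^sup>2 / (q x)\<^sup>2 * (c0 * \<rho> powr \<beta>) \<le> J x"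
          unfolding J_def by (intro mult_left_mono) auto
        then have "k * ((q x - q' x)\<^sup>2 / (q x)\<^sup>2 * (c0 * \<rho> powr \<beta>)) \<le> k * J x" using k by (rule mult_left_mono)
        also have "k * ((q x - q' x)\<^sup>2 / (q x)\<^sup>2 * (c0 * \<rho> powr \<beta>)) = hi\<^sup>2 / (q x)\<^sup>2 * (q x - q' x)\<^sup>2"
          using c0 \<rho> by (simp add: k_def)
        finally have "hi\<^sup>2 / (q x)\<^sup>2 * (q x - q' x)\<^sup>2 \<le> k * J x" .
        moreover have "1 * (q x - q' x)\<^sup>2 \<le> hi\<^sup>2 / (q x)\<^sup>2 * (q x - q' x)\<^sup>2"
        proof (rule mult_right_mono)
          have "(q x)\<^sup>2 \<le> hi\<^sup>2" using elim(1) qp by (intro power_mono) auto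
          then show "1 \<le> hi\<^sup>2 / (q x)\<^sup>2" using qp by simp
        qed simp
        ultimately have "1 * (q x - q' x)\<^sup>2 \<le> k * J x" by (rule order_trans[rotated])
        then show ?thesis using False by simp
      qed
    qed
  qed
  also have "\<dots> = hi\<^sup>2 * measure lebesgue N + k * (LINT x|lebesgue_on \<Omega>. J x)"
    using iN iJ mN by simp
  also have "\<dots> \<le> hi\<^sup>2 * (K * \<rho>) + k * (c * \<delta>)"
    using layer(2)[OF \<rho>] le k unfolding N_def J_def by (intro add_mono mult_left_mono) auto
  also have "\<dots> = hi\<^sup>2 * K * \<rho> + hi\<^sup>2 * c / c0 * \<delta> / \<rho> powr \<beta>" by (simp add: k_def)
  finally show "(L2_norm \<Omega> (\<lambda>x. q x - q' x))\<^sup>2 \<le> hi\<^sup>2 * K * \<rho> + hi\<^sup>2 * c / c0 * \<delta> / \<rho> powr \<beta>" .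
qed

lemma convex_polyhedral_domainD:
  assumes "convex_polyhedral_domain \<Omega>"
  shows "open \<Omega>" "convex \<Omega>" "bounded \<Omega>" "\<Omega> \<in> lmeasurable" "\<Omega> \<noteq> {}"
proof -
  obtain P where P: "polytope P" "\<Omega> = interior P" and "\<Omega> \<noteq> {}"
    using assms by (auto simp: convex_polyhedral_domain_def)
  then show "open \<Omega>" "convex \<Omega>" "bounded \<Omega>" "\<Omega> \<noteq> {}"
    using polytope_imp_convex polytope_imp_bounded by (auto intro: convex_interior bounded_interior)
  then show "\<Omega> \<in> lmeasurable" by (simp add: lmeasurable_open)
qed

theorem theorem4p1:
  fixes \<Omega> :: "(real^'d) set"
    and cD_lo cD_hi c\<sigma>_hi cq_lo cq_hi C c0' cg T T0 T1 T2 :: real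
    and k :: nat
    and D \<sigma> u0 g f1 f2 q F w :: "real^'d \<Rightarrow> real"
    and f u ut :: "real \<Rightarrow> real^'d \<Rightarrow> real"
  assumes dim: "CARD('d) \<in> {1, 2, 3}"
    and dom: "convex_polyhedral_domain \<Omega>"
    and bounds: "0 < cD_lo" "cD_lo \<le> cD_hi" "0 < c\<sigma>_hi" "0 < cq_lo" "cq_lo \<le> cq_hi"
    and times: "0 < T1" "T1 \<le> T0" "2 * T0 \<le> T2" "T2 \<le> T"
    and u0: "u0 \<in> W22 \<Omega> \<inter> W1inf \<Omega>" "0 < c0'" "AE x in lebesgue_on \<Omega>. c0' \<le> u0 x"
    and k: "1 \<le> k"
    and f_reg: "f \<in> Ck_time (Linf \<Omega>) (Linf_norm \<Omega>) {0<..T} k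
                  \<inter> Ck_time (L2 \<Omega>) (L2_norm \<Omega>) {0<..T} (k + 1)"
    and f_nonneg: "\<forall>t\<in>{0<..T}. AE x in lebesgue_on \<Omega>. 0 \<le> f t x"
    and f_early: "\<forall>t\<in>{0<..T0}. AE x in lebesgue_on \<Omega>. f t x = f1 x"
    and f_late: "\<forall>t\<in>{2 * T0..T}. AE x in lebesgue_on \<Omega>. f t x = f2 x"
    and g: "g \<in> W32_2_bd \<Omega> \<inter> W1inf_bd \<Omega>" "0 < cg" "\<forall>x\<in>frontier \<Omega>. cg \<le> g x"
    and D: "D \<in> adm_W12 \<Omega> cD_lo cD_hi \<inter> W1inf \<Omega>"
    and \<sigma>: "\<sigma> \<in> adm_Linf \<Omega> c\<sigma>_hi"
    and u: "parabolic_solution \<Omega> T D \<sigma> f g u0 u ut"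
    and q_def: "AE x in lebesgue_on \<Omega>. q x = D x * \<bar>u T1 x\<bar>\<^sup>2"
    and F_def: "AE x in lebesgue_on \<Omega>.
                  F x = (f T2 x - ut T2 x) * u T1 x - (f T1 x - ut T1 x) * u T2 x"
    and q: "q \<in> W22 \<Omega> \<inter> W1inf \<Omega> \<inter> adm_W12 \<Omega> cq_lo cq_hi"
    and F: "F \<in> Linf \<Omega>"
    and q_bound: "W12_norm \<Omega> q \<le> C"
    and w: "elliptic_weak_solution \<Omega> q F w"
  shows "(AE x in lebesgue_on \<Omega>. w x = u T2 x / u T1 x - 1) \<and>
    (\<exists>c>0. \<forall>q' F' w'.
       q' \<in> adm_W12 \<Omega> cq_lo cq_hi \<and> F' \<in> Linf \<Omega> \<and> W12_norm \<Omega> q' \<le> C \<and>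
       elliptic_weak_solution \<Omega> q' F' w' \<longrightarrow>
       (LINT x|lebesgue_on \<Omega>.
          (q x - q' x)\<^sup>2 / (q x)\<^sup>2 * (q x * (norm (weak_grad \<Omega> w x))\<^sup>2 + F x * w x))
       \<le> c * (W12_norm \<Omega> (\<lambda>x. w x - w' x) + L2_norm \<Omega> (\<lambda>x. F x - F' x))) \<and>
    (\<forall>\<beta>\<ge>0. \<forall>c0>0.
       (AE x in lebesgue_on \<Omega>.
          q x * (norm (weak_grad \<Omega> w x))\<^sup>2 + F x * w x \<ge> c0 * infdist x (frontier \<Omega>) powr \<beta>) \<longrightarrow>
       (\<exists>c>0. \<forall>q' F' w'.
          q' \<in> adm_W12 \<Omega> cq_lo cq_hi \<and> F' \<in> Linf \<Omega> \<and> W12_norm \<Omega> q' \<le> C \<and>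
          elliptic_weak_solution \<Omega> q' F' w' \<longrightarrow>
          L2_norm \<Omega> (\<lambda>x. q x - q' x)
          \<le> c * (W12_norm \<Omega> (\<lambda>x. w x - w' x) + L2_norm \<Omega> (\<lambda>x. F x - F' x))
                 powr (1 / (2 * (1 + \<beta>)))))"
proof -
  note \<Omega> = convex_polyhedral_domainD[OF dom]
  note O = \<Omega>(1,3,4)
  have t: "T1 \<in> {0<..T}" "T2 \<in> {0<..T}" using times by auto
  have D': "D \<in> adm_W12 \<Omega> cD_lo cD_hi" "D \<in> W1inf \<Omega>" using D by auto
  have q': "q \<in> adm_W12 \<Omega> cq_lo cq_hi" "q \<in> W1inf \<Omega>" using q by auto
  note FL = Linf_L2[OF F O(3)]
  have fL: "f t \<in> L2 \<Omega>" if "t \<in> {0<..T}" for t using f_reg that by simp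
  have utL: "ut t \<in> L2 \<Omega>" if "t \<in> {0<..T}" for t using u that by (simp add: parabolic_solution_def)
  have tr: "has_trace \<Omega> (u t) g" if "t \<in> {0<..T}" for t using u that by (simp add: parabolic_solution_def)
  have eq: "(LINT x|lebesgue_on \<Omega>. ut t x * \<phi> x + D x * (weak_grad \<Omega> (u t) x \<bullet> weak_grad \<Omega> \<phi> x) + \<sigma> x * u t x * \<phi> x)
           = (LINT x|lebesgue_on \<Omega>. f t x * \<phi> x)" if "t \<in> {0<..T}" "\<phi> \<in> W12_0 \<Omega>" for t \<phi>
    using u that unfolding parabolic_solution_def by blast
  have \<sigma>': "\<sigma> \<in> Linf \<Omega>" "AE x in lebesgue_on \<Omega>. 0 \<le> \<sigma> x \<and> \<sigma> x \<le> c\<sigma>_hi"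
    using \<sigma> unfolding adm_Linf_def by blast+
  have \<sigma>b: "AE x in lebesgue_on \<Omega>. \<bar>\<sigma> x\<bar> \<le> c\<sigma>_hi" using \<sigma>'(2) by eventually_elim simp
  have qD: "AE x in lebesgue_on \<Omega>. q x = D x * (u T1 x)\<^sup>2" using q_def by simp
  have part1: "AE x in lebesgue_on \<Omega>. w x = u T2 x / u T1 x - 1"
    using bounds
    by (intro quotient_of_snapshots[OF O tr[OF t(1)] tr[OF t(2)] utL[OF t(1)] fL[OF t(1)] utL[OF t(2)] fL[OF t(2)]
          D' bounds(1) _ q' bounds(4) _ Linf_bound(1)[OF \<sigma>'(1)] \<sigma>b qD FL F_def eq[OF t(1)] eq[OF t(2)] w]) auto
  obtain Q BQ where Q: "has_wgrad \<Omega> q Q" "0 \<le> BQ" "\<forall>i. AE x in lebesgue_on \<Omega>. \<bar>Q i x\<bar> \<le> BQ"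
    using W1inf_has_wgrad[OF O(3) q'(2)] by blast
  obtain M where M: "0 \<le> M" "AE x in lebesgue_on \<Omega>. \<bar>w x\<bar> \<le> M"
    using elliptic_bounded[OF O Q(1) bounds(4) adm_W12D(2)[OF O(1) q'(1)] Q(3)[rule_format] F w] by blast
  define A where "A = (1 + cq_hi / cq_lo) * W12_norm \<Omega> w + M * (cq_hi / cq_lo\<^sup>2 * C + C / cq_lo)"
  \<comment> \<open>the summand 1 makes the constant positive even if \<open>A = 0\<close>\<close>
  define c where "c = 2 * A * (1 + CARD('d) * cq_hi) + 1"
  have C0: "0 \<le> C" using W12_norm_nonneg q_bound by (rule order_trans)
  have A0: "0 \<le> A" unfolding A_def using bounds M(1) C0 by (simp add: W12_norm_nonneg)
  have c0: "0 \<le> 2 * A * (1 + CARD('d) * cq_hi)" using A0 bounds by simp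
  then have c: "0 < c" unfolding c_def by linarith
  define m where "m x = q x * (norm (weak_grad \<Omega> w x))\<^sup>2 + F x * w x" for x
  define \<delta> where "\<delta> w' F' = W12_norm \<Omega> (\<lambda>x. w x - w' x) + L2_norm \<Omega> (\<lambda>x. F x - F' x)" for w' F'
  have \<delta>0: "0 \<le> \<delta> w' F'" for w' F' by (simp add: \<delta>_def W12_norm_nonneg L2_norm_nonneg)
  have stab: "integrable (lebesgue_on \<Omega>) (\<lambda>x. (q x - p x)\<^sup>2 / (q x)\<^sup>2 * m x)"
      "(LINT x|lebesgue_on \<Omega>. (q x - p x)\<^sup>2 / (q x)\<^sup>2 * m x) \<le> c * \<delta> w' F'"
    if "p \<in> adm_W12 \<Omega> cq_lo cq_hi \<and> F' \<in> Linf \<Omega> \<and> W12_norm \<Omega> p \<le> C \<and> elliptic_weak_solution \<Omega> p F' w'" for p F' w'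
  proof -
    note S = weighted_stability[OF O bounds(4) q'(1) q_bound _ _ FL Linf_L2[OF _ O(3)] w M(2) _ A_def, of p F' w']
    show "integrable (lebesgue_on \<Omega>) (\<lambda>x. (q x - p x)\<^sup>2 / (q x)\<^sup>2 * m x)"
      unfolding m_def using S(1) that by blast
    have "(LINT x|lebesgue_on \<Omega>. (q x - p x)\<^sup>2 / (q x)\<^sup>2 * m x) \<le> 2 * A * (1 + CARD('d) * cq_hi) * \<delta> w' F'"
      unfolding m_def \<delta>_def using S(2) that by blast
    also have "\<dots> \<le> c * \<delta> w' F'" using \<delta>0 by (intro mult_right_mono) (auto simp: c_def)
    finally show "(LINT x|lebesgue_on \<Omega>. (q x - p x)\<^sup>2 / (q x)\<^sup>2 * m x) \<le> c * \<delta> w' F'" .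
  qed
  have part2: "\<exists>c>0. \<forall>q' F' w'.
       q' \<in> adm_W12 \<Omega> cq_lo cq_hi \<and> F' \<in> Linf \<Omega> \<and> W12_norm \<Omega> q' \<le> C \<and>
       elliptic_weak_solution \<Omega> q' F' w' \<longrightarrow>
       (LINT x|lebesgue_on \<Omega>. (q x - q' x)\<^sup>2 / (q x)\<^sup>2 * m x) \<le> c * \<delta> w' F'"
    using c stab(2) by blast
  obtain K where K: "0 \<le> K" "\<forall>\<rho>>0. measure lebesgue {x\<in>\<Omega>. infdist x (frontier \<Omega>) < \<rho>} \<le> K * \<rho>"
    using boundary_layer_measure[OF \<Omega>(1,2,3,5)] by blast
  have part3: "\<exists>c>0. \<forall>q' F' w'.
          q' \<in> adm_W12 \<Omega> cq_lo cq_hi \<and> F' \<in> Linf \<Omega> \<and> W12_norm \<Omega> q' \<le> C \<and>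
          elliptic_weak_solution \<Omega> q' F' w' \<longrightarrow>
          L2_norm \<Omega> (\<lambda>x. q x - q' x) \<le> c * \<delta> w' F' powr (1 / (2 * (1 + \<beta>)))"
    if \<beta>: "0 \<le> \<beta>" and c0: "0 < c0" and weight: "AE x in lebesgue_on \<Omega>. c0 * infdist x (frontier \<Omega>) powr \<beta> \<le> m x" for \<beta> c0
  proof (intro exI[of _ "sqrt (cq_hi\<^sup>2 * K + cq_hi\<^sup>2 * c / c0) + 1"] conjI allI impI)
    show "0 < sqrt (cq_hi\<^sup>2 * K + cq_hi\<^sup>2 * c / c0) + 1" using K(1) c c0 by (simp add: add_nonneg_pos)
    fix p F' w'
    assume p: "p \<in> adm_W12 \<Omega> cq_lo cq_hi \<and> F' \<in> Linf \<Omega> \<and> W12_norm \<Omega> p \<le> C \<and> elliptic_weak_solution \<Omega> p F' w'"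
    have "L2_norm \<Omega> (\<lambda>x. q x - p x) \<le> sqrt (cq_hi\<^sup>2 * K + cq_hi\<^sup>2 * c / c0) * \<delta> w' F' powr (1 / (2 * (1 + \<beta>)))"
      by (rule weighted_to_L2[OF O(1,3) bounds(4,5) c0 \<beta> q'(1) conjunct1[OF p] K(1) K(2)[rule_format] weight stab[OF p]
            less_imp_le[OF c] \<delta>0])
    also have "\<dots> \<le> (sqrt (cq_hi\<^sup>2 * K + cq_hi\<^sup>2 * c / c0) + 1) * \<delta> w' F' powr (1 / (2 * (1 + \<beta>)))"
      by (intro mult_right_mono) auto
    finally show "L2_norm \<Omega> (\<lambda>x. q x - p x) \<le> (sqrt (cq_hi\<^sup>2 * K + cq_hi\<^sup>2 * c / c0) + 1) * \<delta> w' F' powr (1 / (2 * (1 + \<beta>)))" .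
  qed
  show ?thesis using part1 part2 part3 unfolding m_def \<delta>_def by blast
qed

end
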